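(* Let $e$ be any of $E,\theta,\lambda$ and let $a,b$ be nonzero complex numbers with $\frac ba\notin\{q^n:n\in\mathbb{Z}\}$. Then $$\mathrm{U}_{q,e}(a,b;z)=p_e(a,z)\,(az)^{-\frac{\ln a}{\ln q}}\frac{(b;q)_\infty}{\left(\frac ba;q\right)_\infty}\;{}_2\phi_1\!\left({a,0\atop\frac{aq}b};q;\frac q{abz}\right)+p_e(b,z)\,(bz)^{-\frac{\ln b}{\ln q}}\frac{(a;q)_\infty}{\left(\frac ab;q\right)_\infty}\;{}_2\phi_1\!\left({b,0\atop\frac{bq}a};q;\frac q{abz}\right),$$ in which the $p_e(a,z)$ are $q$-periodic in both variables. More explicitly, $$p_\lambda(a,z)=\frac{\mathcal{P}_q(a\lambda)\,\mathcal{P}_q\!\left(\frac\lambda{az}\right)}{\mathcal{P}_q(\lambda)\,\mathcal{P}_q\!\left(\frac\lambda z\right)},$$ $$p_E(q^\alpha,q^\zeta)=\frac{\sqrt{\frac{-2\pi^3}{\ln^3q}}}{q^{\frac18}(q;q)_\infty^3}\,\theta_1(\pi\alpha,\hat q)\sum_{n=-\infty}^\infty(-1)^n\hat q^{\,n^2}\frac{e^{-2n\pi i(\alpha+\zeta)}}{\sin(\pi\alpha+i\,n\ln\hat q)},$$ and $$p_\theta(q^\alpha,q^\zeta)=\frac{\sqrt{\frac{-2\pi^3}{\ln^3q}}\;\theta_1(\pi\alpha,\hat q)\,\theta_1(\pi(\alpha+\zeta),\hat q)}{q^{\frac18}(q;q)_\infty^3\,\theta_1(\pi\zeta,\hat q)}\left(\frac{\theta_1'(\pi\alpha,\hat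 q)}{\theta_1(\pi\alpha,\hat q)}-\frac{\theta_1'(\pi(\alpha+\zeta),\hat q)}{\theta_1(\pi(\alpha+\zeta),\hat q)}\right).$$
   Context: Throughout $0<q<1$, $\hat q=e^{2\pi^2/\ln q}$; $(a;q)_\infty=\prod_{n\ge0}(1-aq^n)$, $(a;q)_n=(a;q)_\infty/(aq^n;q)_\infty$, $(a_1,\dots,a_k;q)_n=\prod_j(a_j;q)_n$, $C_q=1/\sqrt{-2\pi\ln q}$, $$E_q(\tau)=\exp\left(\frac{\ln^2(\tau/\sqrt q)}{2\ln q}\right),\quad\theta_q(\tau)=(q,-\tau,-q/\tau;q)_\infty=\sum_{n=-\infty}^\infty q^{\binom n2}\tau^n,\quad\mathcal{P}_q(\tau)=-\ln(q)\,C_q\,E_q(\tau)\,\theta_q(\tau).$$ $\theta_1(x,p)=2\sum_{n\ge0}(-1)^np^{(n+\frac12)^2}\sin((2n+1)x)$ is the Jacobi theta function and $\theta_1'$ its derivative in $x$. A function $f$ is $q$-periodic if $f(q\tau)=f(\tau)$. Let ${}_2\phi_1\!\left({a,b\atop c};q;x\right)=\sum_{n\ge0}\frac{(a,b;q)_n}{(c,q;q)_n}x^n$ for $|x|<1$, extended by analytic continuation in $x$. The functions are defined by $$\mathrm{U}_{q,E}(a,b;z)=C_q\int_0^\infty{}_2\phi_1\!\left({a,b\atop0};q;-t\right)E_q\!\left(\tfrac tz\right)\frac{dt}t,\qquad\mathrm{U}_{q,\theta}(a,b;z)=\frac{-1}{\ln q}\int_0^\infty\frac{{}_2\phi_1\!\left({a,b\atop0};q;-t\right)}{\theta_q(t/z)}\frac{dt}t,$$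 $$\mathrm{U}_{q,\lambda}(a,b;z)=\sum_{n=-\infty}^\infty\frac{{}_2\phi_1\!\left({a,b\atop0};q;-q^n\lambda\right)}{\theta_q(q^n\lambda/z)}.$$ In the last case $\lambda\neq0$, $\lambda\notin\{-q^n:n\in\mathbb{Z}\}$ and $z\notin\{-q^n\lambda:n\in\mathbb{Z}\}$. Branches: $\ln a,\ln b,\ln z,\ln\lambda$ are principal (with $|\arg z|<\pi$), and logarithms of products and quotients are the corresponding sums and differences, e.g. $(az)^{-\ln a/\ln q}=\exp(-\ln a(\ln a+\ln z)/\ln q)$; correspondingly $p_e(a,z)=p_e(q^\alpha,q^\zeta)$ with $\alpha=\ln a/\ln q$, $\zeta=\ln z/\ln q$. Removable singularities of the $p_e$ are filled in by continuity. *)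

theory Defs
  imports "HOL-Analysis.Analysis"
begin

definition qpoch_inf :: "real \<Rightarrow> complex \<Rightarrow> complex" where
  "qpoch_inf q a = (\<Prod>n. 1 - a * of_real q ^ n)"

text \<open>The quotient \<open>(a;q)\<^sub>\<infinity> / (a q^n;q)\<^sub>\<infinity>\<close> written as a finite product, so that it also has its
  usual value when \<open>a = q^(-m)\<close> and the quotient reads 0/0.\<close>

definition qpoch :: "real \<Rightarrow> complex \<Rightarrow> nat \<Rightarrow> complex" where
  "qpoch q a n = (\<Prod>k<n. 1 - a * of_real q ^ k)"

definition phi21_series :: "real \<Rightarrow> complex \<Rightarrow> complex \<Rightarrow> complex \<Rightarrow> complex \<Rightarrow> complex" where
  "phi21_series q a b c x =
     (\<Sum>n. qpoch q a n * qpoch q b n / (qpoch q c n * qpoch q (of_real q) n) * x ^ n)"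

definition phi21_poles :: "real \<Rightarrow> complex set" where
  "phi21_poles q = range (\<lambda>n::nat. 1 / of_real q ^ n)"

text \<open>The analytic continuation of the series, which is unique on the connected set
  \<open>- phi21_poles q\<close>. The values on \<open>phi21_poles q\<close> carry no meaning.\<close>

definition phi21 :: "real \<Rightarrow> complex \<Rightarrow> complex \<Rightarrow> complex \<Rightarrow> complex \<Rightarrow> complex" where
  "phi21 q a b c =
     (SOME F. F holomorphic_on (- phi21_poles q) \<and>
              (\<forall>x. norm x < 1 \<longrightarrow> F x = phi21_series q a b c x))"

definition C_q :: "real \<Rightarrow> real" where
  "C_q q = 1 / sqrt (- 2 * pi * ln q)"

definition qhat :: "real \<Rightarrow> real" where
  "qhat q = exp (2 * pi\<^sup>2 / ln q)"

text \<open>\<open>E_q\<close> and \<open>P_q\<close> are multivalued in \<open>\<tau>\<close>. Here they are functions of a chosen logarithm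
  \<open>w\<close> of \<open>\<tau>\<close>; callers pass the sum or difference of the principal logarithms of the factors.\<close>

definition E_q :: "real \<Rightarrow> complex \<Rightarrow> complex" where
  "E_q q w = exp ((w - of_real (ln (sqrt q)))\<^sup>2 / (2 * of_real (ln q)))"

definition theta_q :: "real \<Rightarrow> complex \<Rightarrow> complex" where
  "theta_q q \<tau> = qpoch_inf q (of_real q) * qpoch_inf q (- \<tau>) * qpoch_inf q (- of_real q / \<tau>)"

definition P_q :: "real \<Rightarrow> complex \<Rightarrow> complex" where
  "P_q q w = - of_real (ln q) * of_real (C_q q) * E_q q w * theta_q q (exp w)"

definition theta1 :: "complex \<Rightarrow> real \<Rightarrow> complex" where
  "theta1 x p = 2 * (\<Sum>n::nat. (-1) ^ n * of_real (p powr ((real n + 1/2)\<^sup>2))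
                                  * sin (of_nat (2 * n + 1) * x))"

definition theta1' :: "complex \<Rightarrow> real \<Rightarrow> complex" where
  "theta1' x p = deriv (\<lambda>y. theta1 y p) x"

text \<open>The parameter \<open>e\<close>; the third case carries the number \<open>\<lambda>\<close>.\<close>

datatype kernel = Ker_E | Ker_theta | Ker_lambda complex

fun admissible :: "real \<Rightarrow> kernel \<Rightarrow> complex \<Rightarrow> bool" where
  "admissible q Ker_E z \<longleftrightarrow> z \<noteq> 0 \<and> \<bar>Arg z\<bar> < pi"
| "admissible q Ker_theta z \<longleftrightarrow> z \<noteq> 0 \<and> \<bar>Arg z\<bar> < pi"
| "admissible q (Ker_lambda l) z \<longleftrightarrow> z \<noteq> 0 \<and> \<bar>Arg z\<bar> < pi \<and> l \<noteq> 0 \<and>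
     (\<forall>n::int. l \<noteq> - (of_real q powi n)) \<and> (\<forall>n::int. z \<noteq> - (of_real q powi n) * l)"

fun U :: "real \<Rightarrow> kernel \<Rightarrow> complex \<Rightarrow> complex \<Rightarrow> complex \<Rightarrow> complex" where
  "U q Ker_E a b z = of_real (C_q q) *
     (LINT t:{0<..}|lborel. phi21 q a b 0 (- of_real t) * E_q q (of_real (ln t) - Ln z) / of_real t)"
| "U q Ker_theta a b z = of_real (- 1 / ln q) *
     (LINT t:{0<..}|lborel. phi21 q a b 0 (- of_real t) / theta_q q (of_real t / z) / of_real t)"
| "U q (Ker_lambda l) a b z =
     (\<Sum>\<^sub>\<infinity>n\<in>(UNIV::int set). phi21 q a b 0 (- (of_real q powi n) * l)
                                 / theta_q q (of_real q powi n * l / z))"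

text \<open>Extension by continuity of a function given by a formula valid on \<open>D\<close>.\<close>

definition cont_ext :: "'a::t2_space set \<Rightarrow> ('a \<Rightarrow> complex) \<Rightarrow> 'a \<Rightarrow> complex" where
  "cont_ext D f x = (if x \<in> D then f x else Lim (at x within D) f)"

definition p_const :: "real \<Rightarrow> complex" where
  "p_const q = of_real (sqrt (- 2 * pi ^ 3 / (ln q) ^ 3))
                 / (of_real (q powr (1/8)) * (qpoch_inf q (of_real q)) ^ 3)"

text \<open>The functions \<open>p_E\<close> and \<open>p_\<theta>\<close> in the exponents \<open>(\<alpha>, \<zeta>)\<close>.\<close>

definition pE_exp :: "real \<Rightarrow> complex \<times> complex \<Rightarrow> complex" where
  "pE_exp q = cont_ext
     {(\<alpha>, \<zeta>). \<forall>n::int. sin (of_real pi * \<alpha> + \<i> * of_int n * of_real (ln (qhat q))) \<noteq> 0}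
     (\<lambda>(\<alpha>, \<zeta>). p_const q * theta1 (of_real pi * \<alpha>) (qhat q) *
        (\<Sum>\<^sub>\<infinity>n\<in>(UNIV::int set). (-1) powi n * of_real (qhat q powi (n\<^sup>2)) *
            (exp (- 2 * of_int n * of_real pi * \<i> * (\<alpha> + \<zeta>))
               / sin (of_real pi * \<alpha> + \<i> * of_int n * of_real (ln (qhat q))))))"

definition ptheta_exp :: "real \<Rightarrow> complex \<times> complex \<Rightarrow> complex" where
  "ptheta_exp q = cont_ext
     {(\<alpha>, \<zeta>). theta1 (of_real pi * \<alpha>) (qhat q) \<noteq> 0 \<and>
              theta1 (of_real pi * (\<alpha> + \<zeta>)) (qhat q) \<noteq> 0 \<and>
              theta1 (of_real pi * \<zeta>) (qhat q) \<noteq> 0}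
     (\<lambda>(\<alpha>, \<zeta>). p_const q * theta1 (of_real pi * \<alpha>) (qhat q)
          * theta1 (of_real pi * (\<alpha> + \<zeta>)) (qhat q) / theta1 (of_real pi * \<zeta>) (qhat q)
        * (theta1' (of_real pi * \<alpha>) (qhat q) / theta1 (of_real pi * \<alpha>) (qhat q)
           - theta1' (of_real pi * (\<alpha> + \<zeta>)) (qhat q) / theta1 (of_real pi * (\<alpha> + \<zeta>)) (qhat q)))"

fun p :: "real \<Rightarrow> kernel \<Rightarrow> complex \<Rightarrow> complex \<Rightarrow> complex" where
  "p q Ker_E a z = pE_exp q (Ln a / of_real (ln q), Ln z / of_real (ln q))"
| "p q Ker_theta a z = ptheta_exp q (Ln a / of_real (ln q), Ln z / of_real (ln q))"
| "p q (Ker_lambda l) a z =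
     P_q q (Ln a + Ln l) * P_q q (Ln l - (Ln a + Ln z)) / (P_q q (Ln l) * P_q q (Ln l - Ln z))"

end

theory Submission
  imports Defs "HOL-Complex_Analysis.Complex_Analysis" "HOL-Probability.Probability"
begin

text \<open>
  The two integrals and the sum are treated as one object. Each of them integrates
  \<open>phi21 q a b 0 (- t)\<close> against a weight \<open>w z t\<close> over a set that is invariant under \<open>t \<mapsto> q t\<close>, with an
  invariant measure, and each weight satisfies \<open>w z (q t) = (t / z) w z t\<close>, as \<open>1 / \<theta>(t / z)\<close> does.

  Where the weights live, \<open>phi21 q a b 0 (- t)\<close> has the expansion of theorem \<open>connection\<close>: a sum of
  two terms, of which the first is a constant times \<open>\<theta>(a t) / \<theta>(t)\<close> times an entire series in
  \<open>1 / (b t)\<close>, and the second has \<open>a\<close> and \<open>b\<close> exchanged. Its proof writes the coefficients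
  \<open>(a;q)\<^sub>n (b;q)\<^sub>n / (q;q)\<^sub>n\<close>, continued by zero to negative \<open>n\<close>, as the values at \<open>u = q\<^sup>n\<close> of a
  partial fraction expansion with poles at \<open>a u q\<^sup>m = 1\<close> and \<open>b u q\<^sup>m = 1\<close>. Summing over all integers
  \<open>n\<close> then produces Kronecker's series \<open>\<Sum> x\<^sup>n / (1 - a q\<^sup>n)\<close>, which is a quotient of theta functions.

  The weight law turns multiplication by \<open>t\<^sup>-\<^sup>n\<close> into a constant factor of the integral. So the
  entire series integrates term by term to \<open>phi21 q a 0 (a q / b)\<close> at \<open>q / (a b z)\<close>, and what remains of
  the transform is the single number \<open>moment a z\<close>, the integral of \<open>\<theta>(a t) / \<theta>(t)\<close> against the weight.
  This gives the expansion for large \<open>z\<close>, and a difference equation in \<open>z\<close> satisfied by both sides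
  extends it to all \<open>z\<close> (theorem \<open>transform_expansion\<close>).

  There remain the three moments. For the sum over a geometric progression the terms are those of a
  theta series. For the integrals, folding the half line onto one period gives the integral over
  \<open>[0, 1]\<close> of a quotient of values of the function \<open>s \<mapsto> P_q q (s ln q)\<close>. This function has period 1,
  is multiplied by an exponential under \<open>s \<mapsto> s + 2 \<pi> i / |ln q|\<close>, and is therefore a theta function of
  nome \<open>qhat q\<close>: Jacobi's transformation, obtained here from Liouville's theorem for the shape and from
  the total mass of a normal density for the constant. Comparing the two horizontal sides of a period
  rectangle expresses the integrals through residues, which are the stated formulas for \<open>p\<close>. The
  integrals depend continuously on the exponents, also at the removable singularities of the formulas,
  so they are the continuous extensions in the definition of \<open>p\<close>, and their periodicity is visible.
\<close>

section \<open>Shifted factorials\<close>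

locale qbase =
  fixes q :: real
  assumes q0: "0 < q" and q1: "q < 1"
begin

abbreviation "Q \<equiv> complex_of_real q"
abbreviation "qp \<equiv> qpoch_inf q"
abbreviation "qn \<equiv> qpoch q"
abbreviation "th \<equiv> theta_q q"

lemma q_nz [simp]: "q \<noteq> 0" and Q_nz: "Q \<noteq> 0" and Q_n1 [simp]: "Q \<noteq> 1" and norm_Q [simp]: "norm Q = q"
  using q0 q1 by (auto simp: of_real_eq_1_iff)

lemma qpow_tendsto: "(\<lambda>n. a * Q ^ n) \<longlonglongrightarrow> 0"
  using q0 q1 by (intro tendsto_mult_right_zero LIMSEQ_power_zero) auto

lemma Qpow_eq_1_iff [simp]: "Q ^ n = 1 \<longleftrightarrow> n = 0"
proof -
  have "q ^ n = 1 \<longleftrightarrow> n = 0"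
    using power_less_one_iff[of q n] q0 q1 by (cases "n = 0") auto
  then show ?thesis by (metis of_real_eq_1_iff of_real_power)
qed

lemma summable_norm_qpow: "summable (\<lambda>n. norm (a * Q ^ n))"
  using q0 q1 by (auto simp: norm_mult norm_power intro!: summable_mult summable_geometric)

lemma abs_conv_qp: "abs_convergent_prod (\<lambda>n. 1 - a * Q ^ n)"
  unfolding abs_convergent_prod_conv_summable using summable_norm_qpow[of a] by simp

lemma conv_qp: "convergent_prod (\<lambda>n. 1 - a * Q ^ n)"
  by (rule abs_convergent_prod_imp_convergent_prod[OF abs_conv_qp])

lemma qn_LIMSEQ: "(\<lambda>n. qn a n) \<longlonglongrightarrow> qp a"
proof -
  have "(\<lambda>n. qn a (Suc n)) \<longlonglongrightarrow> qp a"
    using convergent_prod_LIMSEQ[OF conv_qp[of a]]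
    unfolding qpoch_def qpoch_inf_def lessThan_Suc_atMost .
  then show ?thesis by (rule LIMSEQ_imp_Suc)
qed

lemma qn_0 [simp]: "qn a 0 = 1" and qn_Suc: "qn a (Suc n) = qn a n * (1 - a * Q ^ n)"
  by (simp_all add: qpoch_def)

lemma qn_add: "qn a (m + n) = qn a m * qn (a * Q ^ m) n"
  by (induction n) (simp_all add: qn_Suc power_add mult_ac)

lemma qn_Suc': "qn a (Suc n) = (1 - a) * qn (a * Q) n"
  using qn_add[of a 1 n] by (simp add: qn_Suc)

lemma qp_split: "qp a = qn a n * qp (a * Q ^ n)"
proof -
  have "(\<lambda>m. qn a (m + n)) \<longlonglongrightarrow> qp a" using qn_LIMSEQ by (rule LIMSEQ_ignore_initial_segment)
  moreover have "(\<lambda>m. qn a (m + n)) = (\<lambda>m. qn a n * qn (a * Q ^ n) m)"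
    by (simp add: qn_add add.commute[of _ n])
  moreover have "(\<lambda>m. qn a n * qn (a * Q ^ n) m) \<longlonglongrightarrow> qn a n * qp (a * Q ^ n)"
    by (intro tendsto_intros qn_LIMSEQ)
  ultimately show ?thesis using LIMSEQ_unique by metis
qed

lemma qp_step: "qp a = (1 - a) * qp (a * Q)"
  using qp_split[of a 1] by (simp add: qn_Suc)

lemma qp_0 [simp]: "qp 0 = 1" and qn_zero [simp]: "qn 0 n = 1"
  by (simp_all add: qpoch_inf_def qpoch_def)

lemma qp_eq_0_iff: "qp a = 0 \<longleftrightarrow> (\<exists>n. a * Q ^ n = 1)"
proof -
  have "(\<lambda>n. 1 - a * Q ^ n) has_prod qp a"
    unfolding qpoch_inf_def by (rule convergent_prod_has_prod[OF conv_qp])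
  then have "qp a = 0 \<longleftrightarrow> 0 \<in> range (\<lambda>n. 1 - a * Q ^ n)" by (rule has_prod_eq_0_iff)
  moreover have "0 = 1 - a * Q ^ n \<longleftrightarrow> a * Q ^ n = 1" for n by (metis right_minus_eq)
  ultimately show ?thesis by (simp add: image_iff)
qed

lemma qn_eq_0_iff: "qn a n = 0 \<longleftrightarrow> (\<exists>k<n. a * Q ^ k = 1)"
  by (auto simp: qpoch_def prod_zero_iff)

lemma qn_Q_nz [simp]: "qn Q n \<noteq> 0" and qp_Q_nz [simp]: "qp Q \<noteq> 0"
  unfolding qn_eq_0_iff qp_eq_0_iff by (auto simp flip: power_Suc)

text \<open>A bound that is uniform in the number of factors and monotone in the argument.\<close>
lemma norm_qn_le: "norm (qn a n) \<le> exp (norm a / (1 - q))"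
proof -
  have "norm (qn a n) = (\<Prod>k<n. norm (1 - a * Q ^ k))" by (simp add: qpoch_def prod_norm)
  also have "\<dots> \<le> (\<Prod>k<n. 1 + norm a * q ^ k)"
    by (intro prod_mono conjI norm_ge_zero order.trans[OF norm_triangle_ineq4])
       (use q0 in \<open>simp add: norm_mult norm_power\<close>)
  also have "\<dots> \<le> exp (\<Sum>k<n. norm a * q ^ k)"
    by (rule prod_le_exp_sum) (use q0 in auto)
  also have "(\<Sum>k<n. norm a * q ^ k) \<le> norm a * (1 / (1 - q))"
  proof -
    have "(\<Sum>k<n. q ^ k) \<le> (\<Sum>k. q ^ k)"
      using q0 q1 by (intro sum_le_suminf summable_geometric) auto
    also have "\<dots> = 1 / (1 - q)" using q0 q1 by (intro suminf_geometric) auto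
    finally show ?thesis
      using mult_left_mono[of _ "1 / (1 - q)" "norm a"] by (simp add: sum_distrib_left[symmetric])
  qed
  finally show ?thesis by simp
qed

lemma norm_qp_le: "norm (qp a) \<le> exp (norm a / (1 - q))"
  by (rule LIMSEQ_le_const2[OF tendsto_norm[OF qn_LIMSEQ]]) (use norm_qn_le in blast)

text \<open>The partial products converge to the nonzero number \<open>qp c\<close>, hence stay away from \<open>0\<close>.\<close>
lemma qn_lower_bound:
  assumes "\<And>k. c * Q ^ k \<noteq> 1"
  obtains B where "B > 0" "\<And>n. norm (1 / qn c n) \<le> B"
proof -
  have "qp c \<noteq> 0" using assms by (auto simp: qp_eq_0_iff)
  then have "(\<lambda>n. 1 / qn c n) \<longlonglongrightarrow> 1 / qp c" by (intro tendsto_intros qn_LIMSEQ)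
  then have "Bseq (\<lambda>n. 1 / qn c n)" by (intro convergent_imp_Bseq) (auto simp: convergent_def)
  then show ?thesis using that by (auto elim!: BseqE)
qed

lemma qp_holo: "qp holomorphic_on A"
proof -
  have "qp holomorphic_on UNIV"
  proof (rule holomorphic_uniform_sequence[where f="\<lambda>n a. qn a n"])
    show "(\<lambda>a. qn a n) holomorphic_on UNIV" for n
      unfolding qpoch_def by (intro holomorphic_intros)
    fix x :: complex
    define K where "K = cball x 1"
    have "uniformly_convergent_on K (\<lambda>N a. \<Prod>n<N. 1 + (- a * Q ^ n))"
    proof (rule uniformly_convergent_on_prod)
      show "continuous_on K (\<lambda>a. - a * Q ^ n)" for n by (intro continuous_intros)
      show "compact K" by (simp add: K_def)
      show "uniformly_convergent_on K (\<lambda>N a. \<Sum>n<N. norm (- a * Q ^ n))"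
      proof (rule Weierstrass_m_test')
        fix n a assume "a \<in> K"
        then have "norm a \<le> norm x + 1"
          using norm_triangle_sub[of a x] by (auto simp: K_def dist_norm norm_minus_commute)
        then show "norm (norm (- a * Q ^ n)) \<le> (norm x + 1) * q ^ n"
          using q0 by (simp add: norm_mult norm_power mult_right_mono)
      qed (use q0 q1 in \<open>auto intro!: summable_mult summable_geometric\<close>)
    qed
    then obtain l where l: "uniform_limit K (\<lambda>N a. qn a N) l sequentially"
      by (auto simp: uniformly_convergent_on_def qpoch_def)
    have "l a = qp a" if "a \<in> K" for a
      using tendsto_uniform_limitI[OF l that] qn_LIMSEQ LIMSEQ_unique by blast
    then have "uniform_limit K (\<lambda>N a. qn a N) qp sequentially"
      using l by (simp cong: uniform_limit_cong')
    then show "\<exists>d>0. cball x d \<subseteq> UNIV \<and> uniform_limit (cball x d) (\<lambda>n a. qn a n) qp sequentially"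
      by (intro exI[of _ 1]) (auto simp: K_def)
  qed auto
  then show ?thesis by (rule holomorphic_on_subset) auto
qed

lemma qp_holo' [holomorphic_intros]: "f holomorphic_on A \<Longrightarrow> (\<lambda>x. qp (f x)) holomorphic_on A"
  using holomorphic_on_compose_gen[of f A qp UNIV] qp_holo by (auto simp: o_def)

lemma qp_cont [continuous_intros]: "continuous_on A f \<Longrightarrow> continuous_on A (\<lambda>x. qp (f x))"
  using continuous_on_compose2[OF holomorphic_on_imp_continuous_on[OF qp_holo, of UNIV], of A f] by auto

lemma qp_tendsto [tendsto_intros]: "(f \<longlongrightarrow> a) F \<Longrightarrow> ((\<lambda>x. qp (f x)) \<longlongrightarrow> qp a) F"
  by (rule isCont_tendsto_compose[of _ qp])
     (use holomorphic_on_imp_continuous_on[OF qp_holo, of UNIV] in \<open>auto simp: continuous_on_eq_continuous_at\<close>)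

section \<open>The theta function\<close>

lemma theta_q_shift:
  assumes "t \<noteq> 0" shows "th (Q * t) = th t / t"
proof -
  have "qp (- t) = (1 + t) * qp (- (Q * t))" using qp_step[of "- t"] by (simp add: mult_ac)
  moreover have "qp (- Q / (Q * t)) = (1 + 1 / t) * qp (- Q / t)"
    using qp_step[of "- 1 / t"] by (simp add: mult_ac Q_nz)
  ultimately have "th (Q * t) * t = ((1 + 1 / t) * t) * (qp Q * qp (- Q / t) * qp (- (Q * t)))"
    and "th t = (1 + t) * (qp Q * qp (- Q / t) * qp (- (Q * t)))"
    by (simp_all only: theta_q_def mult_ac)
  moreover have "(1 + 1 / t) * t = 1 + t" using assms by (simp add: field_simps)
  ultimately show ?thesis using assms by (metis nonzero_eq_divide_eq)
qed

lemma theta_q_eq_0_iff: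
  assumes "t \<noteq> 0" shows "th t = 0 \<longleftrightarrow> (\<exists>n::int. t = - (Q powi n))"
proof
  assume "th t = 0"
  then have "qp (- t) = 0 \<or> qp (- Q / t) = 0" by (simp add: theta_q_def)
  then consider n where "- t * Q ^ n = 1" | n where "- Q / t * Q ^ n = 1"
    unfolding qp_eq_0_iff by blast
  then show "\<exists>n::int. t = - (Q powi n)"
  proof cases
    case 1
    then have "t * Q ^ n = - 1" by (metis minus_equation_iff mult_minus_left)
    then have "t = - 1 / Q ^ n" using Q_nz by (metis nonzero_eq_divide_eq power_not_zero)
    then have "t = - (Q powi (- int n))" by (simp add: power_int_minus inverse_eq_divide)
    then show ?thesis by blast
  next
    case 2
    then have "t = - (Q * Q ^ n)" using assms by (simp add: divide_simps)
    then have "t = - (Q powi (int (Suc n)))" by (simp del: of_nat_Suc)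
    then show ?thesis by blast
  qed
next
  assume "\<exists>n::int. t = - (Q powi n)"
  then obtain n :: int where n: "t = - (Q powi n)" by blast
  show "th t = 0"
  proof (cases "n \<le> 0")
    case True
    then have "t = - (1 / Q ^ nat (- n))"
      using n by (cases "n = 0") (simp_all add: power_int_def inverse_eq_divide power_divide)
    then have "- t * Q ^ nat (- n) = 1" by simp
    then show ?thesis unfolding theta_q_def mult_eq_0_iff qp_eq_0_iff by blast
  next
    case False
    then obtain m where m: "n = int (Suc m)"
      by (metis not_le gr0_implies_Suc zero_less_imp_eq_int of_nat_0_less_iff)
    then have "t = - (Q * Q ^ m)" using n by (simp only: power_int_of_nat power_Suc)
    then have "- Q / t * Q ^ m = 1" by simp
    then show ?thesis unfolding theta_q_def mult_eq_0_iff qp_eq_0_iff by blast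
  qed
qed

lemma theta_q_holo' [holomorphic_intros]:
  "f holomorphic_on A \<Longrightarrow> (\<And>x. x \<in> A \<Longrightarrow> f x \<noteq> 0) \<Longrightarrow> (\<lambda>x. th (f x)) holomorphic_on A"
  unfolding theta_q_def by (intro holomorphic_intros) auto

lemma theta_q_cont [continuous_intros]:
  "continuous_on A f \<Longrightarrow> (\<And>x. x \<in> A \<Longrightarrow> f x \<noteq> 0) \<Longrightarrow> continuous_on A (\<lambda>x. th (f x))"
  unfolding theta_q_def by (intro continuous_intros) auto

lemma theta_q_tendsto [tendsto_intros]:
  "(f \<longlongrightarrow> a) F \<Longrightarrow> a \<noteq> 0 \<Longrightarrow> ((\<lambda>x. th (f x)) \<longlongrightarrow> th a) F"
  unfolding theta_q_def by (intro tendsto_intros) auto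

text \<open>The factor that vanishes at \<open>-1\<close> split off.\<close>
lemma theta_q_factor: "th (- x) = (1 - x) * (qp Q * qp (x * Q) * qp (Q / x))"
  using qp_step[of x] by (simp add: theta_q_def)

text \<open>The derivative at \<open>-1\<close> is the cofactor of \<open>theta_q_factor\<close> there.\<close>
lemma theta_q_deriv: "(th has_field_derivative qp Q ^ 3) (at (-1))"
proof -
  define g where "g = (\<lambda>t. qp Q * qp (- (t * Q)) * qp (- Q / t))"
  have "g holomorphic_on (- {0})" unfolding g_def by (intro holomorphic_intros) auto
  then have "g field_differentiable at (-1)"
    by (rule holomorphic_on_imp_differentiable_at) auto
  then obtain g' where g': "(g has_field_derivative g') (at (-1))"
    by (auto simp: field_differentiable_def)
  have "((\<lambda>t. (1 + t) * g t) has_field_derivative (1 + (-1)) * g' + 1 * g (-1)) (at (-1))"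
    by (rule derivative_eq_intros g' refl | simp)+
  moreover have "(\<lambda>t. (1 + t) * g t) = th"
    using theta_q_factor[of "- t" for t] by (simp add: g_def fun_eq_iff)
  ultimately show ?thesis by (simp add: g_def power3_eq_cube)
qed

end

section \<open>Unordered and bilateral sums\<close>

lemma norm_summable_integrable_count_space:
  fixes f :: "'a \<Rightarrow> 'b::{banach,second_countable_topology}"
  assumes "(\<lambda>x. norm (f x)) summable_on A"
  shows "integrable (count_space A) f" "(\<integral>x. f x \<partial>count_space A) = infsum f A"
proof -
  have *: "Infinite_Set_Sum.abs_summable_on f A" using assms by (simp add: abs_summable_equivalent)
  show "integrable (count_space A) f" using * by (simp add: Infinite_Set_Sum.abs_summable_on_def)
  show "(\<integral>x. f x \<partial>count_space A) = infsum f A"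
    using infsetsum_infsum[OF *] by (simp add: infsetsum_def)
qed

lemma infsum_dominated_convergence:
  fixes f :: "'a \<Rightarrow> 'b::{banach,second_countable_topology}"
  assumes lim: "\<And>x. x \<in> A \<Longrightarrow> (\<lambda>n. s n x) \<longlonglongrightarrow> f x"
    and bound: "\<And>n x. x \<in> A \<Longrightarrow> norm (s n x) \<le> w x"
    and w: "w summable_on A"
  shows "(\<lambda>n. infsum (s n) A) \<longlonglongrightarrow> infsum f A"
proof -
  have wn: "(\<lambda>x. norm (w x)) summable_on A" using w summable_on_iff_abs_summable_on_real by blast
  have s: "(\<lambda>x. norm (s n x)) summable_on A" for n
    by (rule Infinite_Sum.abs_summable_on_comparison_test'[OF w bound])
  have f_le: "norm (f x) \<le> w x" if "x \<in> A" for x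
    by (rule LIMSEQ_le_const2[OF tendsto_norm[OF lim[OF that]]]) (use bound that in auto)
  have f: "(\<lambda>x. norm (f x)) summable_on A"
    by (rule Infinite_Sum.abs_summable_on_comparison_test'[OF w f_le])
  have "(\<lambda>n. \<integral>x. s n x \<partial>count_space A) \<longlonglongrightarrow> (\<integral>x. f x \<partial>count_space A)"
    by (rule integral_dominated_convergence[where w=w])
       (use lim bound norm_summable_integrable_count_space(1)[OF wn] in \<open>auto simp: AE_count_space\<close>)
  then show ?thesis by (simp add: norm_summable_integrable_count_space(2)[OF s]
      norm_summable_integrable_count_space(2)[OF f])
qed

lemma norm_summable_on_times:
  fixes f :: "'a \<Rightarrow> 'b::{banach,real_normed_algebra}" and g :: "'c \<Rightarrow> 'b"
  assumes f: "(\<lambda>x. norm (f x)) summable_on A" and g: "(\<lambda>y. norm (g y)) summable_on B"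
  shows "(\<lambda>p. norm (f (fst p) * g (snd p))) summable_on A \<times> B"
proof -
  have "(\<lambda>p. norm (norm (f (fst p)) * norm (g (snd p)))) summable_on A \<times> B"
    unfolding Infinite_Sum.abs_summable_on_Sigma_iff
    using f g by (auto simp: norm_mult abs_mult infsum_cmult_right' intro!: summable_on_cmult_right summable_on_cmult_left)
  then show ?thesis
    by (rule Infinite_Sum.abs_summable_on_comparison_test) (use norm_mult_ineq in auto)
qed

lemma summable_ratio_limit:
  fixes f :: "nat \<Rightarrow> 'a::banach"
  assumes ratio: "\<And>n. norm (f (Suc n)) \<le> r n * norm (f n)" and lim: "r \<longlonglongrightarrow> l" and "l < (1::real)"
  shows "summable (\<lambda>n. norm (f n))"
proof -
  obtain c where c: "l < c" "c < 1" using dense[OF \<open>l < 1\<close>] by blast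
  have "\<forall>\<^sub>F n in sequentially. r n < c" using order_tendstoD(2)[OF lim c(1)] .
  then obtain N where N: "\<And>n. n \<ge> N \<Longrightarrow> r n < c" by (auto simp: eventually_sequentially)
  show ?thesis
  proof (rule summable_ratio_test[OF c(2), of N])
    fix n assume "N \<le> n"
    then have "r n * norm (f n) \<le> c * norm (f n)" using N by (intro mult_right_mono) (auto intro: less_imp_le)
    then show "norm (norm (f (Suc n))) \<le> c * norm (norm (f n))" using ratio[of n] by simp
  qed
qed

lemma summable_on_int_iff:
  fixes f :: "int \<Rightarrow> 'b::banach"
  assumes "summable (\<lambda>n. norm (f (int n)))" "summable (\<lambda>n. norm (f (- int n)))"
  shows "(\<lambda>n. norm (f n)) summable_on UNIV"
proof -
  have U: "(UNIV :: int set) = range int \<union> (\<lambda>n. - int n) ` {1..}"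
  proof -
    have "x \<in> range int \<union> (\<lambda>n. - int n) ` {1..}" for x :: int
    proof (cases "x \<ge> 0")
      case True then show ?thesis by (auto intro: range_eqI[of _ _ "nat x"])
    next
      case False then show ?thesis by (auto intro!: image_eqI[of _ _ "nat (- x)"])
    qed
    then show ?thesis by auto
  qed
  have "(\<lambda>n. norm (f n)) summable_on range int"
    using norm_summable_imp_summable_on[of "\<lambda>n. norm (f (int n))"] assms(1)
    by (subst summable_on_reindex) (auto simp: o_def inj_on_def)
  moreover have "(\<lambda>n. norm (f n)) summable_on (\<lambda>n. - int n) ` {1..}"
    using summable_on_subset_banach[OF norm_summable_imp_summable_on[of "\<lambda>n. norm (f (- int n))"], of "{1..}"] assms(2)
    by (subst summable_on_reindex) (auto simp: o_def inj_on_def)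
  ultimately show ?thesis unfolding U by (rule summable_on_Un_disjoint) auto
qed

context qbase
begin

text \<open>The coefficient \<open>q^(n(n-1)/2)\<close> of the theta series; a real power, since the binomial coefficient is
  needed for negative \<open>n\<close>.\<close>
definition qtri :: "int \<Rightarrow> real" where
  "qtri n = q powr (real_of_int (n * (n - 1)) / 2)"

lemma qtri_pos [simp]: "qtri n > 0" "qtri n \<noteq> 0" and qtri_0 [simp]: "qtri 0 = 1" and qtri_1 [simp]: "qtri 1 = 1"
  using q0 by (auto simp: qtri_def)

lemma qtri_add: "qtri (n + m) = qtri n * qtri m * q powi (n * m)"
proof -
  have "q powi (n * m) = q powr real_of_int (n * m)" using q0 by (simp add: powr_real_of_int'[symmetric] del: of_int_mult)
  moreover have "real_of_int ((n + m) * (n + m - 1)) / 2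
      = real_of_int (n * (n - 1)) / 2 + real_of_int (m * (m - 1)) / 2 + real_of_int (n * m)"
    by (simp add: field_simps)
  ultimately show ?thesis unfolding qtri_def by (simp only: powr_add)
qed

lemma qtri_Suc: "qtri (1 + n) = qtri n * q powi n"
  by (simp add: qtri_add)

lemma qtri_int_Suc: "qtri (int (Suc n)) = qtri (int n) * q ^ n"
  using qtri_Suc[of "int n"] by simp

lemma qtri_minus: "qtri (- n) = qtri n * q powi n"
  using qtri_Suc[of n] by (simp add: qtri_def algebra_simps)

lemma qtri_summable_nat: "summable (\<lambda>n. norm (qtri (int n) * R ^ n))"
proof (rule summable_ratio_limit)
  show "norm (qtri (int (Suc n)) * R ^ Suc n) \<le> \<bar>R\<bar> * q ^ n * norm (qtri (int n) * R ^ n)" for n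
    using q0 by (simp add: qtri_int_Suc abs_mult mult_ac power_abs del: of_nat_Suc)
  show "(\<lambda>n. \<bar>R\<bar> * q ^ n) \<longlonglongrightarrow> 0"
    using q0 q1 by (auto intro!: tendsto_mult_right_zero LIMSEQ_power_zero)
qed auto

lemma norm_qtri_powi_summable:
  assumes "x \<noteq> (0::complex)"
  shows "(\<lambda>n. norm (of_real (qtri n) * x powi n)) summable_on UNIV"
proof (rule summable_on_int_iff)
  show "summable (\<lambda>n. norm (of_real (qtri (int n)) * x powi int n))"
    using qtri_summable_nat[of "norm x"] by (simp add: norm_mult norm_power abs_mult)
  have "norm (of_real (qtri (- int n)) * x powi (- int n)) = norm (qtri (int n) * (q / norm x) ^ n)" for n
    using q0 by (simp add: qtri_minus norm_mult norm_power power_int_minus norm_inverse power_mult_distrib power_inverse divide_inverse abs_mult power_abs)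
  then show "summable (\<lambda>n. norm (of_real (qtri (- int n)) * x powi (- int n)))"
    using qtri_summable_nat[of "q / norm x"] by simp
qed

lemma qtri_powi_summable:
  assumes "x \<noteq> (0::complex)"
  shows "(\<lambda>n. of_real (qtri n) * x powi n) summable_on A"
  by (rule summable_on_subset_banach[OF abs_summable_summable]) (use norm_qtri_powi_summable[OF assms] in auto)

section \<open>The triple product identity\<close>

text \<open>The q-binomial coefficient.\<close>
definition qbinom :: "nat \<Rightarrow> nat \<Rightarrow> complex" where
  "qbinom M j = (if j \<le> M then qn Q M / (qn Q j * qn Q (M - j)) else 0)"

lemma qbinom_Suc:
  assumes "j \<le> M"
  shows "qbinom (Suc M) (Suc j) = qbinom M (Suc j) + Q ^ (M - j) * qbinom M j"
proof (cases "j = M")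
  case True then show ?thesis by (simp add: qbinom_def)
next
  case False
  then obtain d where M: "M = j + Suc d" using assms by (metis add_Suc_right le_imp_less_Suc less_SucE less_imp_Suc_add)
  have nz: "1 - Q * Q ^ j \<noteq> 0" "1 - Q * Q ^ d \<noteq> 0"
    using Qpow_eq_1_iff[of "Suc j"] Qpow_eq_1_iff[of "Suc d"] by auto
  have "Q * Q ^ M = (Q * Q ^ d) * (Q * Q ^ j)" by (simp add: M power_add)
  then show ?thesis using nz
    by (simp add: qbinom_def M qn_Suc divide_simps power_add) (simp add: algebra_simps)
qed

lemma qbinomial: "qn (- x) M = (\<Sum>j\<le>M. qbinom M j * of_real (qtri (int j)) * x ^ j)"
proof (induction M)
  case (Suc M)
  let ?t = "\<lambda>j. of_real (qtri (int j)) * x ^ j :: complex"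
  have top: "qbinom M (Suc M) = 0" by (simp add: qbinom_def)
  have b0: "qbinom N 0 = 1" for N by (simp add: qbinom_def)
  have "(\<Sum>j\<le>Suc M. qbinom (Suc M) j * of_real (qtri (int j)) * x ^ j)
     = 1 + (\<Sum>j\<le>M. qbinom (Suc M) (Suc j) * ?t (Suc j))"
    by (subst sum.atMost_Suc_shift) (simp add: b0 mult.assoc del: of_nat_Suc power_Suc)
  also have "(\<Sum>j\<le>M. qbinom (Suc M) (Suc j) * ?t (Suc j))
     = (\<Sum>j\<le>M. qbinom M (Suc j) * ?t (Suc j)) + (\<Sum>j\<le>M. Q ^ (M - j) * qbinom M j * ?t (Suc j))"
    by (subst sum.distrib[symmetric]) (intro sum.cong refl, simp add: qbinom_Suc algebra_simps del: of_nat_Suc power_Suc)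
  also have "(\<Sum>j\<le>M. Q ^ (M - j) * qbinom M j * ?t (Suc j)) = x * Q ^ M * (\<Sum>j\<le>M. qbinom M j * ?t j)"
    unfolding sum_distrib_left
  proof (intro sum.cong refl)
    fix j assume "j \<in> {..M}"
    then have "Q ^ M = Q ^ (M - j) * Q ^ j" by (simp flip: power_add)
    then show "Q ^ (M - j) * qbinom M j * ?t (Suc j) = x * Q ^ M * (qbinom M j * ?t j)"
      by (simp add: qtri_int_Suc del: of_nat_Suc)
  qed
  also have "1 + ((\<Sum>j\<le>M. qbinom M (Suc j) * ?t (Suc j)) + x * Q ^ M * (\<Sum>j\<le>M. qbinom M j * ?t j))
      = (\<Sum>j\<le>Suc M. qbinom M j * ?t j) + x * Q ^ M * (\<Sum>j\<le>M. qbinom M j * ?t j)"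
    by (subst sum.atMost_Suc_shift) (simp add: b0 del: of_nat_Suc power_Suc)
  also have "(\<Sum>j\<le>Suc M. qbinom M j * ?t j) = (\<Sum>j\<le>M. qbinom M j * ?t j)"
    by (simp add: top)
  finally show ?case
    using Suc.IH by (simp add: qn_Suc algebra_simps)
qed (simp add: qbinom_def)

lemma qn_reverse:
  assumes "x \<noteq> 0"
  shows "qn (- x / Q ^ N) N = x ^ N / of_real (qtri (int (Suc N))) * qn (- Q / x) N"
proof (induction N)
  case (Suc N)
  have "qn (- x / Q ^ Suc N) (Suc N) = (1 + x / Q ^ Suc N) * qn (- x / Q ^ N) N"
    by (simp add: qn_Suc')
  also have "1 + x / Q ^ Suc N = x / Q ^ Suc N * (1 + Q ^ Suc N / x)"
    using assms by (simp add: divide_simps)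
  finally show ?case
    unfolding Suc.IH using qtri_int_Suc[of "Suc N"]
    by (simp add: qn_Suc mult_ac del: of_nat_Suc)
qed simp

text \<open>The q-binomial theorem with \<open>2 N\<close> factors, its index shifted by \<open>N\<close>. The triple product is the
  limit \<open>N \<rightarrow> \<infinity>\<close>, in which every q-binomial coefficient tends to \<open>1 / qp Q\<close>.\<close>
lemma finite_triple_product:
  assumes "x \<noteq> 0"
  shows "qn (- x) N * qn (- Q / x) N =
    (\<Sum>n\<in>{- int N..int N}. qbinom (2 * N) (nat (n + int N)) * of_real (qtri n) * x powi n)"
proof -
  have "qn (- (x / Q ^ N)) (2 * N) = qn (- x / Q ^ N) N * qn (- x) N"
    using qn_add[of "- (x / Q ^ N)" N N] by (simp add: mult_2)
  also have "\<dots> = x ^ N / of_real (qtri (int (Suc N))) * (qn (- x) N * qn (- Q / x) N)"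
    by (subst qn_reverse[OF assms]) (simp add: mult_ac)
  finally have eq: "qn (- x) N * qn (- Q / x) N = of_real (qtri (int (Suc N))) / x ^ N * qn (- (x / Q ^ N)) (2 * N)"
    using assms by (simp add: field_simps)
  have tm: "of_real (qtri (int (Suc N))) / x ^ N * (qbinom (2 * N) j * of_real (qtri (int j)) * (x / Q ^ N) ^ j)
      = qbinom (2 * N) j * of_real (qtri (int j - int N)) * x powi (int j - int N)" for j
  proof -
    have pw: "(q ^ j) ^ N = (q ^ N) ^ j" by (metis power_mult mult.commute)
    have "qtri (int j - int N) = qtri (int j) * qtri (- int N) * q powi (- (int j * int N))"
      using qtri_add[of "int j" "- int N"] by simp
    also have "\<dots> = qtri (int j) * qtri (int (Suc N)) / (q ^ N) ^ j"
      using pw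
      by (simp add: qtri_minus qtri_int_Suc power_int_minus power_mult mult.commute[of "int j"] divide_inverse
           flip: of_nat_mult del: of_nat_Suc)
    finally show ?thesis
      using assms by (simp add: power_int_diff power_divide mult_ac)
  qed
  show ?thesis
    unfolding eq qbinomial[of "x / Q ^ N" "2 * N"] sum_distrib_left tm
    by (rule sum.reindex_bij_witness[of _ "\<lambda>n. nat (n + int N)" "\<lambda>j. int j - int N"]) auto
qed

lemma qn_Q_bound: obtains B where "B > 0" "\<And>n. norm (1 / qn Q n) \<le> B"
proof (rule qn_lower_bound[of Q])
  show "Q * Q ^ k \<noteq> 1" for k using Qpow_eq_1_iff[of "Suc k"] by simp
qed (use that in blast)

text \<open>Jacobi's triple product, from \<open>finite_triple_product\<close> by dominated convergence.\<close>
lemma theta_q_series: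
  assumes "x \<noteq> 0"
  shows "((\<lambda>n. of_real (qtri n) * x powi n) has_sum th x) UNIV"
proof -
  obtain B where B: "B > 0" "\<And>n. norm (1 / qn Q n) \<le> B" by (rule qn_Q_bound) blast
  let ?f = "\<lambda>n::int. of_real (qtri n) * x powi n :: complex"
  define c where "c = (\<lambda>N n. if n \<in> {- int N..int N} then qbinom (2 * N) (nat (n + int N)) else 0)"
  define E where "E = exp (norm Q / (1 - q))"
  have c_bound: "norm (c N n) \<le> E * (B * B)" for N n
  proof (cases "n \<in> {- int N..int N}")
    case True
    have "norm (c N n) = norm (qn Q (2*N)) * (norm (1 / qn Q (nat (n + int N))) * norm (1 / qn Q (2 * N - nat (n + int N))))"
      using True by (auto simp: c_def qbinom_def norm_divide norm_mult)
    also have "\<dots> \<le> E * (B * B)"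
      unfolding E_def using B by (intro mult_mono norm_qn_le) (auto intro: less_imp_le)
    finally show ?thesis .
  qed (use B in \<open>auto simp: c_def E_def\<close>)
  have c_lim: "(\<lambda>N. c N n) \<longlonglongrightarrow> 1 / qp Q" for n
  proof -
    have "(\<lambda>N. qn Q (2*N) / (qn Q (nat (n + int N)) * qn Q (nat (int N - n)))) \<longlonglongrightarrow> qp Q / (qp Q * qp Q)"
    proof (intro tendsto_intros)
      have f1: "filterlim (\<lambda>N. nat (n + int N)) sequentially sequentially"
        by (intro filterlim_at_top_mono[OF filterlim_minus_const_nat_at_top[of "nat \<bar>n\<bar>"]] always_eventually) auto
      have f2: "filterlim (\<lambda>N. nat (int N - n)) sequentially sequentially"
        by (intro filterlim_at_top_mono[OF filterlim_minus_const_nat_at_top[of "nat \<bar>n\<bar>"]] always_eventually) auto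
      have f3: "filterlim (\<lambda>N::nat. 2 * N) sequentially sequentially"
        by (intro filterlim_at_top_mono[OF filterlim_ident] always_eventually) auto
      show "(\<lambda>N. qn Q (2*N)) \<longlonglongrightarrow> qp Q" using filterlim_compose[OF qn_LIMSEQ f3] .
      show "(\<lambda>N. qn Q (nat (n + int N))) \<longlonglongrightarrow> qp Q" using filterlim_compose[OF qn_LIMSEQ f1] .
      show "(\<lambda>N. qn Q (nat (int N - n))) \<longlonglongrightarrow> qp Q" using filterlim_compose[OF qn_LIMSEQ f2] .
    qed simp
    moreover have "\<forall>\<^sub>F N in sequentially. qn Q (2*N) / (qn Q (nat (n + int N)) * qn Q (nat (int N - n))) = c N n"
      using eventually_ge_at_top[of "nat \<bar>n\<bar>"]
    proof eventually_elim
      case (elim N)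
      then have "2 * N - nat (n + int N) = nat (int N - n)" "n \<in> {- int N..int N}" by auto
      then show ?case by (auto simp: c_def qbinom_def)
    qed
    ultimately show ?thesis by (simp add: tendsto_cong)
  qed
  have "(\<lambda>N. infsum (\<lambda>n. c N n * ?f n) UNIV) \<longlonglongrightarrow> infsum (\<lambda>n. 1 / qp Q * ?f n) UNIV"
  proof (rule infsum_dominated_convergence)
    show "(\<lambda>n. E * (B * B) * norm (?f n)) summable_on UNIV"
      by (intro summable_on_cmult_right norm_qtri_powi_summable assms)
    show "norm (c N n * ?f n) \<le> E * (B * B) * norm (?f n)" for N n
      unfolding norm_mult[of "c N n"] by (intro mult_right_mono c_bound norm_ge_zero)
  qed (intro tendsto_intros c_lim)
  moreover have "infsum (\<lambda>n. c N n * ?f n) UNIV = qn (- x) N * qn (- Q / x) N" for N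
  proof -
    have "infsum (\<lambda>n. c N n * ?f n) UNIV = infsum (\<lambda>n. qbinom (2 * N) (nat (n + int N)) * of_real (qtri n) * x powi n) {- int N..int N}"
      by (rule infsum_cong_neutral) (auto simp: c_def)
    then show ?thesis unfolding finite_triple_product[OF assms] by simp
  qed
  moreover have "(\<lambda>N. qn (- x) N * qn (- Q / x) N) \<longlonglongrightarrow> qp (- x) * qp (- Q / x)"
    by (intro tendsto_intros qn_LIMSEQ)
  ultimately have "infsum (\<lambda>n. 1 / qp Q * ?f n) UNIV = qp (- x) * qp (- Q / x)"
    using LIMSEQ_unique by simp
  then have "infsum ?f UNIV = th x"
    unfolding infsum_cmult_right' by (simp add: theta_q_def field_simps)
  then show ?thesis using qtri_powi_summable[OF assms, of UNIV] by (metis has_sum_infsum)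
qed

end

context qbase
begin

section \<open>The continuation of the basic hypergeometric series\<close>

text \<open>The possible poles are the zeros of an entire function, so they are a closed countable set
  and their complement is connected.\<close>
lemma phi21_poles_iff: "x \<in> phi21_poles q \<longleftrightarrow> qp x = 0"
proof -
  have "x = 1 / Q ^ n \<longleftrightarrow> x * Q ^ n = 1" for n by (simp add: nonzero_eq_divide_eq)
  then show ?thesis by (auto simp: phi21_poles_def qp_eq_0_iff)
qed

lemma phi21_poles_scale: "Q * x \<in> phi21_poles q \<Longrightarrow> x \<in> phi21_poles q"
  using qp_step[of x] by (simp add: phi21_poles_iff mult.commute)

lemma one_pole: "1 \<in> phi21_poles q"
  unfolding phi21_poles_def by (rule image_eqI[of _ _ 0]) auto

lemma phi21_poles_norm: "x \<in> phi21_poles q \<Longrightarrow> norm x \<ge> 1"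
  using q0 q1 by (auto simp: phi21_poles_def norm_divide norm_power power_le_one)

lemma open_compl_poles: "open (- phi21_poles q)"
proof -
  have "closed {x \<in> UNIV. qp x = 0}"
    by (intro continuous_closed_preimage_constant continuous_intros)
  then show ?thesis by (simp add: closed_def phi21_poles_iff Compl_eq)
qed

lemma connected_compl_poles: "connected (- phi21_poles q)"
  unfolding Compl_eq_Diff_UNIV
  by (rule connected_open_diff_countable) (auto simp: phi21_poles_def connected_UNIV)

lemma norm_Q_mult_less: "norm x < r \<Longrightarrow> norm (Q * x) < r"
  using mult_right_mono[of q 1 "norm x"] q0 q1 by (simp add: norm_mult)

lemma holomorphic_on_scale:
  assumes "f holomorphic_on B" "\<And>x. x \<in> A \<Longrightarrow> c * x \<in> B"
  shows "(\<lambda>x. f (c * x)) holomorphic_on A"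
  using holomorphic_on_compose_gen[of "\<lambda>x. c * x" A f B] assms
  by (auto simp: o_def intro!: holomorphic_intros)

context
  fixes a b c :: complex
  assumes c_ok: "\<And>k. c * Q ^ k \<noteq> 1"
begin

definition phi21_coeff :: "nat \<Rightarrow> complex" where
  "phi21_coeff n = qn a n * qn b n / (qn c n * qn Q n)"

lemma phi21_coeff_Suc:
  "phi21_coeff (Suc n) * ((1 - c * Q ^ n) * (1 - Q * Q ^ n)) = phi21_coeff n * ((1 - a * Q ^ n) * (1 - b * Q ^ n))"
proof -
  have "1 - c * Q ^ n \<noteq> 0" "1 - Q * Q ^ n \<noteq> 0"
    using c_ok[of n] Qpow_eq_1_iff[of "Suc n"] by auto
  then show ?thesis by (simp add: phi21_coeff_def qn_Suc divide_simps)
qed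

lemma phi21_coeff_summable:
  assumes "norm x < 1"
  shows "summable (\<lambda>n. norm (phi21_coeff n * x ^ n))"
proof (rule summable_ratio_limit)
  let ?r = "\<lambda>n. (1 - a * Q ^ n) * (1 - b * Q ^ n) / ((1 - c * Q ^ n) * (1 - Q * Q ^ n)) * x"
  fix n
  have "1 - c * Q ^ n \<noteq> 0" "1 - Q * Q ^ n \<noteq> 0"
    using c_ok[of n] Qpow_eq_1_iff[of "Suc n"] by auto
  then have "phi21_coeff (Suc n) * x ^ Suc n = ?r n * (phi21_coeff n * x ^ n)"
    by (simp add: phi21_coeff_def qn_Suc mult_ac)
  then show "norm (phi21_coeff (Suc n) * x ^ Suc n) \<le> norm (?r n) * norm (phi21_coeff n * x ^ n)"
    by (simp only: norm_mult order.refl)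
next
  have "(\<lambda>n. (1 - a * Q ^ n) * (1 - b * Q ^ n) / ((1 - c * Q ^ n) * (1 - Q * Q ^ n)) * x)
      \<longlonglongrightarrow> (1 - 0) * (1 - 0) / ((1 - 0) * (1 - 0)) * x"
    by (intro tendsto_intros qpow_tendsto) auto
  then show "(\<lambda>n. norm ((1 - a * Q ^ n) * (1 - b * Q ^ n) / ((1 - c * Q ^ n) * (1 - Q * Q ^ n)) * x)) \<longlonglongrightarrow> norm x"
    using tendsto_norm by fastforce
qed (use assms in auto)

lemma phi21_series_sums:
  assumes "norm x < 1"
  shows "(\<lambda>n. phi21_coeff n * x ^ n) sums phi21_series q a b c x"
  unfolding phi21_series_def phi21_coeff_def[symmetric]
  by (rule summable_sums[OF summable_norm_cancel[OF phi21_coeff_summable[OF assms]]])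

text \<open>Comparing coefficients: the recursion of consecutive coefficients is a second order equation in the
  dilation \<open>x \<mapsto> Q x\<close>. It is what continues the series and what the transforms inherit.\<close>
lemma phi21_series_feq:
  assumes "norm x < 1"
  shows "(1 - x) * phi21_series q a b c x = (1 + c / Q - (a + b) * x) * phi21_series q a b c (Q * x)
     + (a * b * x - c / Q) * phi21_series q a b c (Q * (Q * x))"
proof -
  let ?s = "\<lambda>n. phi21_coeff n * x ^ n"
  have qx: "norm (Q * x) < 1" "norm (Q * (Q * x)) < 1"
    using norm_Q_mult_less assms by blast+
  define g where "g = (\<lambda>n. ?s n * (1 - Q ^ n) * (1 - c / Q * Q ^ n))"
  have "(\<lambda>n. (1 - x) * ?s n - (1 + c / Q - (a + b) * x) * (phi21_coeff n * (Q * x) ^ n)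
       - (a * b * x - c / Q) * (phi21_coeff n * (Q * (Q * x)) ^ n)) sums
    ((1 - x) * phi21_series q a b c x - (1 + c / Q - (a + b) * x) * phi21_series q a b c (Q * x)
     - (a * b * x - c / Q) * phi21_series q a b c (Q * (Q * x)))"
    by (intro sums_diff sums_mult phi21_series_sums assms qx)
  moreover have "(1 - x) * ?s n - (1 + c / Q - (a + b) * x) * (phi21_coeff n * (Q * x) ^ n)
       - (a * b * x - c / Q) * (phi21_coeff n * (Q * (Q * x)) ^ n) = g n - g (Suc n)" for n
  proof -
    have "g (Suc n) = phi21_coeff (Suc n) * ((1 - c * Q ^ n) * (1 - Q * Q ^ n)) * x * x ^ n"
      by (simp add: g_def)
    also have "\<dots> = x * ?s n * ((1 - a * Q ^ n) * (1 - b * Q ^ n))"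
      unfolding phi21_coeff_Suc by simp
    finally have gS: "g (Suc n) = x * ?s n * ((1 - a * Q ^ n) * (1 - b * Q ^ n))" .
    show ?thesis unfolding gS unfolding g_def by (simp add: power_mult_distrib) (simp add: algebra_simps)
  qed
  moreover have "(\<lambda>n. g n - g (Suc n)) sums (g 0 - 0)"
  proof (rule telescope_sums')
    have "?s \<longlonglongrightarrow> 0"
      using phi21_series_sums[OF assms] sums_summable summable_LIMSEQ_zero by blast
    then have "g \<longlonglongrightarrow> 0 * (1 - 0) * (1 - 0)"
      unfolding g_def using qpow_tendsto[of 1, unfolded mult_1]
        by (intro tendsto_mult tendsto_diff tendsto_const qpow_tendsto)
    then show "g \<longlonglongrightarrow> 0" by simp
  qed
  ultimately have "(1 - x) * phi21_series q a b c x - (1 + c / Q - (a + b) * x) * phi21_series q a b c (Q * x)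
     - (a * b * x - c / Q) * phi21_series q a b c (Q * (Q * x)) = g 0 - 0"
    using sums_unique2 by simp
  then show ?thesis by (simp add: g_def algebra_simps)
qed

lemma phi21_series_holo: "phi21_series q a b c holomorphic_on ball 0 1"
  by (rule power_series_holomorphic[where a=phi21_coeff]) (use phi21_series_sums in auto)

text \<open>Each step enlarges the disc by the factor \<open>1/q\<close>: the functional equation expresses the value
  at \<open>x\<close> through the values at \<open>q x\<close> and \<open>q^2 x\<close>.\<close>

primrec phi21_extend :: "nat \<Rightarrow> complex \<Rightarrow> complex" where
  "phi21_extend 0 x = phi21_series q a b c x"
| "phi21_extend (Suc N) x = ((1 + c / Q - (a + b) * x) * phi21_extend N (Q * x)
     + (a * b * x - c / Q) * phi21_extend N (Q * (Q * x))) / (1 - x)"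

lemma scaled_disc:
  assumes "x \<in> ball 0 (1 / q ^ Suc N) - phi21_poles q"
  shows "Q * x \<in> ball 0 (1 / q ^ N) - phi21_poles q" "Q * (Q * x) \<in> ball 0 (1 / q ^ N) - phi21_poles q"
proof -
  have "norm x < 1 / q ^ Suc N" using assms by simp
  then have 1: "q * norm x < 1 / q ^ N" using q0 by (simp add: field_simps)
  have "q * (q * norm x) \<le> 1 * (q * norm x)" using q0 q1 by (intro mult_right_mono) auto
  then have "q * (q * norm x) < 1 / q ^ N" using 1 by simp
  with 1 assms phi21_poles_scale show "Q * x \<in> ball 0 (1 / q ^ N) - phi21_poles q"
    "Q * (Q * x) \<in> ball 0 (1 / q ^ N) - phi21_poles q"
    using q0 by (auto simp: norm_mult)
qed

lemma phi21_extend_holo: "phi21_extend N holomorphic_on ball 0 (1 / q ^ N) - phi21_poles q"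
proof (induction N)
  case 0
  have "phi21_extend 0 = phi21_series q a b c" by (rule ext) simp
  then show ?case using phi21_series_holo by (simp add: holomorphic_on_subset)
next
  case (Suc N)
  let ?A = "ball 0 (1 / q ^ Suc N) - phi21_poles q"
  have "(\<lambda>x. phi21_extend N (Q * x)) holomorphic_on ?A"
    by (rule holomorphic_on_scale[OF Suc.IH]) (rule scaled_disc)
  moreover have "(\<lambda>x. phi21_extend N (Q * (Q * x))) holomorphic_on ?A"
    unfolding mult.assoc[symmetric, of Q Q]
    by (rule holomorphic_on_scale[OF Suc.IH]) (use scaled_disc(2) in \<open>simp only: mult.assoc\<close>)
  moreover have "phi21_extend (Suc N) = (\<lambda>x. ((1 + c / Q - (a + b) * x) * phi21_extend N (Q * x)
     + (a * b * x - c / Q) * phi21_extend N (Q * (Q * x))) / (1 - x))" by (rule ext) simp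
  ultimately show ?case
    using one_pole by (auto intro!: holomorphic_intros)
qed

lemma phi21_extend_Suc_eq:
  "x \<in> ball 0 (1 / q ^ N) - phi21_poles q \<Longrightarrow> phi21_extend (Suc N) x = phi21_extend N x"
proof (induction N arbitrary: x)
  case 0
  then have "norm x < 1" "1 - x \<noteq> 0" using one_pole by auto
  then show ?case using phi21_series_feq[of x] by (simp add: field_simps)
next
  case (Suc N)
  have 1: "phi21_extend (Suc N) (Q * x) = phi21_extend N (Q * x)"
    and 2: "phi21_extend (Suc N) (Q * (Q * x)) = phi21_extend N (Q * (Q * x))"
    by (rule Suc.IH, rule scaled_disc[OF Suc.prems])+
  show ?case
    unfolding phi21_extend.simps(2)[of "Suc N"] 1 2 by simp
qed

lemma phi21_extend_add_eq:
  "x \<in> ball 0 (1 / q ^ N) - phi21_poles q \<Longrightarrow> phi21_extend (N + k) x = phi21_extend N x"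
proof (induction k)
  case (Suc k)
  have "1 / q ^ N \<le> 1 / q ^ (N + k)"
    using q0 q1 by (intro divide_left_mono power_decreasing) auto
  then have "x \<in> ball 0 (1 / q ^ (N + k)) - phi21_poles q" using Suc.prems by auto
  then show ?case using Suc phi21_extend_Suc_eq[of x "N + k"] by simp
qed simp

text \<open>The extensions to growing discs agree where they overlap and exhaust the complement of the poles.\<close>
lemma phi21_exists: "\<exists>F. F holomorphic_on (- phi21_poles q) \<and> (\<forall>x. norm x < 1 \<longrightarrow> F x = phi21_series q a b c x)"
proof -
  define D where "D = (\<lambda>N. ball 0 (1 / q ^ N) - phi21_poles q)"
  define F where "F = (\<lambda>x. phi21_extend (LEAST N. norm x < 1 / q ^ N) x)"
  have F_eq: "F x = phi21_extend M x" if "x \<in> D M" for x M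
  proof -
    define N where "N = (LEAST N. norm x < 1 / q ^ N)"
    have M: "norm x < 1 / q ^ M" using that by (simp add: D_def)
    have "norm x < 1 / q ^ N" unfolding N_def using M by (rule LeastI)
    moreover have "N \<le> M" unfolding N_def using M by (rule Least_le)
    ultimately show ?thesis
      using phi21_extend_add_eq[of x N "M - N"] that by (simp add: F_def D_def N_def[symmetric])
  qed
  have "F holomorphic_on (\<Union>N\<in>UNIV. D N)"
  proof (rule holomorphic_on_UN_open)
    fix N
    have "phi21_extend N holomorphic_on D N" unfolding D_def by (rule phi21_extend_holo)
    then show "F holomorphic_on D N" by (rule holomorphic_transform) (simp add: F_eq)
    show "open (D N)" unfolding D_def using open_compl_poles by (simp add: Diff_eq open_Int)
  qed
  moreover have "(\<Union>N\<in>UNIV. D N) = - phi21_poles q"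
  proof -
    have "\<exists>N. norm x < 1 / q ^ N" for x :: complex
    proof -
      obtain N where "norm x < (1 / q) ^ N" using real_arch_pow[of "1 / q" "norm x"] q0 q1 by auto
      then show ?thesis by (auto simp: power_divide)
    qed
    then show ?thesis by (auto simp: D_def)
  qed
  moreover have "F x = phi21_series q a b c x" if "norm x < 1" for x
    using F_eq[of x 0] that phi21_poles_norm[of x] by (force simp: D_def)
  ultimately show ?thesis by (intro exI[of _ F]) auto
qed

lemma phi21_holo: "phi21 q a b c holomorphic_on (- phi21_poles q)"
  and phi21_eq_series: "norm x < 1 \<Longrightarrow> phi21 q a b c x = phi21_series q a b c x"
  using someI_ex[OF phi21_exists] unfolding phi21_def by blast+

lemma phi21_feq:
  assumes "x \<notin> phi21_poles q"
  shows "(1 - x) * phi21 q a b c x = (1 + c / Q - (a + b) * x) * phi21 q a b c (Q * x)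
     + (a * b * x - c / Q) * phi21 q a b c (Q * (Q * x))"
proof (rule analytic_continuation_open[of "ball 0 1" "- phi21_poles q" "\<lambda>x. (1 - x) * phi21 q a b c x"
      "\<lambda>x. (1 + c / Q - (a + b) * x) * phi21 q a b c (Q * x) + (a * b * x - c / Q) * phi21 q a b c (Q * (Q * x))" x])
  have "ball 0 1 \<inter> phi21_poles q = {}" using phi21_poles_norm by fastforce
  then show "ball 0 1 \<subseteq> - phi21_poles q" by blast
  have 1: "(\<lambda>x. phi21 q a b c (Q * x)) holomorphic_on (- phi21_poles q)"
    by (rule holomorphic_on_scale[OF phi21_holo]) (use phi21_poles_scale in auto)
  have 2: "(\<lambda>x. phi21 q a b c (Q * (Q * x))) holomorphic_on (- phi21_poles q)"
    by (rule holomorphic_on_scale[OF 1]) (use phi21_poles_scale in auto)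
  show "(\<lambda>x. (1 + c / Q - (a + b) * x) * phi21 q a b c (Q * x) + (a * b * x - c / Q) * phi21 q a b c (Q * (Q * x)))
      holomorphic_on - phi21_poles q"
    by (intro holomorphic_intros 1 2)
  show "(\<lambda>x. (1 - x) * phi21 q a b c x) holomorphic_on - phi21_poles q"
    by (intro holomorphic_intros phi21_holo)
  fix x :: complex assume "x \<in> ball 0 1"
  then have x: "norm x < 1" by simp
  then have "norm (Q * x) < 1" "norm (Q * (Q * x)) < 1"
    using norm_Q_mult_less by blast+
  with x show "(1 - x) * phi21 q a b c x = (1 + c / Q - (a + b) * x) * phi21 q a b c (Q * x)
     + (a * b * x - c / Q) * phi21 q a b c (Q * (Q * x))"
    using phi21_series_feq[of x] by (simp add: phi21_eq_series)
qed (use assms open_compl_poles connected_compl_poles in auto)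

end

end

lemma suminf_dominated_convergence:
  fixes s :: "nat \<Rightarrow> nat \<Rightarrow> 'b::{banach,real_normed_algebra}"
  assumes "\<And>k. (\<lambda>n. s n k) \<longlonglongrightarrow> f k" "\<And>n k. norm (s n k) \<le> w k" "summable w"
  shows "(\<lambda>n. suminf (s n)) \<longlonglongrightarrow> suminf f"
proof -
  have "eventually (\<lambda>(k,n). norm (s n k) \<le> w k) (at_top \<times>\<^sub>F sequentially)"
    by (rule always_eventually) (use assms(2) in auto)
  from tannerys_theorem[OF assms(1) this assms(3)] show ?thesis by simp
qed

context qbase
begin

lemma abs_qtri [simp]: "\<bar>qtri n\<bar> = qtri n"
  by (rule abs_of_pos) simp

lemma qtri_nonneg [simp]: "qtri n \<ge> 0"
  by (rule less_imp_le) simp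

section \<open>The confluent q-Gauss sum\<close>

definition gauss_term :: "complex \<Rightarrow> complex \<Rightarrow> nat \<Rightarrow> complex" where
  "gauss_term a c n = qn a n / (qn c n * qn Q n) * of_real (qtri (int n)) * (- c / a) ^ n"

lemma qn_inverse_bound:
  assumes "\<And>k. c * Q ^ k \<noteq> 1"
  obtains B where "B > 0" "\<And>N n. norm (1 / qn (c * Q ^ N) n) \<le> B"
proof -
  obtain B where B: "B > 0" "\<And>n. norm (1 / qn c n) \<le> B" using qn_lower_bound[OF assms] by blast
  define E where "E = exp (norm c / (1 - q))"
  have E: "E > 0" "norm (qn c N) \<le> E" for N by (simp_all add: E_def norm_qn_le)
  show ?thesis
  proof (rule that[of "E * B"])
    fix N n
    have "qn c N \<noteq> 0" using assms by (simp add: qn_eq_0_iff)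
    then have "norm (1 / qn (c * Q ^ N) n) = norm (qn c N) * norm (1 / qn c (N + n))"
      by (simp add: qn_add norm_mult norm_divide)
    also have "\<dots> \<le> E * B" using B E by (intro mult_mono) (auto intro: less_imp_le)
    finally show "norm (1 / qn (c * Q ^ N) n) \<le> E * B" .
  qed (use B E in simp)
qed

lemma gauss_term_bound:
  assumes "\<And>k. c * Q ^ k \<noteq> 1"
  obtains B where "B > 0" "\<And>N n. norm (gauss_term a (c * Q ^ N) n) \<le> B * norm (qtri (int n) * norm (c / a) ^ n)"
proof -
  obtain B where B: "B > 0" "\<And>N n. norm (1 / qn (c * Q ^ N) n) \<le> B" using qn_inverse_bound[OF assms] by blast
  obtain B' where B': "B' > 0" "\<And>n. norm (1 / qn Q n) \<le> B'" by (rule qn_Q_bound) blast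
  define E where "E = exp (norm a / (1 - q))"
  show ?thesis
  proof (rule that[of "E * (B * B')"])
    fix N n
    have 1: "norm (qn a n) * (norm (1 / qn (c * Q ^ N) n) * norm (1 / qn Q n)) \<le> E * (B * B')"
      unfolding E_def using B B' by (intro mult_mono norm_qn_le) (auto intro: less_imp_le)
    have "norm (- (c * Q ^ N) / a) \<le> norm (c / a)"
      using q0 q1 power_le_one[of q N] mult_left_mono[of "q ^ N" 1 "norm c / norm a"]
      by (simp add: norm_mult norm_divide norm_power)
    then have 2: "norm ((- (c * Q ^ N) / a) ^ n) \<le> norm (c / a) ^ n"
      unfolding norm_power by (intro power_mono) auto
    have "norm (gauss_term a (c * Q ^ N) n) =
       norm (qn a n) * (norm (1 / qn (c * Q ^ N) n) * norm (1 / qn Q n)) * (qtri (int n) * norm ((- (c * Q ^ N) / a) ^ n))"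
      using qtri_pos(1)[of "int n"] by (simp add: gauss_term_def norm_mult norm_divide)
    also have "\<dots> \<le> E * (B * B') * (qtri (int n) * norm (c / a) ^ n)"
      by (rule mult_mono[OF 1 mult_left_mono[OF 2]]) (use B B' in \<open>auto simp: E_def\<close>)
    finally show "norm (gauss_term a (c * Q ^ N) n) \<le> E * (B * B') * norm (qtri (int n) * norm (c / a) ^ n)"
      by (simp add: abs_mult)
  qed (use B B' in \<open>simp add: E_def\<close>)
qed

lemma gauss_term_summable:
  assumes "\<And>k. c * Q ^ k \<noteq> 1"
  shows "summable (\<lambda>n. gauss_term a c n)"
proof -
  obtain B where "\<And>N n. norm (gauss_term a (c * Q ^ N) n) \<le> B * norm (qtri (int n) * norm (c / a) ^ n)"
    using gauss_term_bound[OF assms] by blast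
  from this[of 0] show ?thesis
    by (intro summable_comparison_test'[OF summable_mult[OF qtri_summable_nat[of "norm (c / a)"], of B]]) simp
qed

lemma gauss_term_Suc:
  assumes "\<And>k. c * Q ^ k \<noteq> 1" "a \<noteq> 0"
  shows "gauss_term a c (Suc n) * (1 - Q * Q ^ n) = gauss_term a c n * (c * Q ^ n * Q ^ n - c / a * Q ^ n) / (1 - c * Q ^ n)"
proof -
  have "1 - c * Q ^ n \<noteq> 0" "1 - Q * Q ^ n \<noteq> 0" using assms(1)[of n] Qpow_eq_1_iff[of "Suc n"] by auto
  then show ?thesis using assms(2)
    by (simp add: gauss_term_def qn_Suc qtri_int_Suc divide_simps del: of_nat_Suc) (simp add: algebra_simps)
qed

text \<open>The difference of the two summands telescopes, with \<open>g n = gauss_term a c n * (1 - Q ^ n)\<close>.\<close>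
lemma gauss_sum_step:
  assumes c: "\<And>k. c * Q ^ k \<noteq> 1" and a: "a \<noteq> 0"
  shows "suminf (gauss_term a c) = (1 - c / a) / (1 - c) * suminf (gauss_term a (c * Q))"
proof -
  have c': "c * Q * Q ^ k \<noteq> 1" for k using c[of "Suc k"] by (simp add: mult_ac)
  have c1: "1 - c \<noteq> 0" using c[of 0] by simp
  define g where "g = (\<lambda>n. gauss_term a c n * (1 - Q ^ n))"
  have "gauss_term a c n - (1 - c / a) / (1 - c) * gauss_term a (c * Q) n = g n - g (Suc n)" for n
  proof -
    have cn: "1 - c * Q ^ n \<noteq> 0" using c[of n] by simp
    have "qn (c * Q) n * (1 - c) = qn c n * (1 - c * Q ^ n)" using qn_Suc[of c n] qn_Suc'[of c n] by (simp add: mult_ac)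
    then have "qn (c * Q) n = qn c n * (1 - c * Q ^ n) / (1 - c)" using c1 by (simp add: eq_divide_eq)
    moreover have "(- (c * Q) / a) ^ n = (- c / a) ^ n * Q ^ n" by (simp add: power_mult_distrib[symmetric])
    ultimately have "gauss_term a (c * Q) n = gauss_term a c n * Q ^ n * (1 - c) / (1 - c * Q ^ n)"
      using c1 cn \<open>(- (c * Q) / a) ^ n = (- c / a) ^ n * Q ^ n\<close>
      by (simp only: gauss_term_def) (simp add: divide_simps)
    moreover have "(1 - c / a) / (1 - c) * (gauss_term a c n * Q ^ n * (1 - c) / (1 - c * Q ^ n))
        = gauss_term a c n * ((1 - c / a) * Q ^ n / (1 - c * Q ^ n))"
      using c1 by simp
    ultimately have "gauss_term a c n - (1 - c / a) / (1 - c) * gauss_term a (c * Q) n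
        = gauss_term a c n * (1 - (1 - c / a) * Q ^ n / (1 - c * Q ^ n))"
      by (simp only: right_diff_distrib mult_1_right)
    also have "\<dots> = gauss_term a c n * ((1 - Q ^ n) - (c * Q ^ n * Q ^ n - c / a * Q ^ n) / (1 - c * Q ^ n))"
      using cn a by (simp add: divide_simps) (simp add: algebra_simps)
    also have "\<dots> = g n - g (Suc n)"
      using gauss_term_Suc[OF c a, of n] by (simp add: g_def algebra_simps)
    finally show ?thesis .
  qed
  moreover have "(\<lambda>n. g n - g (Suc n)) sums (g 0 - 0)"
  proof (rule telescope_sums')
    have "g \<longlonglongrightarrow> 0 * (1 - 0)"
      unfolding g_def
      by (rule tendsto_mult[OF summable_LIMSEQ_zero[OF gauss_term_summable[OF c]]
            tendsto_diff[OF tendsto_const qpow_tendsto[of 1, unfolded mult_1]]])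
    then show "g \<longlonglongrightarrow> 0" by simp
  qed
  ultimately have "(\<lambda>n. gauss_term a c n - (1 - c / a) / (1 - c) * gauss_term a (c * Q) n) sums 0"
    by (simp add: g_def)
  moreover have "(\<lambda>n. gauss_term a c n - (1 - c / a) / (1 - c) * gauss_term a (c * Q) n) sums
     (suminf (gauss_term a c) - (1 - c / a) / (1 - c) * suminf (gauss_term a (c * Q)))"
    by (intro sums_diff sums_mult summable_sums gauss_term_summable c c')
  ultimately show ?thesis using sums_unique2 by fastforce
qed

text \<open>Iterating the step moves \<open>c\<close> to \<open>0\<close>, where only the first term of the series survives.\<close>
lemma gauss_sum:
  assumes c: "\<And>k. c * Q ^ k \<noteq> 1" and a: "a \<noteq> 0"
  shows "suminf (gauss_term a c) = qp (c / a) / qp c"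
proof -
  have iter: "suminf (gauss_term a c) = qn (c / a) N / qn c N * suminf (gauss_term a (c * Q ^ N))" for N
  proof (induction N)
    case (Suc N)
    have "c * Q ^ N * Q ^ k \<noteq> 1" for k using c[of "N + k"] by (simp add: power_add mult.assoc)
    from gauss_sum_step[OF this a] Suc show ?case by (simp add: qn_Suc mult_ac)
  qed simp
  have lim: "(\<lambda>N. suminf (gauss_term a (c * Q ^ N))) \<longlonglongrightarrow> suminf (\<lambda>n. if n = 0 then 1 else 0)"
  proof -
    obtain B where B: "\<And>N n. norm (gauss_term a (c * Q ^ N) n) \<le> B * norm (qtri (int n) * norm (c / a) ^ n)"
      using gauss_term_bound[OF c] by blast
    show ?thesis
    proof (rule suminf_dominated_convergence[OF _ B])
      show "summable (\<lambda>n. B * norm (qtri (int n) * norm (c / a) ^ n))"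
        by (intro summable_mult qtri_summable_nat)
      fix n
      show "(\<lambda>N. gauss_term a (c * Q ^ N) n) \<longlonglongrightarrow> (if n = 0 then 1 else 0)"
      proof (cases "n = 0")
        case False
        have qnl: "(\<lambda>N. qn (c * Q ^ N) n) \<longlonglongrightarrow> qn 0 n"
          unfolding qpoch_def by (intro tendsto_intros qpow_tendsto)
        have "(\<lambda>N. gauss_term a (c * Q ^ N) n) \<longlonglongrightarrow>
            qn a n / (qn 0 n * qn Q n) * of_real (qtri (int n)) * (- 0 / a) ^ n"
          unfolding gauss_term_def using a by (intro tendsto_intros qnl qpow_tendsto) auto
        then show ?thesis using False by (simp add: power_0_left)
      qed (simp add: gauss_term_def)
    qed
  qed
  have "(\<lambda>N. qn (c / a) N / qn c N * suminf (gauss_term a (c * Q ^ N))) \<longlonglongrightarrow> qp (c / a) / qp c * suminf (\<lambda>n. if n = 0 then 1 else 0)"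
    using c by (intro tendsto_intros qn_LIMSEQ lim) (auto simp: qp_eq_0_iff)
  moreover have "suminf (\<lambda>n. if n = 0 then 1 else 0::complex) = 1"
    using suminf_finite[of "{0}" "\<lambda>n. if n = 0 then 1 else 0::complex"] by simp
  ultimately show ?thesis unfolding iter[symmetric] using LIMSEQ_unique[OF tendsto_const] by fastforce
qed

section \<open>A partial fraction expansion\<close>

text \<open>These are the residue data of the quotient \<open>qp (Q u) / (qp (a u) qp (b u))\<close> at \<open>a u Q\<^sup>m = 1\<close>. The
  numbers \<open>pf a b u\<close> below are its partial fraction expansion.\<close>
definition pf_coeff :: "complex \<Rightarrow> complex \<Rightarrow> nat \<Rightarrow> complex" where
  "pf_coeff a b m = qp (Q / a) / (qp Q * qp (b / a)) *
     (qn a m / (qn (a * Q / b) m * qn Q m) * of_real (qtri (int m)) * (- Q\<^sup>2 / b) ^ m)"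

definition pf_sum :: "complex \<Rightarrow> complex \<Rightarrow> complex \<Rightarrow> complex" where
  "pf_sum a b u = (\<Sum>m. pf_coeff a b m / (1 - a * u * Q ^ m))"

definition generic :: "complex \<Rightarrow> complex \<Rightarrow> bool" where
  "generic a b \<longleftrightarrow> a \<noteq> 0 \<and> b \<noteq> 0 \<and> (\<forall>n::int. b / a \<noteq> Q powi n)"

lemma generic_sym: "generic a b \<longleftrightarrow> generic b a"
proof -
  have "generic b a" if "generic a b" for a b
    unfolding generic_def
  proof (intro conjI allI notI)
    fix n :: int assume "a / b = Q powi n"
    then have "b / a = Q powi (- n)" using that by (simp add: power_int_minus generic_def field_simps)
    then show False using that by (auto simp: generic_def)
  qed (use that in \<open>auto simp: generic_def\<close>)
  then show ?thesis by blast
qed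

lemma generic_nz:
  assumes "generic a b"
  shows "b / a * Q ^ k \<noteq> 1" "a * Q / b * Q ^ k \<noteq> 1"
proof -
  have ab: "a \<noteq> 0" "b \<noteq> 0" "\<And>n::int. b / a \<noteq> Q powi n" using assms by (auto simp: generic_def)
  show "b / a * Q ^ k \<noteq> 1"
  proof
    assume "b / a * Q ^ k = 1"
    then have "b / a = 1 / Q ^ k" by (simp add: nonzero_eq_divide_eq)
    then show False using ab(3)[of "- int k"] by (simp add: power_int_minus inverse_eq_divide)
  qed
  show "a * Q / b * Q ^ k \<noteq> 1"
  proof
    assume "a * Q / b * Q ^ k = 1"
    then have "b / a = Q * Q ^ k" using ab(1,2) by (simp add: divide_simps mult_ac)
    then show False using ab(3)[of "int (Suc k)"] by (simp del: of_nat_Suc)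
  qed
qed

lemma pf_coeff_Suc:
  assumes "generic a b"
  shows "pf_coeff a b (Suc m) = pf_coeff a b m * ((1 - a * Q ^ m) / ((1 - a * Q / b * Q ^ m) * (1 - Q * Q ^ m)) * Q ^ m * (- Q\<^sup>2 / b))"
  by (simp add: pf_coeff_def qn_Suc qtri_int_Suc mult_ac del: of_nat_Suc)

lemma pf_coeff_summable:
  assumes "generic a b"
  shows "summable (\<lambda>m. norm (pf_coeff a b m * R ^ m))"
proof (rule summable_ratio_limit)
  let ?r = "\<lambda>m. (1 - a * Q ^ m) / ((1 - a * Q / b * Q ^ m) * (1 - Q * Q ^ m)) * Q ^ m * (- Q\<^sup>2 / b) * R"
  show "norm (pf_coeff a b (Suc m) * R ^ Suc m) \<le> norm (?r m) * norm (pf_coeff a b m * R ^ m)" for m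
    unfolding pf_coeff_Suc[OF assms] norm_mult[symmetric] by (simp add: mult_ac)
  have "?r \<longlonglongrightarrow> (1 - 0) / ((1 - 0) * (1 - 0)) * 0 * (- Q\<^sup>2 / b) * R"
    using qpow_tendsto[of 1, unfolded mult_1] assms
    by (intro tendsto_mult tendsto_divide tendsto_diff tendsto_const qpow_tendsto) (auto simp: generic_def)
  then show "(\<lambda>m. norm (?r m)) \<longlonglongrightarrow> 0" using tendsto_norm_zero by fastforce
qed simp

lemma pf_coeff_summable':
  assumes "generic a b" "Bseq f"
  shows "summable (\<lambda>m. norm (pf_coeff a b m * R ^ m * f m))"
proof -
  obtain B where "\<forall>n. norm (f n) \<le> B" using assms(2) by (rule BseqE)
  then show ?thesis
    by (intro summable_comparison_test'[OF summable_mult2[OF pf_coeff_summable[OF assms(1), of R], of B]])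
       (auto simp: norm_mult intro!: mult_left_mono)
qed

lemma Bseq_pf_factor: "Bseq (\<lambda>m. 1 / (1 - x * Q ^ m))"
proof -
  have "(\<lambda>m. 1 / (1 - x * Q ^ m)) \<longlonglongrightarrow> 1 / (1 - 0)" by (intro tendsto_intros qpow_tendsto) auto
  then show ?thesis by (intro convergent_imp_Bseq) (auto simp: convergent_def)
qed

lemma pf_sum_sums:
  assumes "generic a b"
  shows "(\<lambda>m. pf_coeff a b m / (1 - a * u * Q ^ m)) sums pf_sum a b u"
  unfolding pf_sum_def
  using summable_norm_cancel[OF pf_coeff_summable'[OF assms Bseq_pf_factor, of 1 "a * u"]]
  by (intro summable_sums) simp

text \<open>The \<open>m\<close>-th term of \<open>(1 - au)(1 - bu)\<close> times the expansion; the form for \<open>m = 0\<close> makes sense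
  also at the pole \<open>u = 1/a\<close>.\<close>
definition pf_term :: "complex \<Rightarrow> complex \<Rightarrow> complex \<Rightarrow> nat \<Rightarrow> complex" where
  "pf_term a b u m = pf_coeff a b m *
     (if m = 0 then 1 - b * u else (1 - a * u) * (1 - b * u) / (1 - a * u * Q ^ m))"

text \<open>The key identity: up to a telescoping part, the effect of \<open>u \<mapsto> Q u\<close> on a partial fraction is
  multiplication by \<open>(1 - a u)(1 - b u) / (1 - Q u)\<close>, with an error that is affine in \<open>u\<close>.\<close>
lemma pf_term_telescope:
  fixes a b u :: complex
  assumes ab: "generic a b" and u: "\<And>m. m \<ge> 1 \<Longrightarrow> a * u * Q ^ m \<noteq> 1"
  defines "d \<equiv> \<lambda>m. pf_coeff a b m * (1 - (1/Q) ^ m) * (1 - b / a * (1/Q) ^ m) / (1 - a * u * Q ^ m)"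
  shows "(1 - Q * u) * (pf_coeff a b m / (1 - a * (Q * u) * Q ^ m)) - pf_term a b u m
    = (d (Suc m) - d m) + pf_coeff a b m * ((1 - a - b) / a * (1/Q) ^ m + b / a * ((1/Q) ^ 2) ^ m)
      + u * (b * (pf_coeff a b m * (1/Q) ^ m))"
proof -
  define P where "P = Q ^ m"
  have nz: "P \<noteq> 0" "a \<noteq> 0" "b \<noteq> 0" using ab by (auto simp: P_def generic_def)
  have uS: "1 - a * u * (Q * P) \<noteq> 0" using u[of "Suc m"] by (simp add: P_def)
  have g: "1 - a * Q / b * P \<noteq> 0" "1 - Q * P \<noteq> 0"
    using generic_nz(2)[OF ab, of m] Qpow_eq_1_iff[of "Suc m"] by (auto simp: P_def)
  have inv: "(1/Q) ^ m = 1 / P" "((1/Q) ^ 2) ^ m = 1 / P ^ 2" "(1/Q) ^ Suc m = 1 / (Q * P)" "Q ^ Suc m = Q * P"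
    by (simp_all add: P_def power_divide power_mult[symmetric] mult.commute power_even_eq)
  have g': "b - a * Q * P \<noteq> 0" using g(1) nz by (simp add: divide_simps)
  have "(1 - a * P) / ((1 - a * Q / b * P) * (1 - Q * P)) * P * (- Q\<^sup>2 / b) * (1 - 1 / (Q * P)) * (1 - b / a * (1 / (Q * P)))
     = 1 - 1 / (a * P)"
  proof -
    have 1: "1 - 1 / (Q * P) = - (1 - Q * P) / (Q * P)" using nz by (simp add: divide_simps)
    have 2: "1 - b / a * (1 / (Q * P)) = - (1 - a * Q / b * P) * b / (a * Q * P)" using nz by (simp add: divide_simps)
    show ?thesis unfolding 1 2 using nz g by (simp add: divide_simps power2_eq_square) (simp add: algebra_simps)
  qed
  then have dS: "d (Suc m) = pf_coeff a b m * (1 - 1 / (a * P)) / (1 - a * u * (Q * P))"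
    unfolding d_def pf_coeff_Suc[OF ab] inv P_def[symmetric] by (metis (no_types, opaque_lifting) mult.assoc)
  have A: "(1 - Q * u) / (1 - a * u * (Q * P)) = (1 - 1 / (a * P)) / (1 - a * u * (Q * P)) + 1 / (a * P)"
    using nz uS by (simp add: divide_simps) (simp add: algebra_simps)
  have B: "(if m = 0 then 1 - b * u else (1 - a * u) * (1 - b * u) / (1 - a * u * P))
     = (1 - 1/P) * (1 - b / a * (1/P)) / (1 - a * u * P) + (1/P + b/a * (1/P) - b/a * (1/P^2) - b * u * (1/P))"
  proof (cases "m = 0")
    case True
    then show ?thesis by (simp add: P_def)
  next
    case False
    then have "1 - a * u * P \<noteq> 0" using u[of m] by (simp add: P_def)
    then show ?thesis using nz False by (simp add: divide_simps power2_eq_square) (simp add: algebra_simps)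
  qed
  have "(1 - Q * u) * (pf_coeff a b m / (1 - a * (Q * u) * Q ^ m)) - pf_term a b u m
     = pf_coeff a b m * ((1 - Q * u) / (1 - a * u * (Q * P)) - (if m = 0 then 1 - b * u else (1 - a * u) * (1 - b * u) / (1 - a * u * P)))"
    by (simp add: pf_term_def P_def mult_ac right_diff_distrib)
  also have "\<dots> = pf_coeff a b m * ((1 - 1 / (a * P)) / (1 - a * u * (Q * P)) - (1 - 1/P) * (1 - b / a * (1/P)) / (1 - a * u * P)
      + (1 / (a * P) - (1/P + b/a * (1/P) - b/a * (1/P^2) - b * u * (1/P))))"
    unfolding A B by simp
  also have "1 / (a * P) - (1/P + b/a * (1/P) - b/a * (1/P^2) - b * u * (1/P))
      = ((1 - a - b) / a * (1/P) + b / a * (1/P^2)) + u * b * (1/P)"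
    using nz by (simp add: field_simps)
  finally have fin: "(1 - Q * u) * (pf_coeff a b m / (1 - a * (Q * u) * Q ^ m)) - pf_term a b u m =
    pf_coeff a b m * ((1 - 1 / (a * P)) / (1 - a * u * (Q * P)) - (1 - 1/P) * (1 - b / a * (1/P)) / (1 - a * u * P)
      + (((1 - a - b) / a * (1/P) + b / a * (1/P^2)) + u * b * (1/P)))" .
  have aux: "p * (e / d - y * z / w + ((s + t) + u * b * r)) = (p * e / d - p * y * z / w) + p * (s + t) + u * (b * (p * r))"
    for p e d y z w s t r :: complex by (simp add: algebra_simps)
  show ?thesis
    unfolding fin dS unfolding d_def inv(1,2) P_def[symmetric] by (rule aux)
qed

lemma pf_term_sums:
  assumes ab: "generic a b" and u: "\<And>m. m \<ge> 1 \<Longrightarrow> a * u * Q ^ m \<noteq> 1"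
  shows "pf_term a b u sums ((1 - Q * u) * pf_sum a b (Q * u)
     - (\<Sum>m. pf_coeff a b m * ((1 - a - b) / a * (1/Q) ^ m + b / a * ((1/Q) ^ 2) ^ m))
     - u * (b * (\<Sum>m. pf_coeff a b m * (1/Q) ^ m)))"
proof -
  define d where "d = (\<lambda>m. pf_coeff a b m * (1 - (1/Q) ^ m) * (1 - b / a * (1/Q) ^ m) / (1 - a * u * Q ^ m))"
  have s: "summable (\<lambda>m. pf_coeff a b m * R ^ m)" for R
    by (rule summable_norm_cancel[OF pf_coeff_summable[OF ab]])
  have d0: "d \<longlonglongrightarrow> 0"
  proof -
    have "d = (\<lambda>m. (pf_coeff a b m * 1 ^ m - (1 + b / a) * (pf_coeff a b m * (1/Q) ^ m)
        + b / a * (pf_coeff a b m * ((1/Q) ^ 2) ^ m)) / (1 - a * u * Q ^ m))"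
      by (rule ext) (simp add: d_def power_mult[symmetric] mult.commute[of _ 2] power_mult power2_eq_square power_mult_distrib field_simps)
    moreover have "\<dots> \<longlonglongrightarrow> (0 - (1 + b / a) * 0 + b / a * 0) / (1 - 0)"
      by (intro tendsto_divide tendsto_add tendsto_diff tendsto_mult tendsto_const summable_LIMSEQ_zero s qpow_tendsto) auto
    ultimately show ?thesis by simp
  qed
  have "(\<lambda>m. (1 - Q * u) * (pf_coeff a b m / (1 - a * (Q * u) * Q ^ m))
      - (d (Suc m) - d m) - pf_coeff a b m * ((1 - a - b) / a * (1/Q) ^ m + b / a * ((1/Q) ^ 2) ^ m)
      - u * (b * (pf_coeff a b m * (1/Q) ^ m))) sums
    ((1 - Q * u) * pf_sum a b (Q * u) - (0 - d 0)
     - (\<Sum>m. pf_coeff a b m * ((1 - a - b) / a * (1/Q) ^ m + b / a * ((1/Q) ^ 2) ^ m))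
     - u * (b * (\<Sum>m. pf_coeff a b m * (1/Q) ^ m)))"
  proof -
    have X: "summable (\<lambda>m. pf_coeff a b m * ((1 - a - b) / a * (1/Q) ^ m + b / a * ((1/Q) ^ 2) ^ m))"
      unfolding distrib_left mult.left_commute[of "pf_coeff a b _"] by (intro summable_add summable_mult s)
    show ?thesis
      by (rule sums_diff[OF sums_diff[OF sums_diff[OF sums_mult[OF pf_sum_sums[OF ab]] telescope_sums[OF d0]]
            summable_sums[OF X]] sums_mult[OF sums_mult[OF summable_sums[OF s]]]])
  qed
  moreover have "(1 - Q * u) * (pf_coeff a b m / (1 - a * (Q * u) * Q ^ m))
      - (d (Suc m) - d m) - pf_coeff a b m * ((1 - a - b) / a * (1/Q) ^ m + b / a * ((1/Q) ^ 2) ^ m)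
      - u * (b * (pf_coeff a b m * (1/Q) ^ m)) = pf_term a b u m" for m
  proof -
    have aux: "x - d - e - f = t" if "x - t = d + e + f" for x t d e f :: complex
      using that by (simp add: algebra_simps)
    show ?thesis unfolding d_def by (rule aux[OF pf_term_telescope[OF ab u]])
  qed
  ultimately show ?thesis by (simp add: d_def)
qed

text \<open>The sum of the residues, weighted with the position of the poles, vanishes. This is where the
  summation formula enters.\<close>
lemma pf_coeff_sum:
  assumes ab: "generic a b"
  shows "b * (\<Sum>m. pf_coeff a b m * (1/Q) ^ m) = 
     b / (1 - b / a) * (qp (Q / a) * qp (Q / b) / (qp Q * qp (a * Q / b) * qp (b * Q / a)))"
proof -
  have a: "a \<noteq> 0" "b \<noteq> 0" using ab by (auto simp: generic_def)
  have eq: "(\<lambda>m. pf_coeff a b m * (1/Q) ^ m) = (\<lambda>m. qp (Q / a) / (qp Q * qp (b / a)) * gauss_term a (a * Q / b) m)"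
    using a by (simp add: fun_eq_iff pf_coeff_def gauss_term_def power2_eq_square power_divide[symmetric] mult.assoc power_mult_distrib[symmetric])
  have "suminf (gauss_term a (a * Q / b)) = qp (Q / b) / qp (a * Q / b)"
    using gauss_sum[OF generic_nz(2)[OF ab] a(1)] a by simp
  moreover have "summable (gauss_term a (a * Q / b))"
    by (rule gauss_term_summable[OF generic_nz(2)[OF ab]])
  ultimately have "(\<Sum>m. pf_coeff a b m * (1/Q) ^ m) = qp (Q / a) / (qp Q * qp (b / a)) * (qp (Q / b) / qp (a * Q / b))"
    unfolding eq by (simp only: suminf_mult)
  moreover have "qp (b / a) = (1 - b / a) * qp (b * Q / a)"
    using qp_step[of "b / a"] by simp
  ultimately show ?thesis by simp
qed

definition pf :: "complex \<Rightarrow> complex \<Rightarrow> complex \<Rightarrow> complex" where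
  "pf a b u = pf_sum a b u + pf_sum b a u"

text \<open>The affine errors of the two families add up to zero: the part linear in \<open>u\<close> by \<open>pf_coeff_sum\<close>, the
  constant part by evaluating at \<open>u = 0\<close>.\<close>
lemma pf_step_gen:
  assumes ab: "generic a b" and u: "\<And>m. m \<ge> 1 \<Longrightarrow> a * u * Q ^ m \<noteq> 1" "\<And>m. m \<ge> 1 \<Longrightarrow> b * u * Q ^ m \<noteq> 1"
  shows "(1 - Q * u) * pf a b (Q * u) = suminf (pf_term a b u) + suminf (pf_term b a u)"
proof -
  have ba: "generic b a" using ab generic_sym by blast
  define K where "K = (\<lambda>a b. \<Sum>m. pf_coeff a b m * ((1 - a - b) / a * (1/Q) ^ m + b / a * ((1/Q) ^ 2) ^ m))"
  define L where "L = (\<lambda>a b. b * (\<Sum>m. pf_coeff a b m * (1/Q) ^ m))"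
  have *: "(1 - Q * u) * pf a b (Q * u) = suminf (pf_term a b u) + suminf (pf_term b a u) + (K a b + K b a) + u * (L a b + L b a)"
    if "\<And>m. m \<ge> 1 \<Longrightarrow> a * u * Q ^ m \<noteq> 1" "\<And>m. m \<ge> 1 \<Longrightarrow> b * u * Q ^ m \<noteq> 1" for u
  proof -
    have "suminf (pf_term a b u) = (1 - Q * u) * pf_sum a b (Q * u) - K a b - u * L a b"
      unfolding K_def L_def by (rule sums_unique[symmetric, OF pf_term_sums[OF ab that(1)]])
    moreover have "suminf (pf_term b a u) = (1 - Q * u) * pf_sum b a (Q * u) - K b a - u * L b a"
      unfolding K_def L_def by (rule sums_unique[symmetric, OF pf_term_sums[OF ba that(2)]])
    moreover have "r * (A + B) = s + s' + (k + k') + u * (l + l')"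
      if "s = r * A - k - u * l" "s' = r * B - k' - u * l'" for r A B s s' k k' l l' :: complex
      unfolding that by (simp add: algebra_simps)
    ultimately show ?thesis unfolding pf_def by blast
  qed
  have "suminf (pf_term a b 0) = pf_sum a b 0" for a b
  proof -
    have "pf_term a b 0 = pf_coeff a b" by (rule ext) (simp add: pf_term_def)
    then show ?thesis by (simp add: pf_sum_def)
  qed
  then have K0: "K a b + K b a = 0" using *[of 0] by (simp add: pf_def)
  have nz: "a \<noteq> 0" "b \<noteq> 0" "a \<noteq> b" using generic_nz(1)[OF ab, of 0] ab by (auto simp: generic_def)
  then have "b / (1 - b / a) + a / (1 - a / b) = 0" by (simp add: divide_simps) (simp add: algebra_simps)
  moreover have "L a b + L b a = (b / (1 - b / a) + a / (1 - a / b)) * (qp (Q / a) * qp (Q / b) / (qp Q * qp (a * Q / b) * qp (b * Q / a)))"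
    unfolding L_def pf_coeff_sum[OF ab] pf_coeff_sum[OF ba] by (simp only: distrib_right mult_ac)
  ultimately have "L a b + L b a = 0" by simp
  then show ?thesis using *[OF u] K0 by simp
qed

lemma suminf_pf_term:
  assumes "generic a b" "a * u \<noteq> 1"
  shows "suminf (pf_term a b u) = (1 - a * u) * (1 - b * u) * pf_sum a b u"
proof -
  have "pf_term a b u m = (1 - a * u) * (1 - b * u) * (pf_coeff a b m / (1 - a * u * Q ^ m))" for m
    using assms(2) by (simp add: pf_term_def)
  then have "pf_term a b u = (\<lambda>m. (1 - a * u) * (1 - b * u) * (pf_coeff a b m / (1 - a * u * Q ^ m)))" by blast
  then show ?thesis
    using sums_unique[OF sums_mult[OF pf_sum_sums[OF assms(1), of u]]] by metis
qed

lemma pf_step: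
  assumes "generic a b" "\<And>m. a * u * Q ^ m \<noteq> 1" "\<And>m. b * u * Q ^ m \<noteq> 1"
  shows "(1 - Q * u) * pf a b (Q * u) = (1 - a * u) * (1 - b * u) * pf a b u"
proof -
  have ba: "generic b a" using assms(1) generic_sym by blast
  have "(1 - Q * u) * pf a b (Q * u) = suminf (pf_term a b u) + suminf (pf_term b a u)"
    using assms by (intro pf_step_gen) auto
  also have "suminf (pf_term a b u) = (1 - a * u) * (1 - b * u) * pf_sum a b u"
    using assms(2)[of 0] by (intro suminf_pf_term assms(1)) simp
  also have "suminf (pf_term b a u) = (1 - b * u) * (1 - a * u) * pf_sum b a u"
    using assms(3)[of 0] by (intro suminf_pf_term ba) simp
  finally show ?thesis by (simp only: pf_def mult_ac distrib_left)
qed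

text \<open>At \<open>u = 1 / a\<close> every term but the first one of the family of \<open>a\<close> is killed by a vanishing factor.\<close>
lemma pf_step_pole:
  assumes ab: "generic a b"
  shows "(1 - Q / a) * pf a b (Q / a) = (1 - b / a) * pf_coeff a b 0"
proof -
  have a: "a \<noteq> 0" using ab by (auto simp: generic_def)
  have "suminf (pf_term a b (1 / a)) = (\<Sum>m\<in>{0}. pf_term a b (1 / a) m)"
    using a by (intro suminf_finite) (auto simp: pf_term_def)
  moreover have "suminf (pf_term b a (1 / a)) = 0"
    using a by (subst suminf_finite[of "{}"]) (auto simp: pf_term_def)
  moreover have "(1 - Q * (1 / a)) * pf a b (Q * (1 / a)) = suminf (pf_term a b (1 / a)) + suminf (pf_term b a (1 / a))"
    using a generic_nz(1)[OF ab] by (intro pf_step_gen ab) auto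
  ultimately show ?thesis by (simp add: pf_term_def mult.commute)
qed

lemma pf_iter:
  assumes ab: "generic a b" and u: "\<And>m. a * u * Q ^ m \<noteq> 1" "\<And>m. b * u * Q ^ m \<noteq> 1"
  shows "qn (Q * u) N * pf a b (u * Q ^ N) = qn (a * u) N * qn (b * u) N * pf a b u"
proof (induction N)
  case (Suc N)
  have "a * (u * Q ^ N) * Q ^ m \<noteq> 1" "b * (u * Q ^ N) * Q ^ m \<noteq> 1" for m
    using u[of "N + m"] by (auto simp: power_add mult_ac)
  from pf_step[OF ab this] have "(1 - Q * u * Q ^ N) * pf a b (u * Q ^ Suc N) = (1 - a * u * Q ^ N) * (1 - b * u * Q ^ N) * pf a b (u * Q ^ N)"
    by (simp add: mult_ac)
  then have "qn (Q * u) (Suc N) * pf a b (u * Q ^ Suc N)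
     = (1 - a * u * Q ^ N) * (1 - b * u * Q ^ N) * (qn (Q * u) N * pf a b (u * Q ^ N))"
    by (simp only: qn_Suc) (simp only: mult_ac)
  then show ?case unfolding Suc.IH by (simp only: qn_Suc mult_ac)
qed simp

lemma pf_sum_limit:
  assumes ab: "generic a b" and u: "\<And>m. a * u * Q ^ m \<noteq> 1"
  shows "(\<lambda>N. pf_sum a b (u * Q ^ N)) \<longlonglongrightarrow> pf_sum a b 0"
proof -
  obtain B where B: "\<forall>n. norm (1 / (1 - a * u * Q ^ n)) \<le> B" using Bseq_pf_factor[of "a * u"] by (rule BseqE)
  show ?thesis
    unfolding pf_sum_def
  proof (rule suminf_dominated_convergence)
    show "summable (\<lambda>m. norm (pf_coeff a b m) * B)"
      using summable_mult2[OF pf_coeff_summable[OF ab, of 1]] by simp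
    show "norm (pf_coeff a b m / (1 - a * (u * Q ^ N) * Q ^ m)) \<le> norm (pf_coeff a b m) * B" for N m
      using mult_left_mono[OF spec[OF B, of "N + m"], of "norm (pf_coeff a b m)"]
      by (simp add: norm_divide power_add mult.assoc)
    show "(\<lambda>N. pf_coeff a b m / (1 - a * (u * Q ^ N) * Q ^ m)) \<longlonglongrightarrow> pf_coeff a b m / (1 - a * 0 * Q ^ m)" for m
      by (intro tendsto_divide tendsto_diff tendsto_mult tendsto_const qpow_tendsto) auto
  qed
qed

lemma pf_limit:
  assumes ab: "generic a b" and u: "\<And>m. a * u * Q ^ m \<noteq> 1" "\<And>m. b * u * Q ^ m \<noteq> 1"
  shows "qp (Q * u) * pf a b 0 = qp (a * u) * qp (b * u) * pf a b u"
proof -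
  have ba: "generic b a" using ab generic_sym by blast
  have "(\<lambda>N. qn (Q * u) N * pf a b (u * Q ^ N)) \<longlonglongrightarrow> qp (Q * u) * pf a b 0"
    unfolding pf_def by (intro tendsto_intros qn_LIMSEQ pf_sum_limit ab ba u)
  moreover have "(\<lambda>N. qn (a * u) N * qn (b * u) N * pf a b u) \<longlonglongrightarrow> qp (a * u) * qp (b * u) * pf a b u"
    by (intro tendsto_intros qn_LIMSEQ)
  ultimately show ?thesis unfolding pf_iter[OF ab u] by (rule LIMSEQ_unique)
qed

text \<open>Evaluating \<open>pf_limit\<close> at \<open>u = Q / a\<close>, where \<open>pf_step_pole\<close> gives the value of the expansion, fixes the
  normalization.\<close>
lemma pf_0:
  assumes ab: "generic a b" and a: "qp (Q / a) \<noteq> 0"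
  shows "pf a b 0 = 1"
proof -
  have nz: "a \<noteq> 0" "b \<noteq> 0" using ab by (auto simp: generic_def)
  have "a * (Q / a) * Q ^ m \<noteq> 1" "b * (Q / a) * Q ^ m \<noteq> 1" for m
    using nz Qpow_eq_1_iff[of "Suc m"] generic_nz(1)[OF ab, of "Suc m"] by auto
  from pf_limit[OF ab this] have 1: "qp (Q * (Q / a)) * pf a b 0 = qp Q * qp (b * Q / a) * pf a b (Q / a)"
    using nz by simp
  have "qp (Q / a) * pf a b 0 = (1 - Q / a) * (qp (Q * (Q / a)) * pf a b 0)"
    using qp_step[of "Q / a"] by (simp add: mult_ac)
  also have "\<dots> = qp Q * qp (b * Q / a) * ((1 - Q / a) * pf a b (Q / a))" unfolding 1 by (simp only: mult_ac)
  also have "\<dots> = qp Q * (qp (b * Q / a) * (1 - b / a)) * pf_coeff a b 0" unfolding pf_step_pole[OF ab] by (simp only: mult_ac)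
  also have "qp (b * Q / a) * (1 - b / a) = qp (b / a)" using qp_step[of "b / a"] by (simp add: mult_ac)
  also have "qp Q * qp (b / a) * pf_coeff a b 0 = qp (Q / a)"
  proof -
    have "qp (b / a) \<noteq> 0" unfolding qp_eq_0_iff using generic_nz(1)[OF ab] by blast
    then show ?thesis by (simp add: pf_coeff_def)
  qed
  finally show ?thesis using a by simp
qed

definition nonpow :: "complex \<Rightarrow> bool" where
  "nonpow a \<longleftrightarrow> (\<forall>n::int. a \<noteq> Q powi n)"

lemma nonpow_powi: "nonpow a \<Longrightarrow> a * Q powi n \<noteq> 1"
proof
  assume a: "nonpow a" and "a * Q powi n = 1"
  then have "a = Q powi (- n)" by (simp add: power_int_minus nonzero_eq_divide_eq inverse_eq_divide)
  then show False using a by (auto simp: nonpow_def)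
qed

lemma nonpow_pow: "nonpow a \<Longrightarrow> a * Q ^ n \<noteq> 1"
  using nonpow_powi[of a "int n"] by simp

lemma nonpow_qp: 
  assumes "nonpow a" shows "qp a \<noteq> 0" "qp (Q / a) \<noteq> 0"
proof -
  show "qp a \<noteq> 0" using nonpow_pow[OF assms] by (auto simp: qp_eq_0_iff)
  have "Q / a * Q ^ n \<noteq> 1" for n
  proof
    assume *: "Q / a * Q ^ n = 1"
    then have "a \<noteq> 0" by auto
    then have "a = Q powi (int (Suc n))" using * by (simp add: divide_simps del: of_nat_Suc)
    then show False using assms unfolding nonpow_def by blast
  qed
  then show "qp (Q / a) \<noteq> 0" by (auto simp: qp_eq_0_iff)
qed

text \<open>Both statements are read off from \<open>pf_limit\<close> with the value \<open>1\<close> at \<open>0\<close>: at the negative powers of \<open>q\<close>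
  the factor \<open>qp (Q * u)\<close> vanishes while those of the right hand side do not.\<close>
lemma pf_powers:
  assumes ab: "generic a b" and a: "nonpow a" and b: "nonpow b"
  shows "pf a b (Q ^ n) = qp Q / (qp a * qp b) * (qn a n * qn b n / qn Q n)"
    and "pf a b (1 / Q ^ Suc n) = 0"
proof -
  have "qp Q * pf a b 0 = qp a * qp b * pf a b 1"
    using pf_limit[OF ab, of 1] nonpow_pow a b by simp
  then have 1: "pf a b 1 = qp Q / (qp a * qp b)"
    using pf_0[OF ab nonpow_qp(2)[OF a]] nonpow_qp(1)[OF a] nonpow_qp(1)[OF b] by (simp add: field_simps)
  have "qn Q n * pf a b (Q ^ n) = qn a n * qn b n * pf a b 1"
    using pf_iter[OF ab, of 1 n] nonpow_pow a b by simp
  then show "pf a b (Q ^ n) = qp Q / (qp a * qp b) * (qn a n * qn b n / qn Q n)"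
    unfolding 1 by (metis (no_types, lifting) mult.commute nonzero_eq_divide_eq qn_Q_nz times_divide_eq_right)
  have st: "(1 - Q * (1 / Q ^ Suc n)) * pf a b (Q * (1 / Q ^ Suc n)) = (1 - a * (1 / Q ^ Suc n)) * (1 - b * (1 / Q ^ Suc n)) * pf a b (1 / Q ^ Suc n)"
    and nz: "1 - a * (1 / Q ^ Suc n) \<noteq> 0" "1 - b * (1 / Q ^ Suc n) \<noteq> 0" for n
  proof -
    have e: "x * (1 / Q ^ Suc n) * Q ^ m = x * Q powi (int m - int (Suc n))" for x m
      by (simp add: power_int_diff del: of_nat_Suc)
    show "1 - a * (1 / Q ^ Suc n) \<noteq> 0" "1 - b * (1 / Q ^ Suc n) \<noteq> 0"
      using nonpow_powi[OF a] nonpow_powi[OF b] e[of _ 0] by (metis mult_1_right power_0 right_minus_eq)+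
    show "(1 - Q * (1 / Q ^ Suc n)) * pf a b (Q * (1 / Q ^ Suc n)) = (1 - a * (1 / Q ^ Suc n)) * (1 - b * (1 / Q ^ Suc n)) * pf a b (1 / Q ^ Suc n)"
      by (rule pf_step[OF ab]; unfold e; rule nonpow_powi; fact)
  qed
  show "pf a b (1 / Q ^ Suc n) = 0"
  proof (induction n)
    case 0
    show ?case using st[of 0] nz[of 0] by simp
  next
    case (Suc n)
    have "Q * (1 / Q ^ Suc (Suc n)) = 1 / Q ^ Suc n" by simp
    then show ?case using st[of "Suc n"] nz[of "Suc n"] Suc.IH by (simp del: power_Suc)
  qed
qed

end

lemma infsum_convolution:
  fixes f :: "'a \<Rightarrow> complex" and g :: "int \<Rightarrow> complex" and d :: "'a \<Rightarrow> int"
  assumes f: "(\<lambda>k. norm (f k)) summable_on UNIV" and g: "(\<lambda>n. norm (g n)) summable_on UNIV"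
  shows "infsum f UNIV * infsum g UNIV = (\<Sum>\<^sub>\<infinity>n. \<Sum>\<^sub>\<infinity>k. f k * g (n - d k))"
    and "(\<lambda>n. \<Sum>\<^sub>\<infinity>k. f k * g (n - d k)) summable_on UNIV"
proof -
  have "(\<lambda>p. f (fst p) * g (snd p)) summable_on UNIV \<times> UNIV"
    using norm_summable_on_times[OF f g] by (rule abs_summable_summable)
  moreover have bij: "bij_betw (\<lambda>(k, n). (k, n - d k)) (UNIV \<times> UNIV) (UNIV \<times> UNIV)"
    by (rule bij_betw_byWitness[of _ "\<lambda>(k, n). (k, n + d k)"]) auto
  ultimately have "(\<lambda>p. f (fst ((\<lambda>(k, n). (k, n - d k)) p)) * g (snd ((\<lambda>(k, n). (k, n - d k)) p))) summable_on UNIV \<times> UNIV"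
    using summable_on_reindex_bij_betw[OF bij, of "\<lambda>p. f (fst p) * g (snd p)"] by simp
  then have s: "(\<lambda>(k, n). f k * g (n - d k)) summable_on UNIV \<times> UNIV"
    by (simp add: case_prod_unfold)
  have s': "(\<lambda>(n, k). f k * g (n - d k)) summable_on UNIV \<times> UNIV"
    using s summable_on_swap[of "\<lambda>(k, n). f k * g (n - d k)" UNIV UNIV] by (simp add: case_prod_unfold o_def)
  show "(\<lambda>n. \<Sum>\<^sub>\<infinity>k. f k * g (n - d k)) summable_on UNIV"
    using summable_on_Sigma_banach[OF s'] by simp
  have "(\<Sum>\<^sub>\<infinity>n. \<Sum>\<^sub>\<infinity>k. f k * g (n - d k)) = (\<Sum>\<^sub>\<infinity>k. \<Sum>\<^sub>\<infinity>n. f k * g (n - d k))"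
    using infsum_swap_banach[OF s'] by simp
  also have "\<dots> = (\<Sum>\<^sub>\<infinity>k. f k * infsum g UNIV)"
  proof (rule infsum_cong)
    fix k
    have "bij (\<lambda>n. n - d k)" by (rule bij_betw_byWitness[of _ "\<lambda>n. n + d k"]) auto
    then have "(\<Sum>\<^sub>\<infinity>n. g (n - d k)) = infsum g UNIV"
      by (rule infsum_reindex_bij_betw)
    then show "(\<Sum>\<^sub>\<infinity>n. f k * g (n - d k)) = f k * infsum g UNIV"
      by (simp add: infsum_cmult_right')
  qed
  also have "\<dots> = infsum f UNIV * infsum g UNIV" by (simp add: infsum_cmult_left')
  finally show "infsum f UNIV * infsum g UNIV = (\<Sum>\<^sub>\<infinity>n. \<Sum>\<^sub>\<infinity>k. f k * g (n - d k))" ..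
qed

lemma summable_on_geometric_int:
  assumes "0 \<le> r" "r < (1::real)"
  shows "(\<lambda>n::int. r ^ nat \<bar>n\<bar>) summable_on UNIV"
  using summable_on_int_iff[of "\<lambda>n. r ^ nat \<bar>n\<bar>"] assms by (simp add: summable_geometric)

lemma infsum_int_limit:
  fixes f :: "int \<Rightarrow> 'a::{topological_comm_monoid_add,t2_space}"
  assumes "f summable_on UNIV"
  shows "(\<lambda>N. \<Sum>n\<in>{- int N..int N}. f n) \<longlonglongrightarrow> infsum f UNIV"
proof -
  have "filterlim (\<lambda>N. {- int N..int N}) (finite_subsets_at_top UNIV) sequentially"
    unfolding filterlim_finite_subsets_at_top
  proof (intro allI impI)
    fix X :: "int set" assume X: "finite X \<and> X \<subseteq> UNIV"
    have "\<forall>\<^sub>F N in sequentially. \<forall>x\<in>X. x \<in> {- int N..int N}"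
    proof (rule eventually_ball_finite)
      show "\<forall>x\<in>X. \<forall>\<^sub>F N in sequentially. x \<in> {- int N..int N}"
      proof
        fix x show "\<forall>\<^sub>F N in sequentially. x \<in> {- int N..int N}"
          using eventually_ge_at_top[of "nat \<bar>x\<bar>"] by eventually_elim auto
      qed
    qed (use X in simp)
    then show "\<forall>\<^sub>F N in sequentially. finite {- int N..int N} \<and> X \<subseteq> {- int N..int N} \<and> {- int N..int N} \<subseteq> UNIV"
      by eventually_elim auto
  qed
  then show ?thesis
    using filterlim_compose[of "sum f" "nhds (infsum f UNIV)" "finite_subsets_at_top UNIV"] has_sum_infsum[OF assms]
    by (simp add: has_sum_def)
qed

context qbase
begin

section \<open>A bilateral series for a quotient of theta functions\<close>

text \<open>Kronecker's bilateral series; it converges in the annulus \<open>q < norm x < 1\<close>.\<close>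
definition kron :: "complex \<Rightarrow> complex \<Rightarrow> complex" where
  "kron a x = (\<Sum>\<^sub>\<infinity>n::int. x powi n / (1 - a * Q powi n))"

definition kron_const :: "complex \<Rightarrow> complex" where
  "kron_const a = (\<Sum>\<^sub>\<infinity>k::int. of_real (qtri k) * (- 1) powi k / (1 - a / Q powi k))"

lemma abs_q [simp]: "\<bar>q\<bar> = q"
  using q0 by simp

lemma powi_nonneg: "n \<ge> 0 \<Longrightarrow> x powi n = x ^ nat n"
  by (simp add: power_int_def)

lemma nonpow_shift: "nonpow a \<Longrightarrow> nonpow (a * Q powi n)"
  unfolding nonpow_def
proof (intro allI notI)
  fix m assume a: "\<forall>n::int. a \<noteq> Q powi n" and "a * Q powi n = Q powi m"
  then have "a = Q powi (m - n)" by (simp add: power_int_diff nonzero_eq_divide_eq)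
  with a show False by blast
qed

lemma kron_bound:
  assumes a: "a \<noteq> 0" "nonpow a"
  obtains B where "B \<ge> 0" "\<And>n. norm (1 / (1 - a * Q powi n)) \<le> B" "\<And>n. norm (Q powi n / (1 - a * Q powi n)) \<le> B"
proof -
  obtain B where B: "B > 0" "\<forall>n. norm (1 / (1 - a * Q ^ n)) \<le> B" using Bseq_pf_factor[of a] by (rule BseqE)
  obtain C where C: "C > 0" "\<forall>n. norm (1 / (1 - (1/a) * Q ^ n)) \<le> C" using Bseq_pf_factor[of "1/a"] by (rule BseqE)
  let ?M = "B + norm (1/a) * C"
  have nn: "0 \<le> norm (1/a) * C" using C by simp
  have small: "q ^ m * x \<le> x" if "x \<ge> 0" for m and x :: real
    using mult_right_mono[of "q ^ m" 1 x] power_le_one[of q m] q0 q1 that by simp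
  have *: "norm (1 / (1 - a * Q powi n)) \<le> ?M \<and> norm (Q powi n / (1 - a * Q powi n)) \<le> ?M" for n
  proof (cases "n \<ge> 0")
    case True
    then have n: "Q powi n = Q ^ nat n" by (rule powi_nonneg)
    have 1: "norm (1 / (1 - a * Q powi n)) \<le> B" unfolding n using B by blast
    have "norm (Q powi n / (1 - a * Q powi n)) = q ^ nat n * norm (1 / (1 - a * Q powi n))"
      unfolding n by (simp add: norm_divide norm_power)
    then show ?thesis using 1 small[of "norm (1 / (1 - a * Q powi n))" "nat n"] nn by auto
  next
    case False
    define m where "m = nat (- n)"
    have n: "Q powi n = 1 / Q ^ m" using False by (simp add: power_int_def m_def power_divide inverse_eq_divide)
    have nz: "1 - a * (1 / Q ^ m) \<noteq> 0" using nonpow_powi[OF a(2), of n] by (simp add: n)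
    then have nz': "1 - (1/a) * Q ^ m \<noteq> 0" using a(1) by (auto simp: divide_simps)
    have e: "Q powi n / (1 - a * Q powi n) = - (1/a) * (1 / (1 - (1/a) * Q ^ m))"
      unfolding n using nz nz' a(1) by (simp add: divide_simps)
    have 1: "norm (Q powi n / (1 - a * Q powi n)) \<le> norm (1/a) * C"
      unfolding e norm_mult norm_minus_cancel by (rule mult_left_mono) (use C in auto)
    have "1 / (1 - a * Q powi n) = Q ^ m * (Q powi n / (1 - a * Q powi n))" unfolding n by simp
    then have "norm (1 / (1 - a * Q powi n)) = q ^ m * norm (Q powi n / (1 - a * Q powi n))"
      by (simp only: norm_mult norm_power norm_Q)
    then show ?thesis using 1 small[of "norm (Q powi n / (1 - a * Q powi n))" m] B by auto
  qed
  show ?thesis using that[of ?M] * nn B by auto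
qed

lemma kron_summable:
  assumes a: "a \<noteq> 0" "nonpow a" and x: "q < norm x" "norm x < 1"
  shows "(\<lambda>n::int. norm (x powi n / (1 - a * Q powi n))) summable_on UNIV"
proof -
  obtain B where B: "B \<ge> 0" "\<And>n. norm (1 / (1 - a * Q powi n)) \<le> B" "\<And>n. norm (Q powi n / (1 - a * Q powi n)) \<le> B"
    using kron_bound[OF a] by blast
  have x0: "x \<noteq> 0" using x q0 by auto
  show ?thesis
  proof (rule summable_on_int_iff)
    show "summable (\<lambda>n. norm (x powi int n / (1 - a * Q powi int n)))"
    proof (rule summable_comparison_test')
      show "summable (\<lambda>n. norm x ^ n * B)" using x by (intro summable_mult2 summable_geometric) auto
      show "norm (norm (x powi int n / (1 - a * Q powi int n))) \<le> norm x ^ n * B" for n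
        using mult_left_mono[OF B(2)[of "int n"], of "norm x ^ n"] by (simp add: norm_divide norm_power)
    qed
    show "summable (\<lambda>n. norm (x powi (- int n) / (1 - a * Q powi (- int n))))"
    proof (rule summable_comparison_test')
      have "norm (q / norm x) < 1" using x q0 by (simp add: divide_simps)
      then show "summable (\<lambda>n. (q / norm x) ^ n * B)" by (intro summable_mult2 summable_geometric)
      fix n :: nat
      have "x powi (- int n) / (1 - a * Q powi (- int n)) = (Q / x) ^ n * (Q powi (- int n) / (1 - a * Q powi (- int n)))"
        using x0 by (simp add: power_int_minus power_divide divide_simps)
      then have "norm (x powi (- int n) / (1 - a * Q powi (- int n))) = (q / norm x) ^ n * norm (Q powi (- int n) / (1 - a * Q powi (- int n)))"
        by (simp only: norm_mult norm_power norm_divide norm_Q)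
      also have "\<dots> \<le> (q / norm x) ^ n * B" using B q0 by (intro mult_left_mono) auto
      finally show "norm (norm (x powi (- int n) / (1 - a * Q powi (- int n)))) \<le> (q / norm x) ^ n * B" by simp
    qed
  qed
qed

lemma kron_const_summable:
  assumes a: "a \<noteq> 0" "nonpow a"
  shows "(\<lambda>k::int. norm (of_real (qtri k) * (- 1) powi k / (1 - a / Q powi k))) summable_on UNIV"
proof -
  obtain B where B: "B \<ge> 0" "\<And>n. norm (1 / (1 - a * Q powi n)) \<le> B" "\<And>n. norm (Q powi n / (1 - a * Q powi n)) \<le> B"
    using kron_bound[OF a] by blast
  have "(\<lambda>k. norm (of_real (qtri k) * (- 1::complex) powi k) * B) summable_on UNIV"
    by (rule summable_on_cmult_left[OF norm_qtri_powi_summable]) simp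
  then show ?thesis
  proof (rule Infinite_Sum.abs_summable_on_comparison_test')
    fix k :: int
    show "norm (of_real (qtri k) * (- 1) powi k / (1 - a / Q powi k)) \<le> norm (of_real (qtri k) * (- 1::complex) powi k) * B"
    proof -
      have "x / (1 - a / Q powi k) = x * (1 / (1 - a * Q powi (- k)))" for x
        by (simp add: power_int_minus divide_inverse)
      then have "norm (of_real (qtri k) * (- 1) powi k / (1 - a / Q powi k))
          = norm (of_real (qtri k) * (- 1::complex) powi k) * norm (1 / (1 - a * Q powi (- k)))"
        by (simp only: norm_mult)
      also have "\<dots> \<le> norm (of_real (qtri k) * (- 1::complex) powi k) * B"
        by (rule mult_left_mono[OF B(2) norm_ge_zero])
      finally show ?thesis .
    qed
  qed
qed

lemma kron_const_step:
  assumes a: "a \<noteq> 0" "nonpow a"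
  shows "kron_const (a * Q) = - a * kron_const a"
proof -
  let ?c = "\<lambda>k::int. of_real (qtri k) * (- 1) powi k :: complex"
  have bij: "bij (\<lambda>k::int. 1 + k)" by (rule bij_betw_byWitness[of _ "\<lambda>k. k - 1"]) auto
  have "kron_const (a * Q) = (\<Sum>\<^sub>\<infinity>k::int. ?c (1 + k) / (1 - a * Q / Q powi (1 + k)))"
    unfolding kron_const_def by (rule infsum_reindex_bij_betw[OF bij, symmetric])
  also have "\<dots> = (\<Sum>\<^sub>\<infinity>k::int. - a * (?c k / (1 - a / Q powi k)) - of_real (qtri k) * (- Q) powi k)"
  proof (rule infsum_cong)
    fix k :: int
    have nz: "1 - a / Q powi k \<noteq> 0" "Q powi k \<noteq> 0"
      using nonpow_powi[OF a(2), of "- k"] by (simp_all add: power_int_minus divide_inverse)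
    have e: "?c (1 + k) = - (?c k * Q powi k)" "a * Q / Q powi (1 + k) = a / Q powi k"
      by (simp_all add: qtri_Suc power_int_add)
    have m: "(- Q) powi k = (- 1) powi k * Q powi k" by (simp flip: power_int_mult_distrib)
    show "?c (1 + k) / (1 - a * Q / Q powi (1 + k)) = - a * (?c k / (1 - a / Q powi k)) - of_real (qtri k) * (- Q) powi k"
      unfolding e m using nz by (simp add: divide_simps) (simp add: algebra_simps)
  qed
  also have "\<dots> = - a * kron_const a - th (- Q)"
  proof -
    have 1: "(\<lambda>k. - a * (?c k / (1 - a / Q powi k))) summable_on UNIV"
      by (intro summable_on_cmult_right abs_summable_summable[OF kron_const_summable[OF a]])
    have 2: "((\<lambda>k. of_real (qtri k) * (- Q) powi k) has_sum th (- Q)) UNIV" by (rule theta_q_series) simp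
    have "((\<lambda>k. - a * (?c k / (1 - a / Q powi k)) + - (of_real (qtri k) * (- Q) powi k)) has_sum (- a * kron_const a + - th (- Q))) UNIV"
      unfolding kron_const_def
      by (intro has_sum_add has_sum_cmult_right has_sum_infsum abs_summable_summable[OF kron_const_summable[OF a]])
         (simp add: has_sum_uminus 2)
    then show ?thesis by (simp add: infsumI)
  qed
  also have "th (- Q) = 0" by (subst theta_q_eq_0_iff) (auto intro: exI[of _ 1])
  finally show ?thesis by simp
qed

lemma kron_const_shift:
  assumes a: "a \<noteq> 0" "nonpow a"
  shows "kron_const (a * Q powi n) = (- a) powi n * of_real (qtri n) * kron_const a"
proof -
  have step: "kron_const (a * Q powi (n + 1)) = - (a * Q powi n) * kron_const (a * Q powi n)" for n
    using kron_const_step[of "a * Q powi n"] nonpow_shift[OF a(2)] a(1) by (simp add: power_int_add mult.assoc)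
  have coef: "(- a) powi (n + 1) * of_real (qtri (n + 1)) = - (a * Q powi n) * ((- a) powi n * of_real (qtri n))" for n
    using qtri_Suc[of n] a(1) by (simp add: power_int_add add.commute of_real_power_int mult_ac)
  show ?thesis
  proof (induction n rule: int_induct[where k=0])
    case (step1 i)
    then show ?case unfolding step coef by simp
  next
    case (step2 i)
    have "- (a * Q powi (i - 1)) * kron_const (a * Q powi (i - 1)) = kron_const (a * Q powi i)"
      using step[of "i - 1"] by simp
    also have "\<dots> = - (a * Q powi (i - 1)) * ((- a) powi (i - 1) * of_real (qtri (i - 1)) * kron_const a)"
      unfolding step2.IH using coef[of "i - 1"] by simp
    finally show ?case using a(1) by simp
  qed simp
qed

text \<open>The Cauchy product of the theta series with \<open>kron a x\<close> has the coefficients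
  \<open>kron_const (a * Q powi n)\<close>, which by \<open>kron_const_shift\<close> are again those of a theta series.\<close>
lemma theta_times_kron:
  assumes a: "a \<noteq> 0" "nonpow a" and x: "q < norm x" "norm x < 1"
  shows "th (- x) * kron a x = kron_const a * th (- (a * x))"
proof -
  have x0: "x \<noteq> 0" using x q0 by auto
  let ?f = "\<lambda>k::int. of_real (qtri k) * (- x) powi k :: complex"
  let ?g = "\<lambda>n::int. x powi n / (1 - a * Q powi n)"
  have "th (- x) * kron a x = infsum ?f UNIV * infsum ?g UNIV"
    using theta_q_series[of "- x"] x0 by (simp add: infsumI kron_def)
  also have "\<dots> = (\<Sum>\<^sub>\<infinity>n. \<Sum>\<^sub>\<infinity>k. ?f k * ?g (n - k))"
    by (rule infsum_convolution(1)[OF norm_qtri_powi_summable kron_summable]) (use a x x0 in auto)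
  also have "\<dots> = (\<Sum>\<^sub>\<infinity>n. of_real (qtri n) * (- (a * x)) powi n * kron_const a)"
  proof (rule infsum_cong)
    fix n :: int
    have "?f k * ?g (n - k) = x powi n * (of_real (qtri k) * (- 1) powi k / (1 - a * Q powi n / Q powi k))" for k
    proof -
      have "(- x) powi k = (- 1) powi k * x powi k" by (simp flip: power_int_mult_distrib)
      then show ?thesis using x0 by (simp add: power_int_diff)
    qed
    then have "(\<Sum>\<^sub>\<infinity>k. ?f k * ?g (n - k)) = x powi n * kron_const (a * Q powi n)"
      by (simp only: kron_const_def infsum_cmult_right')
    also have "\<dots> = of_real (qtri n) * (- (a * x)) powi n * kron_const a"
    proof -
      have "(- (a * x)) powi n = (- a) powi n * x powi n" by (simp flip: power_int_mult_distrib)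
      then show ?thesis unfolding kron_const_shift[OF a] by simp
    qed
    finally show "(\<Sum>\<^sub>\<infinity>k. ?f k * ?g (n - k)) = of_real (qtri n) * (- (a * x)) powi n * kron_const a" .
  qed
  also have "\<dots> = kron_const a * th (- (a * x))"
    using theta_q_series[of "- (a * x)"] x0 a(1) by (simp add: infsum_cmult_left' infsumI)
  finally show ?thesis .
qed

lemma kron_difference_sum:
  assumes a: "a \<noteq> 0" "nonpow a"
  defines "y \<equiv> \<lambda>n::int. 1 / (1 - a * Q powi n) - 1 / (1 - a * Q powi (n - 1))"
  obtains C where "C \<ge> 0" "\<And>n. norm (y n) \<le> C * q ^ nat \<bar>n\<bar>" "infsum y UNIV = 1"
proof -
  obtain B where B: "B \<ge> 0" "\<And>n. norm (1 / (1 - a * Q powi n)) \<le> B" "\<And>n. norm (Q powi n / (1 - a * Q powi n)) \<le> B"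
    using kron_bound[OF a] by blast
  define C where "C = norm (a * (1 - 1 / Q)) * (B * B)"
  have C0: "C \<ge> 0" using B by (simp add: C_def)
  have y_eq: "y n = a * (1 - 1 / Q) * (Q powi n * (1 / (1 - a * Q powi n)) * (1 / (1 - a * Q powi (n - 1))))" for n
  proof -
    have nz: "1 - a * Q powi n \<noteq> 0" "1 - a * Q powi (n - 1) \<noteq> 0"
      using nonpow_powi[OF a(2), of n] nonpow_powi[OF a(2), of "n - 1"] by auto
    have "1 / u - 1 / v = (v - u) * (1 / u * (1 / v))" if "u \<noteq> 0" "v \<noteq> 0" for u v :: complex
      using that by (simp add: divide_simps)
    from this[OF nz] have "y n = ((1 - a * Q powi (n - 1)) - (1 - a * Q powi n)) * (1 / (1 - a * Q powi n) * (1 / (1 - a * Q powi (n - 1))))"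
      unfolding y_def .
    also have "(1 - a * Q powi (n - 1)) - (1 - a * Q powi n) = a * (1 - 1 / Q) * Q powi n"
      by (simp add: power_int_diff algebra_simps)
    finally show ?thesis by (simp only: mult.assoc)
  qed
  have bound: "norm (y n) \<le> C * q ^ nat \<bar>n\<bar>" for n
  proof (cases "n \<ge> 0")
    case True
    have "norm (Q powi n) = q ^ nat \<bar>n\<bar>" using True by (simp add: powi_nonneg norm_power)
    then have "norm (Q powi n * (1 / (1 - a * Q powi n)) * (1 / (1 - a * Q powi (n - 1)))) \<le> q ^ nat \<bar>n\<bar> * B * B"
      unfolding norm_mult by (simp only:) (intro mult_mono B order.refl; use B q0 in simp)
    from mult_left_mono[OF this norm_ge_zero[of "a * (1 - 1 / Q)"]]
    show ?thesis unfolding y_eq norm_mult[of "a * (1 - 1 / Q)"] C_def by (simp only: mult_ac)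
  next
    case False
    have e: "1 / (1 - a * Q powi (n - 1)) = Q powi (1 - n) * (Q powi (n - 1) / (1 - a * Q powi (n - 1)))"
      by (simp flip: power_int_add)
    have qq: "q ^ nat (1 - n) \<le> q ^ nat \<bar>n\<bar>" using False q0 q1 by (intro power_decreasing) auto
    have n1: "norm (1 / (1 - a * Q powi (n - 1))) \<le> q ^ nat \<bar>n\<bar> * B"
      unfolding e norm_mult using B(3)[of "n - 1"] B(1) qq q0 False
      by (intro mult_mono) (auto simp: powi_nonneg norm_power)
    have "norm ((Q powi n / (1 - a * Q powi n)) * (1 / (1 - a * Q powi (n - 1)))) \<le> B * (q ^ nat \<bar>n\<bar> * B)"
      unfolding norm_mult[of _ "1 / _"] by (intro mult_mono B n1) (use B in auto)
    then have "norm (Q powi n * (1 / (1 - a * Q powi n)) * (1 / (1 - a * Q powi (n - 1)))) \<le> q ^ nat \<bar>n\<bar> * B * B"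
      by (simp add: mult_ac)
    from mult_left_mono[OF this norm_ge_zero[of "a * (1 - 1 / Q)"]]
    show ?thesis unfolding y_eq norm_mult[of "a * (1 - 1 / Q)"] C_def by (simp only: mult_ac)
  qed
  have sum: "y summable_on UNIV"
  proof -
    have "(\<lambda>n. C * q ^ nat \<bar>n\<bar>) summable_on UNIV"
      by (rule summable_on_cmult_right[OF summable_on_geometric_int]) (use q0 q1 in auto)
    from Infinite_Sum.abs_summable_on_comparison_test'[OF this bound] show ?thesis
      by (rule abs_summable_summable)
  qed
  have partial: "(\<Sum>n\<in>{- int N..int N}. y n) = 1 / (1 - a * Q ^ N) - 1 / (1 - a / Q ^ Suc N)" for N
  proof (induction N)
    case 0
    show ?case by (simp add: y_def power_int_minus divide_inverse)
  next
    case (Suc N)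
    have "{- int (Suc N)..int (Suc N)} = insert (int (Suc N)) (insert (- int (Suc N)) {- int N..int N})" by auto
    then have "(\<Sum>n\<in>{- int (Suc N)..int (Suc N)}. y n) = y (int (Suc N)) + (y (- int (Suc N)) + (\<Sum>n\<in>{- int N..int N}. y n))"
      by simp
    also have "y (int (Suc N)) = 1 / (1 - a * Q ^ Suc N) - 1 / (1 - a * Q ^ N)"
      unfolding y_def power_int_of_nat by simp
    also have "y (- int (Suc N)) = 1 / (1 - a / Q ^ Suc N) - 1 / (1 - a / Q ^ Suc (Suc N))"
    proof -
      have "- int (Suc N) - 1 = - int (Suc (Suc N))" by simp
      then show ?thesis unfolding y_def by (simp only: power_int_minus power_int_of_nat divide_inverse)
    qed
    finally show ?case unfolding Suc.IH by simp
  qed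
  have "(\<lambda>N. 1 / (1 - a * Q ^ N) - 1 / (1 - a / Q ^ Suc N)) \<longlonglongrightarrow> 1 / (1 - 0) - 0"
  proof (intro tendsto_diff)
    show "(\<lambda>N. 1 / (1 - a * Q ^ N)) \<longlonglongrightarrow> 1 / (1 - 0)" by (intro tendsto_intros qpow_tendsto) auto
    have "(\<lambda>N. Q ^ Suc N / (Q ^ Suc N - a)) \<longlonglongrightarrow> 0 / (0 - a)"
      using LIMSEQ_Suc[OF qpow_tendsto[of 1]] a(1)
      by (intro tendsto_divide tendsto_diff tendsto_const) auto
    moreover have "Q ^ Suc N / (Q ^ Suc N - a) = 1 / (1 - a / Q ^ Suc N)" for N
      by (simp add: divide_simps)
    ultimately show "(\<lambda>N. 1 / (1 - a / Q ^ Suc N)) \<longlonglongrightarrow> 0" by simp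
  qed
  then have "infsum y UNIV = 1"
    using infsum_int_limit[OF sum] unfolding partial by (simp add: LIMSEQ_unique)
  with C0 bound show ?thesis using that by blast
qed

text \<open>The constant is found by comparing the residues at \<open>x = 1\<close>.\<close>
lemma kron_const_value:
  assumes a: "a \<noteq> 0" "nonpow a"
  shows "kron_const a * th (- a) = qp Q ^ 3"
proof -
  define y where "y = (\<lambda>n::int. 1 / (1 - a * Q powi n) - 1 / (1 - a * Q powi (n - 1)))"
  obtain C where C: "C \<ge> 0" "\<And>n. norm (y n) \<le> C * q ^ nat \<bar>n\<bar>" "infsum y UNIV = 1"
    using kron_difference_sum[OF a] unfolding y_def by blast
  define r where "r = (1 + q) / 2"
  have r: "q < r" "r < 1" "0 < r" using q0 q1 by (auto simp: r_def)
  define x where "x = (\<lambda>j::nat. 1 - (1 - r) * inverse (real (Suc j)))"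
  have x_ge: "r \<le> x j" and x_lt: "x j < 1" for j
  proof -
    have i: "inverse (real (Suc j)) \<le> 1" "0 < inverse (real (Suc j))" by (auto simp: divide_simps)
    have "(1 - r) * inverse (real (Suc j)) \<le> 1 - r" using mult_left_mono[OF i(1), of "1 - r"] r by simp
    then show "r \<le> x j" unfolding x_def by linarith
    show "x j < 1" using mult_pos_pos[OF _ i(2), of "1 - r"] r by (simp add: x_def)
  qed
  have x_lim: "x \<longlonglongrightarrow> 1"
  proof -
    have "x \<longlonglongrightarrow> 1 - (1 - r) * 0" unfolding x_def by (intro tendsto_intros LIMSEQ_inverse_real_of_nat)
    then show ?thesis by simp
  qed
  let ?X = "\<lambda>j. complex_of_real (x j)"
  have X_lim: "?X \<longlonglongrightarrow> 1" using tendsto_of_real[OF x_lim, where 'a=complex] by simp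
  have X: "q < norm (?X j)" "norm (?X j) < 1" "?X j \<noteq> 0" "?X j \<noteq> 1" for j
    using x_ge[of j] x_lt[of j] r q0 by (auto simp: of_real_eq_1_iff)
  have kron_eq: "(1 - ?X j) * kron a (?X j) = (\<Sum>\<^sub>\<infinity>n. ?X j powi n * y n)" for j
  proof -
    let ?g = "\<lambda>n::int. ?X j powi n / (1 - a * Q powi n)"
    have s: "?g summable_on UNIV" by (rule abs_summable_summable[OF kron_summable[OF a X(1,2)]])
    have bij: "bij (\<lambda>n::int. n - 1)" by (rule bij_betw_byWitness[of _ "\<lambda>n. n + 1"]) auto
    have h1: "(?g has_sum kron a (?X j)) UNIV" unfolding kron_def using s by (rule has_sum_infsum)
    then have "((\<lambda>n. ?g (n - 1)) has_sum kron a (?X j)) UNIV"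
      using has_sum_reindex_bij_betw[OF bij, of ?g] by simp
    then have "((\<lambda>n. ?X j * ?g (n - 1)) has_sum ?X j * kron a (?X j)) UNIV" by (rule has_sum_cmult_right)
    then have "((\<lambda>n. - (?X j * ?g (n - 1))) has_sum - (?X j * kron a (?X j))) UNIV" by (simp add: has_sum_uminus)
    from has_sum_add[OF h1 this]
    have "((\<lambda>n. ?g n + - (?X j * ?g (n - 1))) has_sum ((1 - ?X j) * kron a (?X j))) UNIV"
      by (simp add: left_diff_distrib)
    moreover have "?g n + - (?X j * ?g (n - 1)) = ?X j powi n * y n" for n
    proof -
      have "?X j powi n = ?X j * ?X j powi (n - 1)" using X(3)[of j] by (simp add: power_int_diff)
      then show ?thesis by (simp add: y_def right_diff_distrib)
    qed
    ultimately show ?thesis by (simp add: infsumI)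
  qed
  have sum_lim: "(\<lambda>j. \<Sum>\<^sub>\<infinity>n. ?X j powi n * y n) \<longlonglongrightarrow> infsum y UNIV"
  proof (rule infsum_dominated_convergence)
    have "0 \<le> q / r" "q / r < 1" using r q0 by (auto simp: divide_simps)
    then show "(\<lambda>n. C * (q / r) ^ nat \<bar>n\<bar>) summable_on UNIV"
      by (rule summable_on_cmult_right[OF summable_on_geometric_int])
    show "(\<lambda>j. ?X j powi n * y n) \<longlonglongrightarrow> y n" for n
    proof -
      have "(\<lambda>j. ?X j powi n * y n) \<longlonglongrightarrow> 1 powi n * y n"
        by (intro tendsto_mult tendsto_power_int X_lim tendsto_const) auto
      then show ?thesis by simp
    qed
    fix j n
    have "norm (?X j powi n) \<le> (1 / r) ^ nat \<bar>n\<bar>"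
    proof (cases "n \<ge> 0")
      case True
      have "1 \<le> 1 / r" using r by simp
      then have "x j \<le> 1 / r" using x_lt[of j] by linarith
      then have "x j ^ nat n \<le> (1 / r) ^ nat n" using x_ge[of j] r by (intro power_mono) auto
      then show ?thesis using True x_ge[of j] r by (simp add: powi_nonneg norm_power)
    next
      case False
      have "(1 / x j) ^ nat (- n) \<le> (1 / r) ^ nat (- n)" using x_ge[of j] r by (intro power_mono) (auto simp: frac_le)
      then show ?thesis using False x_ge[of j] r by (simp add: power_int_def norm_inverse norm_divide norm_power inverse_eq_divide power_divide)
    qed
    then have "norm (?X j powi n) * norm (y n) \<le> (1 / r) ^ nat \<bar>n\<bar> * (C * q ^ nat \<bar>n\<bar>)"
      using C r by (intro mult_mono) auto
    then show "norm (?X j powi n * y n) \<le> C * (q / r) ^ nat \<bar>n\<bar>"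
      by (simp add: norm_mult power_divide mult_ac)
  qed
  have "qp Q * qp (?X j * Q) * qp (Q / ?X j) * (\<Sum>\<^sub>\<infinity>n. ?X j powi n * y n) = kron_const a * th (- (a * ?X j))" for j
    unfolding kron_eq[symmetric] theta_times_kron[OF a X(1,2), symmetric] theta_q_factor[of "?X j"] by (simp only: mult_ac)
  moreover have "(\<lambda>j. qp Q * qp (?X j * Q) * qp (Q / ?X j) * (\<Sum>\<^sub>\<infinity>n. ?X j powi n * y n))
      \<longlonglongrightarrow> qp Q * qp (1 * Q) * qp (Q / 1) * infsum y UNIV"
    by (intro tendsto_intros X_lim sum_lim) auto
  moreover have "(\<lambda>j. kron_const a * th (- (a * ?X j))) \<longlonglongrightarrow> kron_const a * th (- (a * 1))"
    using a by (intro tendsto_intros X_lim) auto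
  ultimately show ?thesis
    unfolding C(3) using LIMSEQ_unique by (fastforce simp: power3_eq_cube)
qed

section \<open>The connection formula\<close>

definition psi :: "complex \<Rightarrow> complex \<Rightarrow> complex \<Rightarrow> complex" where
  "psi a b y = (\<Sum>m. qn a m / (qn (a * Q / b) m * qn Q m) * of_real (qtri (int m)) * y ^ m)"

definition conn :: "complex \<Rightarrow> complex \<Rightarrow> complex \<Rightarrow> complex" where
  "conn a b x = qp b / qp (b / a) * (th (- (a * x)) / th (- x)) * psi a b (- Q\<^sup>2 / (b * x))"

lemma psi_term_bound:
  assumes "\<And>k. a * Q / b * Q ^ k \<noteq> 1"
  obtains B where "B > 0" "\<And>m. norm (qn a m / (qn (a * Q / b) m * qn Q m)) \<le> B"
proof -
  obtain B where B: "B > 0" "\<And>n. norm (1 / qn (a * Q / b) n) \<le> B" using qn_lower_bound[OF assms] by blast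
  obtain B' where B': "B' > 0" "\<And>n. norm (1 / qn Q n) \<le> B'" by (rule qn_Q_bound) blast
  show ?thesis
  proof (rule that[of "exp (norm a / (1 - q)) * (B * B')"])
    fix m
    have "norm (qn a m) * (norm (1 / qn (a * Q / b) m) * norm (1 / qn Q m)) \<le> exp (norm a / (1 - q)) * (B * B')"
      by (intro mult_mono norm_qn_le B B') (use B B' in \<open>auto intro: less_imp_le\<close>)
    then show "norm (qn a m / (qn (a * Q / b) m * qn Q m)) \<le> exp (norm a / (1 - q)) * (B * B')"
      by (simp add: norm_mult norm_divide)
  qed (use B B' in simp)
qed

lemma psi_summable:
  assumes "\<And>k. a * Q / b * Q ^ k \<noteq> 1"
  shows "summable (\<lambda>m. norm (qn a m / (qn (a * Q / b) m * qn Q m) * of_real (qtri (int m)) * y ^ m))"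
proof -
  obtain B where B: "B > 0" "\<And>m. norm (qn a m / (qn (a * Q / b) m * qn Q m)) \<le> B" using psi_term_bound[OF assms] by blast
  show ?thesis
  proof (rule summable_comparison_test')
    show "summable (\<lambda>m. B * norm (qtri (int m) * norm y ^ m))" by (intro summable_mult qtri_summable_nat)
    show "norm (norm (qn a m / (qn (a * Q / b) m * qn Q m) * of_real (qtri (int m)) * y ^ m)) \<le> B * norm (qtri (int m) * norm y ^ m)" for m
    proof -
      have "norm (qn a m / (qn (a * Q / b) m * qn Q m) * of_real (qtri (int m)) * y ^ m)
          = norm (qn a m / (qn (a * Q / b) m * qn Q m)) * (qtri (int m) * norm y ^ m)"
        by (simp only: norm_mult norm_power norm_of_real abs_qtri mult.assoc)
      also have "\<dots> \<le> B * (qtri (int m) * norm y ^ m)" by (intro mult_right_mono B) simp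
      finally show ?thesis by (simp add: abs_mult)
    qed
  qed
qed

lemma psi_holo:
  assumes "\<And>k. a * Q / b * Q ^ k \<noteq> 1"
  shows "psi a b holomorphic_on A"
proof -
  have "psi a b holomorphic_on ball 0 r" for r
    by (rule power_series_holomorphic[where a="\<lambda>m. qn a m / (qn (a * Q / b) m * qn Q m) * of_real (qtri (int m))"])
       (unfold psi_def, use summable_norm_cancel[OF psi_summable[OF assms]] summable_sums in auto)
  then have "psi a b holomorphic_on (\<Union>r\<in>UNIV. ball 0 r)" by (intro holomorphic_on_UN_open) auto
  moreover have "(\<Union>r\<in>UNIV. ball (0::complex) r) = UNIV" by (auto intro: gt_ex)
  ultimately show ?thesis using holomorphic_on_subset by blast
qed

text \<open>Summing over \<open>n\<close> first turns each partial fraction into a shifted Kronecker series, that is, into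
  \<open>kron a x\<close> times a power of \<open>x\<close>.\<close>
lemma bilateral_pf_sum:
  assumes ab: "generic a b" and a: "nonpow a" and x: "q < norm x" "norm x < 1"
  shows "((\<lambda>n. pf_sum a b (Q powi n) * x powi n) has_sum
    (qp (Q / a) / (qp Q * qp (b / a)) * psi a b (- Q\<^sup>2 / (b * x)) * kron a x)) UNIV"
proof -
  have x0: "x \<noteq> 0" using x q0 by auto
  have a0: "a \<noteq> 0" using ab by (auto simp: generic_def)
  let ?f = "\<lambda>m. pf_coeff a b m * (1 / x) ^ m"
  let ?g = "\<lambda>n::int. x powi n / (1 - a * Q powi n)"
  have fs: "summable (\<lambda>m. norm (?f m))" by (rule pf_coeff_summable[OF ab])
  have f: "(\<lambda>m. norm (?f m)) summable_on UNIV"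
    using norm_summable_imp_summable_on[of "\<lambda>m. norm (?f m)"] fs by simp
  have inner: "(\<Sum>\<^sub>\<infinity>m. ?f m * ?g (n - - int m)) = pf_sum a b (Q powi n) * x powi n" for n
  proof -
    have "?f m * ?g (n - - int m) = pf_coeff a b m / (1 - a * Q powi n * Q ^ m) * x powi n" for m
      using x0 by (simp add: power_int_add power_divide mult_ac)
    moreover have "((\<lambda>m. pf_coeff a b m / (1 - a * Q powi n * Q ^ m)) has_sum pf_sum a b (Q powi n)) UNIV"
      using pf_coeff_summable'[OF ab Bseq_pf_factor, of 1 "a * Q powi n"] pf_sum_sums[OF ab, of "Q powi n"]
      by (intro norm_summable_imp_has_sum) simp_all
    ultimately show ?thesis
      by (simp only: infsum_cmult_left' infsumI)
  qed
  have "infsum ?f UNIV = qp (Q / a) / (qp Q * qp (b / a)) * psi a b (- Q\<^sup>2 / (b * x))"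
  proof -
    have "?f m = qp (Q / a) / (qp Q * qp (b / a)) * (qn a m / (qn (a * Q / b) m * qn Q m) * of_real (qtri (int m)) * (- Q\<^sup>2 / (b * x)) ^ m)" for m
    proof -
      have "(- Q\<^sup>2 / (b * x)) ^ m = (- Q\<^sup>2 / b) ^ m * (1 / x) ^ m" by (simp flip: power_mult_distrib)
      then show ?thesis by (simp only: pf_coeff_def mult.assoc)
    qed
    then have "?f sums (qp (Q / a) / (qp Q * qp (b / a)) * psi a b (- Q\<^sup>2 / (b * x)))"
      unfolding psi_def
      by (simp only:) (intro sums_mult summable_sums summable_norm_cancel[OF psi_summable] generic_nz[OF ab])
    then show ?thesis by (intro infsumI norm_summable_imp_has_sum fs)
  qed
  then show ?thesis
    using infsum_convolution[OF f kron_summable[OF a0 a x], of "\<lambda>m. - int m"] has_sum_infsum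
    unfolding inner by (metis kron_def)
qed

lemma theta_q_annulus_nz:
assumes x: "q < norm x" "norm x < 1"
shows "th (- x) \<noteq> 0"
proof
  assume "th (- x) = 0"
  then obtain n :: int where n: "x = Q powi n" using x q0 by (subst (asm) theta_q_eq_0_iff) auto
  then have nx: "norm x = q powi n" by (simp add: norm_power_int)
  show False
  proof (cases "n \<le> 0")
    case True
    then have "norm x = (1 / q) ^ nat (- n)" using nx by (cases "n = 0") (auto simp: power_int_def inverse_eq_divide power_divide)
    moreover have "1 \<le> (1 / q) ^ nat (- n)" by (rule one_le_power) (use q0 q1 in simp)
    ultimately show False using x(2) by linarith
  next
    case False
    then have "norm x \<le> q ^ 1" unfolding nx using q0 q1 by (simp add: powi_nonneg) (intro power_decreasing[of 1, simplified]; simp)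
    then show False using x by simp
  qed
qed

text \<open>The coefficients of the series are values of \<open>pf\<close> at the powers of \<open>Q\<close>, and \<open>pf\<close> vanishes at the negative
  ones, so the series is the bilateral sum evaluated by \<open>bilateral_pf_sum\<close>.\<close>
lemma connection_annulus:
  assumes ab: "generic a b" and a: "nonpow a" and b: "nonpow b" and x: "q < norm x" "norm x < 1"
  shows "phi21_series q a b 0 x = conn a b x + conn b a x"
proof -
  have x0: "x \<noteq> 0" using x q0 by auto
  have ba: "generic b a" using ab generic_sym by blast
  have nz: "a \<noteq> 0" "b \<noteq> 0" using ab by (auto simp: generic_def)
  have thx: "th (- x) \<noteq> 0" by (rule theta_q_annulus_nz[OF x])
  let ?K = "qp Q / (qp a * qp b)"
  have main: "?K * phi21_series q a b 0 x = (\<Sum>\<^sub>\<infinity>n. pf a b (Q powi n) * x powi n)"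
  proof -
    have s: "summable (\<lambda>n. norm (phi21_coeff a b 0 n * x ^ n))" by (rule phi21_coeff_summable) (use x in auto)
    have "((\<lambda>n. phi21_coeff a b 0 n * x ^ n) has_sum phi21_series q a b 0 x) UNIV"
      using s phi21_series_sums[of 0 x a b] x by (intro norm_summable_imp_has_sum) auto
    then have "((\<lambda>n. ?K * (phi21_coeff a b 0 n * x ^ n)) has_sum ?K * phi21_series q a b 0 x) UNIV"
      by (rule has_sum_cmult_right)
    moreover have "?K * (phi21_coeff a b 0 n * x ^ n) = pf a b (Q powi int n) * x powi int n" for n
      using pf_powers(1)[OF ab a b, of n] by (simp add: phi21_coeff_def)
    ultimately have "((\<lambda>n. pf a b (Q powi n) * x powi n) has_sum ?K * phi21_series q a b 0 x) (range int)"
      by (subst has_sum_reindex) (auto simp: o_def)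
    then have "((\<lambda>n. pf a b (Q powi n) * x powi n) has_sum ?K * phi21_series q a b 0 x) UNIV"
    proof (rule has_sum_cong_neutral[THEN iffD1, rotated -1])
      fix n :: int assume "n \<in> UNIV - range int"
      then have "n < 0" by (metis Diff_iff not_le nat_0_le rangeI)
      then obtain k where "n = - int (Suc k)" by (metis negD)
      then have "Q powi n = 1 / Q ^ Suc k" by (simp only: power_int_minus power_int_of_nat inverse_eq_divide)
      then show "pf a b (Q powi n) * x powi n = 0" using pf_powers(2)[OF ab a b, of k] by simp
    qed auto
    then show ?thesis by (rule infsumI[symmetric])
  qed
  let ?k = "\<lambda>a b. qp (Q / a) / (qp Q * qp (b / a)) * psi a b (- Q\<^sup>2 / (b * x)) * kron a x"
  have "((\<lambda>n. pf a b (Q powi n) * x powi n) has_sum (?k a b + ?k b a)) UNIV"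
    unfolding pf_def distrib_right by (intro has_sum_add bilateral_pf_sum ab ba a b x)
  with main have "?K * phi21_series q a b 0 x = ?k a b + ?k b a" by (simp add: infsumI)
  then have "phi21_series q a b 0 x = (qp a * qp b) / qp Q * (?k a b + ?k b a)"
    using nonpow_qp[OF a] nonpow_qp[OF b] by (simp add: field_simps)
  moreover have "(qp a * qp b) / qp Q * ?k a b = conn a b x" if "nonpow a" "a \<noteq> 0" for a b
  proof -
    have tha: "th (- a) = qp Q * qp a * qp (Q / a)" by (simp add: theta_q_def)
    have "kron a x = kron_const a * th (- (a * x)) / th (- x)"
      using theta_times_kron[OF that(2,1) x] thx by (simp add: field_simps)
    also have "kron_const a = qp Q ^ 3 / (qp Q * qp a * qp (Q / a))"
      using kron_const_value[OF that(2,1)] nonpow_qp[OF that(1)] unfolding tha by (simp add: nonzero_eq_divide_eq)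
    finally show ?thesis
      unfolding conn_def using nonpow_qp[OF that(1)] by (simp add: power3_eq_cube)
  qed
  from this[OF a nz(1), of b] this[OF b nz(2), of a] have "(qp a * qp b) / qp Q * ?k a b = conn a b x" "(qp a * qp b) / qp Q * ?k b a = conn b a x"
    by (simp_all add: mult.commute[of "qp b"])
  ultimately show ?thesis by (simp only: distrib_left)
qed

end

context qbase
begin

lemma qn_tendsto: "(f \<longlongrightarrow> a) F \<Longrightarrow> ((\<lambda>j. qn (f j) m) \<longlongrightarrow> qn a m) F"
  unfolding qpoch_def by (intro tendsto_intros)

lemma generic_alt: "generic a b \<longleftrightarrow> a \<noteq> 0 \<and> b \<noteq> 0 \<and> th (- (b / a)) \<noteq> 0"
proof (cases "a \<noteq> 0 \<and> b \<noteq> 0")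
  case True
  then have "- (b / a) \<noteq> 0" by simp
  from theta_q_eq_0_iff[OF this] show ?thesis by (auto simp: generic_def)
qed (auto simp: generic_def)

lemma eventually_norm_less:
  fixes f :: "nat \<Rightarrow> complex"
  assumes "f \<longlonglongrightarrow> l"
  shows "\<forall>\<^sub>F j in sequentially. norm (f j) \<le> norm l + 1"
  using order_tendstoD(2)[OF tendsto_norm[OF assms], of "norm l + 1"] by (auto elim: eventually_mono)

lemma psi_tendsto:
  assumes A: "A \<longlonglongrightarrow> a" and B: "B \<longlonglongrightarrow> b" and Y: "Y \<longlonglongrightarrow> y" and ab: "generic a b"
  shows "(\<lambda>j. psi (A j) (B j) (Y j)) \<longlonglongrightarrow> psi a b y"
proof -
  define c where "c = a * Q / b"
  define C where "C = (\<lambda>j. A j * Q / B j)"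
  have b0: "b \<noteq> 0" using ab by (simp add: generic_def)
  have C: "C \<longlonglongrightarrow> c" unfolding C_def c_def using b0 by (intro tendsto_intros A B)
  have cnz: "c * Q ^ k \<noteq> 1" for k using generic_nz(2)[OF ab, of k] by (simp add: c_def)
  then have qc: "qp c \<noteq> 0" by (auto simp: qp_eq_0_iff)
  define e where "e = norm (qp c) / 2"
  have e: "e > 0" "e < norm (qp c)" using qc by (auto simp: e_def)
  have "\<forall>\<^sub>F j in sequentially. norm (A j) \<le> norm a + 1 \<and> norm (Y j) \<le> norm y + 1 \<and> norm (C j) \<le> norm c + 1 \<and> e < norm (qp (C j))"
    using order_tendstoD(1)[OF tendsto_norm[OF qp_tendsto[OF C]] e(2)]
    by (intro eventually_conj eventually_norm_less A Y C)
  then obtain J where J: "\<And>j. j \<ge> J \<Longrightarrow> norm (A j) \<le> norm a + 1 \<and> norm (Y j) \<le> norm y + 1 \<and> norm (C j) \<le> norm c + 1 \<and> e < norm (qp (C j))"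
    by (auto simp: eventually_sequentially)
  obtain BQ where BQ: "BQ > 0" "\<And>n. norm (1 / qn Q n) \<le> BQ" by (rule qn_Q_bound) blast
  define EA where "EA = exp ((norm a + 1) / (1 - q))"
  define EC where "EC = exp ((norm c + 1) / (1 - q)) / e"
  have pos: "EA > 0" "EC > 0" using e by (auto simp: EA_def EC_def)
  have mono: "exp (x / (1 - q)) \<le> exp (y / (1 - q))" if "x \<le> y" for x y :: real
    using that q1 by (simp add: divide_right_mono)
  have "(\<lambda>j. psi (A (j + J)) (B (j + J)) (Y (j + J))) \<longlonglongrightarrow> psi a b y"
    unfolding psi_def
  proof (rule suminf_dominated_convergence)
    show "summable (\<lambda>m. EA * (EC * BQ) * norm (qtri (int m) * (norm y + 1) ^ m))"
      by (intro summable_mult qtri_summable_nat)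
    fix m
    show "(\<lambda>j. qn (A (j + J)) m / (qn (A (j + J) * Q / B (j + J)) m * qn Q m) * of_real (qtri (int m)) * Y (j + J) ^ m)
      \<longlonglongrightarrow> qn a m / (qn (a * Q / b) m * qn Q m) * of_real (qtri (int m)) * y ^ m"
    proof -
      have "qn (a * Q / b) m \<noteq> 0" using cnz by (auto simp: qn_eq_0_iff c_def)
      then show ?thesis
        using b0 by (intro tendsto_intros qn_tendsto LIMSEQ_ignore_initial_segment[OF A] LIMSEQ_ignore_initial_segment[OF B]
            LIMSEQ_ignore_initial_segment[OF Y]) auto
    qed
    fix j
    note J' = J[of "j + J", simplified]
    have "norm (qn (A (j + J)) m) \<le> EA"
      unfolding EA_def using norm_qn_le[of "A (j + J)" m] mono[of "norm (A (j + J))" "norm a + 1"] J' by linarith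
    moreover have "norm (1 / qn (C (j + J)) m) \<le> EC"
    proof -
      have nz: "qp (C (j + J)) \<noteq> 0" using J' e by auto
      then have eq: "1 / qn (C (j + J)) m = qp (C (j + J) * Q ^ m) / qp (C (j + J))"
        using qp_split[of "C (j + J)" m] by (auto simp: divide_simps)
      have "norm (C (j + J) * Q ^ m) \<le> norm c + 1"
        using J' mult_left_mono[OF power_le_one[of q m], of "norm (C (j + J))"] q0 q1
        by (simp add: norm_mult norm_power)
      then have "norm (qp (C (j + J) * Q ^ m)) \<le> exp ((norm c + 1) / (1 - q))"
        using norm_qp_le[of "C (j + J) * Q ^ m"] mono[of "norm (C (j + J) * Q ^ m)" "norm c + 1"] by linarith
      then show ?thesis unfolding eq norm_divide EC_def using J' e by (intro frac_le) auto
    qed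
    ultimately have 1: "norm (qn (A (j + J)) m) * (norm (1 / qn (C (j + J)) m) * norm (1 / qn Q m)) \<le> EA * (EC * BQ)"
      using pos BQ by (intro mult_mono) auto
    have 2: "norm (Y (j + J) ^ m) \<le> (norm y + 1) ^ m" unfolding norm_power using J' by (intro power_mono) auto
    have "norm (qn (A (j + J)) m / (qn (C (j + J)) m * qn Q m) * of_real (qtri (int m)) * Y (j + J) ^ m)
      = norm (qn (A (j + J)) m) * (norm (1 / qn (C (j + J)) m) * norm (1 / qn Q m)) * (qtri (int m) * norm (Y (j + J) ^ m))"
      by (simp add: norm_mult norm_divide)
    also have "\<dots> \<le> EA * (EC * BQ) * (qtri (int m) * (norm y + 1) ^ m)"
      by (rule mult_mono[OF 1 mult_left_mono[OF 2]]) (use pos BQ in auto)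
    finally show "norm (qn (A (j + J)) m / (qn (A (j + J) * Q / B (j + J)) m * qn Q m) * of_real (qtri (int m)) * Y (j + J) ^ m)
       \<le> EA * (EC * BQ) * norm (qtri (int m) * (norm y + 1) ^ m)"
      by (simp add: abs_mult C_def)
  qed
  then show ?thesis by (rule LIMSEQ_offset)
qed

lemma conn_tendsto:
  assumes A: "A \<longlonglongrightarrow> a" and B: "B \<longlonglongrightarrow> b" and ab: "generic a b" and x: "x \<noteq> 0" "th (- x) \<noteq> 0"
  shows "(\<lambda>j. conn (A j) (B j) x) \<longlonglongrightarrow> conn a b x"
proof -
  have nz: "a \<noteq> 0" "b \<noteq> 0" using ab by (auto simp: generic_def)
  have "qp (b / a) \<noteq> 0" using generic_nz(1)[OF ab] by (auto simp: qp_eq_0_iff)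
  then show ?thesis
    unfolding conn_def using nz x by (intro tendsto_intros psi_tendsto A B ab) auto
qed

lemma phi21_series_tendsto:
  assumes A: "A \<longlonglongrightarrow> a" and x: "norm x < 1"
  shows "(\<lambda>j. phi21_series q (A j) b 0 x) \<longlonglongrightarrow> phi21_series q a b 0 x"
proof -
  obtain J where J: "\<And>j. j \<ge> J \<Longrightarrow> norm (A j) \<le> norm a + 1"
    using eventually_norm_less[OF A] by (auto simp: eventually_sequentially)
  obtain BQ where BQ: "BQ > 0" "\<And>n. norm (1 / qn Q n) \<le> BQ" by (rule qn_Q_bound) blast
  define EA where "EA = exp ((norm a + 1) / (1 - q))"
  define EB where "EB = exp (norm b / (1 - q))"
  have "(\<lambda>j. phi21_series q (A (j + J)) b 0 x) \<longlonglongrightarrow> phi21_series q a b 0 x"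
    unfolding phi21_series_def
  proof (rule suminf_dominated_convergence)
    show "summable (\<lambda>n. EA * EB * BQ * norm x ^ n)" using x by (intro summable_mult summable_geometric) auto
    fix n
    show "(\<lambda>j. qn (A (j + J)) n * qn b n / (qn 0 n * qn (of_real q) n) * x ^ n) \<longlonglongrightarrow> qn a n * qn b n / (qn 0 n * qn (of_real q) n) * x ^ n"
      by (intro tendsto_intros qn_tendsto LIMSEQ_ignore_initial_segment[OF A]) simp
    fix j
    have "norm (A (j + J)) / (1 - q) \<le> (norm a + 1) / (1 - q)" using J[of "j + J"] q1 by (intro divide_right_mono) auto
    then have "norm (qn (A (j + J)) n) \<le> EA" unfolding EA_def using norm_qn_le[of "A (j + J)" n] by (meson exp_le_cancel_iff order.trans)
    then have "norm (qn (A (j + J)) n) * norm (qn b n) * norm (1 / qn Q n) \<le> EA * EB * BQ"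
      unfolding EB_def by (intro mult_mono norm_qn_le BQ) (auto simp: EA_def)
    then have "norm (qn (A (j + J)) n) * norm (qn b n) * norm (1 / qn Q n) * norm x ^ n \<le> EA * EB * BQ * norm x ^ n"
      by (rule mult_right_mono) simp
    then show "norm (qn (A (j + J)) n * qn b n / (qn 0 n * qn (of_real q) n) * x ^ n) \<le> EA * EB * BQ * norm x ^ n"
      by (simp add: norm_mult norm_divide norm_power)
  qed
  then show ?thesis by (rule LIMSEQ_offset)
qed

text \<open>A parameter that is a power of \<open>q\<close> is reached as a limit of other parameters.\<close>
lemma connection_annulus_pow:
  assumes ab: "generic a b" and a: "\<not> nonpow a" and x: "q < norm x" "norm x < 1"
  shows "phi21_series q a b 0 x = conn a b x + conn b a x"
proof -
  have ba: "generic b a" using ab generic_sym by blast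
  have nz: "a \<noteq> 0" "b \<noteq> 0" using ab by (auto simp: generic_def)
  obtain n0 :: int where n0: "a = Q powi n0" using a by (auto simp: nonpow_def)
  have b: "nonpow b"
    unfolding nonpow_def
  proof (intro allI notI)
    fix n :: int assume "b = Q powi n"
    then have "b / a = Q powi (n - n0)" by (simp add: n0 power_int_diff)
    then show False using ab by (auto simp: generic_def)
  qed
  define t where "t = (\<lambda>j. (1 / q - 1) / 2 * inverse (real (Suc j)))"
  define A where "A = (\<lambda>j. a * of_real (1 + t j))"
  have t_pos: "t j > 0" and t_less: "1 + t j < 1 / q" for j
  proof -
    define d where "d = 1 / q - 1"
    have q_d: "1 / q = 1 + d" by (simp add: d_def)
    have d: "d > 0" using q0 q1 by (simp add: d_def)
    have i: "inverse (real (Suc j)) \<le> 1" "0 < inverse (real (Suc j))" by (auto simp: divide_simps)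
    show "t j > 0" unfolding t_def d_def[symmetric] using d i by (intro mult_pos_pos) auto
    have "t j \<le> d / 2 * 1" unfolding t_def d_def[symmetric] using d i by (intro mult_left_mono) auto
    then show "1 + t j < 1 / q" unfolding q_d using d by linarith
  qed
  have "t \<longlonglongrightarrow> (1 / q - 1) / 2 * 0" unfolding t_def by (intro tendsto_intros LIMSEQ_inverse_real_of_nat)
  then have "A \<longlonglongrightarrow> a * of_real (1 + 0)" unfolding A_def by (intro tendsto_intros) simp
  then have A: "A \<longlonglongrightarrow> a" by simp
  have A_nonpow: "nonpow (A j)" for j
    unfolding nonpow_def
  proof (intro allI notI)
    fix n :: int assume "A j = Q powi n"
    then have "of_real (1 + t j) = Q powi (n - n0)" by (simp add: A_def n0 power_int_diff nonzero_eq_divide_eq mult.commute)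
    then have eq: "1 + t j = q powi (n - n0)" by (metis of_real_eq_iff of_real_power_int)
    show False
    proof (cases "n - n0 \<ge> 0")
      case True
      then show False using eq t_pos[of j] power_le_one[of q "nat (n - n0)"] q0 q1 by (simp add: powi_nonneg)
    next
      case False
      then have "1 + t j = (1 / q) ^ nat (n0 - n)" using eq by (simp add: power_int_def inverse_eq_divide power_divide)
      moreover have "(1 / q) ^ 1 \<le> (1 / q) ^ nat (n0 - n)" using False q0 q1 by (intro power_increasing) auto
      ultimately show False using t_less[of j] by simp
    qed
  qed
  have "(\<lambda>j. th (- (b / A j))) \<longlonglongrightarrow> th (- (b / a))" using nz by (intro tendsto_intros A) auto
  then have ev: "\<forall>\<^sub>F j in sequentially. th (- (b / A j)) \<noteq> 0"
    using ab by (intro tendsto_imp_eventually_ne) (auto simp: generic_alt)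
  have "\<forall>\<^sub>F j in sequentially. phi21_series q (A j) b 0 x = conn (A j) b x + conn b (A j) x"
    using ev
  proof eventually_elim
    case (elim j)
    have "1 + t j \<noteq> 0" using t_pos[of j] by linarith
    then have "A j \<noteq> 0" using nz unfolding A_def by (metis mult_eq_0_iff of_real_eq_0_iff)
    then show ?case using elim nz by (intro connection_annulus A_nonpow b x) (simp add: generic_alt)
  qed
  moreover have "(\<lambda>j. conn (A j) b x + conn b (A j) x) \<longlonglongrightarrow> conn a b x + conn b a x"
    using theta_q_annulus_nz[OF x] x q0
    by (intro tendsto_add conn_tendsto A tendsto_const ab ba) auto
  ultimately have "(\<lambda>j. phi21_series q (A j) b 0 x) \<longlonglongrightarrow> conn a b x + conn b a x"
    by (simp add: tendsto_cong)
  then show ?thesis using phi21_series_tendsto[OF A x(2), of b] LIMSEQ_unique by blast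
qed

lemma conn_holo:
  assumes ab: "generic a b" and S: "\<And>x. x \<in> S \<Longrightarrow> x \<noteq> 0 \<and> th (- x) \<noteq> 0"
  shows "conn a b holomorphic_on S"
proof -
  have h1: "(psi a b \<circ> (\<lambda>x. - Q\<^sup>2 / (b * x))) holomorphic_on S"
    using S ab by (intro holomorphic_on_compose psi_holo generic_nz(2)[OF ab] holomorphic_intros) (auto simp: generic_def)
  have h2: "(\<lambda>x. qp b / qp (b / a) * (th (- (a * x)) / th (- x))) holomorphic_on S"
  proof -
    have "qp (b / a) \<noteq> 0" using generic_nz(1)[OF ab] by (auto simp: qp_eq_0_iff)
    then show ?thesis using S ab by (intro holomorphic_intros) (auto simp: generic_def)
  qed
  have "(\<lambda>x. qp b / qp (b / a) * (th (- (a * x)) / th (- x)) * (psi a b \<circ> (\<lambda>x. - Q\<^sup>2 / (b * x))) x) holomorphic_on S"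
    by (rule holomorphic_on_mult[OF h2 h1])
  moreover have "conn a b = (\<lambda>x. qp b / qp (b / a) * (th (- (a * x)) / th (- x)) * (psi a b \<circ> (\<lambda>x. - Q\<^sup>2 / (b * x))) x)"
    by (rule ext) (simp add: conn_def)
  ultimately show ?thesis by simp
qed

text \<open>Both sides are holomorphic on the connected set of \<open>x\<close> away from \<open>0\<close> and the powers of \<open>q\<close>, and agree in
  the annulus.\<close>
theorem connection:
  assumes ab: "generic a b" and x: "x \<noteq> 0" "th (- x) \<noteq> 0"
  shows "phi21 q a b 0 x = conn a b x + conn b a x"
proof -
  define S where "S = {x. x \<noteq> 0 \<and> th (- x) \<noteq> 0}"
  define U where "U = {x :: complex. q < norm x \<and> norm x < 1}"
  have ba: "generic b a" using ab generic_sym by blast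
  have S_eq: "S = UNIV - ({0} \<union> range (\<lambda>n::int. Q powi n))"
  proof -
    have "th (- x) = 0 \<longleftrightarrow> (\<exists>n::int. x = Q powi n)" if "x \<noteq> 0" for x
      using theta_q_eq_0_iff[of "- x"] that by simp
    then show ?thesis unfolding S_def by auto
  qed
  show ?thesis
  proof (rule analytic_continuation_open[of U S "phi21 q a b 0" "\<lambda>x. conn a b x + conn b a x" x])
  show "open S"
  proof -
    have "open ((- {0}) \<inter> (\<lambda>x. th (- x)) -` (- {0}))"
      by (rule continuous_open_preimage) (auto intro!: continuous_intros)
    moreover have "(- {0}) \<inter> (\<lambda>x. th (- x)) -` (- {0}) = S" by (auto simp: S_def)
    ultimately show ?thesis by simp
  qed
  show "connected S" unfolding S_eq
    by (rule connected_open_diff_countable) (auto simp: connected_UNIV)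
  show "open U" unfolding U_def by (intro open_Collect_conj open_Collect_less continuous_intros)
  show "U \<noteq> {}"
  proof -
    have "of_real ((1 + q) / 2) \<in> U" unfolding U_def using q0 q1 by (simp add: norm_divide del: of_real_add of_real_divide)
    then show ?thesis by blast
  qed
  show "U \<subseteq> S" using theta_q_annulus_nz q0 by (auto simp: U_def S_def)
  have "S \<subseteq> - phi21_poles q"
  proof
    fix x assume "x \<in> S"
    moreover have "1 / Q ^ n = Q powi (- int n)" for n by (simp add: power_int_minus inverse_eq_divide)
    ultimately show "x \<in> - phi21_poles q" unfolding S_eq phi21_poles_def by auto
  qed
  then show "phi21 q a b 0 holomorphic_on S" using phi21_holo[of 0 a b] holomorphic_on_subset by auto
  show "(\<lambda>x. conn a b x + conn b a x) holomorphic_on S"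
    by (intro holomorphic_on_add conn_holo ab ba) (auto simp: S_def)
  show "x \<in> S" using x by (simp add: S_def)
  fix x assume "x \<in> U"
  then have x: "q < norm x" "norm x < 1" by (auto simp: U_def)
  have "phi21_series q a b 0 x = conn a b x + conn b a x"
  proof (cases "nonpow a \<and> nonpow b")
    case True then show ?thesis using connection_annulus[OF ab _ _ x] by blast
  next
    case False
    have "phi21_series q a b 0 x = phi21_series q b a 0 x" by (simp add: phi21_series_def mult.commute)
    then show ?thesis using connection_annulus_pow[OF ab _ x] connection_annulus_pow[OF ba _ x] False by (auto simp: add.commute)
  qed
  then show "phi21 q a b 0 x = conn a b x + conn b a x" using phi21_eq_series[of 0 x a b] x by simp
  qed
qed

end

section \<open>Invariant measures and their weights\<close>

text \<open>The two integrals and the sum are integrals against a measure on a set of complex numbers,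
  invariant under the dilation by \<open>q\<close>.\<close>
locale qmeasure = qbase +
  fixes X :: "complex set" and M :: "complex measure"
  assumes zero_notin: "0 \<notin> X"
    and X_scale: "t \<in> X \<Longrightarrow> Q * t \<in> X" "t \<in> X \<Longrightarrow> t / Q \<in> X"
    and theta_nz: "t \<in> X \<Longrightarrow> th t \<noteq> 0"
    and compact_X: "0 < r \<Longrightarrow> compact (X \<inter> {t. r \<le> norm t \<and> norm t \<le> R})"
    and sets_M: "sets M = sets borel"
    and X_borel: "X \<in> sets borel"
    and invariant: "distr M borel (\<lambda>t. Q * t) = M"
    and integrable_min: "set_integrable M X (\<lambda>t. min (norm t) (1 / norm t))"
begin

lemma X_iff: "Q * t \<in> X \<longleftrightarrow> t \<in> X"
  using X_scale(1)[of t] X_scale(2)[of "Q * t"] by auto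

lemma X_nz: "t \<in> X \<Longrightarrow> t \<noteq> 0"
  using zero_notin by auto

lemma X_div_pow: "t \<in> X \<Longrightarrow> t / Q ^ n \<in> X"
proof (induction n)
  case (Suc n) then show ?case using X_scale(2)[of "t / Q ^ n"] by (simp add: mult.commute)
qed auto

lemma X_mult_pow: "t \<in> X \<Longrightarrow> Q ^ n * t \<in> X"
proof (induction n)
  case (Suc n) then show ?case using X_scale(1)[of "Q ^ n * t"] by (simp add: mult.assoc)
qed auto

lemma set_measurable:
  fixes f :: "complex \<Rightarrow> 'a::{banach,second_countable_topology}"
  assumes "continuous_on X f"
  shows "set_borel_measurable M X f"
proof -
  have "(\<lambda>t. indicator X t *\<^sub>R f t) \<in> borel_measurable borel"
    by (rule borel_measurable_continuous_on_indicator[OF X_borel assms])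
  then show ?thesis unfolding set_borel_measurable_def using sets_M by (simp cong: measurable_cong_sets)
qed

lemma dilate_measurable: "(\<lambda>t. Q * t) \<in> measurable M borel"
proof -
  have "(\<lambda>t. Q * t) \<in> borel_measurable borel" by (intro borel_measurable_continuous_onI continuous_intros)
  then show ?thesis using sets_M by (simp cong: measurable_cong_sets)
qed

lemma indicator_dilate: "(indicator X (Q * t) :: real) = indicator X t"
  by (simp add: indicator_def X_iff)

lemma set_measurable_borel:
  fixes f :: "complex \<Rightarrow> 'a::{banach,second_countable_topology}"
  assumes "continuous_on X f"
  shows "(\<lambda>t. indicator X t *\<^sub>R f t) \<in> borel_measurable borel"
  by (rule borel_measurable_continuous_on_indicator[OF X_borel assms])

lemma integral_dilate:
  fixes f :: "complex \<Rightarrow> 'a::{banach,second_countable_topology}"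
  assumes "continuous_on X f"
  shows "(LINT t:X|M. f (Q * t)) = (LINT t:X|M. f t)"
  using integral_distr[OF dilate_measurable set_measurable_borel[OF assms]]
  unfolding invariant set_lebesgue_integral_def indicator_dilate by simp

lemma integrable_dilate:
  fixes f :: "complex \<Rightarrow> 'a::{banach,second_countable_topology}"
  assumes "continuous_on X f" "set_integrable M X f"
  shows "set_integrable M X (\<lambda>t. f (Q * t))"
  using integrable_distr_eq[OF dilate_measurable set_measurable_borel[OF assms(1)]] assms(2)
  unfolding invariant set_integrable_def indicator_dilate by simp

text \<open>Functions that transform like \<open>1/\<theta>(t/z)\<close>.\<close>
definition weight :: "complex \<Rightarrow> (complex \<Rightarrow> complex) \<Rightarrow> bool" where
  "weight z y \<longleftrightarrow> z \<noteq> 0 \<and> continuous_on X y \<and> (\<forall>t\<in>X. y (Q * t) = t / z * y t)"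

lemma theta_ratio_dilate:
  assumes "a \<noteq> 0" "t \<in> X"
  shows "th (a * (Q * t)) / th (Q * t) = th (a * t) / th t / a"
proof -
  have "th (a * (Q * t)) = th (a * t) / (a * t)"
    using theta_q_shift[of "a * t"] assms X_nz[OF assms(2)] by (simp add: mult_ac)
  moreover have "th (Q * t) = th t / t" using theta_q_shift X_nz[OF assms(2)] by blast
  ultimately show ?thesis using assms X_nz[OF assms(2)] theta_nz[OF assms(2)] by simp
qed

lemma weight_theta:
  assumes "weight z y" "a \<noteq> 0"
  shows "weight (a * z) (\<lambda>t. th (a * t) / th t * y t)"
  unfolding weight_def
proof (intro conjI ballI)
  show "continuous_on X (\<lambda>t. th (a * t) / th t * y t)"
    using assms X_nz theta_nz by (intro continuous_intros) (auto simp: weight_def)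
  fix t assume t: "t \<in> X"
  show "th (a * (Q * t)) / th (Q * t) * y (Q * t) = t / (a * z) * (th (a * t) / th t * y t)"
    unfolding theta_ratio_dilate[OF assms(2) t] using assms t by (simp add: weight_def mult_ac)
qed (use assms in \<open>auto simp: weight_def\<close>)

lemma weight_div:
  assumes "weight z y"
  shows "weight (z * Q ^ n) (\<lambda>t. y t / t ^ n)"
  unfolding weight_def
proof (intro conjI ballI)
  show "continuous_on X (\<lambda>t. y t / t ^ n)"
    using assms X_nz by (intro continuous_intros) (auto simp: weight_def)
  fix t assume "t \<in> X"
  then show "y (Q * t) / (Q * t) ^ n = t / (z * Q ^ n) * (y t / t ^ n)"
    using assms by (simp add: weight_def power_mult_distrib)
qed (use assms in \<open>auto simp: weight_def\<close>)

text \<open>Along each orbit the ratio of consecutive values tends to \<open>0\<close> at one end and to infinity at the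
  other one, hence the decay at both ends is faster than that of any power.\<close>
lemma weight_decay:
  assumes y: "weight z y"
  shows "\<exists>C\<ge>0. \<forall>t\<in>X. norm (y t) \<le> C * norm t powi k"
proof -
  have z: "z \<noteq> 0" and cont: "continuous_on X y" and shift: "\<And>t. t \<in> X \<Longrightarrow> y (Q * t) = t / z * y t"
    using y by (auto simp: weight_def)
  define u where "u = (\<lambda>t. norm (y t) * norm t powi (- k))"
  define R where "R = q powi k * norm z"
  have R: "R > 0" using q0 z by (simp add: R_def)
  have u_nn: "u t \<ge> 0" for t by (simp add: u_def)
  have u_shift: "u (Q * t) = norm t / R * u t" if "t \<in> X" for t
    using shift[OF that] by (simp add: u_def R_def norm_mult norm_divide power_int_mult_distrib power_int_minus field_simps)
  define K where "K = X \<inter> {t. q * R \<le> norm t \<and> norm t \<le> R / q}"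
  have "compact K" unfolding K_def using q0 R by (intro compact_X) simp
  moreover have "continuous_on K u"
  proof -
    have "continuous_on K y" by (rule continuous_on_subset[OF cont]) (auto simp: K_def)
    then show ?thesis unfolding u_def using X_nz by (intro continuous_intros) (auto simp: K_def)
  qed
  ultimately have "bounded (u ` K)" by (intro compact_imp_bounded compact_continuous_image)
  then obtain C where "C > 0" and C: "\<And>t. t \<in> K \<Longrightarrow> u t \<le> C"
    unfolding bounded_pos by (metis abs_le_D1 imageI real_norm_def)
  have below: "u (Q ^ n * t) \<le> u t" if "t \<in> X" "norm t \<le> R" for n t
  proof (induction n)
    case (Suc n)
    have "q ^ n * norm t \<le> 1 * R" using that q0 q1 R by (intro mult_mono power_le_one) auto
    then have le1: "norm (Q ^ n * t) / R \<le> 1" using R by (simp add: norm_mult norm_power)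
    have "u (Q ^ Suc n * t) = norm (Q ^ n * t) / R * u (Q ^ n * t)"
      using u_shift[OF X_mult_pow[OF that(1), of n]] by (simp add: mult.assoc)
    also have "\<dots> \<le> 1 * u (Q ^ n * t)" by (intro mult_right_mono le1 u_nn)
    finally show ?case using Suc.IH by simp
  qed simp
  have above: "u (t / Q ^ n) \<le> u t" if "t \<in> X" "R \<le> norm t" for n t
  proof (induction n)
    case (Suc n)
    have t': "t / Q ^ Suc n \<in> X" using X_div_pow[OF that(1)] .
    have "norm t * q ^ Suc n \<le> norm t" using q0 q1 power_le_one[of q "Suc n"] by (intro mult_left_le) auto
    then have "norm t \<le> norm t / q ^ Suc n" using q0 by (simp add: pos_le_divide_eq del: power_Suc)
    then have "R \<le> norm (t / Q ^ Suc n)" using that(2) by (simp add: norm_divide norm_power norm_mult)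
    then have ge1: "1 \<le> norm (t / Q ^ Suc n) / R" using R by (simp add: pos_le_divide_eq)
    have "u (t / Q ^ n) = norm (t / Q ^ Suc n) / R * u (t / Q ^ Suc n)"
      using u_shift[OF t'] by simp
    moreover have "1 * u (t / Q ^ Suc n) \<le> norm (t / Q ^ Suc n) / R * u (t / Q ^ Suc n)"
      by (intro mult_right_mono ge1 u_nn)
    ultimately show ?case using Suc.IH by simp
  qed simp
  have qR: "q * R \<le> R" "R \<le> R / q" using q0 q1 R by (auto simp: pos_le_divide_eq)
  have "u t \<le> C" if t: "t \<in> X" for t
  proof -
    have "t \<in> K \<or> norm t < q * R \<or> norm t > R / q" using t by (auto simp: K_def)
    then consider "t \<in> K" | "norm t < q * R" | "norm t > R / q" by blast
    then show ?thesis
    proof cases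
      case 1 then show ?thesis by (rule C)
    next
      case 2
      have tp: "norm t > 0" using X_nz[OF t] by simp
      have "\<exists>n. q ^ n * R < norm t"
        using real_arch_pow_inv[of "norm t / R" q] tp R q1 by (simp add: pos_less_divide_eq)
      define n where "n = (LEAST n. q ^ n * R < norm t)"
      have n: "q ^ n * R < norm t" unfolding n_def by (rule LeastI_ex) fact
      have "n \<noteq> 0" using n 2 qR by (intro notI) simp
      then obtain m where m: "n = Suc m" by (metis not0_implies_Suc)
      have m': "norm t \<le> q ^ m * R" using not_less_Least[of m "\<lambda>n. q ^ n * R < norm t"] m n_def by simp
      define s where "s = t / Q ^ m"
      have s: "s \<in> X" "Q ^ m * s = t" unfolding s_def using X_div_pow[OF t] by auto
      have ns: "norm s \<le> R" "q * R \<le> norm s"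
        using m' n q0 by (simp_all add: s_def m norm_divide norm_power pos_divide_le_eq pos_le_divide_eq mult_ac)
      then have "s \<in> K" using s qR by (simp add: K_def)
      then show ?thesis using below[OF s(1) ns(1), of m] C[of s] s(2) by simp
    next
      case 3
      have tp: "norm t > 0" using X_nz[OF t] by simp
      have "\<exists>n. q ^ n * norm t < R / q"
        using real_arch_pow_inv[of "R / q / norm t" q] tp R q0 q1 by (simp add: pos_less_divide_eq mult_ac)
      define n where "n = (LEAST n. q ^ n * norm t < R / q)"
      have n: "q ^ n * norm t < R / q" unfolding n_def by (rule LeastI_ex) fact
      have "n \<noteq> 0" using n 3 by (intro notI) simp
      then obtain m where m: "n = Suc m" by (metis not0_implies_Suc)
      have m': "R / q \<le> q ^ m * norm t" using not_less_Least[of m "\<lambda>n. q ^ n * norm t < R / q"] m n_def by simp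
      define s where "s = Q ^ n * t"
      have s: "s \<in> X" "s / Q ^ n = t" unfolding s_def using X_mult_pow[OF t] by auto
      have lo: "R \<le> norm s" using m' q0 by (simp add: s_def m norm_mult norm_power pos_divide_le_eq mult_ac)
      have hi: "norm s \<le> R / q" using n by (simp add: s_def norm_mult norm_power)
      have "s \<in> K" using s lo hi qR by (simp add: K_def)
      then show ?thesis using above[OF s(1) lo, of n] s(2) C[of s] by simp
    qed
  qed
  then have "norm (y t) \<le> C * norm t powi k" if "t \<in> X" for t
  proof -
    have pk: "0 < norm t powi k" using X_nz[OF that] by (simp add: zero_less_power_int)
    have "norm (y t) / norm t powi k \<le> C"
      using \<open>\<And>t. t \<in> X \<Longrightarrow> u t \<le> C\<close>[OF that] by (simp add: u_def power_int_minus divide_inverse)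
    then show ?thesis using pk by (simp add: pos_divide_le_eq)
  qed
  then show ?thesis using \<open>C > 0\<close> by (intro exI[of _ C]) auto
qed

lemma weight_measurable: "weight z y \<Longrightarrow> set_borel_measurable M X y"
  by (rule set_measurable) (simp add: weight_def)

lemma weight_integrable:
  assumes "weight z y"
  shows "set_integrable M X y"
proof -
  obtain C where C: "C \<ge> 0" "\<And>t. t \<in> X \<Longrightarrow> norm (y t) \<le> C * norm t powi 1" using weight_decay[OF assms, of 1] by blast
  obtain D where D: "D \<ge> 0" "\<And>t. t \<in> X \<Longrightarrow> norm (y t) \<le> D * norm t powi (-1)" using weight_decay[OF assms, of "-1"] by blast
  have int: "set_integrable M X (\<lambda>t. (C + D) * min (norm t) (1 / norm t))"
    using integrable_min by simp
  have "norm (y t) \<le> (C + D) * min (norm t) (1 / norm t)" if "t \<in> X" for t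
  proof -
    have "C * norm t \<le> (C + D) * norm t" using D by (intro mult_right_mono) auto
    then have "norm (y t) \<le> (C + D) * norm t" using C(2)[OF that] by simp
    moreover have "D * (1 / norm t) \<le> (C + D) * (1 / norm t)" using C by (intro mult_right_mono) auto
    then have "norm (y t) \<le> (C + D) * (1 / norm t)" using D(2)[OF that] by (simp add: power_int_minus divide_inverse)
    ultimately show ?thesis by (simp add: min_def)
  qed
  then have "AE t in M. t \<in> X \<longrightarrow> norm (y t) \<le> norm ((C + D) * min (norm t) (1 / norm t))"
    unfolding real_norm_def by (intro AE_I2 impI order.trans[OF _ abs_ge_self])
  then show ?thesis by (rule set_integrable_bound[OF int weight_measurable[OF assms]])
qed

text \<open>Dividing by \<open>t\<^sup>n\<close> shifts the weight from \<open>z\<close> to \<open>z Q\<^sup>n\<close>; invariance of the measure then gives a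
  recursion in \<open>n\<close>.\<close>
lemma weight_moment:
  assumes y: "weight z y"
  shows "(LINT t:X|M. y t / t ^ n) = (LINT t:X|M. y t) / (z ^ n * of_real (qtri (int (Suc n))))"
    and "(LINT t:X|M. norm (y t / t ^ n)) = (LINT t:X|M. norm (y t)) / (norm z ^ n * qtri (int (Suc n)))"
proof -
  have z: "z \<noteq> 0" and shift: "\<And>t. t \<in> X \<Longrightarrow> y (Q * t) = t / z * y t"
    using y by (auto simp: weight_def)
  have cont: "continuous_on X (\<lambda>t. y t / t ^ n)" for n
    using weight_div[OF y, of n] by (simp add: weight_def)
  have cont': "continuous_on X (\<lambda>t. norm (y t / t ^ n))" for n
    by (intro continuous_on_norm cont)
  have e: "y (Q * t) / (Q * t) ^ Suc n = 1 / (z * Q ^ Suc n) * (y t / t ^ n)" if "t \<in> X" for t n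
    using shift[OF that] X_nz[OF that] by (simp add: power_mult_distrib)
  have step: "(LINT t:X|M. y t / t ^ Suc n) = 1 / (z * Q ^ Suc n) * (LINT t:X|M. y t / t ^ n)" for n
  proof -
    have "(LINT t:X|M. y t / t ^ Suc n) = (LINT t:X|M. y (Q * t) / (Q * t) ^ Suc n)"
      using integral_dilate[OF cont[of "Suc n"]] by simp
    also have "\<dots> = (LINT t:X|M. 1 / (z * Q ^ Suc n) * (y t / t ^ n))"
      unfolding set_lebesgue_integral_def
      by (intro Bochner_Integration.integral_cong refl) (use e in \<open>auto simp: indicator_def simp del: power_Suc\<close>)
    finally show ?thesis unfolding set_integral_mult_right .
  qed
  have step': "(LINT t:X|M. norm (y t / t ^ Suc n)) = norm (1 / (z * Q ^ Suc n)) * (LINT t:X|M. norm (y t / t ^ n))" for n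
  proof -
    have "(LINT t:X|M. norm (y t / t ^ Suc n)) = (LINT t:X|M. norm (y (Q * t) / (Q * t) ^ Suc n))"
      using integral_dilate[OF cont'[of "Suc n"]] by simp
    also have "\<dots> = (LINT t:X|M. norm (1 / (z * Q ^ Suc n)) * norm (y t / t ^ n))"
      unfolding set_lebesgue_integral_def
      by (intro Bochner_Integration.integral_cong refl) (use e in \<open>auto simp: indicator_def norm_mult[symmetric] simp del: power_Suc norm_mult norm_divide\<close>)
    finally show ?thesis unfolding set_integral_mult_right .
  qed
  show "(LINT t:X|M. y t / t ^ n) = (LINT t:X|M. y t) / (z ^ n * of_real (qtri (int (Suc n))))"
  proof (induction n)
    case (Suc n)
    show ?case unfolding step Suc.IH qtri_int_Suc[of "Suc n"] by (simp add: mult_ac del: of_nat_Suc)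
  qed simp
  show "(LINT t:X|M. norm (y t / t ^ n)) = (LINT t:X|M. norm (y t)) / (norm z ^ n * qtri (int (Suc n)))"
  proof (induction n)
    case (Suc n)
    show ?case unfolding step' Suc.IH qtri_int_Suc[of "Suc n"] by (simp add: norm_divide norm_mult norm_power mult_ac del: of_nat_Suc)
  qed simp
qed

text \<open>Integrating the connection formula term by term turns the entire series \<open>psi\<close> into \<open>phi21\<close>.\<close>
lemma integral_psi:
  assumes y: "weight z y" and ab: "generic a b" and conv: "norm (Q / (b * z)) < 1"
  shows "set_integrable M X (\<lambda>t. y t * psi a b (Q\<^sup>2 / (b * t)))"
    and "(LINT t:X|M. y t * psi a b (Q\<^sup>2 / (b * t))) = (LINT t:X|M. y t) * phi21 q a 0 (a * Q / b) (Q / (b * z))"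
proof -
  have z: "z \<noteq> 0" using y by (simp add: weight_def)
  define d where "d = (\<lambda>n. qn a n / (qn (a * Q / b) n * qn Q n) * of_real (qtri (int n)) * (Q\<^sup>2 / b) ^ n)"
  define f where "f = (\<lambda>n t. indicator X t *\<^sub>R (d n * (y t / t ^ n)))"
  have int: "set_integrable M X (\<lambda>t. y t / t ^ n)" for n by (rule weight_integrable[OF weight_div[OF y]])
  have f_int: "integrable M (f n)" for n
    using set_integrable_mult_right[OF int, of "d n" n] unfolding set_integrable_def f_def by simp
  have y_sum: "(\<lambda>n. f n t) sums (indicator X t *\<^sub>R (y t * psi a b (Q\<^sup>2 / (b * t))))"
    and y_abs: "summable (\<lambda>n. norm (f n t))" for t
  proof -
    have s: "summable (\<lambda>n. norm (qn a n / (qn (a * Q / b) n * qn Q n) * of_real (qtri (int n)) * (Q\<^sup>2 / (b * t)) ^ n))"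
      by (rule psi_summable[OF generic_nz(2)[OF ab]])
    have eq: "d n * (y t / t ^ n) = y t * (qn a n / (qn (a * Q / b) n * qn Q n) * of_real (qtri (int n)) * (Q\<^sup>2 / (b * t)) ^ n)" for n
      by (simp add: d_def power_divide power_mult_distrib mult_ac)
    show "(\<lambda>n. f n t) sums (indicator X t *\<^sub>R (y t * psi a b (Q\<^sup>2 / (b * t))))"
      unfolding f_def eq psi_def by (intro sums_scaleR_right sums_mult summable_sums summable_norm_cancel[OF s])
    show "summable (\<lambda>n. norm (f n t))"
      unfolding f_def eq norm_scaleR norm_mult[of "y t"] by (intro summable_mult s)
  qed
  have coeff: "d n / (z ^ n * of_real (qtri (int (Suc n)))) = phi21_coeff a 0 (a * Q / b) n * (Q / (b * z)) ^ n" for n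
    unfolding d_def phi21_coeff_def[OF generic_nz(2)[OF ab]] qtri_int_Suc by (simp add: power_divide power_mult_distrib power2_eq_square)
  have cs: "summable (\<lambda>n. norm (phi21_coeff a 0 (a * Q / b) n * (Q / (b * z)) ^ n))"
    by (rule phi21_coeff_summable[OF generic_nz(2)[OF ab] conv])
  have norms: "(\<integral>t. norm (f n t) \<partial>M) = norm (phi21_coeff a 0 (a * Q / b) n * (Q / (b * z)) ^ n) * (LINT t:X|M. norm (y t))" for n
  proof -
    have "(\<integral>t. norm (f n t) \<partial>M) = (LINT t:X|M. norm (d n) * norm (y t / t ^ n))"
      unfolding set_lebesgue_integral_def f_def by (intro Bochner_Integration.integral_cong refl) (auto simp: indicator_def norm_mult norm_divide)
    also have "\<dots> = norm (d n) * ((LINT t:X|M. norm (y t)) / (norm z ^ n * qtri (int (Suc n))))"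
      using weight_moment(2)[OF y, of n] by simp
    also have "\<dots> = norm (d n / (z ^ n * of_real (qtri (int (Suc n))))) * (LINT t:X|M. norm (y t))"
      by (simp add: norm_divide norm_mult norm_power del: of_nat_Suc)
    finally show ?thesis unfolding coeff .
  qed
  have ns: "summable (\<lambda>n. \<integral>t. norm (f n t) \<partial>M)" unfolding norms by (intro summable_mult2 cs)
  have ae: "AE t in M. summable (\<lambda>n. norm (f n t))" using y_abs by simp
  have sum_eq: "(\<Sum>n. f n t) = indicator X t *\<^sub>R (y t * psi a b (Q\<^sup>2 / (b * t)))" for t
    using y_sum sums_unique by metis
  show "set_integrable M X (\<lambda>t. y t * psi a b (Q\<^sup>2 / (b * t)))"
    unfolding set_integrable_def using integrable_suminf[OF f_int ae ns] unfolding sum_eq .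
  have "(\<lambda>n. integral\<^sup>L M (f n)) sums (LINT t:X|M. y t * psi a b (Q\<^sup>2 / (b * t)))"
    unfolding set_lebesgue_integral_def using sums_integral[OF f_int ae ns] unfolding sum_eq .
  moreover have "integral\<^sup>L M (f n) = (LINT t:X|M. y t) * (phi21_coeff a 0 (a * Q / b) n * (Q / (b * z)) ^ n)" for n
  proof -
    have "integral\<^sup>L M (f n) = (LINT t:X|M. d n * (y t / t ^ n))" unfolding set_lebesgue_integral_def f_def ..
    also have "\<dots> = d n * ((LINT t:X|M. y t) / (z ^ n * of_real (qtri (int (Suc n)))))"
      unfolding set_integral_mult_right weight_moment(1)[OF y] ..
    also have "\<dots> = d n / (z ^ n * of_real (qtri (int (Suc n)))) * (LINT t:X|M. y t)"
      by (simp del: of_nat_Suc)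
    finally show ?thesis unfolding coeff by (simp only: mult.commute)
  qed
  ultimately have "(\<lambda>n. (LINT t:X|M. y t) * (phi21_coeff a 0 (a * Q / b) n * (Q / (b * z)) ^ n)) sums (LINT t:X|M. y t * psi a b (Q\<^sup>2 / (b * t)))"
    by simp
  moreover have "(\<lambda>n. (LINT t:X|M. y t) * (phi21_coeff a 0 (a * Q / b) n * (Q / (b * z)) ^ n)) sums ((LINT t:X|M. y t) * phi21 q a 0 (a * Q / b) (Q / (b * z)))"
    using sums_mult[OF phi21_series_sums[OF generic_nz(2)[OF ab] conv]] phi21_eq_series[OF generic_nz(2)[OF ab] conv] by simp
  ultimately show "(LINT t:X|M. y t * psi a b (Q\<^sup>2 / (b * t))) = (LINT t:X|M. y t) * phi21 q a 0 (a * Q / b) (Q / (b * z))"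
    by (rule sums_unique2)
qed

lemma bounded_phi21_near_zero:
  obtains C where "C \<ge> 0" "\<And>t. t \<in> X \<Longrightarrow> norm t \<le> 1 \<Longrightarrow> norm (phi21 q a b 0 (- t)) \<le> C"
proof -
  have hol: "phi21 q a b 0 holomorphic_on (- phi21_poles q)" by (rule phi21_holo) simp
  then have cont: "continuous_on (- phi21_poles q) (phi21 q a b 0)" by (rule holomorphic_on_imp_continuous_on)
  define K where "K = cball 0 (1/2) \<union> uminus ` (X \<inter> {t. 1/2 \<le> norm t \<and> norm t \<le> 1})"
  have "compact K" unfolding K_def
    by (intro compact_Un compact_cball compact_continuous_image compact_X continuous_intros) auto
  moreover have "K \<subseteq> - phi21_poles q"
  proof
    fix x assume "x \<in> K"
    then consider "norm x \<le> 1/2" | "- x \<in> X" by (auto simp: K_def)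
    then show "x \<in> - phi21_poles q"
    proof cases
      case 1 then show ?thesis using phi21_poles_norm[of x] by auto
    next
      case 2
      show ?thesis
      proof
        assume "x \<in> phi21_poles q"
        then have "th (- x) = 0" by (simp add: phi21_poles_iff theta_q_def)
        then show False using theta_nz[OF 2] by simp
      qed
    qed
  qed
  ultimately have "bounded (phi21 q a b 0 ` K)"
    using cont by (intro compact_imp_bounded compact_continuous_image) (auto intro: continuous_on_subset)
  then obtain C where C: "C > 0" "\<And>x. x \<in> K \<Longrightarrow> norm (phi21 q a b 0 x) \<le> C"
    unfolding bounded_pos by blast
  show ?thesis
  proof (rule that[of C])
    fix t assume "t \<in> X" "norm t \<le> 1"
    then have "- t \<in> K" by (cases "norm t \<le> 1/2") (auto simp: K_def)
    then show "norm (phi21 q a b 0 (- t)) \<le> C" by (rule C)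
  qed (use C in simp)
qed

lemma phi21_continuous_on_X: "continuous_on X (\<lambda>t. phi21 q a b 0 (- t))"
proof -
  have "phi21 q a b 0 holomorphic_on (- phi21_poles q)" by (rule phi21_holo) simp
  then have cont: "continuous_on (- phi21_poles q) (phi21 q a b 0)" by (rule holomorphic_on_imp_continuous_on)
  have "- t \<notin> phi21_poles q" if "t \<in> X" for t
    using theta_nz[OF that] by (auto simp: phi21_poles_iff theta_q_def)
  then show ?thesis by (intro continuous_on_compose2[OF cont] continuous_intros) auto
qed

lemma conn_neg: "conn a b (- t) = qp b / qp (b / a) * (th (a * t) / th t * psi a b (Q\<^sup>2 / (b * t)))"
  by (simp add: conn_def mult.assoc)

lemma psi_bounded:
  assumes "generic a b"
  obtains C where "C \<ge> 0" "\<And>t. norm t \<ge> 1 \<Longrightarrow> norm (psi a b (Q\<^sup>2 / (b * t))) \<le> C"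
proof -
  define K where "K = cball (0::complex) (norm (Q\<^sup>2 / b))"
  have "continuous_on K (psi a b)"
    by (rule holomorphic_on_imp_continuous_on[OF psi_holo[OF generic_nz(2)[OF assms]]])
  then have "bounded (psi a b ` K)" unfolding K_def by (intro compact_imp_bounded compact_continuous_image) auto
  then obtain C where C: "C > 0" "\<And>x. x \<in> K \<Longrightarrow> norm (psi a b x) \<le> C" unfolding bounded_pos by blast
  show ?thesis
  proof (rule that[of C])
    fix t :: complex assume "norm t \<ge> 1"
    then have "norm (Q\<^sup>2 / b) / norm t \<le> norm (Q\<^sup>2 / b) / 1" by (intro divide_left_mono) auto
    then have "Q\<^sup>2 / (b * t) \<in> K" by (simp add: K_def norm_divide norm_mult)
    then show "norm (psi a b (Q\<^sup>2 / (b * t))) \<le> C" by (rule C)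
  qed (use C in simp)
qed

text \<open>Near \<open>0\<close> the function is bounded; for large \<open>t\<close> the connection formula bounds it by weights of the
  shape \<open>\<theta>(a t) / \<theta>(t) * w t\<close>.\<close>
lemma phi21_weight_integrable:
  assumes ab: "generic a b" and w: "weight z w"
  shows "set_integrable M X (\<lambda>t. phi21 q a b 0 (- t) * w t)"
proof -
  have ba: "generic b a" using ab generic_sym by blast
  have nz: "a \<noteq> 0" "b \<noteq> 0" using ab by (auto simp: generic_def)
  obtain C where C: "C \<ge> 0" "\<And>t. t \<in> X \<Longrightarrow> norm t \<le> 1 \<Longrightarrow> norm (phi21 q a b 0 (- t)) \<le> C"
    using bounded_phi21_near_zero[of a b] by blast
  obtain A where A: "A \<ge> 0" "\<And>t. norm t \<ge> 1 \<Longrightarrow> norm (psi a b (Q\<^sup>2 / (b * t))) \<le> A" using psi_bounded[OF ab] by blast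
  obtain B where B: "B \<ge> 0" "\<And>t. norm t \<ge> 1 \<Longrightarrow> norm (psi b a (Q\<^sup>2 / (a * t))) \<le> B" using psi_bounded[OF ba] by blast
  let ?ya = "\<lambda>t. th (a * t) / th t * w t" and ?yb = "\<lambda>t. th (b * t) / th t * w t"
  let ?ka = "norm (qp b / qp (b / a)) * A" and ?kb = "norm (qp a / qp (a / b)) * B"
  let ?G = "\<lambda>t. C * norm (w t) + (?ka * norm (?ya t) + ?kb * norm (?yb t))"
  have int: "set_integrable M X ?G"
    by (intro set_integral_add(1) set_integrable_mult_right set_integrable_norm weight_integrable[OF w]
        weight_integrable[OF weight_theta[OF w]] nz)
  have cont: "continuous_on X (\<lambda>t. phi21 q a b 0 (- t) * w t)"
    using w by (intro continuous_intros phi21_continuous_on_X) (simp add: weight_def)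
  have "norm (phi21 q a b 0 (- t) * w t) \<le> ?G t" if t: "t \<in> X" for t
  proof (cases "norm t \<le> 1")
    case True
    have "norm (phi21 q a b 0 (- t) * w t) \<le> C * norm (w t)"
      unfolding norm_mult by (intro mult_right_mono C t True) simp
    moreover have "0 \<le> ?ka * norm (?ya t) + ?kb * norm (?yb t)" using A B by (intro add_nonneg_nonneg mult_nonneg_nonneg) auto
    ultimately show ?thesis by linarith
  next
    case False
    then have t1: "norm t \<ge> 1" by simp
    have "phi21 q a b 0 (- t) = conn a b (- t) + conn b a (- t)"
      using connection[OF ab, of "- t"] X_nz[OF t] theta_nz[OF t] by simp
    then have eq: "phi21 q a b 0 (- t) * w t = qp b / qp (b / a) * psi a b (Q\<^sup>2 / (b * t)) * ?ya t + qp a / qp (a / b) * psi b a (Q\<^sup>2 / (a * t)) * ?yb t"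
      unfolding conn_neg by (simp only: distrib_left distrib_right mult_ac)
    have "norm (phi21 q a b 0 (- t) * w t) \<le> norm (qp b / qp (b / a)) * norm (psi a b (Q\<^sup>2 / (b * t))) * norm (?ya t)
        + norm (qp a / qp (a / b)) * norm (psi b a (Q\<^sup>2 / (a * t))) * norm (?yb t)"
      unfolding eq by (rule order.trans[OF norm_triangle_ineq]) (simp only: norm_mult order.refl)
    also have "\<dots> \<le> ?ka * norm (?ya t) + ?kb * norm (?yb t)"
      by (rule add_mono[OF mult_right_mono[OF mult_left_mono[OF A(2)[OF t1]]] mult_right_mono[OF mult_left_mono[OF B(2)[OF t1]]]])
         (rule norm_ge_zero)+
    finally show ?thesis using C(1) mult_nonneg_nonneg[OF C(1) norm_ge_zero[of "w t"]] by linarith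
  qed
  then have "AE t in M. t \<in> X \<longrightarrow> norm (phi21 q a b 0 (- t) * w t) \<le> norm (?G t)"
    unfolding real_norm_def by (intro AE_I2 impI order.trans[OF _ abs_ge_self])
  then show ?thesis by (rule set_integrable_bound[OF int set_measurable[OF cont]])
qed

end

text \<open>The compatibility of the weights under simultaneous dilation turns a dilation of the parameter \<open>z\<close>
  into one of the variable of integration.\<close>
locale qkernel = qmeasure +
  fixes w :: "complex \<Rightarrow> complex \<Rightarrow> complex" and Z :: "complex set"
  assumes weight_w: "z \<in> Z \<Longrightarrow> weight z (w z)"
    and Z_scale: "z \<in> Z \<Longrightarrow> Q * z \<in> Z" "z \<in> Z \<Longrightarrow> z / Q \<in> Z"
    and w_scale: "z \<in> Z \<Longrightarrow> t \<in> X \<Longrightarrow> w (Q * z) (Q * t) = w z t"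
begin

definition transform :: "complex \<Rightarrow> complex \<Rightarrow> complex \<Rightarrow> complex" where
  "transform a b z = (LINT t:X|M. phi21 q a b 0 (- t) * w z t)"

text \<open>Up to a constant factor, the part of the transform that depends on the kernel.\<close>
definition moment :: "complex \<Rightarrow> complex \<Rightarrow> complex" where
  "moment a z = (LINT t:X|M. th (a * t) / th t * w z t)"

lemma Z_nz: "z \<in> Z \<Longrightarrow> z \<noteq> 0"
  using weight_w by (auto simp: weight_def)

lemma w_dilate: "z \<in> Z \<Longrightarrow> t \<in> X \<Longrightarrow> w z (Q * t) = t / z * w z t"
  using weight_w by (auto simp: weight_def)

lemma set_integral_cong:
  "(\<And>t. t \<in> X \<Longrightarrow> f t = g t) \<Longrightarrow> (LINT t:X|M. f t) = (LINT t:X|M. g t :: complex)"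
  unfolding set_lebesgue_integral_def by (intro Bochner_Integration.integral_cong refl) (auto simp: indicator_def)

lemma moment_dilate:
  assumes "z \<in> Z" "a \<noteq> 0"
  shows "moment a (Q * z) = moment a z / a"
proof -
  have "continuous_on X (\<lambda>t. th (a * t) / th t * w (Q * z) t)"
    using weight_theta[OF weight_w[OF Z_scale(1)[OF assms(1)]] assms(2)] by (simp add: weight_def)
  from integral_dilate[OF this] have "moment a (Q * z) = (LINT t:X|M. th (a * (Q * t)) / th (Q * t) * w (Q * z) (Q * t))"
    by (simp add: moment_def)
  also have "\<dots> = (LINT t:X|M. 1 / a * (th (a * t) / th t * w z t))"
    by (rule set_integral_cong) (simp add: theta_ratio_dilate assms w_scale)
  also have "\<dots> = 1 / a * moment a z" unfolding moment_def set_integral_mult_right ..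
  finally show ?thesis by simp
qed

text \<open>Insert the connection formula and integrate each of the two terms by \<open>integral_psi\<close>; the condition is
  the convergence of the resulting series.\<close>
lemma transform_expansion_large:
  assumes z: "z \<in> Z" and ab: "generic a b" and conv: "norm (Q / (a * b * z)) < 1"
  shows "transform a b z = qp b / qp (b / a) * moment a z * phi21 q a 0 (a * Q / b) (Q / (a * b * z))
     + qp a / qp (a / b) * moment b z * phi21 q b 0 (b * Q / a) (Q / (a * b * z))"
proof -
  have ba: "generic b a" using ab generic_sym by blast
  have nz: "a \<noteq> 0" "b \<noteq> 0" using ab by (auto simp: generic_def)
  let ?ya = "\<lambda>t. th (a * t) / th t * w z t" and ?yb = "\<lambda>t. th (b * t) / th t * w z t"
  have wa: "weight (a * z) ?ya" and wb: "weight (b * z) ?yb" using weight_theta[OF weight_w[OF z]] nz by auto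
  have ca: "norm (Q / (b * (a * z))) < 1" and cb: "norm (Q / (a * (b * z))) < 1" using conv by (simp_all add: mult_ac)
  have ea: "Q / (b * (a * z)) = Q / (a * b * z)" and eb: "Q / (a * (b * z)) = Q / (a * b * z)" by (simp_all add: mult_ac)
  have "transform a b z = (LINT t:X|M. qp b / qp (b / a) * (?ya t * psi a b (Q\<^sup>2 / (b * t))) + qp a / qp (a / b) * (?yb t * psi b a (Q\<^sup>2 / (a * t))))"
    unfolding transform_def
  proof (rule set_integral_cong)
    fix t assume t: "t \<in> X"
    have "phi21 q a b 0 (- t) = conn a b (- t) + conn b a (- t)"
      using connection[OF ab, of "- t"] X_nz[OF t] theta_nz[OF t] by simp
    then show "phi21 q a b 0 (- t) * w z t = qp b / qp (b / a) * (?ya t * psi a b (Q\<^sup>2 / (b * t))) + qp a / qp (a / b) * (?yb t * psi b a (Q\<^sup>2 / (a * t)))"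
      unfolding conn_neg by (simp only: distrib_left distrib_right mult_ac)
  qed
  also have "\<dots> = qp b / qp (b / a) * (LINT t:X|M. ?ya t * psi a b (Q\<^sup>2 / (b * t))) + qp a / qp (a / b) * (LINT t:X|M. ?yb t * psi b a (Q\<^sup>2 / (a * t)))"
    by (subst set_integral_add(2); (intro set_integrable_mult_right integral_psi(1)[OF wa ab ca] integral_psi(1)[OF wb ba cb])?;
        simp only: set_integral_mult_right)
  also have "\<dots> = qp b / qp (b / a) * (moment a z * phi21 q a 0 (a * Q / b) (Q / (a * b * z)))
     + qp a / qp (a / b) * (moment b z * phi21 q b 0 (b * Q / a) (Q / (a * b * z)))"
    unfolding integral_psi(2)[OF wa ab ca] integral_psi(2)[OF wb ba cb] moment_def ea eb ..
  finally show ?thesis by (simp only: mult.assoc)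
qed

text \<open>The transform inherits a difference equation from its integrand.\<close>
lemma transform_difference_equation:
  assumes z: "z \<in> Z" and ab: "generic a b"
  shows "z * transform a b (z / Q) = (- 1 + (a + b) * z) * transform a b z + (1 - a * b * z) * transform a b (Q * z)"
proof -
  define F where "F = (\<lambda>t. phi21 q a b 0 (- t))"
  have zQ: "Q * z \<in> Z" "z / Q \<in> Z" using Z_scale z by auto
  have z0: "z \<noteq> 0" using Z_nz z by simp
  have int: "set_integrable M X (\<lambda>t. F t * w z t)" and cont: "continuous_on X (\<lambda>t. F t * w z t)" if "z \<in> Z" for z
    using phi21_weight_integrable[OF ab weight_w[OF that]] phi21_continuous_on_X weight_w[OF that]
    by (auto simp: F_def weight_def intro!: continuous_intros)
  have T: "transform a b z = (LINT t:X|M. F t * w z t)" for z by (simp add: transform_def F_def)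
  have e1: "t * F t * w z t = z * (F t * w (z / Q) t)" if "t \<in> X" for t
  proof -
    have "w (z / Q) t = t / z * w z t" using w_scale[OF zQ(2) that] w_dilate[OF z that] by simp
    then show ?thesis using z0 by simp
  qed
  have e2: "F (Q * t) * w z t = F (Q * t) * w (Q * z) (Q * t)" if "t \<in> X" for t
    using w_scale[OF z that] by simp
  have e3: "t * F (Q * t) * w z t = z * (F (Q * t) * w z (Q * t))" if "t \<in> X" for t
    using w_dilate[OF z that] z0 by simp
  have e4: "t * F (Q * (Q * t)) * w z t = z * (F (Q * (Q * t)) * w (Q * z) (Q * (Q * t)))" if "t \<in> X" for t
    using w_dilate[OF z that] w_scale[OF z X_scale(1)[OF that]] z0 by simp
  have i2: "set_integrable M X (\<lambda>t. F (Q * t) * w (Q * z) (Q * t))"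
    by (rule integrable_dilate[OF cont int]) (rule zQ)+
  have i3: "set_integrable M X (\<lambda>t. F (Q * t) * w z (Q * t))"
    by (rule integrable_dilate[OF cont int]) (rule z)+
  have c2: "continuous_on X (\<lambda>t. F (Q * t) * w (Q * z) (Q * t))"
    by (rule continuous_on_compose2[OF cont[OF zQ(1)]]) (auto intro!: continuous_intros X_scale)
  have i4: "set_integrable M X (\<lambda>t. F (Q * (Q * t)) * w (Q * z) (Q * (Q * t)))"
    by (rule integrable_dilate[OF c2 i2])
  have s2: "(LINT t:X|M. F (Q * t) * w (Q * z) (Q * t)) = transform a b (Q * z)"
    unfolding T by (rule integral_dilate[OF cont[OF zQ(1)]])
  have s3: "(LINT t:X|M. F (Q * t) * w z (Q * t)) = transform a b z"
    unfolding T by (rule integral_dilate[OF cont[OF z]])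
  have s4: "(LINT t:X|M. F (Q * (Q * t)) * w (Q * z) (Q * (Q * t))) = transform a b (Q * z)"
    unfolding s2[symmetric] by (rule integral_dilate[OF c2])
  have feq: "F t * w z t + z * (F t * w (z / Q) t) = F (Q * t) * w (Q * z) (Q * t)
      + ((a + b) * z * (F (Q * t) * w z (Q * t)) - a * b * z * (F (Q * (Q * t)) * w (Q * z) (Q * (Q * t))))" if t: "t \<in> X" for t
  proof -
    have "- t \<notin> phi21_poles q" using theta_nz[OF t] by (auto simp: phi21_poles_iff theta_q_def)
    from phi21_feq[of 0, OF _ this, of a b] have "(1 + t) * F t = (1 + (a + b) * t) * F (Q * t) - a * b * t * F (Q * (Q * t))"
      by (simp add: F_def)
    then have "(1 + t) * F t * w z t = ((1 + (a + b) * t) * F (Q * t) - a * b * t * F (Q * (Q * t))) * w z t" by simp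
    then have "F t * w z t + t * F t * w z t = F (Q * t) * w z t + ((a + b) * (t * F (Q * t) * w z t) - a * b * (t * F (Q * (Q * t)) * w z t))"
      by (simp add: algebra_simps)
    then show ?thesis unfolding e1[OF t] e3[OF t] e4[OF t] unfolding e2[OF t] by (simp only: mult.assoc)
  qed
  have "(LINT t:X|M. F t * w z t + z * (F t * w (z / Q) t)) = transform a b z + z * transform a b (z / Q)"
    unfolding T by (subst set_integral_add(2)) (auto intro!: set_integrable_mult_right int z zQ)
  moreover have "(LINT t:X|M. F t * w z t + z * (F t * w (z / Q) t)) =
    (LINT t:X|M. F (Q * t) * w (Q * z) (Q * t)
      + ((a + b) * z * (F (Q * t) * w z (Q * t)) - a * b * z * (F (Q * (Q * t)) * w (Q * z) (Q * (Q * t)))))"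
    by (rule set_integral_cong) (rule feq)
  moreover have "\<dots> = transform a b (Q * z) + ((a + b) * z * transform a b z - a * b * z * transform a b (Q * z))"
  proof -
    have j3: "set_integrable M X (\<lambda>t. (a + b) * z * (F (Q * t) * w z (Q * t)))"
      and j4: "set_integrable M X (\<lambda>t. a * b * z * (F (Q * (Q * t)) * w (Q * z) (Q * (Q * t))))"
      by (intro set_integrable_mult_right i3 i4)+
    show ?thesis
      unfolding set_integral_add(2)[OF i2 set_integral_diff(1)[OF j3 j4]] set_integral_diff(2)[OF j3 j4]
      unfolding set_integral_mult_right s2 s3 s4 ..
  qed
  ultimately show ?thesis by (simp add: algebra_simps)
qed

lemma expansion_difference_equation:
  assumes z: "z \<in> Z" and ab: "generic a b" and pole: "1 / (a * b * z) \<notin> phi21_poles q"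
  defines "V \<equiv> \<lambda>z. moment a z * phi21 q a 0 (a * Q / b) (Q / (a * b * z))"
  shows "z * V (z / Q) = (- 1 + (a + b) * z) * V z + (1 - a * b * z) * V (Q * z)"
proof -
  have nz: "a \<noteq> 0" "b \<noteq> 0" "z \<noteq> 0" using ab Z_nz[OF z] by (auto simp: generic_def)
  define m where "m = moment a z"
  define f where "f = phi21 q a 0 (a * Q / b)"
  have m1: "moment a (Q * z) = m / a" unfolding m_def by (rule moment_dilate[OF z nz(1)])
  have m2: "moment a (z / Q) = m * a"
    using moment_dilate[OF Z_scale(2)[OF z] nz(1)] nz by (simp add: m_def)
  define y where "y = 1 / (a * b * z)"
  have y: "Q / (a * b * z) = Q * y" "Q / (a * b * (Q * z)) = y" "Q / (a * b * (z / Q)) = Q * (Q * y)"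
    by (simp_all add: y_def)
  have eq: "(1 - y) * f y = (1 + a / b - a * y) * f (Q * y) - a / b * f (Q * (Q * y))"
    using phi21_feq[OF generic_nz(2)[OF ab] pole, of a 0] by (simp add: f_def y_def)
  have E: "(- b * z) * (1 - y) = (1 - a * b * z) / a" "(- b * z) * (1 + a / b - a * y) = 1 - (a + b) * z"
    "(- b * z) * (a / b) = - (a * z)"
    using nz by (simp_all add: y_def field_simps)
  have "(1 - a * b * z) / a * f y = (- b * z) * ((1 - y) * f y)"
    unfolding E(1)[symmetric] by (simp only: mult.assoc)
  also have "\<dots> = ((- b * z) * (1 + a / b - a * y)) * f (Q * y) - ((- b * z) * (a / b)) * f (Q * (Q * y))"
  proof -
    have "x * (p * u - r * v) = (x * p) * u - (x * r) * v" for x p u r v :: complex by (simp add: algebra_simps)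
    then show ?thesis unfolding eq .
  qed
  also have "\<dots> = (1 - (a + b) * z) * f (Q * y) + a * z * f (Q * (Q * y))"
    unfolding E(2,3) by simp
  finally have "(1 - a * b * z) / a * f y = (1 - (a + b) * z) * f (Q * y) + a * z * f (Q * (Q * y))" .
  moreover have "(1 - a * b * z) * (m / a * f y) = m * ((1 - a * b * z) / a * f y)" by simp
  ultimately have eq': "(1 - a * b * z) * (m / a * f y) = m * ((1 - (a + b) * z) * f (Q * y) + a * z * f (Q * (Q * y)))"
    by simp
  show ?thesis
    unfolding V_def y m1 m2 f_def[symmetric] m_def[symmetric] eq' by (simp add: algebra_simps)
qed

text \<open>The difference equation carries the expansion from large \<open>z\<close> to all \<open>z\<close>; its leading coefficient
  vanishes only where the next step would meet a pole.\<close>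
theorem transform_expansion:
  assumes z: "z \<in> Z" and ab: "generic a b" and pole: "Q / (a * b * z) \<notin> phi21_poles q"
  shows "transform a b z = qp b / qp (b / a) * moment a z * phi21 q a 0 (a * Q / b) (Q / (a * b * z))
     + qp a / qp (a / b) * moment b z * phi21 q b 0 (b * Q / a) (Q / (a * b * z))"
proof -
  have ba: "generic b a" using ab generic_sym by blast
  have nz: "a \<noteq> 0" "b \<noteq> 0" using ab by (auto simp: generic_def)
  define V where "V = (\<lambda>a b z. moment a z * phi21 q a 0 (a * Q / b) (Q / (a * b * z)))"
  define W where "W = (\<lambda>z. qp b / qp (b / a) * V a b z + qp a / qp (a / b) * V b a z)"
  have Vb: "V b a z = moment b z * phi21 q b 0 (b * Q / a) (Q / (a * b * z))" for z
    by (simp add: V_def mult.commute[of a b])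
  have claim: "transform a b z = W z"
    if "z \<in> Z" "Q / (a * b * z) \<notin> phi21_poles q" "norm (Q / (a * b * z)) < 1 / q ^ N" for z N
    using that
  proof (induction N arbitrary: z rule: less_induct)
    case (less N)
    show ?case
    proof (cases "norm (Q / (a * b * z)) < 1")
      case True
      then show ?thesis
        using transform_expansion_large[OF less.prems(1) ab True]
        unfolding W_def Vb unfolding V_def by (simp only: mult.assoc)
    next
      case False
      then obtain n where N: "N = Suc n" using less.prems(3) by (cases N) auto
      define x where "x = Q / (a * b * z)"
      have zn: "z \<noteq> 0" using Z_nz less.prems(1) by simp
      define z1 where "z1 = z / Q"
      have z1: "z1 \<in> Z" "z1 / Q \<in> Z" "Q * z1 = z"
        using Z_scale(2)[OF less.prems(1)] Z_scale(2)[OF Z_scale(2)[OF less.prems(1)]] by (auto simp only: z1_def) simp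
      have x1: "Q / (a * b * z1) = Q * x" "Q / (a * b * (z1 / Q)) = Q * (Q * x)" "1 / (a * b * z1) = x"
        by (simp_all add: x_def z1_def)
      have xp: "x \<notin> phi21_poles q" using less.prems(2) by (simp add: x_def)
      then have xp1: "Q * x \<notin> phi21_poles q" "Q * (Q * x) \<notin> phi21_poles q" using phi21_poles_scale by blast+
      have "norm x < 1 / q ^ Suc n" using less.prems(3) by (simp add: x_def N)
      then have "norm (Q * x) < 1 / q ^ n" using q0 by (simp add: norm_mult field_simps)
      then have n1: "norm (Q * x) < 1 / q ^ n" "norm (Q * (Q * x)) < 1 / q ^ n" using norm_Q_mult_less by blast+
      have t1: "transform a b z1 = W z1" by (rule less.IH[of n]) (use z1 x1 xp1 n1 N in auto)
      have t2: "transform a b (z1 / Q) = W (z1 / Q)" by (rule less.IH[of n]) (use z1 x1 xp1 n1 N in auto)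
      have pole1: "1 / (a * b * z1) \<notin> phi21_poles q" "1 / (b * a * z1) \<notin> phi21_poles q"
        using xp x1(3) by (simp_all add: mult.commute[of b a])
      have Va: "z1 * V a b (z1 / Q) = (- 1 + (a + b) * z1) * V a b z1 + (1 - a * b * z1) * V a b z"
        unfolding V_def using expansion_difference_equation[OF z1(1) ab pole1(1)] z1(3) by simp
      have Vb': "z1 * V b a (z1 / Q) = (- 1 + (a + b) * z1) * V b a z1 + (1 - a * b * z1) * V b a z"
        unfolding V_def using expansion_difference_equation[OF z1(1) ba pole1(2)] z1(3)
        by (simp add: add.commute[of b a] mult.commute[of b a])
      have "z1 * W (z1 / Q) = qp b / qp (b / a) * (z1 * V a b (z1 / Q)) + qp a / qp (a / b) * (z1 * V b a (z1 / Q))"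
        unfolding W_def by (simp only: distrib_left mult_ac)
      also have "\<dots> = (- 1 + (a + b) * z1) * W z1 + (1 - a * b * z1) * W z"
      proof -
        have "c * (p * v + r * v') + d * (p * u + r * u') = p * (c * v + d * u) + r * (c * v' + d * u')"
          for c d p r v v' u u' :: complex by (simp add: algebra_simps)
        then show ?thesis unfolding Va Vb' W_def .
      qed
      finally have "z1 * W (z1 / Q) = (- 1 + (a + b) * z1) * W z1 + (1 - a * b * z1) * W z" .
      moreover have "z1 * transform a b (z1 / Q) = (- 1 + (a + b) * z1) * transform a b z1 + (1 - a * b * z1) * transform a b z"
        using transform_difference_equation[OF z1(1) ab] z1(3) by simp
      ultimately have "(1 - a * b * z1) * transform a b z = (1 - a * b * z1) * W z"
        unfolding t1 t2 by simp
      moreover have "1 - a * b * z1 \<noteq> 0"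
      proof
        assume "1 - a * b * z1 = 0"
        then have "x = 1" using x1(3) by simp
        then show False using xp one_pole by simp
      qed
      ultimately show ?thesis by simp
    qed
  qed
  obtain N where "norm (Q / (a * b * z)) < (1 / q) ^ N" using real_arch_pow[of "1 / q"] q0 q1 by auto
  then have "transform a b z = W z" by (intro claim[OF z pole, of N]) (simp add: power_divide)
  then show ?thesis unfolding W_def Vb unfolding V_def by (simp only: mult.assoc)
qed

end

lemma integrable_count_space_infsum:
  fixes f :: "'a \<Rightarrow> 'b::{banach,second_countable_topology}"
  assumes "integrable (count_space UNIV) f"
  shows "(\<integral>x. f x \<partial>count_space UNIV) = infsum f UNIV"
proof -
  have "Infinite_Set_Sum.abs_summable_on f UNIV" using assms by (simp add: Infinite_Set_Sum.abs_summable_on_def)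
  from infsetsum_infsum[OF this] show ?thesis by (simp add: infsetsum_def)
qed

lemma exp_minus_abs_le: "exp (- \<bar>s\<bar>) \<le> 2 * inverse (1 + s\<^sup>2)" for s :: real
proof -
  have "1 + \<bar>s\<bar> + \<bar>s\<bar>\<^sup>2 / 2 \<le> exp \<bar>s\<bar>" by (rule exp_lower_Taylor_quadratic) simp
  then have "(1 + s\<^sup>2) / 2 \<le> exp \<bar>s\<bar>" by simp
  then have "inverse (exp \<bar>s\<bar>) \<le> inverse ((1 + s\<^sup>2) / 2)"
    by (intro le_imp_inverse_le) (auto intro!: divide_pos_pos add_pos_nonneg)
  moreover have "inverse ((1 + s\<^sup>2) / 2) = 2 * inverse (1 + s\<^sup>2)" unfolding inverse_divide by (rule divide_inverse)
  ultimately show ?thesis by (simp add: exp_minus)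
qed

lemma integrable_exp_minus_abs: "integrable lborel (\<lambda>s::real. exp (- \<bar>s\<bar>))"
proof (rule Bochner_Integration.integrable_bound)
  have "set_integrable lborel (einterval (-\<infinity>) \<infinity>) (\<lambda>x. inverse (1 + x^2))"
    by (rule integrable_inverse_1_plus_square)
  then have "integrable lborel (\<lambda>x::real. inverse (1 + x^2))"
    unfolding set_integrable_def by (simp add: einterval_def)
  then show "integrable lborel (\<lambda>x::real. 2 * inverse (1 + x^2))" by simp
  have "norm (exp (- \<bar>s\<bar>)) \<le> norm (2 * inverse (1 + s\<^sup>2))" for s :: real
    unfolding real_norm_def abs_exp_cancel by (rule order.trans[OF exp_minus_abs_le abs_ge_self])
  then show "AE s::real in lborel. norm (exp (- \<bar>s\<bar>)) \<le> norm (2 * inverse (1 + s\<^sup>2))"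
    by simp
qed simp

context qbase
begin

lemma theta_q_powi_shift:
  assumes "t \<noteq> 0"
  shows "th (Q powi n * t) = th t / (of_real (qtri n) * t powi n)"
proof (induction n rule: int_induct[where k=0])
  case (step1 i)
  have "th (Q powi (i + 1) * t) = th (Q * (Q powi i * t))" by (simp add: power_int_add mult_ac)
  also have "\<dots> = th (Q powi i * t) / (Q powi i * t)" using assms by (intro theta_q_shift) simp
  finally show ?case unfolding step1.IH using qtri_Suc[of i] assms
    by (simp add: power_int_add add.commute of_real_power_int mult_ac)
next
  case (step2 i)
  have "th (Q powi i * t) = th (Q * (Q powi (i - 1) * t))" by (simp add: power_int_diff)
  also have "\<dots> = th (Q powi (i - 1) * t) / (Q powi (i - 1) * t)" using assms by (intro theta_q_shift) simp
  finally have "th (Q powi (i - 1) * t) = th (Q powi i * t) * (Q powi (i - 1) * t)" using assms by simp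
  moreover have "qtri i = qtri (i - 1) * q powi (i - 1)" using qtri_Suc[of "i - 1"] by simp
  moreover have "t powi i = t powi (i - 1) * t" using assms by (simp add: power_int_diff)
  ultimately show ?case unfolding step2.IH using assms by (simp add: of_real_power_int)
qed simp

lemma theta_ratio_powi_shift:
  assumes "a \<noteq> 0" "t \<noteq> 0"
  shows "th (a * (Q powi n * t)) / th (Q powi n * t) = th (a * t) / th t / a powi n"
proof -
  have "th (a * (Q powi n * t)) = th (a * t) / (of_real (qtri n) * (a * t) powi n)"
    using theta_q_powi_shift[of "a * t" n] assms by (simp add: mult_ac)
  then show ?thesis unfolding theta_q_powi_shift[OF assms(2)] using assms
    by (simp add: power_int_mult_distrib)
qed

section \<open>The geometric progression\<close>

context
  fixes l :: complex
  assumes l0: "l \<noteq> 0" and l_ok: "\<And>n::int. l \<noteq> - (Q powi n)"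
begin

definition progression :: "complex set" where "progression = range (\<lambda>n::int. Q powi n * l)"
text \<open>Counting measure on the exponents, carried over to the progression.\<close>
definition prog_measure :: "complex measure" where
  "prog_measure = distr (count_space UNIV) borel (\<lambda>n::int. Q powi n * l)"

lemma prog_finite:
  assumes "0 < r" shows "finite (progression \<inter> {t. r \<le> norm t \<and> norm t \<le> R})"
proof -
  have nl: "norm l > 0" using l0 by simp
  obtain m where m: "q ^ m < r / norm l" using real_arch_pow_inv[of "r / norm l" q] assms nl q1 by auto
  obtain k where k: "R / norm l < (1 / q) ^ k" using real_arch_pow[of "1 / q" "R / norm l"] q0 q1 by auto
  have "progression \<inter> {t. r \<le> norm t \<and> norm t \<le> R} \<subseteq> (\<lambda>n. Q powi n * l) ` {- int k..int m}"
  proof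
    fix t assume t: "t \<in> progression \<inter> {t. r \<le> norm t \<and> norm t \<le> R}"
    then obtain n where tn: "t = Q powi n * l" unfolding progression_def by blast
    with t have n: "t = Q powi n * l" "r \<le> q powi n * norm l" "q powi n * norm l \<le> R"
      by (auto simp: norm_mult norm_power_int)
    have "n \<le> int m"
    proof (rule ccontr)
      assume "\<not> n \<le> int m"
      then have "q ^ nat n \<le> q ^ m" "n \<ge> 0" using q0 q1 by (auto intro!: power_decreasing)
      then have "q powi n < r / norm l" using m by (simp add: powi_nonneg)
      then show False using n(2) nl by (simp add: pos_less_divide_eq)
    qed
    moreover have "- int k \<le> n"
    proof (rule ccontr)
      assume a: "\<not> - int k \<le> n"
      then have "(1 / q) ^ k \<le> (1 / q) ^ nat (- n)" using q0 q1 by (intro power_increasing) auto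
      moreover have "q powi n = (1 / q) ^ nat (- n)" using a by (simp add: power_int_def inverse_eq_divide power_divide)
      ultimately have "R / norm l < q powi n" using k by simp
      then show False using n(3) nl by (simp add: pos_divide_less_eq)
    qed
    ultimately show "t \<in> (\<lambda>n. Q powi n * l) ` {- int k..int m}" using n(1) by auto
  qed
  then show ?thesis by (rule finite_subset) simp
qed

lemma prog_integrable_iff:
  fixes f :: "complex \<Rightarrow> 'b::{banach,second_countable_topology}"
  assumes "(\<lambda>t. indicator progression t *\<^sub>R f t) \<in> borel_measurable borel"
  shows "set_integrable prog_measure progression f \<longleftrightarrow> integrable (count_space UNIV) (\<lambda>n::int. f (Q powi n * l))"
    and "(LINT t:progression|prog_measure. f t) = (\<integral>n. f (Q powi n * l) \<partial>count_space (UNIV::int set))"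
proof -
  have ind: "(indicator progression (Q powi n * l) :: real) = 1" for n
    unfolding progression_def by (rule indicator_simps(1), rule rangeI)
  have "(\<lambda>n::int. Q powi n * l) \<in> measurable (count_space UNIV) borel" by simp
  from integrable_distr_eq[OF this assms] integral_distr[OF this assms]
  show "set_integrable prog_measure progression f \<longleftrightarrow> integrable (count_space UNIV) (\<lambda>n::int. f (Q powi n * l))"
    and "(LINT t:progression|prog_measure. f t) = (\<integral>n. f (Q powi n * l) \<partial>count_space (UNIV::int set))"
    unfolding set_integrable_def set_lebesgue_integral_def prog_measure_def by (simp_all add: ind)
qed

lemma prog_borel: "progression \<in> sets borel"
  unfolding progression_def by (rule sets.countable) auto

lemma qmeasure_progression: "qmeasure q progression prog_measure"
proof
  show "0 \<notin> progression" using l0 by (auto simp: progression_def)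
  show "Q * t \<in> progression" "t / Q \<in> progression" if t: "t \<in> progression" for t
  proof -
    obtain n where n: "t = Q powi n * l" using t unfolding progression_def by blast
    have "Q * t = Q powi (n + 1) * l" "t / Q = Q powi (n - 1) * l" by (simp_all add: n power_int_add power_int_diff)
    then show "Q * t \<in> progression" "t / Q \<in> progression" unfolding progression_def by blast+
  qed
  show "th t \<noteq> 0" if t: "t \<in> progression" for t
  proof -
    obtain n where n: "t = Q powi n * l" using t unfolding progression_def by blast
    have "th l \<noteq> 0" using theta_q_eq_0_iff[OF l0] l_ok by auto
    then show ?thesis unfolding n theta_q_powi_shift[OF l0] using l0 by simp
  qed
  show "compact (progression \<inter> {t. r \<le> norm t \<and> norm t \<le> R})" if "0 < r" for r R
    using prog_finite[OF that] by (rule finite_imp_compact)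
  show "sets prog_measure = sets borel" by (simp add: prog_measure_def)
  show "progression \<in> sets borel" by (rule prog_borel)
  have bij: "bij (\<lambda>n::int. n + 1)" by (rule bij_betw_byWitness[of _ "\<lambda>n. n - 1"]) auto
  have "distr prog_measure borel (\<lambda>t. Q * t) = distr (count_space UNIV) borel ((\<lambda>t. Q * t) \<circ> (\<lambda>n::int. Q powi n * l))"
    unfolding prog_measure_def
    by (rule distr_distr) (auto intro!: borel_measurable_continuous_onI continuous_intros)
  also have "(\<lambda>t. Q * t) \<circ> (\<lambda>n::int. Q powi n * l) = (\<lambda>n. Q powi n * l) \<circ> (\<lambda>n. n + 1)"
    by (auto simp: power_int_add)
  also have "distr (count_space UNIV) borel ((\<lambda>n::int. Q powi n * l) \<circ> (\<lambda>n. n + 1))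
      = distr (distr (count_space UNIV) (count_space UNIV) (\<lambda>n::int. n + 1)) borel (\<lambda>n. Q powi n * l)"
    by (rule distr_distr[symmetric]) auto
  also have "\<dots> = prog_measure" unfolding prog_measure_def distr_bij_count_space[OF bij] ..
  finally show "distr prog_measure borel (\<lambda>t. Q * t) = prog_measure" .
  have meas: "(\<lambda>t. indicator progression t *\<^sub>R min (norm t) (1 / norm t)) \<in> borel_measurable borel"
    using prog_borel by measurable
  define K where "K = norm l + 1 / norm l"
  have K: "norm l \<le> K" "1 / norm l \<le> K" by (auto simp: K_def)
  have "(\<lambda>n::int. norm (min (norm (Q powi n * l)) (1 / norm (Q powi n * l)))) summable_on UNIV"
  proof (rule Infinite_Sum.abs_summable_on_comparison_test')
    show "(\<lambda>n::int. K * q ^ nat \<bar>n\<bar>) summable_on UNIV"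
      by (rule summable_on_cmult_right[OF summable_on_geometric_int]) (use q0 q1 in auto)
    fix n :: int
    show "norm (min (norm (Q powi n * l)) (1 / norm (Q powi n * l))) \<le> K * q ^ nat \<bar>n\<bar>"
    proof (cases "n \<ge> 0")
      case True
      have "min (norm (Q powi n * l)) (1 / norm (Q powi n * l)) \<le> norm (Q powi n * l)" by simp
      also have "\<dots> = norm l * q ^ nat \<bar>n\<bar>" using True by (simp add: norm_mult powi_nonneg norm_power)
      also have "\<dots> \<le> K * q ^ nat \<bar>n\<bar>" using K q0 by (intro mult_right_mono) auto
      finally show ?thesis by simp
    next
      case False
      have "min (norm (Q powi n * l)) (1 / norm (Q powi n * l)) \<le> 1 / norm (Q powi n * l)" by simp
      also have "\<dots> = 1 / norm l * q ^ nat \<bar>n\<bar>" using False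
        by (simp add: norm_mult norm_power_int power_int_def divide_inverse power_inverse norm_inverse norm_power)
      also have "\<dots> \<le> K * q ^ nat \<bar>n\<bar>" using K q0 by (intro mult_right_mono) auto
      finally show ?thesis by simp
    qed
  qed
  then show "set_integrable prog_measure progression (\<lambda>t. min (norm t) (1 / norm t))"
    unfolding prog_integrable_iff(1)[OF meas] by (rule norm_summable_integrable_count_space)
qed

definition prog_domain :: "complex set" where
  "prog_domain = {z. z \<noteq> 0 \<and> (\<forall>n::int. z \<noteq> - (Q powi n) * l)}"

lemma qkernel_progression: "qkernel q progression prog_measure (\<lambda>z t. 1 / th (t / z)) prog_domain"
proof -
  interpret qmeasure q progression prog_measure by (rule qmeasure_progression)
  have nz: "th (t / z) \<noteq> 0" if z: "z \<in> prog_domain" and t: "t \<in> progression" for z t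
  proof
    assume 0: "th (t / z) = 0"
    obtain n where n: "t = Q powi n * l" using t unfolding progression_def by blast
    have zn: "z \<noteq> 0" using z by (simp add: prog_domain_def)
    then have "t / z \<noteq> 0" using n l0 by simp
    then obtain m :: int where "t / z = - (Q powi m)" using 0 theta_q_eq_0_iff by blast
    then have "z = - (Q powi (n - m)) * l" using zn by (simp add: n power_int_diff divide_simps) (simp add: mult_ac)?
    then show False using z by (auto simp: prog_domain_def)
  qed
  show ?thesis
  proof
    fix z assume z: "z \<in> prog_domain"
    then have zn: "z \<noteq> 0" by (simp add: prog_domain_def)
    show "weight z (\<lambda>t. 1 / th (t / z))"
      unfolding weight_def
    proof (intro conjI ballI)
      show "continuous_on progression (\<lambda>t. 1 / th (t / z))"
        using nz[OF z] X_nz zn by (intro continuous_intros) auto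
      fix t assume "t \<in> progression"
      then show "1 / th (Q * t / z) = t / z * (1 / th (t / z))"
        using theta_q_shift[of "t / z"] X_nz zn by simp
    qed (rule zn)
    show "Q * z \<in> prog_domain" "z / Q \<in> prog_domain"
    proof -
      have "Q * z \<noteq> - (Q powi n) * l" "z / Q \<noteq> - (Q powi n) * l" for n
      proof -
        have "z \<noteq> - (Q powi (n - 1)) * l" "z \<noteq> - (Q powi (n + 1)) * l" using z by (auto simp: prog_domain_def)
        then show "Q * z \<noteq> - (Q powi n) * l" "z / Q \<noteq> - (Q powi n) * l"
          by (auto simp: power_int_diff power_int_add divide_simps mult_ac)
      qed
      then show "Q * z \<in> prog_domain" "z / Q \<in> prog_domain" using zn by (auto simp: prog_domain_def)
    qed
  qed simp
qed

text \<open>All factors of the summand scale explicitly under \<open>l \<mapsto> Q powi n * l\<close>, and what is left to sum is the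
  series of \<open>th (l / (a * z))\<close>.\<close>
lemma prog_moment:
  assumes a: "a \<noteq> 0" and z: "z \<in> prog_domain"
  shows "qkernel.moment q progression prog_measure (\<lambda>z t. 1 / th (t / z)) a z
    = th (a * l) * th (l / (a * z)) / (th l * th (l / z))"
proof -
  interpret qkernel q progression prog_measure "\<lambda>z t. 1 / th (t / z)" prog_domain by (rule qkernel_progression)
  have zn: "z \<noteq> 0" using Z_nz[OF z] .
  have "(\<lambda>t. indicator progression t *\<^sub>R (th (a * t) / th t * (1 / th (t / z)))) \<in> borel_measurable borel"
    using weight_theta[OF weight_w[OF z] a] by (intro set_measurable_borel) (simp add: weight_def)
  then have "moment a z = (\<integral>n. th (a * (Q powi n * l)) / th (Q powi n * l) * (1 / th (Q powi n * l / z)) \<partial>count_space (UNIV::int set))"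
    unfolding moment_def by (rule prog_integrable_iff(2))
  also have "\<dots> = (\<integral>n. th (a * l) / (th l * th (l / z)) * (of_real (qtri n) * (l / (a * z)) powi n) \<partial>count_space (UNIV::int set))"
  proof (intro Bochner_Integration.integral_cong refl)
    fix n :: int
    have "th (Q powi n * l / z) = th (l / z) / (of_real (qtri n) * (l / z) powi n)"
      using theta_q_powi_shift[of "l / z" n] l0 zn by simp
    then show "th (a * (Q powi n * l)) / th (Q powi n * l) * (1 / th (Q powi n * l / z)) = th (a * l) / (th l * th (l / z)) * (of_real (qtri n) * (l / (a * z)) powi n)"
      unfolding theta_ratio_powi_shift[OF a l0] using a by (simp add: power_int_divide_distrib power_int_mult_distrib)
  qed
  also have "\<dots> = th (a * l) / (th l * th (l / z)) * (\<Sum>\<^sub>\<infinity>n. of_real (qtri n) * (l / (a * z)) powi n)"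
  proof -
    have "(\<integral>n. of_real (qtri n) * (l / (a * z)) powi n \<partial>count_space (UNIV::int set)) = (\<Sum>\<^sub>\<infinity>n. of_real (qtri n) * (l / (a * z)) powi n)"
      using a l0 zn by (intro norm_summable_integrable_count_space(2) norm_qtri_powi_summable) simp
    then show ?thesis by (simp only: Bochner_Integration.integral_mult_right_zero)
  qed
  also have "(\<Sum>\<^sub>\<infinity>n. of_real (qtri n) * (l / (a * z)) powi n) = th (l / (a * z))"
    using theta_q_series[of "l / (a * z)"] a l0 zn by (intro infsumI) simp
  finally show ?thesis by simp
qed

lemma prog_transform:
  assumes z: "z \<in> prog_domain" and ab: "generic a b"
  shows "qkernel.transform q progression prog_measure (\<lambda>z t. 1 / th (t / z)) a b z
    = (\<Sum>\<^sub>\<infinity>n\<in>(UNIV::int set). phi21 q a b 0 (- (Q powi n) * l) / th (Q powi n * l / z))"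
proof -
  interpret qkernel q progression prog_measure "\<lambda>z t. 1 / th (t / z)" prog_domain by (rule qkernel_progression)
  have "continuous_on progression (\<lambda>t. phi21 q a b 0 (- t) * (1 / th (t / z)))"
    using weight_w[OF z] by (intro continuous_on_mult phi21_continuous_on_X) (simp add: weight_def)
  from set_measurable_borel[OF this] have meas: "(\<lambda>t. indicator progression t *\<^sub>R (phi21 q a b 0 (- t) * (1 / th (t / z)))) \<in> borel_measurable borel" .
  have "integrable (count_space UNIV) (\<lambda>n::int. phi21 q a b 0 (- (Q powi n * l)) * (1 / th (Q powi n * l / z)))"
    using phi21_weight_integrable[OF ab weight_w[OF z]] unfolding prog_integrable_iff(1)[OF meas] .
  from integrable_count_space_infsum[OF this] show ?thesis
    unfolding transform_def prog_integrable_iff(2)[OF meas] by simp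
qed

end

section \<open>The positive half line\<close>

definition pos_line :: "complex set" where "pos_line = complex_of_real ` {0<..}"
text \<open>The image of Lebesgue measure under \<open>exp\<close> is the measure \<open>dt / t\<close>, which is invariant under
  dilations.\<close>
definition pos_measure :: "complex measure" where
  "pos_measure = distr lborel borel (\<lambda>s. complex_of_real (exp s))"

lemma pos_line_borel: "pos_line \<in> sets borel"
proof -
  have "pos_line = {t. Im t = 0} \<inter> {t. Re t > 0}"
    by (auto simp: pos_line_def complex_eq_iff image_iff)
  moreover have "{t. Im t = 0} \<in> sets borel" by (intro borel_closed closed_Collect_eq continuous_intros)
  moreover have "{t. Re t > 0} \<in> sets borel" by (intro borel_open open_Collect_less continuous_intros)
  ultimately show ?thesis by (metis sets.Int)
qed

lemma exp_measurable: "(\<lambda>s. complex_of_real (exp s)) \<in> measurable lborel borel"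
  by (simp add: borel_measurable_continuous_onI continuous_on_of_real continuous_on_exp)

lemma pos_integral:
  fixes f :: "complex \<Rightarrow> 'b::{banach,second_countable_topology}"
  assumes "continuous_on pos_line f"
  shows "set_integrable pos_measure pos_line f \<longleftrightarrow> integrable lborel (\<lambda>s. f (of_real (exp s)))"
    and "(LINT t:pos_line|pos_measure. f t) = (\<integral>s. f (of_real (exp s)) \<partial>lborel)"
proof -
  have "(\<lambda>t. indicator pos_line t *\<^sub>R f t) \<in> borel_measurable borel"
    by (rule borel_measurable_continuous_on_indicator[OF pos_line_borel assms])
  moreover have "complex_of_real (exp s) \<in> pos_line" for s by (auto simp: pos_line_def)
  ultimately show "set_integrable pos_measure pos_line f \<longleftrightarrow> integrable lborel (\<lambda>s. f (of_real (exp s)))"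
    and "(LINT t:pos_line|pos_measure. f t) = (\<integral>s. f (of_real (exp s)) \<partial>lborel)"
    using integrable_distr_eq[OF exp_measurable, of "\<lambda>t. indicator pos_line t *\<^sub>R f t"]
      integral_distr[OF exp_measurable, of "\<lambda>t. indicator pos_line t *\<^sub>R f t"]
    unfolding set_integrable_def set_lebesgue_integral_def pos_measure_def by simp_all
qed

lemma pos_not_minus_power: "t > 0 \<Longrightarrow> complex_of_real t \<noteq> - (Q powi n)"
proof
  assume t: "t > 0" and "complex_of_real t = - (Q powi n)"
  then have "complex_of_real t = of_real (- (q powi n))" by (simp add: of_real_power_int)
  then have "t = - (q powi n)" by (simp only: of_real_eq_iff)
  then show False using t q0 zero_less_power_int[of q n] by linarith
qed

lemma qmeasure_pos: "qmeasure q pos_line pos_measure"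
proof
  show "0 \<notin> pos_line" by (auto simp: pos_line_def)
  show "Q * t \<in> pos_line" "t / Q \<in> pos_line" if "t \<in> pos_line" for t
    using that q0 by (auto simp: pos_line_def simp flip: of_real_mult of_real_divide)
  show "th t \<noteq> 0" if t: "t \<in> pos_line" for t
  proof
    assume "th t = 0"
    moreover obtain r where "r > 0" "t = of_real r" using t by (auto simp: pos_line_def)
    ultimately show False using theta_q_eq_0_iff[of t] pos_not_minus_power[of r] by auto
  qed
  show "compact (pos_line \<inter> {t. r \<le> norm t \<and> norm t \<le> R})" if "0 < r" for r R
  proof -
    have "pos_line \<inter> {t. r \<le> norm t \<and> norm t \<le> R} = of_real ` {r..R}" using that by (auto simp: pos_line_def)
    then show ?thesis by (simp add: compact_continuous_image continuous_on_of_real)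
  qed
  show "sets pos_measure = sets borel" by (simp add: pos_measure_def)
  show "pos_line \<in> sets borel" by (rule pos_line_borel)
  have "distr pos_measure borel (\<lambda>t. Q * t) = distr lborel borel ((\<lambda>t. Q * t) \<circ> (\<lambda>s. complex_of_real (exp s)))"
    unfolding pos_measure_def
    by (rule distr_distr[OF _ exp_measurable]) (auto intro!: borel_measurable_continuous_onI continuous_intros)
  also have "(\<lambda>t. Q * t) \<circ> (\<lambda>s. complex_of_real (exp s)) = (\<lambda>s. complex_of_real (exp s)) \<circ> (+) (ln q)"
    using q0 by (auto simp: exp_add)
  also have "distr lborel borel ((\<lambda>s. complex_of_real (exp s)) \<circ> (+) (ln q)) = distr (distr lborel borel ((+) (ln q))) borel (\<lambda>s. complex_of_real (exp s))"
    by (rule distr_distr[symmetric]) (use exp_measurable in auto)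
  also have "\<dots> = pos_measure" unfolding pos_measure_def lborel_distr_plus ..
  finally show "distr pos_measure borel (\<lambda>t. Q * t) = pos_measure" .
  have cont: "continuous_on pos_line (\<lambda>t. min (norm t) (1 / norm t))"
    by (intro continuous_intros) (auto simp: pos_line_def)
  have "min (norm (complex_of_real (exp s))) (1 / norm (complex_of_real (exp s))) = exp (- \<bar>s\<bar>)" for s :: real
  proof -
    have "min (exp s) (exp (- s)) = exp (- \<bar>s\<bar>)" by (cases "s \<ge> 0") (auto simp: min_def)
    then show ?thesis by (simp add: exp_minus divide_inverse)
  qed
  then show "set_integrable pos_measure pos_line (\<lambda>t. min (norm t) (1 / norm t))"
    unfolding pos_integral(1)[OF cont] using integrable_exp_minus_abs by simp
qed

text \<open>Substitution \<open>t = exp s\<close>.\<close>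
lemma half_line_integral:
  fixes f :: "complex \<Rightarrow> complex"
  assumes cont: "continuous_on pos_line f" and int: "set_integrable pos_measure pos_line f"
  shows "(LINT t:{0<..}|lborel. f (of_real t) / of_real t) = (LINT t:pos_line|pos_measure. f t)"
proof -
  have fi: "integrable lborel (\<lambda>s. f (of_real (exp s)))" using int unfolding pos_integral(1)[OF cont] .
  have fc: "continuous_on {0<..} (\<lambda>t. f (complex_of_real t))"
    by (rule continuous_on_compose2[OF cont]) (auto simp: pos_line_def intro!: continuous_intros)
  have fc': "continuous_on {0<..} (\<lambda>t. f (complex_of_real t) / of_real t)"
    by (intro continuous_intros fc) auto
  have at: "isCont (\<lambda>t. f (complex_of_real t) / of_real t) (exp x)" for x :: real
    using fc' by (simp add: continuous_on_eq_continuous_at)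
  have lim0: "((ereal \<circ> exp \<circ> real_of_ereal) \<longlongrightarrow> 0) (at_right (-\<infinity>))"
    unfolding zero_ereal_def by (simp add: ereal_tendsto_simps exp_at_bot)
  have lim1: "((ereal \<circ> exp \<circ> real_of_ereal) \<longlongrightarrow> \<infinity>) (at_left \<infinity>)"
    by (simp add: ereal_tendsto_simps exp_at_top)
  have "set_integrable lborel (einterval 0 \<infinity>) (\<lambda>t. norm (f (complex_of_real t) / of_real t))"
  proof (rule interval_integral_substitution_nonneg(1)[where g=exp and g'=exp and a="-\<infinity>" and b=\<infinity>, OF _ _ _ _ _ _ lim0 lim1])
    show "isCont (\<lambda>t. norm (f (complex_of_real t) / of_real t)) (exp x)" for x :: real
      by (intro continuous_norm at)
    have "integrable lborel (\<lambda>s. norm (f (of_real (exp s))))" using fi by simp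
    then show "set_integrable lborel (einterval (-\<infinity>) \<infinity>) (\<lambda>x. norm (f (complex_of_real (exp x)) / of_real (exp x)) * exp x)"
      by (simp add: set_integrable_def einterval_def norm_divide)
  qed auto
  then have ni: "set_integrable lborel (einterval 0 \<infinity>) (\<lambda>t. f (complex_of_real t) / of_real t)"
  proof (rule set_integrable_bound)
    have "einterval 0 \<infinity> = {0<..}" by (auto simp: einterval_def zero_ereal_def)
    then show "set_borel_measurable lborel (einterval 0 \<infinity>) (\<lambda>t. f (complex_of_real t) / of_real t)"
      using borel_measurable_continuous_on_indicator[OF _ fc'] by (simp add: set_borel_measurable_def)
  qed simp
  have "(LBINT t=0..\<infinity>. f (complex_of_real t) / of_real t) = (LBINT s=-\<infinity>..\<infinity>. exp s *\<^sub>R (f (complex_of_real (exp s)) / of_real (exp s)))"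
  proof (rule interval_integral_substitution_integrable[where g=exp and g'=exp, OF _ _ _ _ _ lim0 lim1 _ ni])
    show "isCont (\<lambda>t. f (complex_of_real t) / of_real t) (exp x)" for x :: real by (rule at)
    show "set_integrable lborel (einterval (-\<infinity>) \<infinity>) (\<lambda>s. exp s *\<^sub>R (f (complex_of_real (exp s)) / of_real (exp s)))"
      using fi by (simp add: set_integrable_def einterval_def scaleR_conv_of_real)
  qed auto
  moreover have "(LBINT t=0..\<infinity>. f (complex_of_real t) / of_real t) = (LINT t:{0<..}|lborel. f (complex_of_real t) / of_real t)"
    by (simp add: zero_ereal_def interval_integral_to_infinity_eq)
  moreover have "(LBINT s=-\<infinity>..\<infinity>. exp s *\<^sub>R (f (complex_of_real (exp s)) / of_real (exp s))) = (\<integral>s. f (of_real (exp s)) \<partial>lborel)"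
    by (simp add: interval_lebesgue_integral_def einterval_def set_lebesgue_integral_def scaleR_conv_of_real)
  ultimately show ?thesis unfolding pos_integral(2)[OF cont] by simp
qed

end

section \<open>Folding an integral onto one period\<close>

lemma integral_int_sum:
  fixes f :: "int \<Rightarrow> real \<Rightarrow> complex"
  assumes ab: "a \<le> b" and cont: "\<And>n. continuous_on {a..b} (f n)"
    and bound: "\<And>n s. s \<in> {a..b} \<Longrightarrow> norm (f n s) \<le> w n" and w: "w summable_on UNIV"
  shows "((\<lambda>n. integral {a..b} (f n)) has_sum integral {a..b} (\<lambda>s. \<Sum>\<^sub>\<infinity>n. f n s)) UNIV"
proof -
  define S where "S = (\<lambda>s. \<Sum>\<^sub>\<infinity>n. f n s)"
  have w0: "w n \<ge> 0" for n using order.trans[OF norm_ge_zero bound[of a n]] ab by simp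
  have fs: "(\<lambda>n. f n s) summable_on UNIV" if "s \<in> {a..b}" for s
    by (rule abs_summable_summable[OF Infinite_Sum.abs_summable_on_comparison_test'[OF w]]) (use bound that in auto)
  have set_int: "set_integrable lborel {a..b} g" if "continuous_on {a..b} g" for g :: "real \<Rightarrow> complex"
    using borel_integrable_atLeastAtMost'[OF that] by simp
  have leb: "integral {a..b} g = (LINT s:{a..b}|lborel. g s)" if "continuous_on {a..b} g" for g :: "real \<Rightarrow> complex"
    using set_borel_integral_eq_integral(2)[OF set_int[OF that]] by simp
  have In: "norm (integral {a..b} (f n)) \<le> (b - a) * w n" for n
    using integral_bound[OF ab cont[of n] bound[of _ n]] by (simp add: mult.commute)
  have Is: "(\<lambda>n. integral {a..b} (f n)) summable_on UNIV"
    by (rule abs_summable_summable[OF Infinite_Sum.abs_summable_on_comparison_test'[OF _ In]])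
       (intro summable_on_cmult_right w)
  have csum: "continuous_on {a..b} (\<lambda>s. \<Sum>n\<in>{- int N..int N}. f n s)" for N by (intro continuous_on_sum cont)
  have Sc: "continuous_on {a..b} S"
  proof (rule uniform_limit_theorem)
    show "uniform_limit {a..b} (\<lambda>N s. \<Sum>n\<in>{- int N..int N}. f n s) S sequentially"
    proof (rule uniform_limitI)
      fix e :: real assume e: "e > 0"
      have "\<forall>\<^sub>F N in sequentially. dist (\<Sum>n\<in>{- int N..int N}. w n) (infsum w UNIV) < e"
        using tendstoD[OF infsum_int_limit[OF w] e] .
      then show "\<forall>\<^sub>F N in sequentially. \<forall>s\<in>{a..b}. dist (\<Sum>n\<in>{- int N..int N}. f n s) (S s) < e"
      proof eventually_elim
        case (elim N)
        show ?case
        proof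
          fix s assume s: "s \<in> {a..b}"
          let ?A = "{- int N..int N}"
          have sA: "(\<lambda>n. f n s) summable_on UNIV - ?A" "w summable_on UNIV - ?A"
            using summable_on_subset_banach[OF fs[OF s]] summable_on_subset_banach[OF w] by auto
          have "S s = (\<Sum>n\<in>?A. f n s) + infsum (\<lambda>n. f n s) (UNIV - ?A)"
            unfolding S_def using infsum_Un_disjoint[of "\<lambda>n. f n s" ?A "UNIV - ?A"] sA by simp
          moreover have "infsum w UNIV = (\<Sum>n\<in>?A. w n) + infsum w (UNIV - ?A)"
            using infsum_Un_disjoint[of w ?A "UNIV - ?A"] sA by simp
          moreover have "norm (infsum (\<lambda>n. f n s) (UNIV - ?A)) \<le> infsum w (UNIV - ?A)"
            using norm_infsum_le[OF has_sum_infsum[OF sA(1)] has_sum_infsum[OF sA(2)]] bound s by blast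
          ultimately show "dist (\<Sum>n\<in>?A. f n s) (S s) < e" using elim by (simp add: dist_norm)
        qed
      qed
    qed
  qed (use csum in auto)
  have lim: "(\<lambda>N. LINT s:{a..b}|lborel. (\<Sum>n\<in>{- int N..int N}. f n s)) \<longlonglongrightarrow> (LINT s:{a..b}|lborel. S s)"
    unfolding set_lebesgue_integral_def
  proof (rule integral_dominated_convergence)
    show "(\<lambda>s. indicator {a..b} s *\<^sub>R S s) \<in> borel_measurable lborel"
      using borel_measurable_continuous_on_indicator[OF _ Sc] by simp
    show "(\<lambda>s. indicator {a..b} s *\<^sub>R (\<Sum>n\<in>{- int N..int N}. f n s)) \<in> borel_measurable lborel" for N
      using borel_measurable_continuous_on_indicator[OF _ csum] by simp
    show "integrable lborel (\<lambda>s. indicator {a..b} s * infsum w UNIV)"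
      using borel_integrable_atLeastAtMost'[of a b "\<lambda>_. infsum w UNIV"] by (simp add: set_integrable_def)
    show "AE s in lborel. (\<lambda>N. indicator {a..b} s *\<^sub>R (\<Sum>n\<in>{- int N..int N}. f n s)) \<longlonglongrightarrow> indicator {a..b} s *\<^sub>R S s"
      using infsum_int_limit[OF fs] by (intro AE_I2) (auto simp: indicator_def S_def intro!: tendsto_scaleR)
    show "AE s in lborel. norm (indicator {a..b} s *\<^sub>R (\<Sum>n\<in>{- int N..int N}. f n s)) \<le> indicator {a..b} s * infsum w UNIV" for N
    proof (intro AE_I2)
      fix s
      have "norm (\<Sum>n\<in>{- int N..int N}. f n s) \<le> infsum w UNIV" if "s \<in> {a..b}"
      proof -
        have "norm (\<Sum>n\<in>{- int N..int N}. f n s) \<le> (\<Sum>n\<in>{- int N..int N}. w n)"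
          by (intro sum_norm_le bound that)
        also have "\<dots> \<le> infsum w UNIV" by (rule finite_sum_le_infsum[OF w]) (use w0 in auto)
        finally show ?thesis .
      qed
      then show "norm (indicator {a..b} s *\<^sub>R (\<Sum>n\<in>{- int N..int N}. f n s)) \<le> indicator {a..b} s * infsum w UNIV"
        by (auto simp: indicator_def)
    qed
  qed
  have "(LINT s:{a..b}|lborel. (\<Sum>n\<in>{- int N..int N}. f n s)) = (\<Sum>n\<in>{- int N..int N}. integral {a..b} (f n))" for N
    unfolding leb[OF csum, symmetric] by (intro integral_sum integrable_continuous_real cont) simp
  with lim have "(\<lambda>N. \<Sum>n\<in>{- int N..int N}. integral {a..b} (f n)) \<longlonglongrightarrow> integral {a..b} S"
    unfolding leb[OF Sc] by simp
  with infsum_int_limit[OF Is] have "infsum (\<lambda>n. integral {a..b} (f n)) UNIV = integral {a..b} S"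
    by (rule LIMSEQ_unique)
  then show ?thesis using has_sum_infsum[OF Is] by (simp add: S_def)
qed

text \<open>The integer translates of the interval tile the line, and the summable majorant allows to
  exchange sum and integral.\<close>
lemma integral_line_fold:
  fixes g :: "real \<Rightarrow> complex"
  assumes cont: "continuous_on UNIV g" and int: "integrable lborel g"
    and bound: "\<And>n s. s \<in> {x0..x0+1} \<Longrightarrow> norm (g (s + of_int n)) \<le> w n" and w: "w summable_on UNIV"
  shows "(\<integral>s. g s \<partial>lborel) = integral {x0..x0+1} (\<lambda>s. \<Sum>\<^sub>\<infinity>n::int. g (s + of_int n))"
proof -
  have cg: "continuous_on A g" for A by (rule continuous_on_subset[OF cont]) simp
  have ig: "g integrable_on {a..b}" for a b by (intro integrable_continuous_real cg)
  have hs: "((\<lambda>n. integral {x0..x0+1} (\<lambda>s. g (s + of_int n))) has_sum integral {x0..x0+1} (\<lambda>s. \<Sum>\<^sub>\<infinity>n. g (s + of_int n))) UNIV"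
    by (rule integral_int_sum[OF _ _ bound w]) (auto intro!: continuous_on_compose2[OF cont] continuous_intros)
  have shift: "integral {x0..x0+1} (\<lambda>s. g (s + of_int n)) = integral {x0 + of_int n..x0 + of_int n + 1} g" for n
    using integral_shift[where f=g and a=x0 and b="x0 + 1" and c="of_int n"] cg by (simp add: add_ac o_def)
  define I where "I = (\<lambda>n::int. integral {x0..x0+1} (\<lambda>s. g (s + of_int n)))"
  have partial: "(\<Sum>n\<in>{- int N..int N}. I n) = integral {x0 - real N..x0 + real N + 1} g" for N
  proof (induction N)
    case (Suc N)
    have "{- int (Suc N)..int (Suc N)} = insert (int (Suc N)) (insert (- int (Suc N)) {- int N..int N})" by auto
    then have "(\<Sum>n\<in>{- int (Suc N)..int (Suc N)}. I n) = I (int (Suc N)) + (I (- int (Suc N)) + (\<Sum>n\<in>{- int N..int N}. I n))"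
      by simp
    moreover have "I (int (Suc N)) = integral {x0 + real N + 1..x0 + real N + 2} g"
      unfolding I_def shift by (simp add: add_ac)
    moreover have "I (- int (Suc N)) = integral {x0 - real N - 1..x0 - real N} g"
      unfolding I_def shift by (simp add: algebra_simps)
    ultimately have "(\<Sum>n\<in>{- int (Suc N)..int (Suc N)}. I n)
       = integral {x0 + real N + 1..x0 + real N + 2} g + (integral {x0 - real N - 1..x0 - real N} g + integral {x0 - real N..x0 + real N + 1} g)"
      unfolding Suc.IH by simp
    also have "integral {x0 - real N - 1..x0 - real N} g + integral {x0 - real N..x0 + real N + 1} g = integral {x0 - real N - 1..x0 + real N + 1} g"
      by (rule Henstock_Kurzweil_Integration.integral_combine) (auto intro: ig)
    also have "integral {x0 + real N + 1..x0 + real N + 2} g + integral {x0 - real N - 1..x0 + real N + 1} g = integral {x0 - real N - 1..x0 + real N + 2} g"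
      using Henstock_Kurzweil_Integration.integral_combine[of "x0 - real N - 1" "x0 + real N + 1" "x0 + real N + 2" g] ig by (simp add: add.commute)
    finally show ?case by (simp add: algebra_simps)
  qed (simp add: I_def)
  have leb: "integral {a..b} g = (LINT s:{a..b}|lborel. g s)" for a b
    using set_borel_integral_eq_integral(2)[of "{a..b}" g] borel_integrable_atLeastAtMost'[OF cg] by simp
  have "(\<lambda>N. LINT s:{x0 - real N..x0 + real N + 1}|lborel. g s) \<longlonglongrightarrow> (\<integral>s. g s \<partial>lborel)"
    unfolding set_lebesgue_integral_def
  proof (rule integral_dominated_convergence[where w="\<lambda>s. norm (g s)"])
    show "AE s in lborel. (\<lambda>N. indicator {x0 - real N..x0 + real N + 1} s *\<^sub>R g s) \<longlonglongrightarrow> g s"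
    proof (intro AE_I2 tendsto_eventually)
      fix s
      show "\<forall>\<^sub>F N in sequentially. indicator {x0 - real N..x0 + real N + 1} s *\<^sub>R g s = g s"
        using eventually_ge_at_top[of "nat \<lceil>\<bar>s - x0\<bar>\<rceil>"]
      proof eventually_elim
        case (elim N)
        then have "\<bar>s - x0\<bar> \<le> real N" by (simp add: nat_ceiling_le_eq)
        then have "s \<in> {x0 - real N..x0 + real N + 1}" by (auto simp: abs_le_iff)
        then show ?case by simp
      qed
    qed
    show "(\<lambda>s. indicator {x0 - real N..x0 + real N + 1} s *\<^sub>R g s) \<in> borel_measurable lborel" for N
      using borel_measurable_continuous_on_indicator[OF _ cg] by simp
  qed (use int in \<open>auto simp: indicator_def\<close>)
  then have "(\<lambda>N. \<Sum>n\<in>{- int N..int N}. integral {x0..x0+1} (\<lambda>s. g (s + of_int n))) \<longlonglongrightarrow> (\<integral>s. g s \<partial>lborel)"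
    unfolding I_def[symmetric] partial leb .
  moreover have "(\<lambda>N. \<Sum>n\<in>{- int N..int N}. integral {x0..x0+1} (\<lambda>s. g (s + of_int n))) \<longlonglongrightarrow> integral {x0..x0+1} (\<lambda>s. \<Sum>\<^sub>\<infinity>n. g (s + of_int n))"
    using infsum_int_limit[OF has_sum_imp_summable[OF hs]] infsumI[OF hs] by simp
  ultimately show ?thesis by (rule LIMSEQ_unique)
qed

context qbase
begin

definition qexp :: "real \<Rightarrow> complex" where "qexp s = of_real (exp (s * ln q))"

lemma ln_q: "ln q < 0" using q0 q1 by simp

lemma qexp_pos: "qexp s \<in> pos_line" "qexp s \<noteq> 0" by (auto simp: qexp_def pos_line_def)

lemma qexp_shift: "qexp (s + of_int n) = Q powi n * qexp s"
proof -
  have "exp (of_int n * ln q) = q powi n" using q0 by (simp add: powr_real_of_int'[symmetric] powr_def)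
  then have "exp ((s + of_int n) * ln q) = q powi n * exp (s * ln q)" by (simp add: distrib_right exp_add)
  then show ?thesis by (simp add: qexp_def of_real_power_int)
qed

lemma qexp_cont [continuous_intros]: "continuous_on A f \<Longrightarrow> continuous_on A (\<lambda>s. qexp (f s))"
  unfolding qexp_def by (intro continuous_intros)

interpretation pos: qmeasure q pos_line pos_measure by (rule qmeasure_pos)

lemma weight_powi:
  assumes y: "pos.weight z y" and t: "t \<in> pos_line"
  shows "y (Q powi n * t) = of_real (qtri n) * (t / z) powi n * y t"
proof -
  have z: "z \<noteq> 0" and shift: "\<And>t. t \<in> pos_line \<Longrightarrow> y (Q * t) = t / z * y t" using y by (auto simp: pos.weight_def)
  have t0: "t \<noteq> 0" using pos.X_nz t by blast
  have Xp: "Q powi n * t \<in> pos_line" for n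
  proof -
    obtain r where r: "r > 0" "t = of_real r" using t by (auto simp: pos_line_def)
    have "Q powi n * t = of_real (q powi n * r)" by (simp add: r of_real_power_int)
    moreover have "q powi n * r > 0" using r q0 by (simp add: zero_less_power_int)
    ultimately show ?thesis unfolding pos_line_def by blast
  qed
  show ?thesis
  proof (induction n rule: int_induct[where k=0])
    case (step1 i)
    have "y (Q powi (i + 1) * t) = y (Q * (Q powi i * t))" by (simp add: power_int_add mult_ac)
    also have "\<dots> = Q powi i * t / z * y (Q powi i * t)" by (rule shift[OF Xp])
    finally show ?case unfolding step1.IH using qtri_Suc[of i] t0 z
      by (simp add: power_int_add add.commute of_real_power_int)
  next
    case (step2 i)
    have "y (Q powi i * t) = y (Q * (Q powi (i - 1) * t))" by (simp add: power_int_diff)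
    also have "\<dots> = Q powi (i - 1) * t / z * y (Q powi (i - 1) * t)" by (rule shift[OF Xp])
    finally have "Q powi (i - 1) * t / z * y (Q powi (i - 1) * t) = of_real (qtri i) * (t / z) powi i * y t" using step2.IH by simp
    moreover have "qtri i = qtri (i - 1) * q powi (i - 1)" using qtri_Suc[of "i - 1"] by simp
    moreover have "(t / z) powi i = (t / z) powi (i - 1) * (t / z)" using t0 z by (simp add: power_int_diff)
    ultimately have "Q powi (i - 1) * t / z * y (Q powi (i - 1) * t) = Q powi (i - 1) * t / z * (of_real (qtri (i - 1)) * (t / z) powi (i - 1) * y t)"
      by (simp add: of_real_power_int mult_ac)
    then show ?case using t0 z by simp
  qed simp
qed

text \<open>In the variable \<open>s\<close> with \<open>t = q\<^sup>s\<close> the dilation is a unit translation. The translates of a weight are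
  the weight times the terms of a theta series.\<close>
lemma pos_fold:
  assumes y: "pos.weight z y"
  shows "(LINT t:pos_line|pos_measure. y t) = of_real (- ln q) * integral {x0..x0+1} (\<lambda>s. y (qexp s) * th (qexp s / z))"
proof -
  have z: "z \<noteq> 0" and yc: "continuous_on pos_line y" using y by (auto simp: pos.weight_def)
  define g where "g = (\<lambda>s. y (qexp s))"
  have gc: "continuous_on A g" for A unfolding g_def
    by (rule continuous_on_compose2[OF yc]) (auto intro!: continuous_intros qexp_pos)
  have int0: "integrable lborel (\<lambda>s. y (of_real (exp s)))"
    using pos.weight_integrable[OF y] unfolding pos_integral(1)[OF yc] .
  then have int: "integrable lborel g"
    unfolding g_def qexp_def using lborel_integrable_real_affine[OF int0, of "ln q" 0] ln_q by (simp add: mult.commute)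
  have "(LINT t:pos_line|pos_measure. y t) = (\<integral>s. y (of_real (exp s)) \<partial>lborel)" by (rule pos_integral(2)[OF yc])
  also have "\<dots> = \<bar>ln q\<bar> *\<^sub>R (\<integral>s. g s \<partial>lborel)"
    using lborel_integral_real_affine[of "ln q" "\<lambda>s. y (of_real (exp s))" 0] ln_q unfolding g_def qexp_def by (simp add: mult.commute)
  also have "\<dots> = of_real (- ln q) * (\<integral>s. g s \<partial>lborel)" using ln_q by (simp add: scaleR_conv_of_real)
  finally have 1: "(LINT t:pos_line|pos_measure. y t) = of_real (- ln q) * (\<integral>s. g s \<partial>lborel)" .
  have g_shift: "g (s + of_int n) = of_real (qtri n) * (qexp s / z) powi n * g s" for s n
    unfolding g_def qexp_shift by (rule weight_powi[OF y qexp_pos(1)])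
  have "compact (g ` {x0..x0+1})" by (intro compact_continuous_image gc) simp
  then obtain C where C: "C > 0" "\<And>s. s \<in> {x0..x0+1} \<Longrightarrow> norm (g s) \<le> C"
    using compact_imp_bounded bounded_pos by (metis imageI)
  define w where "w = (\<lambda>n. C * (norm (of_real (qtri n) * (qexp x0 / z) powi n) + norm (of_real (qtri n) * (qexp (x0 + 1) / z) powi n)))"
  have ws: "w summable_on UNIV"
    unfolding w_def using z qexp_pos(2) by (intro summable_on_cmult_right summable_on_add norm_qtri_powi_summable) auto
  have bound: "norm (g (s + of_int n)) \<le> w n" if s: "s \<in> {x0..x0+1}" for s n
  proof -
    have mono: "norm (qexp (x0 + 1)) \<le> norm (qexp s)" "norm (qexp s) \<le> norm (qexp x0)"
      using s ln_q by (auto simp: qexp_def mult_right_mono_neg)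
    have p: "norm (qexp s) > 0" "norm (qexp (x0 + 1)) > 0" using qexp_pos(2) by auto
    have "norm ((qexp s / z) powi n) \<le> norm ((qexp x0 / z) powi n) + norm ((qexp (x0 + 1) / z) powi n)"
    proof (cases "n \<ge> 0")
      case True
      have "norm (qexp s / z) ^ nat n \<le> norm (qexp x0 / z) ^ nat n"
        by (intro power_mono) (use mono in \<open>auto simp: norm_divide divide_right_mono\<close>)
      then have "norm ((qexp s / z) powi n) \<le> norm ((qexp x0 / z) powi n)" using True by (simp only: powi_nonneg norm_power)
      then show ?thesis using norm_ge_zero[of "(qexp (x0 + 1) / z) powi n"] by linarith
    next
      case False
      have "norm (z / qexp s) ^ nat (- n) \<le> norm (z / qexp (x0 + 1)) ^ nat (- n)"
        by (intro power_mono) (use mono p in \<open>auto simp: norm_divide intro!: divide_left_mono mult_pos_pos\<close>)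
      moreover have "(x / z) powi n = (z / x) ^ nat (- n)" for x using False by (simp add: power_int_def)
      ultimately have "norm ((qexp s / z) powi n) \<le> norm ((qexp (x0 + 1) / z) powi n)" by (simp only: norm_power)
      then show ?thesis using norm_ge_zero[of "(qexp x0 / z) powi n"] by linarith
    qed
    then have "norm (of_real (qtri n) * (qexp s / z) powi n) * norm (g s) \<le> (qtri n * (norm ((qexp x0 / z) powi n) + norm ((qexp (x0 + 1) / z) powi n))) * C"
      unfolding norm_mult by (intro mult_mono C s) auto
    then show ?thesis unfolding g_shift w_def by (simp add: norm_mult algebra_simps)
  qed
  have "(\<integral>s. g s \<partial>lborel) = integral {x0..x0+1} (\<lambda>s. \<Sum>\<^sub>\<infinity>n. g (s + of_int n))"
    by (rule integral_line_fold[OF gc int bound ws])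
  also have "(\<lambda>s. \<Sum>\<^sub>\<infinity>n. g (s + of_int n)) = (\<lambda>s. y (qexp s) * th (qexp s / z))"
  proof
    fix s
    have "qexp s / z \<noteq> 0" using qexp_pos(2) z by simp
    from theta_q_series[OF this] show "(\<Sum>\<^sub>\<infinity>n. g (s + of_int n)) = y (qexp s) * th (qexp s / z)"
      unfolding g_shift by (simp add: infsum_cmult_left' infsum_cmult_right' infsumI g_def mult.commute)
  qed
  finally show ?thesis unfolding 1 by simp
qed

text \<open>The slit plane on which the principal logarithm is continuous.\<close>
definition slit :: "complex set" where "slit = {z. z \<noteq> 0 \<and> \<bar>Arg z\<bar> < pi}"

lemma slit_scale: "r > 0 \<Longrightarrow> z \<in> slit \<Longrightarrow> of_real r * z \<in> slit" "r > 0 \<Longrightarrow> z \<in> slit \<Longrightarrow> z / of_real r \<in> slit"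
  by (auto simp: slit_def)

lemma E_q_shift: "E_q q (of_real (ln q) + u) = exp u * E_q q u"
proof -
  have l: "complex_of_real (ln q) \<noteq> 0" using ln_q by simp
  have s: "ln (sqrt q) = ln q / 2" using q0 by (simp add: ln_sqrt)
  have "(of_real (ln q) + u - of_real (ln q / 2))\<^sup>2 / (2 * of_real (ln q)) = u + (u - of_real (ln q / 2))\<^sup>2 / (2 * of_real (ln q))"
    using l by (simp add: field_simps power2_eq_square)
  then show ?thesis unfolding E_q_def s exp_add[symmetric] by simp
qed

definition gauss_weight :: "complex \<Rightarrow> complex \<Rightarrow> complex" where
  "gauss_weight z t = of_real (C_q q) * E_q q (Ln t - Ln z)"

lemma E_q_cont [continuous_intros]: "continuous_on A f \<Longrightarrow> continuous_on A (\<lambda>x. E_q q (f x))"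
  unfolding E_q_def using ln_q by (intro continuous_intros) auto

lemma Ln_Q_times: "z \<noteq> 0 \<Longrightarrow> Ln (Q * z) = of_real (ln q) + Ln z"
  using q0 by (simp add: Ln_times_of_real Ln_of_real)

text \<open>Completing the square: adding \<open>ln q\<close> to the logarithm multiplies the Gaussian by the argument itself.\<close>
lemma qkernel_gauss: "qkernel q pos_line pos_measure gauss_weight slit"
proof
  fix z assume z: "z \<in> slit"
  then have z0: "z \<noteq> 0" by (simp add: slit_def)
  show "pos.weight z (gauss_weight z)"
    unfolding pos.weight_def
  proof (intro conjI ballI)
    show "continuous_on pos_line (gauss_weight z)"
      unfolding gauss_weight_def by (intro continuous_intros) (auto simp: pos_line_def complex_nonpos_Reals_iff)
    fix t assume t: "t \<in> pos_line"
    then have t0: "t \<noteq> 0" by (rule pos.X_nz)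
    have "gauss_weight z (Q * t) = of_real (C_q q) * E_q q (of_real (ln q) + (Ln t - Ln z))"
      unfolding gauss_weight_def Ln_Q_times[OF t0] by (simp add: add_diff_eq)
    also have "\<dots> = t / z * gauss_weight z t"
      unfolding E_q_shift gauss_weight_def using t0 z0 by (simp add: exp_diff)
    finally show "gauss_weight z (Q * t) = t / z * gauss_weight z t" .
  qed (rule z0)
  show "Q * z \<in> slit" "z / Q \<in> slit" using slit_scale z q0 by auto
  fix t assume t: "t \<in> pos_line"
  show "gauss_weight (Q * z) (Q * t) = gauss_weight z t"
    unfolding gauss_weight_def Ln_Q_times[OF pos.X_nz[OF t]] Ln_Q_times[OF z0] by simp
qed

lemma theta_slit_nz:
  assumes "z \<in> slit" "t \<in> pos_line" shows "th (t / z) \<noteq> 0"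
proof
  assume "th (t / z) = 0"
  moreover have z0: "z \<noteq> 0" "t \<noteq> 0" using assms pos.X_nz by (auto simp: slit_def)
  ultimately obtain n :: int where "t / z = - (Q powi n)" using theta_q_eq_0_iff[of "t / z"] by auto
  moreover obtain r where r: "r > 0" "t = of_real r" using assms by (auto simp: pos_line_def)
  ultimately have "z = - of_real (r / q powi n)" using z0 by (simp add: of_real_power_int divide_simps) (simp add: mult_ac)?
  moreover have "r / q powi n > 0" using r q0 by (simp add: zero_less_power_int)
  ultimately have "Arg z = pi" using Arg_of_real[of "- (r / q powi n)"] by simp
  then show False using assms by (simp add: slit_def)
qed

lemma qkernel_theta: "qkernel q pos_line pos_measure (\<lambda>z t. of_real (- 1 / ln q) / th (t / z)) slit"
proof
  fix z assume z: "z \<in> slit"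
  then have z0: "z \<noteq> 0" by (simp add: slit_def)
  show "pos.weight z (\<lambda>t. of_real (- 1 / ln q) / th (t / z))"
    unfolding pos.weight_def
  proof (intro conjI ballI)
    show "continuous_on pos_line (\<lambda>t. of_real (- 1 / ln q) / th (t / z))"
      using z0 pos.X_nz theta_slit_nz[OF z] by (intro continuous_intros) auto
    fix t assume t: "t \<in> pos_line"
    show "of_real (- 1 / ln q) / th (Q * t / z) = t / z * (of_real (- 1 / ln q) / th (t / z))"
      using theta_q_shift[of "t / z"] z0 pos.X_nz[OF t] by simp
  qed (rule z0)
  show "Q * z \<in> slit" "z / Q \<in> slit" using slit_scale z q0 by auto
qed simp

end

section \<open>Periodic and doubly periodic functions\<close>

lemma int_periodic:
  fixes f :: "'a::real_algebra_1 \<Rightarrow> 'b"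
  assumes "\<And>x. f (x + t) = f x"
  shows "f (x + of_int n * t) = f x"
proof (induction n rule: int_induct[where k=0])
  case (step1 i)
  then show ?case using assms[of "x + of_int i * t"] by (simp add: algebra_simps)
next
  case (step2 i)
  then show ?case using assms[of "x + of_int (i - 1) * t"] by (simp add: algebra_simps)
qed simp

text \<open>All values are taken on a compact period rectangle.\<close>
lemma entire_doubly_periodic_constant:
  fixes f :: "complex \<Rightarrow> complex"
  assumes f: "f holomorphic_on UNIV" and T: "T > 0"
    and per: "\<And>s. f (s + 1) = f s" "\<And>s. f (s + \<i> * of_real T) = f s"
  shows "f s = f s'"
proof -
  have "f s \<in> f ` cbox 0 (Complex 1 T)" for s
  proof -
    define n m where "n = \<lfloor>Re s\<rfloor>" "m = \<lfloor>Im s / T\<rfloor>"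
    define s1 where "s1 = s + of_int (- n) * 1 + of_int (- m) * (\<i> * of_real T)"
    have "f s1 = f s" unfolding s1_def
      using int_periodic[of f "\<i> * of_real T", OF per(2)] int_periodic[of f 1, OF per(1)] by metis
    moreover have "s1 \<in> cbox 0 (Complex 1 T)"
    proof -
      have "of_int m * T \<le> Im s" "Im s < (of_int m + 1) * T"
        using T unfolding n_m_def by (simp_all add: pos_le_divide_eq[symmetric] pos_divide_less_eq[symmetric])
      moreover have "of_int n \<le> Re s" "Re s < of_int n + 1" unfolding n_m_def by auto
      ultimately show ?thesis unfolding s1_def in_cbox_complex_iff by (auto simp: algebra_simps)
    qed
    ultimately show ?thesis by (metis imageI)
  qed
  then have "range f \<subseteq> f ` cbox 0 (Complex 1 T)" by blast
  moreover have "compact (f ` cbox 0 (Complex 1 T))"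
    by (intro compact_continuous_image holomorphic_on_imp_continuous_on holomorphic_on_subset[OF f]) auto
  ultimately have "bounded (range f)" using bounded_subset compact_imp_bounded by blast
  from Liouville_theorem[OF f this] show ?thesis by (auto simp: constant_on_def)
qed

text \<open>The integers are the disjoint union of \<open>n\<close> and \<open>-n-1\<close> for natural \<open>n\<close>. This pairs the terms
  \<open>\<plusminus>(2n+1)\<close> of a theta series into sines.\<close>
lemma has_sum_int_fold:
  fixes f :: "int \<Rightarrow> complex"
  assumes "(f has_sum S) UNIV"
  shows "(\<lambda>n. f (int n) + f (- int n - 1)) sums S"
proof -
  have sub: "f summable_on A" for A
    using summable_on_subset_banach[OF has_sum_imp_summable[OF assms]] by simp
  have r: "((\<lambda>n. f (g n)) has_sum infsum f (range g)) UNIV" if "inj g" for g :: "nat \<Rightarrow> int"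
    using has_sum_infsum[OF sub[of "range g"]] has_sum_reindex[OF that, of f "infsum f (range g)"] by (simp add: o_def)
  have U: "UNIV = range int \<union> range (\<lambda>n. - int n - 1)"
  proof -
    have "k \<in> range int \<union> range (\<lambda>n. - int n - 1)" for k
    proof (cases "k \<ge> 0")
      case True then show ?thesis by (metis UnI1 nat_0_le rangeI)
    next
      case False
      then have "k = - int (nat (- k - 1)) - 1" by simp
      then show ?thesis by blast
    qed
    then show ?thesis by blast
  qed
  have "infsum f UNIV = infsum f (range int) + infsum f (range (\<lambda>n. - int n - 1))"
    unfolding U by (rule infsum_Un_disjoint[OF sub sub]) auto
  then have "S = infsum f (range int) + infsum f (range (\<lambda>n. - int n - 1))" using infsumI[OF assms] by simp
  moreover have "(\<lambda>n. f (int n)) sums infsum f (range int)"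
    by (rule has_sum_imp_sums[OF r]) (simp add: inj_def)
  moreover have "(\<lambda>n. f (- int n - 1)) sums infsum f (range (\<lambda>n. - int n - 1))"
    by (rule has_sum_imp_sums[OF r]) (simp add: inj_def)
  ultimately show ?thesis using sums_add by blast
qed

lemma integral_exp_period:
  "integral {0..1} (\<lambda>s. exp (2 * of_real pi * \<i> * of_int n * of_real s)) = (if n = 0 then 1 else (0::complex))"
proof (cases "n = 0")
  case False
  let ?c = "2 * of_real pi * \<i> * of_int n"
  have c: "?c \<noteq> 0" using False by simp
  have e1: "exp ?c = 1" using exp_integer_2pi[of "of_int n"] by (simp add: mult_ac)
  have "((\<lambda>s. exp (?c * of_real s)) has_integral exp (?c * of_real 1) / ?c - exp (?c * of_real 0) / ?c) {0..1}"
  proof (rule fundamental_theorem_of_calculus)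
    fix x :: real
    have "((\<lambda>z. exp (?c * z) / ?c) has_field_derivative exp (?c * of_real x)) (at (of_real x))"
      using c by (auto intro!: derivative_eq_intros)
    from has_vector_derivative_real_field[OF this]
    show "((\<lambda>s. exp (?c * of_real s) / ?c) has_vector_derivative exp (?c * of_real x)) (at x within {0..1})"
      by (rule has_vector_derivative_at_within)
  qed simp
  then show ?thesis using e1 False by (simp add: integral_unique)
qed simp

context qbase
begin

section \<open>Jacobi's transformation\<close>

definition per :: real where "per = 2 * pi / - ln q"
text \<open>The quasi-period, so that \<open>tau * ln q = - 2 pi i\<close>; half of it is a zero of
  \<open>P_exp\<close> below.\<close>
definition tau :: complex where "tau = \<i> * of_real per"
definition sigma :: complex where "sigma = tau / 2"
text \<open>The function \<open>P_q\<close> in exponents: the argument is the logarithm to base \<open>q\<close>.\<close>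
definition P_exp :: "complex \<Rightarrow> complex" where "P_exp s = P_q q (s * of_real (ln q))"

abbreviation "L \<equiv> complex_of_real (ln q)"
abbreviation "qh \<equiv> qhat q"
abbreviation "H \<equiv> complex_of_real (qhat q)"

lemma per_pos: "per > 0" using ln_q by (simp add: per_def divide_pos_neg)
lemma L_nz: "L \<noteq> 0" using ln_q by simp
lemma tau_L: "tau * L = - (2 * of_real pi * \<i>)" using ln_q by (simp add: tau_def per_def)
lemma sigma_L: "sigma * L = - (of_real pi * \<i>)" using tau_L by (simp add: sigma_def)
lemma C_q_pos: "C_q q > 0" using ln_q by (simp add: C_q_def mult_pos_neg)

lemma qh_pos: "0 < qh" and qh_less_1: "qh < 1" using ln_q by (auto simp: qhat_def divide_pos_neg)

lemma ln_qh: "ln qh = - (pi * per)" by (simp add: qhat_def per_def power2_eq_square)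

lemma H_exp: "H = exp (of_real pi * \<i> * tau)"
proof -
  have "of_real pi * \<i> * tau = complex_of_real (ln qh)" unfolding ln_qh tau_def by (simp add: algebra_simps)
  then show ?thesis using qh_pos by (simp only: exp_of_real exp_ln)
qed

lemma E_q_exponent: "E_q q (s * L) = exp (L * (s - 1/2)\<^sup>2 / 2)"
proof -
  have s: "ln (sqrt q) = ln q / 2" using q0 by (simp add: ln_sqrt)
  have "(s * L - of_real (ln q / 2))\<^sup>2 / (2 * L) = L * (s - 1/2)\<^sup>2 / 2"
    using L_nz by (simp add: field_simps power2_eq_square)
  then show ?thesis unfolding E_q_def s by (rule arg_cong)
qed

lemma P_exp_eq: "P_exp s = - L * of_real (C_q q) * E_q q (s * L) * th (exp (s * L))"
  by (simp add: P_exp_def P_q_def)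

lemma P_q_P_exp: "P_q q w = P_exp (w / L)" using L_nz by (simp add: P_exp_def)

lemma P_exp_1: "P_exp (s + 1) = P_exp s"
proof -
  have "(s + 1) * L = L + s * L" by (simp add: algebra_simps)
  moreover have "exp L = Q" using q0 by (simp add: exp_of_real)
  ultimately show ?thesis unfolding P_exp_eq E_q_shift using theta_q_shift[of "exp (s * L)"] E_q_shift[of "s * L"]
    by (simp add: exp_add)
qed

text \<open>The theta factor does not change, and the Gaussian acquires the exponential of a linear function.\<close>
lemma P_exp_tau: "P_exp (s + tau) = - (exp (- (2 * of_real pi * \<i> * s)) / H) * P_exp s"
proof -
  have "(s + tau) * L = s * L + (- (2 * of_real pi * \<i>))" using tau_L by (simp add: algebra_simps)
  then have 1: "exp ((s + tau) * L) = exp (s * L)" by (simp only: exp_add exp_minus exp_two_pi_i inverse_1 mult_1_right)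
  have "L * (s + tau - 1/2)\<^sup>2 / 2 = L * (s - 1/2)\<^sup>2 / 2 + (tau * L) * (s - 1/2) + (tau * L) * tau / 2"
    by (simp add: field_simps power2_eq_square)
  also have "\<dots> = L * (s - 1/2)\<^sup>2 / 2 + (- (2 * of_real pi * \<i> * s)) + of_real pi * \<i> - of_real pi * \<i> * tau"
    unfolding tau_L by (simp add: algebra_simps)
  finally have X: "L * (s + tau - 1/2)\<^sup>2 / 2 = L * (s - 1/2)\<^sup>2 / 2 + (- (2 * of_real pi * \<i> * s)) + of_real pi * \<i> - of_real pi * \<i> * tau" .
  have "E_q q ((s + tau) * L) = - (exp (- (2 * of_real pi * \<i> * s)) / H) * E_q q (s * L)"
    unfolding E_q_exponent H_exp X exp_add exp_diff exp_pi_i by (simp add: mult_ac)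
  then show ?thesis unfolding P_exp_eq 1 by simp
qed

lemma P_exp_holo: "P_exp holomorphic_on A"
proof -
  have "P_exp = (\<lambda>s. - L * of_real (C_q q) * exp (L * (s - 1/2)\<^sup>2 / 2) * th (exp (s * L)))"
    unfolding P_exp_eq E_q_exponent by simp
  then show ?thesis by (auto intro!: holomorphic_intros theta_q_holo')
qed

lemma exp_L_eq_powi_iff: "exp (x * L) = Q powi n \<longleftrightarrow> (\<exists>m. x = of_int n + of_int m * tau)"
proof -
  have "Q powi n = exp (of_int n * L)" using q0 by (simp add: exp_power_int[symmetric] exp_of_real)
  then have "exp (x * L) = Q powi n \<longleftrightarrow> (\<exists>m. x * L = of_int n * L + of_int (2 * m) * (of_real pi * \<i>))"
    by (simp add: exp_eq mult_ac)
  also have "\<dots> \<longleftrightarrow> (\<exists>m. x * L = (of_int n + of_int (- m) * tau) * L)"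
    using tau_L by (simp add: algebra_simps)
  also have "\<dots> \<longleftrightarrow> (\<exists>m. x = of_int n + of_int (- m) * tau)" using L_nz by simp
  also have "\<dots> \<longleftrightarrow> (\<exists>m. x = of_int n + of_int m * tau)" by (metis minus_minus)
  finally show ?thesis .
qed

lemma P_exp_zero_iff: "P_exp (sigma + x) = 0 \<longleftrightarrow> (\<exists>n m. x = of_int n + of_int m * tau)"
proof -
  have e: "exp ((sigma + x) * L) = - exp (x * L)"
    unfolding distrib_right sigma_L exp_add by (simp add: exp_minus)
  have "P_exp (sigma + x) = 0 \<longleftrightarrow> th (exp ((sigma + x) * L)) = 0"
    using ln_q C_q_pos by (simp add: P_exp_eq E_q_def)
  also have "\<dots> \<longleftrightarrow> (\<exists>n. exp (x * L) = Q powi n)" unfolding e using theta_q_eq_0_iff[of "- exp (x * L)"] by simp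
  finally show ?thesis using exp_L_eq_powi_iff by auto
qed

interpretation hat: qbase "qh\<^sup>2" using qh_pos qh_less_1 by unfold_locales (auto simp: power_less_one_iff)

text \<open>The theta function of base \<open>(qhat q)\<^sup>2\<close>, normalized to follow the same two translation laws as \<open>P_exp\<close>.\<close>
definition hat_theta :: "complex \<Rightarrow> complex" where "hat_theta s = theta_q (qh\<^sup>2) (- (H * exp (2 * of_real pi * \<i> * s)))"

lemma hat_theta_1: "hat_theta (s + 1) = hat_theta s"
  by (simp add: hat_theta_def distrib_left exp_add)

lemma hat_theta_tau: "hat_theta (s + tau) = - (exp (- (2 * of_real pi * \<i> * s)) / H) * hat_theta s"
proof -
  have "exp (2 * of_real pi * \<i> * tau) = H\<^sup>2"
    unfolding H_exp exp_double[symmetric] by (simp add: mult_ac)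
  then have e: "- (H * exp (2 * of_real pi * \<i> * (s + tau))) = of_real (qh\<^sup>2) * (- (H * exp (2 * of_real pi * \<i> * s)))"
    by (simp add: distrib_left exp_add mult_ac)
  have "hat_theta (s + tau) = hat_theta s / (- (H * exp (2 * of_real pi * \<i> * s)))"
    unfolding hat_theta_def e by (rule hat.theta_q_shift) (use qh_pos in simp)
  then show ?thesis by (simp add: exp_minus divide_inverse mult_ac)
qed

lemma hat_theta_holo: "hat_theta holomorphic_on A"
  unfolding hat_theta_def using qh_pos by (auto intro!: holomorphic_intros hat.theta_q_holo')

lemma exp_2sigma: "exp (2 * of_real pi * \<i> * sigma) = H"
  unfolding H_exp sigma_def by (simp add: mult_ac)

lemma hat_theta_zero:
  assumes "hat_theta (- sigma + x) = 0" shows "\<exists>n m. x = of_int n + of_int m * tau"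
proof -
  have H0: "H \<noteq> 0" using qh_pos by simp
  have "H * exp (2 * of_real pi * \<i> * (- sigma + x)) = exp (2 * of_real pi * \<i> * x)"
    unfolding distrib_left exp_add using exp_2sigma H0 by (simp add: exp_minus)
  with assms have "theta_q (qh\<^sup>2) (- exp (2 * of_real pi * \<i> * x)) = 0" by (simp add: hat_theta_def)
  then obtain n :: int where "exp (2 * of_real pi * \<i> * x) = complex_of_real (qh\<^sup>2) powi n"
    using hat.theta_q_eq_0_iff[of "- exp (2 * of_real pi * \<i> * x)"] by auto
  also have "complex_of_real (qh\<^sup>2) = exp (2 * of_real pi * \<i> * tau)"
    unfolding of_real_power H_exp exp_double[symmetric] by (simp add: mult_ac)
  also have "\<dots> powi n = exp (of_int n * (2 * of_real pi * \<i> * tau))" by (simp add: exp_power_int[symmetric])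
  finally obtain m :: int where "2 * of_real pi * \<i> * x = of_int n * (2 * of_real pi * \<i> * tau) + of_int (2 * m) * pi * \<i>"
    by (auto simp: exp_eq)
  then have "2 * of_real pi * \<i> * x = 2 * of_real pi * \<i> * (of_int m + of_int n * tau)" by (simp add: algebra_simps)
  then have "x = of_int m + of_int n * tau" by simp
  then show ?thesis by blast
qed

lemma theta_comp_deriv:
  assumes "qbase r" "(g has_field_derivative D) (at s)" "g s = -1"
  shows "((\<lambda>s. theta_q r (g s)) has_field_derivative (qpoch_inf r (of_real r) ^ 3 * D)) (at s)"
  using DERIV_chain2[where f="theta_q r" and g=g, OF _ assms(2)] qbase.theta_q_deriv[OF assms(1)] assms(3) by simp

lemma hat_theta_deriv_nz: "deriv hat_theta (- sigma) \<noteq> 0"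
proof -
  have g: "- (H * exp (2 * of_real pi * \<i> * (- sigma))) = -1"
    using exp_2sigma qh_pos by (simp add: exp_minus)
  have "((\<lambda>s. - (H * exp (2 * of_real pi * \<i> * s))) has_field_derivative (- (H * exp (2 * of_real pi * \<i> * (- sigma))) * (2 * of_real pi * \<i>))) (at (- sigma))"
    by (auto intro!: derivative_eq_intros)
  from theta_comp_deriv[OF hat.qbase_axioms this g]
  have "(hat_theta has_field_derivative (qpoch_inf (qh\<^sup>2) (of_real (qh\<^sup>2)) ^ 3 * (-1 * (2 * of_real pi * \<i>)))) (at (- sigma))"
    unfolding g hat_theta_def .
  moreover have "qpoch_inf (qh\<^sup>2) (of_real (qh\<^sup>2)) \<noteq> 0"
    using hat.qp_eq_0_iff[of "of_real (qh\<^sup>2)"] hat.Qpow_eq_1_iff by (auto simp flip: power_Suc)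
  ultimately show ?thesis using DERIV_imp_deriv by fastforce
qed

lemma P_exp_zero_shift: "P_exp (- sigma) = 0"
proof -
  have "- tau = of_int 0 + of_int (-1) * tau" by simp
  then have "P_exp (sigma + - tau) = 0" using P_exp_zero_iff by blast
  moreover have "sigma + - tau = - sigma" by (simp add: sigma_def)
  ultimately show ?thesis by metis
qed

lemma hat_theta_zero_shift: "hat_theta (- sigma) = 0"
proof -
  have g: "- (H * exp (2 * of_real pi * \<i> * (- sigma))) = -1"
    using exp_2sigma qh_pos by (simp add: exp_minus)
  show ?thesis unfolding hat_theta_def g using hat.theta_q_eq_0_iff[of "-1"] by (auto intro: exI[of _ 0])
qed

text \<open>The quotient is doubly periodic. Modulo the periods the denominator has a single simple zero, which is
  also a zero of the numerator, so the quotient is entire.\<close>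
lemma P_exp_hat_theta_proportional: "\<exists>C. \<forall>s. P_exp s = C * hat_theta s"
proof -
  let ?z = "- sigma"
  define T1 where "T1 = (\<lambda>w. if w = ?z then deriv P_exp ?z else (P_exp w - P_exp ?z) / (w - ?z))"
  define J1 where "J1 = (\<lambda>w. if w = ?z then deriv hat_theta ?z else (hat_theta w - hat_theta ?z) / (w - ?z))"
  have T1: "T1 holomorphic_on UNIV" and J1: "J1 holomorphic_on UNIV"
    unfolding T1_def J1_def using pole_lemma[of _ UNIV ?z] P_exp_holo hat_theta_holo by auto
  \<comment> \<open>at the common zeros, the limit of the quotient; by periodicity it is the same at all of them\<close>
  define R where "R = (\<lambda>s. if hat_theta s = 0 then deriv P_exp ?z / deriv hat_theta ?z else P_exp s / hat_theta s)"
  have Rper: "R (s + 1) = R s" "R (s + tau) = R s" for s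
    unfolding R_def P_exp_1 hat_theta_1 P_exp_tau hat_theta_tau using qh_pos by auto
  have Rz: "R field_differentiable (at ?z)"
  proof (rule holomorphic_on_imp_differentiable_at[of _ "{s. J1 s \<noteq> 0}"])
    show "open {s. J1 s \<noteq> 0}"
      using holomorphic_on_imp_continuous_on[OF J1] by (intro open_Collect_neq) auto
    have "(\<lambda>s. T1 s / J1 s) holomorphic_on {s. J1 s \<noteq> 0}"
      by (intro holomorphic_intros holomorphic_on_subset[OF T1] holomorphic_on_subset[OF J1]) auto
    then show "R holomorphic_on {s. J1 s \<noteq> 0}"
    proof (rule holomorphic_transform)
      fix s assume "s \<in> {s. J1 s \<noteq> 0}"
      then show "T1 s / J1 s = R s"
        unfolding R_def T1_def J1_def P_exp_zero_shift hat_theta_zero_shift using hat_theta_zero_shift by (cases "s = ?z") auto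
    qed
    show "?z \<in> {s. J1 s \<noteq> 0}" using hat_theta_deriv_nz by (simp add: J1_def)
  qed
  have Rd: "R field_differentiable (at s)" for s
  proof (cases "hat_theta s = 0")
    case False
    have o: "open {s. hat_theta s \<noteq> 0}"
      using holomorphic_on_imp_continuous_on[OF hat_theta_holo] by (intro open_Collect_neq) auto
    have "R holomorphic_on {s. hat_theta s \<noteq> 0}"
      by (rule holomorphic_transform[of "\<lambda>s. P_exp s / hat_theta s"]) (auto intro!: holomorphic_intros P_exp_holo hat_theta_holo simp: R_def)
    then show ?thesis using holomorphic_on_imp_differentiable_at o False by blast
  next
    case True
    obtain n m where nm: "s = ?z + (of_int n + of_int m * tau)"
      using hat_theta_zero[of "s + sigma"] True by (auto simp: algebra_simps)
    have "R w = R (w + of_int (- n) * 1 + of_int (- m) * tau)" for w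
      using int_periodic[of R tau, OF Rper(2)] int_periodic[of R 1, OF Rper(1)] by metis
    then have "R = R \<circ> (\<lambda>w. w - (of_int n + of_int m * tau))" by (auto simp: fun_eq_iff algebra_simps)
    moreover have "R \<circ> (\<lambda>w. w - (of_int n + of_int m * tau)) field_differentiable (at s)"
      by (rule field_differentiable_compose) (use Rz in \<open>auto simp: nm intro!: derivative_intros\<close>)
    ultimately show ?thesis by simp
  qed
  then have "R holomorphic_on UNIV" by (simp add: holomorphic_on_open field_differentiable_def)
  then have const: "R s = R 0" for s
    by (rule entire_doubly_periodic_constant[OF _ per_pos]) (use Rper in \<open>auto simp: tau_def\<close>)
  have "P_exp s = R 0 * hat_theta s" if "hat_theta s \<noteq> 0" for s
    using const[of s] that unfolding R_def by (auto simp: field_simps split: if_splits)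
  moreover have "P_exp s = R 0 * hat_theta s" if J: "hat_theta s = 0" for s
  proof -
    obtain n m where nm: "s + sigma = of_int n + of_int m * tau"
      using hat_theta_zero[of "s + sigma"] J by auto
    then have "s = sigma + (of_int n + of_int (m - 1) * tau)" by (simp add: sigma_def algebra_simps)
    then have "P_exp s = 0" using P_exp_zero_iff[of "of_int n + of_int (m - 1) * tau"] by blast
    then show ?thesis using J by simp
  qed
  ultimately show ?thesis by blast
qed

definition hat_coeff :: "int \<Rightarrow> complex" where "hat_coeff n = (-1) powi n * of_real (qh powi (n\<^sup>2))"

lemma hat_coeff_qtri: "of_real (hat.qtri n) * (- (H * x)) powi n = hat_coeff n * x powi n"
proof -
  have e: "(2::real) * (real_of_int n * (real_of_int n - 1) / 2) = real_of_int (n\<^sup>2) - real_of_int n"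
    by (simp add: power2_eq_square field_simps)
  have "hat.qtri n = qh powr (2 * (real_of_int n * (real_of_int n - 1) / 2))"
  proof -
    have "qh\<^sup>2 = qh powr 2" using qh_pos by (simp add: powr_numeral)
    then show ?thesis unfolding hat.qtri_def by (simp only: powr_powr of_int_mult of_int_diff of_int_1)
  qed
  also have "\<dots> = qh powr real_of_int (n\<^sup>2) / qh powr real_of_int n" unfolding e by (rule powr_diff)
  also have "\<dots> = qh powi (n\<^sup>2) / qh powi n"
    using powr_real_of_int'[of qh "n\<^sup>2"] powr_real_of_int'[of qh n] qh_pos by simp
  finally have "hat.qtri n = qh powi (n\<^sup>2) / qh powi n" .
  moreover have "(- (H * x)) powi n = (-1) powi n * H powi n * x powi n"
    by (metis mult_minus1 power_int_mult_distrib mult.assoc)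
  moreover have "H powi n \<noteq> 0" using qh_pos by simp
  ultimately show ?thesis by (simp add: hat_coeff_def of_real_power_int)
qed

lemma hat_coeff_summable: "x \<noteq> 0 \<Longrightarrow> (\<lambda>n. norm (hat_coeff n * x powi n)) summable_on UNIV"
  using hat.norm_qtri_powi_summable[of "- (H * x)"] qh_pos unfolding hat_coeff_qtri by simp

lemma hat_theta_series: "((\<lambda>n. hat_coeff n * exp (2 * of_real pi * \<i> * s) powi n) has_sum hat_theta s) UNIV"
  using hat.theta_q_series[of "- (H * exp (2 * of_real pi * \<i> * s))"] qh_pos unfolding hat_coeff_qtri hat_theta_def by simp

lemma integral_hat_theta: "integral {0..1} (\<lambda>s. hat_theta (of_real s)) = 1"
proof -
  let ?f = "\<lambda>n::int. \<lambda>s::real. hat_coeff n * exp (2 * of_real pi * \<i> * of_real s) powi n"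
  have pw: "exp (2 * of_real pi * \<i> * of_real s) powi n = exp (2 * of_real pi * \<i> * of_int n * of_real s)" for n s
    unfolding exp_power_int by (simp add: mult_ac)
  have ne: "norm (exp (2 * of_real pi * \<i> * of_real s)) = 1" for s by (simp add: norm_exp_eq_Re)
  have "((\<lambda>n. integral {0..1} (?f n)) has_sum integral {0..1} (\<lambda>s. \<Sum>\<^sub>\<infinity>n. ?f n s)) UNIV"
  proof (rule integral_int_sum)
    show "(\<lambda>n. norm (hat_coeff n * 1 powi n)) summable_on UNIV" by (rule hat_coeff_summable) simp
    show "norm (?f n s) \<le> norm (hat_coeff n * 1 powi n)" for n s by (simp add: norm_mult norm_power_int ne)
    show "continuous_on {0..1} (?f n)" for n unfolding pw by (intro continuous_intros)
  qed simp
  moreover have "integral {0..1} (?f n) = (if n = 0 then 1 else 0)" for n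
    unfolding pw integral_mult_right integral_exp_period by (simp add: hat_coeff_def)
  moreover have "((\<lambda>n::int. if n = 0 then 1 else 0) has_sum (1::complex)) UNIV"
    using has_sum_finite_neutralI[of "{0::int}" UNIV "\<lambda>n. if n = 0 then 1 else (0::complex)" 1] by auto
  moreover have "(\<lambda>s. \<Sum>\<^sub>\<infinity>n. ?f n s) = (\<lambda>s. hat_theta (of_real s))"
    using infsumI[OF hat_theta_series] by auto
  ultimately show ?thesis using has_sum_unique by fastforce
qed

text \<open>Read backwards, \<open>pos_fold\<close> turns this into the total mass of a normal density with mean \<open>ln q / 2\<close> and
  variance \<open>- ln q\<close>.\<close>
lemma integral_P_exp: "integral {0..1} (\<lambda>s. P_exp (of_real s)) = 1"
proof -
  interpret pos: qmeasure q pos_line pos_measure by (rule qmeasure_pos)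
  have "1 \<in> slit" by (simp add: slit_def)
  then have w: "pos.weight 1 (gauss_weight 1)"
    using qkernel.weight_w[OF qkernel_gauss] by simp
  then have yc: "continuous_on pos_line (gauss_weight 1)" by (auto simp: pos.weight_def)
  have "(LINT t:pos_line|pos_measure. gauss_weight 1 t) = of_real (- ln q) * integral {0..0+1} (\<lambda>s. gauss_weight 1 (qexp s) * th (qexp s / 1))"
    by (rule pos_fold[OF w])
  also have "\<dots> = integral {0..1} (\<lambda>s. of_real (- ln q) * (gauss_weight 1 (qexp s) * th (qexp s)))" by simp
  also have "\<dots> = integral {0..1} (\<lambda>s. P_exp (of_real s))"
  proof (rule arg_cong[where f="integral {0..1}"], rule ext)
    fix s
    have "Ln (qexp s) = of_real s * L" unfolding qexp_def by (simp add: Ln_of_real)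
    moreover have "qexp s = exp (of_real s * L)" unfolding qexp_def exp_of_real[symmetric] by simp
    ultimately show "of_real (- ln q) * (gauss_weight 1 (qexp s) * th (qexp s)) = P_exp (of_real s)"
      unfolding P_exp_eq gauss_weight_def by simp
  qed
  finally have "integral {0..1} (\<lambda>s. P_exp (of_real s)) = (LINT t:pos_line|pos_measure. gauss_weight 1 t)" ..
  also have "\<dots> = (\<integral>s. gauss_weight 1 (of_real (exp s)) \<partial>lborel)" by (rule pos_integral(2)[OF yc])
  also have "\<dots> = (\<integral>s. complex_of_real (normal_density (ln q / 2) (sqrt (- ln q)) s) \<partial>lborel)"
  proof (rule Bochner_Integration.integral_cong)
    fix s :: real
    have s: "ln (sqrt q) = ln q / 2" using q0 by (simp add: ln_sqrt)
    have "E_q q (of_real s) = of_real (exp (- (s - ln q / 2)\<^sup>2 / (2 * (sqrt (- ln q))\<^sup>2)))"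
      unfolding E_q_def s using ln_q by (simp add: exp_of_real[symmetric])
    moreover have "C_q q = 1 / sqrt (2 * pi * (sqrt (- ln q))\<^sup>2)" using ln_q by (simp add: C_q_def)
    ultimately show "gauss_weight 1 (of_real (exp s)) = of_real (normal_density (ln q / 2) (sqrt (- ln q)) s)"
      unfolding gauss_weight_def normal_density_def by (simp add: Ln_of_real)
  qed simp
  also have "\<dots> = 1" using ln_q by simp
  finally show ?thesis .
qed

lemma P_exp_hat_theta: "P_exp s = hat_theta s"
proof -
  obtain C where C: "\<And>s. P_exp s = C * hat_theta s" using P_exp_hat_theta_proportional by blast
  have "integral {0..1} (\<lambda>s. P_exp (of_real s)) = C * integral {0..1} (\<lambda>s. hat_theta (of_real s))" unfolding C by simp
  then have "C = 1" unfolding integral_P_exp integral_hat_theta by simp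
  then show ?thesis using C by simp
qed

lemma P_exp_series: "((\<lambda>n. hat_coeff n * exp (2 * of_real pi * \<i> * s) powi n) has_sum P_exp s) UNIV"
  unfolding P_exp_hat_theta by (rule hat_theta_series)

text \<open>The theta function of the statement, with the period normalized to \<open>1\<close> up to sign.\<close>
definition theta1_pi :: "complex \<Rightarrow> complex" where "theta1_pi x = theta1 (of_real pi * x) qh"

lemma P_exp_sigma_sums:
  "(\<lambda>n. (-1) ^ n * of_real (qh powr ((real n + 1/2)\<^sup>2)) * sin (of_nat (2 * n + 1) * (of_real pi * x))) sums
     (P_exp (sigma + x) / (\<i> * of_real (qh powr (-1/4)) * exp (- (\<i> * of_real pi * x))) / 2)"
proof -
  define f where "f = (\<lambda>n::int. hat_coeff n * exp (2 * of_real pi * \<i> * (sigma + x)) powi n)"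
  define K where "K = \<i> * complex_of_real (qh powr (-1/4)) * exp (- (\<i> * of_real pi * x))"
  have K: "K \<noteq> 0" using qh_pos by (simp add: K_def)
  have fe: "f n = (-1) powi n * of_real (qh powr (-1/4)) * of_real (qh powr ((of_int n + 1/2)\<^sup>2)) * exp (of_int n * (2 * of_real pi * \<i> * x))" for n
  proof -
    have "exp (2 * of_real pi * \<i> * (sigma + x)) powi n = of_real (qh powi n) * exp (of_int n * (2 * of_real pi * \<i> * x))"
      unfolding distrib_left exp_add exp_2sigma power_int_mult_distrib by (simp add: exp_power_int of_real_power_int)
    moreover have pq: "qh powi (n\<^sup>2) * qh powi n = qh powr (-1/4) * qh powr ((of_int n + 1/2)\<^sup>2)"
    proof -
      have "qh powi (n\<^sup>2) * qh powi n = qh powr (of_int (n\<^sup>2) + of_int n)"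
        using qh_pos by (simp add: powr_real_of_int'[symmetric] powr_add)
      also have "of_int (n\<^sup>2) + of_int n = -1/4 + (real_of_int n + 1/2)\<^sup>2" by (simp add: power2_eq_square algebra_simps)
      finally show ?thesis by (simp only: powr_add)
    qed
    moreover from pq have "complex_of_real (qh powi (n\<^sup>2)) * of_real (qh powi n) = of_real (qh powr (-1/4)) * of_real (qh powr ((of_int n + 1/2)\<^sup>2))"
      by (simp only: of_real_mult[symmetric])
    ultimately show ?thesis unfolding f_def hat_coeff_def by (simp only: mult.assoc) (simp only: mult.assoc[symmetric])
  qed
  have pair: "f (int n) + f (- int n - 1) = K * (2 * ((-1) ^ n * of_real (qh powr ((real n + 1/2)\<^sup>2)) * sin (of_nat (2 * n + 1) * (of_real pi * x))))" for n
  proof -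
    define y where "y = \<i> * of_real pi * x"
    have s: "2 * sin (of_nat (2 * n + 1) * (of_real pi * x)) = - \<i> * (exp (of_nat (2*n+1) * y) - exp (- (of_nat (2*n+1) * y)))"
      unfolding sin_exp_eq y_def by (simp add: field_simps)
    have m: "(-1::complex) powi (- int n - 1) = - ((-1) ^ n)"
      by (simp add: power_int_diff power_int_minus flip: power_inverse)
    have sq: "(real_of_int (- int n - 1) + 1/2)\<^sup>2 = (real n + 1/2)\<^sup>2" by (simp add: power2_eq_square algebra_simps)
    have e1: "exp (of_int (int n) * (2 * of_real pi * \<i> * x)) = exp (- y) * exp (of_nat (2*n+1) * y)"
      unfolding exp_add[symmetric] y_def by (rule arg_cong[where f=exp]) (simp add: algebra_simps)
    have e2: "exp (of_int (- int n - 1) * (2 * of_real pi * \<i> * x)) = exp (- y) * exp (- (of_nat (2*n+1) * y))"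
      unfolding exp_add[symmetric] y_def by (rule arg_cong[where f=exp]) (simp add: algebra_simps)
    define G g1 g2 k e where "G = complex_of_real (qh powr ((real n + 1/2)\<^sup>2))" "g1 = exp (of_nat (2*n+1) * y)"
      "g2 = exp (- (of_nat (2*n+1) * y))" "k = complex_of_real (qh powr (-1/4))" "e = exp (- y)"
    have f1: "f (int n) = (-1) ^ n * k * G * (e * g1)"
      unfolding fe e1 G_g1_g2_k_e_def by simp
    have f2: "f (- int n - 1) = - ((-1) ^ n) * k * G * (e * g2)"
      unfolding fe e2 m sq G_g1_g2_k_e_def by simp
    have "K * (2 * ((-1) ^ n * G * sin (of_nat (2 * n + 1) * (of_real pi * x)))) = K * ((-1) ^ n * G) * (2 * sin (of_nat (2 * n + 1) * (of_real pi * x)))"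
      by (simp only: mult_ac)
    also have "\<dots> = \<i> * k * e * ((-1) ^ n * G) * (- \<i> * (g1 - g2))"
      unfolding s K_def G_g1_g2_k_e_def y_def by simp
    also have "\<dots> = f (int n) + f (- int n - 1)" unfolding f1 f2 by (simp add: algebra_simps)
    finally show ?thesis unfolding G_g1_g2_k_e_def ..
  qed
  have "(\<lambda>n. f (int n) + f (- int n - 1)) sums P_exp (sigma + x)"
    unfolding f_def by (rule has_sum_int_fold[OF P_exp_series[of "sigma + x"]])
  then have s: "(\<lambda>n. K * (2 * ((-1) ^ n * of_real (qh powr ((real n + 1/2)\<^sup>2)) * sin (of_nat (2 * n + 1) * (of_real pi * x))))) sums P_exp (sigma + x)"
    unfolding pair .
  then have "(\<lambda>n. 2 * ((-1) ^ n * of_real (qh powr ((real n + 1/2)\<^sup>2)) * sin (of_nat (2 * n + 1) * (of_real pi * x)))) sums (P_exp (sigma + x) / K)"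
    using sums_mult[OF s, of "1 / K"] K by (simp add: divide_simps mult_ac)
  from sums_mult[OF this, of "1/2"]
  have "(\<lambda>n. (-1) ^ n * of_real (qh powr ((real n + 1/2)\<^sup>2)) * sin (of_nat (2 * n + 1) * (of_real pi * x))) sums (P_exp (sigma + x) / K / 2)"
    by (simp add: mult.commute)
  then show ?thesis unfolding K_def .
qed

lemma P_exp_sigma_eq: "P_exp (sigma + x) = \<i> * of_real (qh powr (-1/4)) * exp (- (\<i> * of_real pi * x)) * theta1_pi x"
  unfolding theta1_pi_def theta1_def sums_unique[OF P_exp_sigma_sums, symmetric] using qh_pos by simp

lemma theta1_pi_P_exp: "theta1_pi x = - \<i> * of_real (qh powr (1/4)) * exp (\<i> * of_real pi * x) * P_exp (sigma + x)"
proof -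
  have "of_real (qh powr (1/4)) * complex_of_real (qh powr (-1/4)) = 1"
    unfolding of_real_mult[symmetric] powr_add[symmetric] using qh_pos by simp
  moreover have "exp (\<i> * of_real pi * x) * exp (- (\<i> * of_real pi * x)) = 1" unfolding exp_add[symmetric] by simp
  moreover have "- \<i> * k * e * (\<i> * k' * e' * v) = k * k' * (e * e') * v" for k e k' e' v
  proof -
    have "- \<i> * k * e * (\<i> * k' * e' * v) = - (\<i> * \<i>) * (k * k' * (e * e') * v)" by algebra
    then show ?thesis by simp
  qed
  ultimately show ?thesis unfolding P_exp_sigma_eq by simp
qed

lemma theta1_pi_holo: "theta1_pi holomorphic_on A"
proof -
  have "(\<lambda>x. - \<i> * of_real (qh powr (1/4)) * exp (\<i> * of_real pi * x) * (P_exp \<circ> (\<lambda>x. sigma + x)) x) holomorphic_on A"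
    by (intro holomorphic_intros holomorphic_on_compose P_exp_holo)
  then show ?thesis by (simp add: theta1_pi_P_exp[abs_def] o_def)
qed

lemma theta1_pi_zero_iff: "theta1_pi x = 0 \<longleftrightarrow> (\<exists>n m. x = of_int n + of_int m * tau)"
  unfolding theta1_pi_P_exp using P_exp_zero_iff qh_pos by simp

lemma theta1_pi_odd: "theta1_pi (- x) = - theta1_pi x"
proof -
  have "(\<lambda>n. (-1) ^ n * of_real (qh powr ((real n + 1/2)\<^sup>2)) * sin (of_nat (2 * n + 1) * (of_real pi * (- x)))) =
    (\<lambda>n. - ((-1) ^ n * of_real (qh powr ((real n + 1/2)\<^sup>2)) * sin (of_nat (2 * n + 1) * (of_real pi * x))) :: complex)"
    by (simp add: fun_eq_iff)
  then show ?thesis unfolding theta1_pi_def theta1_def using suminf_minus[OF sums_summable[OF P_exp_sigma_sums[of x]]] by simp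
qed

lemma theta1_pi_1: "theta1_pi (x + 1) = - theta1_pi x"
  unfolding theta1_pi_P_exp add.assoc[symmetric] P_exp_1 by (simp add: distrib_left exp_add)

definition theta1_pi' :: "complex \<Rightarrow> complex" where "theta1_pi' = deriv theta1_pi"

lemma theta1_pi_deriv: "(theta1_pi has_field_derivative theta1_pi' x) (at x)"
  unfolding theta1_pi'_def by (rule holomorphic_derivI[OF theta1_pi_holo open_UNIV UNIV_I])

lemma theta1_pi'_theta1': "theta1_pi' x = of_real pi * theta1' (of_real pi * x) qh"
proof -
  have "(theta1_pi has_field_derivative theta1_pi' (of_real pi * x / of_real pi)) (at (of_real pi * x / of_real pi))" by (rule theta1_pi_deriv)
  from DERIV_chain2[where f=theta1_pi and g="\<lambda>y. y / of_real pi" and Db="1 / of_real pi" and s=UNIV, OF this]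
  have "((\<lambda>y. theta1_pi (y / of_real pi)) has_field_derivative theta1_pi' x * (1 / of_real pi)) (at (of_real pi * x))"
    using DERIV_cdivide[OF DERIV_ident, of "of_real pi" "of_real pi * x" UNIV] by simp
  then have "((\<lambda>y. theta1 y qh) has_field_derivative theta1_pi' x / of_real pi) (at (of_real pi * x))"
    by (simp add: theta1_pi_def)
  then show ?thesis unfolding theta1'_def by (simp add: DERIV_imp_deriv)
qed

lemma theta1_pi_0: "theta1_pi 0 = 0" using theta1_pi_zero_iff[of 0] by (auto intro: exI[of _ 0])

text \<open>Differentiate both expressions of \<open>P_exp\<close> at its zero \<open>sigma\<close>: the product, with \<open>theta_q_deriv\<close>, and the
  series. This is where the constant of the statement comes from.\<close>
lemma theta1_pi'_0: "theta1_pi' 0 = of_real ((ln q)\<^sup>2 * C_q q * q powr (1/8)) * qp Q ^ 3"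
proof -
  have g: "exp (sigma * L) = -1" unfolding sigma_L by (simp add: exp_minus)
  have "((\<lambda>s. exp (s * L)) has_field_derivative (exp (sigma * L) * L)) (at sigma)"
    by (auto intro!: derivative_eq_intros)
  from theta_comp_deriv[OF qbase_axioms this g]
  have 1: "((\<lambda>s. th (exp (s * L))) has_field_derivative (qp Q ^ 3 * (-1 * L))) (at sigma)" unfolding g .
  have th0: "th (exp (sigma * L)) = 0" unfolding g using theta_q_eq_0_iff[of "-1"] by (auto intro: exI[of _ 0])
  obtain E' where E': "((\<lambda>s. - L * of_real (C_q q) * E_q q (s * L)) has_field_derivative E') (at sigma)"
  proof -
    have "(\<lambda>s. - L * of_real (C_q q) * E_q q (s * L)) holomorphic_on UNIV"
      unfolding E_q_exponent by (intro holomorphic_intros) auto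
    then show thesis using that holomorphic_derivI open_UNIV UNIV_I by blast
  qed
  have 2: "(P_exp has_field_derivative (- L * of_real (C_q q) * E_q q (sigma * L)) * (qp Q ^ 3 * (-1 * L))) (at sigma)"
    using DERIV_mult[OF E' 1] unfolding P_exp_eq[abs_def] th0 by (simp add: mult_ac)
  have "((\<lambda>x. P_exp (sigma + x)) has_field_derivative (- L * of_real (C_q q) * E_q q (sigma * L)) * (qp Q ^ 3 * (-1 * L)) * 1) (at 0)"
    by (rule DERIV_chain2[where f=P_exp and g="\<lambda>x. sigma + x"]) (use 2 in \<open>auto intro!: derivative_eq_intros\<close>)
  moreover have "((\<lambda>x. \<i> * of_real (qh powr (-1/4)) * exp (- (\<i> * of_real pi * x)) * theta1_pi x) has_field_derivative \<i> * of_real (qh powr (-1/4)) * theta1_pi' 0) (at 0)"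
    by (auto intro!: derivative_eq_intros theta1_pi_deriv simp: theta1_pi_0)
  ultimately have e: "\<i> * of_real (qh powr (-1/4)) * theta1_pi' 0 = (- L * of_real (C_q q) * E_q q (sigma * L)) * (qp Q ^ 3 * (-1 * L)) * 1"
    unfolding P_exp_sigma_eq using DERIV_unique by blast
  have "E_q q (sigma * L) = \<i> * of_real (qh powr (-1/4)) * of_real (q powr (1/8))"
  proof -
    have "L * (sigma - 1/2)\<^sup>2 / 2 = (sigma * L) * sigma / 2 - sigma * L / 2 + L / 8"
      by (simp add: field_simps power2_eq_square)
    also have "\<dots> = - (of_real pi * \<i> * tau) / 4 + of_real pi / 2 * \<i> + L / 8" unfolding sigma_L by (simp add: sigma_def)
    also have "- (of_real pi * \<i> * tau) / 4 = of_real (-1/4 * ln qh)" unfolding ln_qh tau_def by (simp add: algebra_simps)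
    finally have "E_q q (sigma * L) = exp (of_real (-1/4 * ln qh) + of_real pi / 2 * \<i> + L / 8)" unfolding E_q_exponent by (rule arg_cong)
    also have "\<dots> = of_real (exp (-1/4 * ln qh)) * exp (of_real pi / 2 * \<i>) * of_real (exp (1/8 * ln q))"
      unfolding exp_add exp_of_real[symmetric] by simp
    also have "exp (of_real pi / 2 * \<i>) = \<i>" using cis_conv_exp[of "pi/2"] by (simp add: mult.commute)
    finally show ?thesis using q0 qh_pos by (simp add: powr_def mult_ac)
  qed
  then have "(\<i> * of_real (qh powr (-1/4))) * theta1_pi' 0 = (\<i> * of_real (qh powr (-1/4))) * (of_real ((ln q)\<^sup>2 * C_q q * q powr (1/8)) * qp Q ^ 3)"
    unfolding e by (simp add: power2_eq_square mult_ac)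
  then show ?thesis using qh_pos by simp
qed

lemma theta1_pi'_0_nz: "theta1_pi' 0 \<noteq> 0" unfolding theta1_pi'_0 using ln_q C_q_pos q0 qp_Q_nz by simp

lemma p_const_theta1_pi': "p_const q = of_real pi / theta1_pi' 0"
proof -
  have "sqrt (- 2 * pi ^ 3 / (ln q) ^ 3) = pi / ((ln q)\<^sup>2 * C_q q)"
  proof (rule real_sqrt_unique)
    have "(C_q q)\<^sup>2 = 1 / (- 2 * pi * ln q)" using ln_q by (simp add: C_q_def power_divide mult_nonneg_nonpos)
    then have "(pi / ((ln q)\<^sup>2 * C_q q))\<^sup>2 = pi\<^sup>2 / ((ln q) ^ 4 * (1 / (- 2 * pi * ln q)))"
      by (simp add: power_divide power_mult_distrib flip: power_mult)
    also have "\<dots> = - 2 * pi ^ 3 / (ln q) ^ 3"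
      using ln_q by (simp add: field_simps power_numeral_reduce)
    finally show "(pi / ((ln q)\<^sup>2 * C_q q))\<^sup>2 = - 2 * pi ^ 3 / (ln q) ^ 3" .
  qed (use C_q_pos in simp)
  then show ?thesis unfolding p_const_def theta1_pi'_0 by simp
qed

end

section \<open>Period rectangles, residues and continuous extension\<close>

lemma contour_integral_unit_segment:
  "contour_integral (linepath a (a + d)) f = d * integral {0..1} (\<lambda>x. f (a + of_real x * d))"
proof -
  have "contour_integral (linepath a (a + d)) f = integral {0..1} (\<lambda>x. f (linepath a (a + d) x) * d)"
    unfolding contour_integral_integral by simp
  also have "\<dots> = integral {0..1} (\<lambda>x. d * f (a + of_real x * d))"
    by (simp add: linepath_def scaleR_conv_of_real algebra_simps)
  finally show ?thesis by simp
qed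

text \<open>In the residue theorem for the rectangle the two vertical sides cancel by periodicity.\<close>
lemma periodic_rectangle_integral:
  fixes f :: "complex \<Rightarrow> complex"
  assumes T: "T > 0" and B: "open B" "connected B" "cbox p0 (p0 + Complex 1 T) \<subseteq> B"
    and S: "finite S" "S \<subseteq> box p0 (p0 + Complex 1 T)" and f: "f holomorphic_on B - S"
    and per: "\<And>s. f (s + 1) = f s"
  shows "integral {0..1} (\<lambda>x. f (p0 + of_real x)) - integral {0..1} (\<lambda>x. f (p0 + \<i> * of_real T + of_real x)) =
           2 * of_real pi * \<i> * (\<Sum>z\<in>S. residue f z)"
proof -
  let ?b = "p0 + Complex 1 T"
  have c: "?b = p0 + 1 + \<i> * of_real T" by (simp add: complex_eq_iff)
  have rp: "rectpath p0 ?b = linepath p0 (p0 + 1) +++ linepath (p0 + 1) ?b +++ linepath ?b (p0 + \<i> * of_real T) +++ linepath (p0 + \<i> * of_real T) p0"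
    unfolding rectpath_def Let_def by (rule arg_cong2[where f="(+++)"] arg_cong2[where f=linepath] refl | simp add: complex_eq_iff)+
  have ri: "Re p0 \<le> Re ?b" "Im p0 \<le> Im ?b" using T by auto
  have im: "path_image (rectpath p0 ?b) = cbox p0 ?b - box p0 ?b"
    by (rule path_image_rectpath_cbox_minus_box[OF ri])
  have imB: "path_image (rectpath p0 ?b) \<subseteq> B - S" unfolding im using B S by blast
  have segs: "closed_segment p0 (p0 + 1) \<subseteq> B - S" "closed_segment (p0 + 1) ?b \<subseteq> B - S"
    "closed_segment ?b (p0 + \<i> * of_real T) \<subseteq> B - S" "closed_segment (p0 + \<i> * of_real T) p0 \<subseteq> B - S"
    using imB unfolding rp by (simp_all add: path_image_join)
  have ci: "f contour_integrable_on linepath u v" if "closed_segment u v \<subseteq> B - S" for u v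
    by (rule contour_integrable_continuous_linepath)
       (rule continuous_on_subset[OF holomorphic_on_imp_continuous_on[OF f] that])
  have R: "contour_integral (rectpath p0 ?b) f = complex_of_real (2 * pi) * \<i> * (\<Sum>z\<in>S. winding_number (rectpath p0 ?b) z * residue f z)"
  proof (rule Residue_theorem[OF B(1,2) S(1) f])
    show "\<forall>z. z \<notin> B \<longrightarrow> winding_number (rectpath p0 ?b) z = 0"
      using winding_number_rectpath_outside[OF ri] B(3) by blast
  qed (use imB in auto)
  have "contour_integral (rectpath p0 ?b) f = 2 * of_real pi * \<i> * (\<Sum>z\<in>S. winding_number (rectpath p0 ?b) z * residue f z)"
    unfolding R by simp
  also have "(\<Sum>z\<in>S. winding_number (rectpath p0 ?b) z * residue f z) = (\<Sum>z\<in>S. residue f z)"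
    using S(2) winding_number_rectpath by (intro sum.cong) auto
  also have "contour_integral (rectpath p0 ?b) f = contour_integral (linepath p0 (p0 + 1)) f + (contour_integral (linepath (p0 + 1) ?b) f
      + (contour_integral (linepath ?b (p0 + \<i> * of_real T)) f + contour_integral (linepath (p0 + \<i> * of_real T) p0) f))"
    unfolding rp using ci segs by simp
  also have "contour_integral (linepath (p0 + 1) ?b) f = contour_integral (linepath p0 (p0 + \<i> * of_real T)) f"
  proof -
    have "p0 + 1 + of_real x * (\<i> * of_real T) = p0 + of_real x * (\<i> * of_real T) + 1" for x by simp
    then have "f (p0 + 1 + of_real x * (\<i> * of_real T)) = f (p0 + of_real x * (\<i> * of_real T))" for x by (simp only: per)
    then show ?thesis unfolding c contour_integral_unit_segment by simp
  qed
  also have "contour_integral (linepath (p0 + \<i> * of_real T) p0) f = - contour_integral (linepath p0 (p0 + \<i> * of_real T)) f"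
    using contour_integral_reversepath[of "linepath p0 (p0 + \<i> * of_real T)" f] by simp
  also have "contour_integral (linepath ?b (p0 + \<i> * of_real T)) f = - contour_integral (linepath (p0 + \<i> * of_real T) (p0 + \<i> * of_real T + 1)) f"
    using contour_integral_reversepath[of "linepath (p0 + \<i> * of_real T) (p0 + \<i> * of_real T + 1)" f] unfolding c by (simp add: add_ac)
  also have "contour_integral (linepath (p0 + \<i> * of_real T) (p0 + \<i> * of_real T + 1)) f = integral {0..1} (\<lambda>x. f (p0 + \<i> * of_real T + of_real x))"
    unfolding contour_integral_unit_segment by simp
  also have "contour_integral (linepath p0 (p0 + 1)) f = integral {0..1} (\<lambda>x. f (p0 + of_real x))"
    unfolding contour_integral_unit_segment by simp
  finally show ?thesis by simp
qed

lemma residue_quotient: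
  assumes s: "open s" "z \<in> s" and F: "F holomorphic_on s" and G: "G holomorphic_on s"
    and nz: "\<And>w. w \<in> s \<Longrightarrow> w \<noteq> z \<Longrightarrow> G w \<noteq> 0" and z: "G z = 0" "(G has_field_derivative D) (at z)" "D \<noteq> 0"
  shows "residue (\<lambda>w. F w / G w) z = F z / D"
proof (rule residue_simple'[OF s])
  show "(\<lambda>w. F w / G w) holomorphic_on s - {z}"
    using nz by (intro holomorphic_intros holomorphic_on_subset[OF F] holomorphic_on_subset[OF G]) auto
  have "(F \<longlongrightarrow> F z) (at z)"
    using holomorphic_on_imp_continuous_on[OF F] s by (simp add: continuous_on_eq_continuous_at isCont_def)
  moreover have "((\<lambda>w. (G w - G z) / (w - z)) \<longlongrightarrow> D) (at z)"
    using z(2) by (simp add: has_field_derivative_iff)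
  ultimately have "((\<lambda>w. F w / ((G w - G z) / (w - z))) \<longlongrightarrow> F z / D) (at z)"
    using z(3) by (intro tendsto_divide)
  then show "((\<lambda>w. F w / G w * (w - z)) \<longlongrightarrow> F z / D) (at z)" using z(1) by simp
qed

text \<open>The part of the interval to the left of \<open>0\<close> is moved by one period.\<close>
lemma integral_unit_period:
  fixes g :: "real \<Rightarrow> complex"
  assumes g: "continuous_on UNIV g" and per: "\<And>s. g (s + 1) = g s" and x: "-1 \<le> x" "x \<le> 0"
  shows "integral {x..x+1} g = integral {0..1} g"
proof -
  have gi: "g integrable_on {a..b}" for a b
    by (intro integrable_continuous_real continuous_on_subset[OF g]) simp
  have "integral {x..0} g = integral {x..0} (g \<circ> (\<lambda>s. s + 1))" by (simp add: o_def per)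
  also have "\<dots> = integral {x+1..1} g"
    using integral_shift[where f=g and a=x and b=0 and c=1] continuous_on_subset[OF g] by simp
  finally have 1: "integral {x..0} g = integral {x+1..1} g" .
  have "integral {x..0} g + integral {0..x+1} g = integral {x..x+1} g"
    using x by (intro Henstock_Kurzweil_Integration.integral_combine gi) auto
  moreover have "integral {0..x+1} g + integral {x+1..1} g = integral {0..1} g"
    using x by (intro Henstock_Kurzweil_Integration.integral_combine gi) auto
  ultimately show ?thesis using 1 by (simp add: add.commute)
qed

lemma integral_unit_shift:
  fixes g :: "real \<Rightarrow> complex"
  assumes g: "continuous_on UNIV g"
  shows "integral {x..x+1} g = integral {0..1} (\<lambda>s. g (x + s))"
  using integral_shift[where f=g and a=0 and b=1 and c=x] continuous_on_subset[OF g]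
  by (simp add: o_def add.commute)

text \<open>A continuous function that agrees with the formula on \<open>D\<close> identifies the limit at the points of
  accumulation.\<close>
lemma cont_ext_eqI:
  fixes f :: "'a::t2_space \<Rightarrow> complex"
  assumes W: "open W" "x \<in> W" and G: "continuous_on W G" and eq: "\<And>y. y \<in> D \<Longrightarrow> y \<in> W \<Longrightarrow> f y = G y"
    and lim: "x islimpt D"
  shows "cont_ext D f x = G x"
proof (cases "x \<in> D")
  case True then show ?thesis using eq W by (simp add: cont_ext_def)
next
  case False
  have "(G \<longlongrightarrow> G x) (at x)" using G W by (simp add: continuous_on_eq_continuous_at isCont_def)
  then have "(G \<longlongrightarrow> G x) (at x within D)" by (rule tendsto_within_subset) simp
  moreover have "\<forall>\<^sub>F y in at x within D. f y = G y"
    using eventually_at_topological W eq by blast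
  ultimately have "(f \<longlongrightarrow> G x) (at x within D)" using tendsto_cong by blast
  then have "Lim (at x within D) f = G x" using lim trivial_limit_within by (intro tendsto_Lim) auto
  then show ?thesis using False by (simp add: cont_ext_def)
qed

lemma generic_real_shift:
  fixes a b c e :: real
  assumes "e > 0"
  obtains r where "0 < r" "r < e" "\<And>n::int. a + r \<noteq> of_int n" "\<And>n::int. b + r \<noteq> of_int n" "\<And>n::int. c + 2 * r \<noteq> of_int n"
proof -
  define X where "X = range (\<lambda>n::int. of_int n - a) \<union> range (\<lambda>n::int. of_int n - b) \<union> range (\<lambda>n::int. (of_int n - c) / 2)"
  have "countable X" unfolding X_def by (intro countable_Un countable_image) auto
  moreover have "uncountable {0<..<e}" using assms uncountable_open_interval by simp
  ultimately have "\<not> {0<..<e} \<subseteq> X" using countable_subset by blast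
  then obtain r where "r \<in> {0<..<e}" "r \<notin> X" by blast
  then have r: "0 < r" "r < e" "r \<notin> X" by auto
  have "a + r \<noteq> of_int n" "b + r \<noteq> of_int n" "c + 2 * r \<noteq> of_int n" for n
    using r(3) unfolding X_def by (auto simp: image_iff algebra_simps)
  with r show thesis using that by blast
qed

text \<open>Moving both exponents by the same small real number avoids the countably many real parts at which a
  formula for \<open>p\<close> may degenerate.\<close>
lemma islimpt_diagonal_shift:
  fixes D :: "(complex \<times> complex) set"
  assumes "\<And>r::real. (\<And>n::int. Re \<alpha> + r \<noteq> of_int n) \<Longrightarrow> (\<And>n::int. Re \<zeta> + r \<noteq> of_int n) \<Longrightarrow>
      (\<And>n::int. Re (\<alpha> + \<zeta>) + 2 * r \<noteq> of_int n) \<Longrightarrow> (\<alpha> + of_real r, \<zeta> + of_real r) \<in> D"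
  shows "(\<alpha>, \<zeta>) islimpt D"
  unfolding islimpt_approachable
proof (intro allI impI)
  fix e :: real assume e: "0 < e"
  then obtain r where r: "0 < r" "r < e / 2" "\<And>n::int. Re \<alpha> + r \<noteq> of_int n" "\<And>n::int. Re \<zeta> + r \<noteq> of_int n"
      "\<And>n::int. Re (\<alpha> + \<zeta>) + 2 * r \<noteq> of_int n"
    using generic_real_shift[of "e / 2" "Re \<alpha>" "Re \<zeta>" "Re (\<alpha> + \<zeta>)"] by auto
  have "dist (\<alpha> + of_real r, \<zeta> + of_real r) (\<alpha>, \<zeta>) \<le> r + r"
    using norm_Pair_le[of "complex_of_real r" "complex_of_real r"] r by (simp add: dist_norm)
  then show "\<exists>x'\<in>D. x' \<noteq> (\<alpha>, \<zeta>) \<and> dist x' (\<alpha>, \<zeta>) < e"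
    using assms[OF r(3-5)] r by (intro bexI[of _ "(\<alpha> + of_real r, \<zeta> + of_real r)"]) auto
qed

context qbase
begin

lemma P_exp_nz: "\<bar>Im s\<bar> < per / 2 \<Longrightarrow> P_exp s \<noteq> 0"
proof
  assume s: "\<bar>Im s\<bar> < per / 2" and "P_exp s = 0"
  then obtain n m where "s - sigma = of_int n + of_int m * tau" using P_exp_zero_iff[of "s - sigma"] by auto
  then have "Im s - per / 2 = of_int m * per" by (auto simp: complex_eq_iff sigma_def tau_def)
  then have i: "Im s = (of_int m + 1/2) * per" by (simp add: algebra_simps)
  have "1/2 \<le> \<bar>real_of_int m + 1/2\<bar>" by (cases "m \<ge> 0") auto
  then have "1/2 * per \<le> \<bar>Im s\<bar>" unfolding i abs_mult using per_pos by (simp add: mult_right_mono)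
  then show False using s by simp
qed

lemma P_exp_cont [continuous_intros]: "continuous_on A f \<Longrightarrow> continuous_on A (\<lambda>x. P_exp (f x))"
  using holomorphic_on_imp_continuous_on[OF P_exp_holo[of UNIV]] continuous_on_compose2 by blast

lemma P_exp_holo_comp [holomorphic_intros]: "f holomorphic_on A \<Longrightarrow> (\<lambda>x. P_exp (f x)) holomorphic_on A"
  using holomorphic_on_compose[OF _ P_exp_holo] by (simp add: o_def)

definition P_exp' :: "complex \<Rightarrow> complex" where "P_exp' = deriv P_exp"

lemma P_exp_deriv: "(P_exp has_field_derivative P_exp' s) (at s)"
  unfolding P_exp'_def by (rule holomorphic_derivI[OF P_exp_holo open_UNIV UNIV_I])

lemma P_exp'_holo_comp [holomorphic_intros]: "f holomorphic_on A \<Longrightarrow> (\<lambda>x. P_exp' (f x)) holomorphic_on A"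
  using holomorphic_on_compose[OF _ holomorphic_on_subset[OF holomorphic_deriv[OF P_exp_holo open_UNIV]]]
  by (simp add: o_def P_exp'_def)

lemma P_exp'_cont [continuous_intros]: "continuous_on A f \<Longrightarrow> continuous_on A (\<lambda>x. P_exp' (f x))"
proof (rule continuous_on_compose2[of UNIV P_exp'])
  show "continuous_on UNIV P_exp'"
    unfolding P_exp'_def by (intro holomorphic_on_imp_continuous_on holomorphic_deriv P_exp_holo open_UNIV)
qed auto

lemma P_exp'_1: "P_exp' (s + 1) = P_exp' s"
proof -
  have "((\<lambda>s. P_exp (s + 1)) has_field_derivative P_exp' (s + 1) * 1) (at s)"
    by (rule DERIV_chain2[where f=P_exp and g="\<lambda>s. s + 1", OF P_exp_deriv]) (auto intro!: derivative_eq_intros)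
  then show ?thesis unfolding P_exp_1 using DERIV_unique[OF _ P_exp_deriv, of _ s] by simp
qed

text \<open>The multiplier of \<open>P_exp\<close> under \<open>s \<mapsto> s + tau\<close>.\<close>
definition tau_factor :: "complex \<Rightarrow> complex" where "tau_factor s = - (exp (- (2 * of_real pi * \<i> * s)) / H)"

lemma H_nz: "H \<noteq> 0" using qh_pos by simp

lemma P_exp'_tau: "P_exp' (s + tau) = tau_factor s * (P_exp' s - 2 * of_real pi * \<i> * P_exp s)"
proof -
  have "((\<lambda>s. P_exp (s + tau)) has_field_derivative P_exp' (s + tau) * 1) (at s)"
    by (rule DERIV_chain2[where f=P_exp and g="\<lambda>s. s + tau", OF P_exp_deriv]) (auto intro!: derivative_eq_intros)
  moreover have mk: "tau_factor = (\<lambda>s. (- 1 / H) * exp (- (2 * of_real pi * \<i> * s)))" by (simp add: fun_eq_iff tau_factor_def)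
  have "((\<lambda>s. k * exp (- (2 * of_real pi * \<i> * s)) * P_exp s) has_field_derivative k * exp (- (2 * of_real pi * \<i> * s)) * (P_exp' s - 2 * of_real pi * \<i> * P_exp s)) (at s)" for k
    by (auto intro!: derivative_eq_intros P_exp_deriv simp: algebra_simps)
  from this[of "- 1 / H"] have "((\<lambda>s. tau_factor s * P_exp s) has_field_derivative tau_factor s * (P_exp' s - 2 * of_real pi * \<i> * P_exp s)) (at s)"
    unfolding mk .
  ultimately show ?thesis unfolding P_exp_tau tau_factor_def[symmetric] using DERIV_unique by fastforce
qed

definition sigma_const :: complex where "sigma_const = \<i> * of_real (qh powr (-1/4))"

lemma sigma_const_nz: "sigma_const \<noteq> 0" using qh_pos by (simp add: sigma_const_def)

lemma P_exp_sigma_shift: "P_exp (sigma + x) = sigma_const * exp (- (\<i> * of_real pi * x)) * theta1_pi x"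
  by (simp add: P_exp_sigma_eq sigma_const_def)

lemma P_exp'_sigma_shift: "P_exp' (sigma + x) = sigma_const * exp (- (\<i> * of_real pi * x)) * (theta1_pi' x - \<i> * of_real pi * theta1_pi x)"
proof -
  have "((\<lambda>x. P_exp (sigma + x)) has_field_derivative P_exp' (sigma + x) * 1) (at x)"
    by (rule DERIV_chain2[where f=P_exp and g="\<lambda>x. sigma + x", OF P_exp_deriv]) (auto intro!: derivative_eq_intros)
  moreover have "((\<lambda>x. sigma_const * exp (- (\<i> * of_real pi * x)) * theta1_pi x) has_field_derivative
      sigma_const * exp (- (\<i> * of_real pi * x)) * (theta1_pi' x - \<i> * of_real pi * theta1_pi x)) (at x)"
    by (auto intro!: derivative_eq_intros theta1_pi_deriv simp: algebra_simps)
  ultimately show ?thesis unfolding P_exp_sigma_shift using DERIV_unique by fastforce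
qed

lemma P_exp'_sigma: "P_exp' sigma = sigma_const * theta1_pi' 0" using P_exp'_sigma_shift[of 0] by (simp add: theta1_pi_0)

lemma P_exp_sigma: "P_exp sigma = 0" using P_exp_sigma_shift[of 0] by (simp add: theta1_pi_0)

lemma P_exp'_sigma_nz: "P_exp' sigma \<noteq> 0" unfolding P_exp'_sigma using sigma_const_nz theta1_pi'_0_nz by simp

lemma theta1_pi'_1: "theta1_pi' (x + 1) = - theta1_pi' x"
proof -
  have "((\<lambda>s. theta1_pi (s + 1)) has_field_derivative theta1_pi' (x + 1) * 1) (at x)"
    by (rule DERIV_chain2[where f=theta1_pi and g="\<lambda>s. s + 1", OF theta1_pi_deriv]) (auto intro!: derivative_eq_intros)
  moreover have "((\<lambda>s. - theta1_pi s) has_field_derivative - theta1_pi' x) (at x)"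
    by (auto intro!: derivative_eq_intros theta1_pi_deriv)
  ultimately show ?thesis unfolding theta1_pi_1 using DERIV_unique by fastforce
qed

lemma Re_sigma [simp]: "Re sigma = 0" and Im_sigma [simp]: "Im sigma = per / 2"
  by (simp_all add: sigma_def tau_def)

lemma P_exp_zero_imp: "P_exp s = 0 \<Longrightarrow> \<exists>n m. Re s = of_int n \<and> Im s = per / 2 + of_int m * per"
proof -
  assume "P_exp s = 0"
  then obtain n m where "s - sigma = of_int n + of_int m * tau" using P_exp_zero_iff[of "s - sigma"] by auto
  then have "s = sigma + of_int n + of_int m * tau" by (simp add: algebra_simps)
  then have "Re s = of_int n \<and> Im s = per / 2 + of_int m * per" by (simp add: tau_def)
  then show ?thesis by blast
qed

section \<open>The coefficient of the Gaussian transform\<close>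

definition period_integral_E :: "complex \<times> complex \<Rightarrow> complex" where
  "period_integral_E = (\<lambda>(\<alpha>, \<zeta>). integral {0..1} (\<lambda>s. P_exp (of_real s + \<alpha>) * P_exp (of_real s - \<zeta> - \<alpha>) / P_exp (of_real s)))"

definition period_integral_theta :: "complex \<times> complex \<Rightarrow> complex" where
  "period_integral_theta = (\<lambda>(\<alpha>, \<zeta>). integral {0..1} (\<lambda>s. P_exp (of_real s + \<alpha>) * P_exp (of_real s - \<zeta> - \<alpha>) / (P_exp (of_real s) * P_exp (of_real s - \<zeta>))))"

lemma P_exp_minus_1: "P_exp (s - 1) = P_exp s" using P_exp_1[of "s - 1"] by simp

lemma period_integral_E_periodic: "period_integral_E (\<alpha> + 1, \<zeta>) = period_integral_E (\<alpha>, \<zeta>)" "period_integral_E (\<alpha>, \<zeta> + 1) = period_integral_E (\<alpha>, \<zeta>)"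
  and period_integral_theta_periodic: "period_integral_theta (\<alpha> + 1, \<zeta>) = period_integral_theta (\<alpha>, \<zeta>)" "period_integral_theta (\<alpha>, \<zeta> + 1) = period_integral_theta (\<alpha>, \<zeta>)"
proof -
  have "P_exp (s + (\<alpha> + 1)) = P_exp (s + \<alpha>)" "P_exp (s - \<zeta> - (\<alpha> + 1)) = P_exp (s - \<zeta> - \<alpha>)"
    "P_exp (s - (\<zeta> + 1) - \<alpha>) = P_exp (s - \<zeta> - \<alpha>)" "P_exp (s - (\<zeta> + 1)) = P_exp (s - \<zeta>)" for s
    using P_exp_1[of "s + \<alpha>"] P_exp_minus_1[of "s - \<zeta> - \<alpha>"] P_exp_minus_1[of "s - \<zeta>"] by (simp_all add: algebra_simps)
  then show "period_integral_E (\<alpha> + 1, \<zeta>) = period_integral_E (\<alpha>, \<zeta>)" "period_integral_E (\<alpha>, \<zeta> + 1) = period_integral_E (\<alpha>, \<zeta>)"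
      "period_integral_theta (\<alpha> + 1, \<zeta>) = period_integral_theta (\<alpha>, \<zeta>)" "period_integral_theta (\<alpha>, \<zeta> + 1) = period_integral_theta (\<alpha>, \<zeta>)"
    unfolding period_integral_E_def period_integral_theta_def by simp_all
qed

lemma period_integral_E_cont: "continuous_on UNIV period_integral_E"
proof -
  have "continuous_on UNIV (\<lambda>x. integral (cbox 0 1) ((\<lambda>x s. P_exp (of_real s + fst x) * P_exp (of_real s - snd x - fst x) / P_exp (of_real s)) x))"
    by (rule integral_continuous_on_param) (auto intro!: continuous_intros P_exp_nz simp: case_prod_beta per_pos)
  then show ?thesis unfolding period_integral_E_def by (simp add: case_prod_beta)
qed

lemma period_integral_theta_cont: "continuous_on {x. \<bar>Im (snd x)\<bar> < per / 2} period_integral_theta"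
proof -
  have "continuous_on {x. \<bar>Im (snd x)\<bar> < per / 2} (\<lambda>x. integral (cbox 0 1) ((\<lambda>x s. P_exp (of_real s + fst x) * P_exp (of_real s - snd x - fst x) / (P_exp (of_real s) * P_exp (of_real s - snd x))) x))"
    by (rule integral_continuous_on_param) (use P_exp_nz per_pos in \<open>auto intro!: continuous_intros simp: case_prod_beta\<close>)
  then show ?thesis unfolding period_integral_theta_def by (simp add: case_prod_beta)
qed

lemma P_exp_pole_box:
  assumes "P_exp s = 0" "-1 < Re s" "Re s < 1" "- per / 2 < Im s" "Im s < 3 * per / 2"
  shows "s = sigma"
proof -
  obtain n m where nm: "Re s = of_int n" "Im s = per / 2 + of_int m * per" using P_exp_zero_imp[OF assms(1)] by blast
  have "n = 0" using assms(2,3) unfolding nm by simp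
  moreover have "(-1) * per < of_int m * per" "of_int m * per < 1 * per" using assms(4,5) unfolding nm by simp_all
  then have "m = 0" using per_pos by (simp only: mult_less_cancel_right_pos)
  ultimately show ?thesis using nm by (simp add: complex_eq_iff)
qed

text \<open>The integrand is multiplied by a constant under \<open>s \<mapsto> s + tau\<close>, so the difference of the two horizontal
  sides of the period rectangle is a multiple of the integral itself. The only pole inside is \<open>sigma\<close>.\<close>
lemma fourier_coefficient:
  assumes X: "sin (of_real pi * \<alpha> + \<i> * of_int n * of_real (ln qh)) \<noteq> 0"
  shows "integral {0..1} (\<lambda>s. P_exp (of_real s + \<alpha>) / P_exp (of_real s) * exp (2 * of_real pi * \<i> * of_real s) powi n) =
    p_const q * theta1_pi \<alpha> / sin (of_real pi * \<alpha> + \<i> * of_int n * of_real (ln qh))"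
proof -
  define Y where "Y = of_real pi * \<alpha> + \<i> * of_int n * of_real (ln qh)"
  define f where "f = (\<lambda>s. P_exp (s + \<alpha>) * exp (of_int n * (2 * of_real pi * \<i> * s)) / P_exp s)"
  define d where "d = integral {0..1} (\<lambda>s. f (of_real s))"
  define p0 where "p0 = complex_of_real (-1/2)"
  define B where "B = box (Complex (-1) (- per / 2)) (Complex 1 (3 * per / 2))"
  have f1: "f (s + 1) = f s" for s
  proof -
    have "P_exp (s + 1 + \<alpha>) = P_exp (s + \<alpha>)" using P_exp_1[of "s + \<alpha>"] by (simp add: add_ac)
    moreover have "of_int n * (2 * of_real pi * \<i> * (s + 1)) = of_int n * (2 * of_real pi * \<i> * s) + of_int n * (2 * of_real pi * \<i>)"
      by (simp add: algebra_simps)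
    moreover have "exp (of_int n * (2 * of_real pi * \<i>)) = 1" using exp_integer_2pi[of "of_int n"] by (simp add: mult_ac)
    ultimately show ?thesis unfolding f_def P_exp_1 by (simp add: exp_add)
  qed
  have ftau: "f (s + tau) = exp (- 2 * \<i> * Y) * f s" for s
  proof -
    have a: "P_exp (s + tau + \<alpha>) = tau_factor (s + \<alpha>) * P_exp (s + \<alpha>)" using P_exp_tau[of "s + \<alpha>"] by (simp add: add_ac tau_factor_def)
    have b: "P_exp (s + tau) = tau_factor s * P_exp s" using P_exp_tau[of s] by (simp add: tau_factor_def)
    have m: "tau_factor (s + \<alpha>) = exp (- (2 * of_real pi * \<i> * \<alpha>)) * tau_factor s"
    proof -
      have "- (2 * of_real pi * \<i> * (s + \<alpha>)) = - (2 * of_real pi * \<i> * \<alpha>) + - (2 * of_real pi * \<i> * s)" by (simp add: algebra_simps)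
      then show ?thesis unfolding tau_factor_def by (simp only: exp_add) simp
    qed
    have m0: "tau_factor s \<noteq> 0" using H_nz by (simp add: tau_factor_def)
    have e: "exp (of_int n * (2 * of_real pi * \<i> * (s + tau))) = exp (of_int n * (2 * of_real pi * \<i> * tau)) * exp (of_int n * (2 * of_real pi * \<i> * s))"
      unfolding exp_add[symmetric] by (rule arg_cong[where f=exp]) (simp add: algebra_simps)
    have y: "exp (- 2 * \<i> * Y) = exp (- (2 * of_real pi * \<i> * \<alpha>)) * exp (of_int n * (2 * of_real pi * \<i> * tau))"
      unfolding exp_add[symmetric] Y_def ln_qh tau_def by (rule arg_cong[where f=exp]) (simp add: algebra_simps)
    show ?thesis unfolding f_def a b m e y using m0 by simp
  qed
  have Bz: "P_exp s \<noteq> 0" if "s \<in> B" "s \<noteq> sigma" for s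
    using P_exp_pole_box[of s] that by (auto simp: B_def in_box_complex_iff)
  have fh: "f holomorphic_on B - {sigma}"
    unfolding f_def using Bz by (auto intro!: holomorphic_intros)
  have sB: "sigma \<in> B" using per_pos by (auto simp: B_def in_box_complex_iff)
  have R: "integral {0..1} (\<lambda>x. f (p0 + of_real x)) - integral {0..1} (\<lambda>x. f (p0 + \<i> * of_real per + of_real x)) =
           2 * of_real pi * \<i> * (\<Sum>z\<in>{sigma}. residue f z)"
  proof (rule periodic_rectangle_integral[OF per_pos])
    show "open B" "connected B" unfolding B_def by (auto intro: convex_connected)
    show "cbox p0 (p0 + Complex 1 per) \<subseteq> B"
      unfolding B_def p0_def using per_pos by (auto simp: in_box_complex_iff in_cbox_complex_iff)
    show "{sigma} \<subseteq> box p0 (p0 + Complex 1 per)" using per_pos by (auto simp: p0_def in_box_complex_iff)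
  qed (use fh f1 in auto)
  have top: "integral {0..1} (\<lambda>x. f (p0 + \<i> * of_real per + of_real x)) = exp (- 2 * \<i> * Y) * integral {0..1} (\<lambda>x. f (p0 + of_real x))"
  proof -
    have "p0 + \<i> * of_real per + of_real x = p0 + of_real x + tau" for x by (simp add: tau_def)
    then have "f (p0 + \<i> * of_real per + of_real x) = exp (- 2 * \<i> * Y) * f (p0 + of_real x)" for x by (simp only: ftau)
    then show ?thesis by (simp only: integral_mult_right)
  qed
  have bot: "integral {0..1} (\<lambda>x. f (p0 + of_real x)) = d"
  proof -
    have c: "continuous_on UNIV (\<lambda>s. f (of_real s))" unfolding f_def
      using P_exp_nz per_pos by (intro continuous_intros) auto
    have "integral {-1/2..-1/2+1} (\<lambda>s. f (of_real s)) = d" unfolding d_def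
      by (rule integral_unit_period[OF c]) (auto simp: f1)
    then show ?thesis unfolding integral_unit_shift[OF c] p0_def of_real_add .
  qed
  have res: "residue f sigma = sigma_const * exp (- (\<i> * of_real pi * \<alpha>)) * theta1_pi \<alpha> * exp (of_int n * (2 * of_real pi * \<i> * sigma)) / (sigma_const * theta1_pi' 0)"
    unfolding f_def P_exp_sigma_shift[symmetric] P_exp'_sigma[symmetric]
    by (rule residue_quotient[of B sigma]) (use Bz sB P_exp_sigma P_exp'_sigma_nz P_exp_deriv in \<open>auto simp: B_def intro!: holomorphic_intros\<close>)
  have eY: "exp (- (\<i> * of_real pi * \<alpha>)) * exp (of_int n * (2 * of_real pi * \<i> * sigma)) = exp (- \<i> * Y)"
    unfolding exp_add[symmetric] Y_def ln_qh tau_def sigma_def by (rule arg_cong[where f=exp]) (simp add: algebra_simps)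
  have "residue f sigma = exp (- \<i> * Y) * theta1_pi \<alpha> / theta1_pi' 0"
    unfolding res eY[symmetric] using sigma_const_nz by simp
  then have "d - exp (- 2 * \<i> * Y) * d = 2 * of_real pi * \<i> * (exp (- \<i> * Y) * theta1_pi \<alpha> / theta1_pi' 0)"
    using R unfolding top bot by simp
  then have eq: "(1 - exp (- 2 * \<i> * Y)) * d = 2 * of_real pi * \<i> * (exp (- \<i> * Y) * theta1_pi \<alpha> / theta1_pi' 0)"
    by (simp only: left_diff_distrib mult_1_left)
  have s: "(1 - exp (- 2 * \<i> * Y)) = exp (- \<i> * Y) * (2 * \<i> * sin Y)"
  proof -
    have "exp (- \<i> * Y) * exp (\<i> * Y) = 1" "exp (- \<i> * Y) * exp (- \<i> * Y) = exp (- 2 * \<i> * Y)"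
      unfolding exp_add[symmetric] by (simp_all add: mult.assoc)
    moreover have "2 * \<i> * sin Y = exp (\<i> * Y) - exp (- \<i> * Y)" unfolding sin_exp_eq by (simp add: field_simps)
    ultimately show ?thesis by (simp only: right_diff_distrib)
  qed
  have "exp (- \<i> * Y) * (2 * \<i>) * (sin Y * d) = exp (- \<i> * Y) * (2 * \<i>) * (of_real pi * theta1_pi \<alpha> / theta1_pi' 0)"
    using eq unfolding s by (simp add: mult_ac)
  moreover have "exp (- \<i> * Y) * (2 * \<i>) \<noteq> 0" by simp
  ultimately have "sin Y * d = of_real pi * theta1_pi \<alpha> / theta1_pi' 0" using mult_left_cancel by blast
  then have "d = p_const q * theta1_pi \<alpha> / sin Y" using X theta1_pi'_0_nz unfolding p_const_theta1_pi' Y_def[symmetric] by (simp add: field_simps)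
  moreover have "d = integral {0..1} (\<lambda>s. P_exp (of_real s + \<alpha>) / P_exp (of_real s) * exp (2 * of_real pi * \<i> * of_real s) powi n)"
    unfolding d_def f_def exp_power_int by simp
  ultimately show ?thesis unfolding Y_def by simp
qed

text \<open>Expand one factor in its Fourier series; each term is evaluated by \<open>fourier_coefficient\<close>.\<close>
lemma period_integral_E_series:
  assumes X: "\<And>n::int. sin (of_real pi * \<alpha> + \<i> * of_int n * of_real (ln qh)) \<noteq> 0"
  shows "period_integral_E (\<alpha>, \<zeta>) = p_const q * theta1 (of_real pi * \<alpha>) qh *
        (\<Sum>\<^sub>\<infinity>n\<in>(UNIV::int set). (-1) powi n * of_real (qh powi (n\<^sup>2)) *
            (exp (- 2 * of_int n * of_real pi * \<i> * (\<alpha> + \<zeta>)) / sin (of_real pi * \<alpha> + \<i> * of_int n * of_real (ln qh))))"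
proof -
  define r where "r = (\<lambda>s::real. P_exp (of_real s + \<alpha>) / P_exp (of_real s))"
  define e where "e = exp (- 2 * of_real pi * \<i> * (\<alpha> + \<zeta>))"
  define E where "E = (\<lambda>s::real. exp (2 * of_real pi * \<i> * of_real s))"
  let ?f = "\<lambda>n s. r s * (hat_coeff n * (e * E s) powi n)"
  have rc: "continuous_on {0..1} r" unfolding r_def using P_exp_nz per_pos by (intro continuous_intros) auto
  have "compact (r ` {0..1})" by (intro compact_continuous_image rc) simp
  then obtain C where C: "C > 0" "\<And>s. s \<in> {0..1} \<Longrightarrow> norm (r s) \<le> C"
    using compact_imp_bounded bounded_pos by (metis imageI)
  have NE: "norm (E s) = 1" for s by (simp add: E_def norm_exp_eq_Re)
  have hs: "((\<lambda>n. integral {0..1} (?f n)) has_sum integral {0..1} (\<lambda>s. \<Sum>\<^sub>\<infinity>n. ?f n s)) UNIV"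
  proof (rule integral_int_sum)
    show "(\<lambda>n. C * norm (hat_coeff n * e powi n)) summable_on UNIV"
      by (intro summable_on_cmult_right hat_coeff_summable) (simp add: e_def)
    show "norm (?f n s) \<le> C * norm (hat_coeff n * e powi n)" if "s \<in> {0..1}" for n s
      unfolding norm_mult[of "r s"] using C(2)[OF that] C(1)
      by (intro mult_mono) (auto simp: norm_mult power_int_mult_distrib norm_power_int NE)
    show "continuous_on {0..1} (?f n)" for n
      unfolding E_def e_def exp_add[symmetric] exp_power_int by (intro continuous_intros rc)
  qed simp
  have "(\<Sum>\<^sub>\<infinity>n. ?f n s) = P_exp (of_real s + \<alpha>) * P_exp (of_real s - \<zeta> - \<alpha>) / P_exp (of_real s)" for s
  proof -
    have "e * E s = exp (2 * of_real pi * \<i> * (of_real s - \<zeta> - \<alpha>))"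
      unfolding e_def E_def exp_add[symmetric] by (rule arg_cong[where f=exp]) (simp add: algebra_simps)
    with P_exp_series[of "of_real s - \<zeta> - \<alpha>"] have "(\<Sum>\<^sub>\<infinity>n. hat_coeff n * (e * E s) powi n) = P_exp (of_real s - \<zeta> - \<alpha>)"
      by (simp add: infsumI)
    then show ?thesis unfolding infsum_cmult_right' by (simp add: r_def)
  qed
  then have "period_integral_E (\<alpha>, \<zeta>) = (\<Sum>\<^sub>\<infinity>n. integral {0..1} (?f n))" using infsumI[OF hs] by (simp add: period_integral_E_def)
  also have "\<dots> = (\<Sum>\<^sub>\<infinity>n. p_const q * theta1 (of_real pi * \<alpha>) qh * ((-1) powi n * of_real (qh powi (n\<^sup>2)) *
            (exp (- 2 * of_int n * of_real pi * \<i> * (\<alpha> + \<zeta>)) / sin (of_real pi * \<alpha> + \<i> * of_int n * of_real (ln qh)))))"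
  proof (rule infsum_cong)
    fix n :: int
    have "?f n = (\<lambda>s. hat_coeff n * e powi n * (P_exp (of_real s + \<alpha>) / P_exp (of_real s) * exp (2 * of_real pi * \<i> * of_real s) powi n))"
      by (simp add: fun_eq_iff r_def E_def power_int_mult_distrib)
    then have "integral {0..1} (?f n) = hat_coeff n * e powi n * integral {0..1} (\<lambda>s. P_exp (of_real s + \<alpha>) / P_exp (of_real s) * exp (2 * of_real pi * \<i> * of_real s) powi n)"
      by (simp only: integral_mult_right)
    also have "\<dots> = hat_coeff n * e powi n * (p_const q * theta1_pi \<alpha> / sin (of_real pi * \<alpha> + \<i> * of_int n * of_real (ln qh)))"
      unfolding fourier_coefficient[OF X] ..
    also have "e powi n = exp (- 2 * of_int n * of_real pi * \<i> * (\<alpha> + \<zeta>))"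
      unfolding e_def exp_power_int by (simp add: mult_ac)
    finally show "integral {0..1} (?f n) = p_const q * theta1 (of_real pi * \<alpha>) qh * ((-1) powi n * of_real (qh powi (n\<^sup>2)) *
            (exp (- 2 * of_int n * of_real pi * \<i> * (\<alpha> + \<zeta>)) / sin (of_real pi * \<alpha> + \<i> * of_int n * of_real (ln qh))))"
      unfolding hat_coeff_def theta1_pi_def by simp
  qed
  finally show ?thesis by (simp only: infsum_cmult_right')
qed

lemma sin_nz: "(\<And>k::int. Re \<alpha> \<noteq> of_int k) \<Longrightarrow> sin (of_real pi * \<alpha> + \<i> * of_int n * of_real (ln qh)) \<noteq> 0"
proof
  assume a: "\<And>k::int. Re \<alpha> \<noteq> of_int k" and "sin (of_real pi * \<alpha> + \<i> * of_int n * of_real (ln qh)) = 0"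
  then obtain k :: int where "of_real pi * \<alpha> + \<i> * of_int n * of_real (ln qh) = of_real (of_int k * pi)" by (auto simp: sin_eq_0)
  then have "Re (of_real pi * \<alpha> + \<i> * of_int n * of_real (ln qh)) = of_int k * pi" by simp
  then have "Re \<alpha> = of_int k" by simp
  then show False using a by blast
qed

lemma pE_exp_eq: "pE_exp q x = period_integral_E x"
proof -
  obtain \<alpha> \<zeta> where x: "x = (\<alpha>, \<zeta>)" by (cases x)
  show ?thesis
    unfolding pE_exp_def x
  proof (rule cont_ext_eqI[OF open_UNIV UNIV_I period_integral_E_cont])
    show "(\<alpha>, \<zeta>) islimpt {(\<alpha>, \<zeta>). \<forall>n::int. sin (of_real pi * \<alpha> + \<i> * of_int n * of_real (ln qh)) \<noteq> 0}"
      by (rule islimpt_diagonal_shift) (use sin_nz in auto)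
  qed (use period_integral_E_series in auto)
qed

section \<open>The coefficient of the theta transform\<close>

text \<open>The integrand is elliptic, so a shift by \<open>tau\<close> gives nothing. Replacing one factor by its derivative gives
  a function \<open>\<Omega>\<close> whose increment under \<open>s \<mapsto> s + tau\<close> is \<open>- 2 pi i\<close> times the integrand. Hence the integral
  is the sum of the residues of \<open>\<Omega>\<close> at \<open>sigma\<close> and \<open>sigma + \<zeta>\<close>.\<close>
lemma period_integral_theta_residues_unit:
  assumes z: "0 \<le> Re \<zeta>" "Re \<zeta> < 1" "\<bar>Im \<zeta>\<bar> < per / 2" and V: "theta1_pi \<zeta> \<noteq> 0"
  shows "period_integral_theta (\<alpha>, \<zeta>) = (theta1_pi' \<alpha> * theta1_pi (\<alpha> + \<zeta>) - theta1_pi' (\<alpha> + \<zeta>) * theta1_pi \<alpha>) / (theta1_pi' 0 * theta1_pi \<zeta>)"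
proof -
  define f where "f = (\<lambda>s. P_exp (s + \<alpha>) * P_exp (s - \<zeta> - \<alpha>) / (P_exp s * P_exp (s - \<zeta>)))"
  define \<Omega> where "\<Omega> = (\<lambda>s. P_exp' (s + \<alpha>) * P_exp (s - \<zeta> - \<alpha>) / (P_exp s * P_exp (s - \<zeta>)))"
  \<comment> \<open>halfway between \<open>Re \<zeta> - 1\<close> and \<open>0\<close>, so that both poles lie strictly between the vertical sides\<close>
  define x0 where "x0 = (Re \<zeta> - 1) / 2"
  define p0 where "p0 = complex_of_real x0"
  \<comment> \<open>the margin by which the rectangle can be enlarged vertically without meeting further poles\<close>
  define h where "h = per / 2 - \<bar>Im \<zeta>\<bar>"
  define B where "B = box (Complex (Re \<zeta> - 1) (- h)) (Complex 1 (per + h))"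
  have h: "h > 0" using z by (simp add: h_def)
  have x0: "-1 \<le> x0" "x0 \<le> 0" "x0 < 0" "Re \<zeta> < x0 + 1" "Re \<zeta> - 1 < x0" "x0 + 1 < 1" using z by (auto simp: x0_def field_simps)
  have z0: "\<zeta> \<noteq> 0" using V theta1_pi_0 by auto
  have shift: "P_exp (s + 1 + c) = P_exp (s + c)" "P_exp (s + 1 - c) = P_exp (s - c)" "P_exp' (s + 1 + c) = P_exp' (s + c)" for s c
    using P_exp_1[of "s + c"] P_exp_1[of "s - c"] P_exp'_1[of "s + c"] by (simp_all add: algebra_simps)
  have shift2: "P_exp (s + 1 - c - d) = P_exp (s - c - d)" for s c d using shift(2)[of s "c + d"] by (simp add: diff_diff_eq)
  have f1: "f (s + 1) = f s" and O1: "\<Omega> (s + 1) = \<Omega> s" for s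
    unfolding f_def \<Omega>_def shift shift2 P_exp_1 by simp_all
  have Otau: "\<Omega> (s + tau) = \<Omega> s - 2 * of_real pi * \<i> * f s" for s
  proof -
    have t: "P_exp (s + tau + c) = tau_factor (s + c) * P_exp (s + c)" for c using P_exp_tau[of "s + c"] by (simp add: add_ac tau_factor_def)
    have t0: "P_exp (s + tau) = tau_factor s * P_exp s" using t[of 0] by simp
    have t1: "P_exp (s + tau - \<zeta>) = tau_factor (s - \<zeta>) * P_exp (s - \<zeta>)" using t[of "- \<zeta>"] by simp
    have t2: "P_exp (s + tau - \<zeta> - \<alpha>) = tau_factor (s - \<zeta> - \<alpha>) * P_exp (s - \<zeta> - \<alpha>)"
    proof -
      have "s + tau + (- \<zeta> - \<alpha>) = s + tau - \<zeta> - \<alpha>" "s + (- \<zeta> - \<alpha>) = s - \<zeta> - \<alpha>" by simp_all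
      then show ?thesis using t[of "- \<zeta> - \<alpha>"] by metis
    qed
    have t3: "P_exp' (s + tau + \<alpha>) = tau_factor (s + \<alpha>) * (P_exp' (s + \<alpha>) - 2 * of_real pi * \<i> * P_exp (s + \<alpha>))"
      using P_exp'_tau[of "s + \<alpha>"] by (simp add: add_ac)
    have m: "tau_factor (s + \<alpha>) * tau_factor (s - \<zeta> - \<alpha>) = tau_factor s * tau_factor (s - \<zeta>)"
    proof -
      have "exp (- (2 * of_real pi * \<i> * (s + \<alpha>))) * exp (- (2 * of_real pi * \<i> * (s - \<zeta> - \<alpha>))) =
            exp (- (2 * of_real pi * \<i> * s)) * exp (- (2 * of_real pi * \<i> * (s - \<zeta>)))"
        unfolding exp_add[symmetric] by (rule arg_cong[where f=exp]) (simp add: algebra_simps)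
      then show ?thesis unfolding tau_factor_def by simp
    qed
    have nz: "tau_factor s * tau_factor (s - \<zeta>) \<noteq> 0" using H_nz by (simp add: tau_factor_def)
    have "\<Omega> (s + tau) = (tau_factor (s + \<alpha>) * tau_factor (s - \<zeta> - \<alpha>)) * ((P_exp' (s + \<alpha>) - 2 * of_real pi * \<i> * P_exp (s + \<alpha>)) * P_exp (s - \<zeta> - \<alpha>)) /
       ((tau_factor s * tau_factor (s - \<zeta>)) * (P_exp s * P_exp (s - \<zeta>)))"
      unfolding \<Omega>_def t0 t1 t2 t3 by (simp only: mult_ac)
    also have "\<dots> = ((P_exp' (s + \<alpha>) - 2 * of_real pi * \<i> * P_exp (s + \<alpha>)) * P_exp (s - \<zeta> - \<alpha>)) / (P_exp s * P_exp (s - \<zeta>))"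
      unfolding m by (rule mult_divide_mult_cancel_left[OF nz])
    also have "\<dots> = \<Omega> s - 2 * of_real pi * \<i> * f s"
      unfolding \<Omega>_def f_def by (simp only: left_diff_distrib diff_divide_distrib times_divide_eq_right mult.assoc)
    finally show ?thesis .
  qed
  have Bz1: "s = sigma" if s: "s \<in> B" "P_exp s = 0" for s
  proof (rule P_exp_pole_box[OF s(2)])
    have "Im s > - h" "Im s < per + h" using s by (auto simp: B_def in_box_complex_iff)
    then show "- per / 2 < Im s" "Im s < 3 * per / 2" by (auto simp: h_def)
  qed (use s z in \<open>auto simp: B_def in_box_complex_iff\<close>)
  have Bz2: "s = sigma + \<zeta>" if s: "s \<in> B" "P_exp (s - \<zeta>) = 0" for s
  proof -
    have "s - \<zeta> = sigma"
    proof (rule P_exp_pole_box[OF s(2)])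
      have "Im s > - h" "Im s < per + h" using s by (auto simp: B_def in_box_complex_iff)
      then show "- per / 2 < Im (s - \<zeta>)" "Im (s - \<zeta>) < 3 * per / 2" by (auto simp: h_def)
    qed (use s z in \<open>auto simp: B_def in_box_complex_iff\<close>)
    then show ?thesis by (simp add: algebra_simps)
  qed
  have inS: "{sigma, sigma + \<zeta>} \<subseteq> box p0 (p0 + Complex 1 per)"
    using x0 z by (auto simp: p0_def in_box_complex_iff)
  have box: "cbox p0 (p0 + Complex 1 per) \<subseteq> B"
    unfolding B_def p0_def using x0 h per_pos by (auto simp: in_box_complex_iff in_cbox_complex_iff)
  have sB: "sigma \<in> B" "sigma + \<zeta> \<in> B" using inS box box_subset_cbox by blast+
  have oB: "open B" "connected B" unfolding B_def by (auto intro: convex_connected)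
  have "\<Omega> holomorphic_on B - {sigma, sigma + \<zeta>}"
    unfolding \<Omega>_def using Bz1 Bz2 by (intro holomorphic_intros) auto
  from periodic_rectangle_integral[OF per_pos oB box _ inS this O1]
  have R: "integral {0..1} (\<lambda>x. \<Omega> (p0 + of_real x)) - integral {0..1} (\<lambda>x. \<Omega> (p0 + \<i> * of_real per + of_real x)) =
           2 * of_real pi * \<i> * (residue \<Omega> sigma + residue \<Omega> (sigma + \<zeta>))"
    using z0 by simp
  have nz: "P_exp (p0 + of_real x) \<noteq> 0" "P_exp (p0 + of_real x - \<zeta>) \<noteq> 0" for x
    using P_exp_nz z per_pos by (simp_all add: p0_def)
  have fi: "(\<lambda>x. f (p0 + of_real x)) integrable_on {0..1}" and Oi: "(\<lambda>x. \<Omega> (p0 + of_real x)) integrable_on {0..1}"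
    unfolding f_def \<Omega>_def using nz by (intro integrable_continuous_real continuous_intros; simp)+
  have "p0 + \<i> * of_real per + of_real x = p0 + of_real x + tau" for x by (simp add: tau_def)
  then have "integral {0..1} (\<lambda>x. \<Omega> (p0 + \<i> * of_real per + of_real x)) = integral {0..1} (\<lambda>x. \<Omega> (p0 + of_real x) - 2 * of_real pi * \<i> * f (p0 + of_real x))"
    by (simp only: Otau)
  also have "\<dots> = integral {0..1} (\<lambda>x. \<Omega> (p0 + of_real x)) - 2 * of_real pi * \<i> * integral {0..1} (\<lambda>x. f (p0 + of_real x))"
    using integral_diff[OF Oi integrable_on_mult_right[OF fi, of "2 * of_real pi * \<i>"]] by simp
  finally have "2 * of_real pi * \<i> * integral {0..1} (\<lambda>x. f (p0 + of_real x)) = 2 * of_real pi * \<i> * (residue \<Omega> sigma + residue \<Omega> (sigma + \<zeta>))"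
    using R by simp
  then have I: "integral {0..1} (\<lambda>x. f (p0 + of_real x)) = residue \<Omega> sigma + residue \<Omega> (sigma + \<zeta>)" by simp
  have c: "continuous_on UNIV (\<lambda>s. f (of_real s))" unfolding f_def
    using P_exp_nz z per_pos by (intro continuous_intros) auto
  have G: "period_integral_theta (\<alpha>, \<zeta>) = integral {0..1} (\<lambda>x. f (p0 + of_real x))"
    using integral_unit_period[OF c _ x0(1,2)] f1 integral_unit_shift[OF c, of x0]
    by (simp add: period_integral_theta_def f_def p0_def)
  have Q0: "\<Omega> = (\<lambda>s. (P_exp' (s + \<alpha>) * P_exp (s - \<zeta> - \<alpha>) / P_exp (s - \<zeta>)) / P_exp s)"
    "\<Omega> = (\<lambda>s. (P_exp' (s + \<alpha>) * P_exp (s - \<zeta> - \<alpha>) / P_exp s) / P_exp (s - \<zeta>))"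
    unfolding \<Omega>_def by (simp_all add: fun_eq_iff)
  have R1: "residue \<Omega> sigma = P_exp' (sigma + \<alpha>) * P_exp (sigma - \<zeta> - \<alpha>) / P_exp (sigma - \<zeta>) / P_exp' sigma"
    unfolding Q0(1)
  proof (rule residue_quotient[of "B - {sigma + \<zeta>}" sigma])
    show "(\<lambda>s. P_exp' (s + \<alpha>) * P_exp (s - \<zeta> - \<alpha>) / P_exp (s - \<zeta>)) holomorphic_on B - {sigma + \<zeta>}"
      using Bz2 by (intro holomorphic_intros) auto
    show "P_exp w \<noteq> 0" if "w \<in> B - {sigma + \<zeta>}" "w \<noteq> sigma" for w using Bz1[of w] that by blast
    show "open (B - {sigma + \<zeta>})" by (rule open_delete[OF oB(1)])
    show "sigma \<in> B - {sigma + \<zeta>}" using sB z0 by simp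
  qed (rule P_exp_holo P_exp_sigma P_exp_deriv P_exp'_sigma_nz)+
  have R2: "residue \<Omega> (sigma + \<zeta>) = P_exp' (sigma + \<zeta> + \<alpha>) * P_exp (sigma + \<zeta> - \<zeta> - \<alpha>) / P_exp (sigma + \<zeta>) / P_exp' sigma"
    unfolding Q0(2)
  proof (rule residue_quotient[of "B - {sigma}" "sigma + \<zeta>"])
    have "((\<lambda>s. P_exp (s - \<zeta>)) has_field_derivative P_exp' (sigma + \<zeta> - \<zeta>) * 1) (at (sigma + \<zeta>))"
      by (rule DERIV_chain2[where f=P_exp and g="\<lambda>s. s - \<zeta>", OF P_exp_deriv]) (auto intro!: derivative_eq_intros)
    then show "((\<lambda>s. P_exp (s - \<zeta>)) has_field_derivative P_exp' sigma) (at (sigma + \<zeta>))" by simp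
    show "(\<lambda>s. P_exp' (s + \<alpha>) * P_exp (s - \<zeta> - \<alpha>) / P_exp s) holomorphic_on B - {sigma}"
      using Bz1 by (intro holomorphic_intros) auto
    show "(\<lambda>s. P_exp (s - \<zeta>)) holomorphic_on B - {sigma}" by (intro holomorphic_intros)
    show "P_exp (w - \<zeta>) \<noteq> 0" if "w \<in> B - {sigma}" "w \<noteq> sigma + \<zeta>" for w using Bz2[of w] that by blast
    show "open (B - {sigma})" by (rule open_delete[OF oB(1)])
    show "sigma + \<zeta> \<in> B - {sigma}" using sB z0 by simp
    show "P_exp (sigma + \<zeta> - \<zeta>) = 0" using P_exp_sigma by simp
  qed (rule P_exp'_sigma_nz)
  define ea ez where "ea = exp (- (\<i> * of_real pi * \<alpha>))" "ez = exp (- (\<i> * of_real pi * \<zeta>))"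
  have e: "ea \<noteq> 0" "ez \<noteq> 0" by (simp_all add: ea_ez_def)
  have ex1: "exp (- (\<i> * of_real pi * (\<zeta> + \<alpha>))) = ea * ez" "exp (- (\<i> * of_real pi * (\<alpha> + \<zeta>))) = ea * ez"
    unfolding ea_ez_def exp_add[symmetric] by (simp_all add: algebra_simps)
  have neg: "exp (- (\<i> * of_real pi * (- x))) = 1 / exp (- (\<i> * of_real pi * x))" for x
    by (simp add: exp_minus divide_inverse)
  have ex: "exp (- (\<i> * of_real pi * (- \<zeta>))) = 1 / ez" "exp (- (\<i> * of_real pi * (- \<alpha>))) = 1 / ea"
     "exp (- (\<i> * of_real pi * (- (\<alpha> + \<zeta>)))) = 1 / (ea * ez)"
    unfolding neg ex1 ea_ez_def[symmetric] by (rule refl)+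
  note ex = ex1 ex
  have s1: "P_exp (sigma - \<zeta> - \<alpha>) = sigma_const * (1 / (ea * ez)) * - theta1_pi (\<alpha> + \<zeta>)"
    using P_exp_sigma_shift[of "- (\<alpha> + \<zeta>)"] unfolding ex theta1_pi_odd by (simp add: algebra_simps)
  have s2: "P_exp (sigma - \<zeta>) = sigma_const * (1 / ez) * - theta1_pi \<zeta>"
    using P_exp_sigma_shift[of "- \<zeta>"] unfolding ex theta1_pi_odd by simp
  have s3: "P_exp (sigma + \<zeta> - \<zeta> - \<alpha>) = sigma_const * (1 / ea) * - theta1_pi \<alpha>"
    using P_exp_sigma_shift[of "- \<alpha>"] unfolding ex theta1_pi_odd by simp
  have s4: "P_exp' (sigma + \<alpha>) = sigma_const * ea * (theta1_pi' \<alpha> - \<i> * of_real pi * theta1_pi \<alpha>)" unfolding P_exp'_sigma_shift ea_ez_def ..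
  have s5: "P_exp' (sigma + \<zeta> + \<alpha>) = sigma_const * (ea * ez) * (theta1_pi' (\<alpha> + \<zeta>) - \<i> * of_real pi * theta1_pi (\<alpha> + \<zeta>))"
    using P_exp'_sigma_shift[of "\<alpha> + \<zeta>"] unfolding ex by (simp add: add_ac)
  have s6: "P_exp (sigma + \<zeta>) = sigma_const * ez * theta1_pi \<zeta>" unfolding P_exp_sigma_shift ea_ez_def ..
  have al: "sigma_const * ea * A * (sigma_const * (1 / (ea * ez)) * - B) / (sigma_const * (1 / ez) * - C) / (sigma_const * D) = A * B / (D * C)"
    "sigma_const * (ea * ez) * A * (sigma_const * (1 / ea) * - B) / (sigma_const * ez * C) / (sigma_const * D) = - (A * B) / (D * C)"
    if "C \<noteq> 0" "D \<noteq> 0" for A B C D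
    using that e sigma_const_nz by (simp_all add: field_simps)
  have "residue \<Omega> sigma = (theta1_pi' \<alpha> - \<i> * of_real pi * theta1_pi \<alpha>) * theta1_pi (\<alpha> + \<zeta>) / (theta1_pi' 0 * theta1_pi \<zeta>)"
    unfolding R1 s1 s2 s4 P_exp'_sigma by (rule al(1)[OF V theta1_pi'_0_nz])
  moreover have "residue \<Omega> (sigma + \<zeta>) = - ((theta1_pi' (\<alpha> + \<zeta>) - \<i> * of_real pi * theta1_pi (\<alpha> + \<zeta>)) * theta1_pi \<alpha>) / (theta1_pi' 0 * theta1_pi \<zeta>)"
    unfolding R2 s3 s5 s6 P_exp'_sigma by (rule al(2)[OF V theta1_pi'_0_nz])
  ultimately have "period_integral_theta (\<alpha>, \<zeta>) = ((theta1_pi' \<alpha> - \<i> * of_real pi * theta1_pi \<alpha>) * theta1_pi (\<alpha> + \<zeta>) +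
      - ((theta1_pi' (\<alpha> + \<zeta>) - \<i> * of_real pi * theta1_pi (\<alpha> + \<zeta>)) * theta1_pi \<alpha>)) / (theta1_pi' 0 * theta1_pi \<zeta>)"
    unfolding G I by (simp only: add_divide_distrib)
  then show ?thesis by (simp add: algebra_simps)
qed

lemma period_integral_theta_residues:
  assumes z: "\<bar>Im \<zeta>\<bar> < per / 2" and V: "theta1_pi \<zeta> \<noteq> 0"
  shows "period_integral_theta (\<alpha>, \<zeta>) = (theta1_pi' \<alpha> * theta1_pi (\<alpha> + \<zeta>) - theta1_pi' (\<alpha> + \<zeta>) * theta1_pi \<alpha>) / (theta1_pi' 0 * theta1_pi \<zeta>)"
proof -
  define W where "W = (\<lambda>\<zeta>. (theta1_pi' \<alpha> * theta1_pi (\<alpha> + \<zeta>) - theta1_pi' (\<alpha> + \<zeta>) * theta1_pi \<alpha>) / (theta1_pi' 0 * theta1_pi \<zeta>))"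
  have W1: "W (s + 1) = W s" for s
  proof -
    have "theta1_pi' \<alpha> * - theta1_pi (\<alpha> + s) - - theta1_pi' (\<alpha> + s) * theta1_pi \<alpha> = - (theta1_pi' \<alpha> * theta1_pi (\<alpha> + s) - theta1_pi' (\<alpha> + s) * theta1_pi \<alpha>)"
      "theta1_pi' 0 * - theta1_pi s = - (theta1_pi' 0 * theta1_pi s)" by simp_all
    then show ?thesis unfolding W_def add.assoc[symmetric] theta1_pi_1 theta1_pi'_1 by (simp only: minus_divide_divide)
  qed
  have V1: "(theta1_pi (s + 1) = 0) = (theta1_pi s = 0)" for s unfolding theta1_pi_1 by simp
  \<comment> \<open>reduce \<open>\<zeta>\<close> modulo \<open>1\<close>; both sides are unchanged\<close>
  define \<xi> where "\<xi> = \<zeta> + of_int (- \<lfloor>Re \<zeta>\<rfloor>) * 1"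
  have x: "period_integral_theta (\<alpha>, \<xi>) = period_integral_theta (\<alpha>, \<zeta>)" "W \<xi> = W \<zeta>" "(theta1_pi \<xi> = 0) = (theta1_pi \<zeta> = 0)"
    unfolding \<xi>_def
    by (rule int_periodic[of "\<lambda>\<zeta>. period_integral_theta (\<alpha>, \<zeta>)" 1, OF period_integral_theta_periodic(2)], rule int_periodic[of W 1, OF W1],
        rule int_periodic[of "\<lambda>s. theta1_pi s = 0" 1, OF V1])
  have "period_integral_theta (\<alpha>, \<xi>) = W \<xi>" unfolding W_def
    by (rule period_integral_theta_residues_unit) (use z V x(3) in \<open>auto simp: \<xi>_def\<close>, linarith+)
  then have "period_integral_theta (\<alpha>, \<zeta>) = W \<zeta>" using x by simp
  then show ?thesis unfolding W_def .
qed

lemma theta1_pi_nz: "(\<And>k::int. Re s \<noteq> of_int k) \<Longrightarrow> theta1_pi s \<noteq> 0"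
  unfolding theta1_pi_zero_iff by (auto simp: complex_eq_iff tau_def)

lemma ptheta_exp_eq:
  assumes z: "\<bar>Im \<zeta>\<bar> < per / 2"
  shows "ptheta_exp q (\<alpha>, \<zeta>) = period_integral_theta (\<alpha>, \<zeta>)"
  unfolding ptheta_exp_def
proof (rule cont_ext_eqI[OF _ _ period_integral_theta_cont])
  show "open {x. \<bar>Im (snd x)\<bar> < per / 2}" by (intro open_Collect_less continuous_intros)
  show "(\<alpha>, \<zeta>) \<in> {x. \<bar>Im (snd x)\<bar> < per / 2}" using z by simp
  show "(\<alpha>, \<zeta>) islimpt {(\<alpha>, \<zeta>). theta1 (of_real pi * \<alpha>) qh \<noteq> 0 \<and> theta1 (of_real pi * (\<alpha> + \<zeta>)) qh \<noteq> 0 \<and> theta1 (of_real pi * \<zeta>) qh \<noteq> 0}"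
    unfolding theta1_pi_def[symmetric] by (rule islimpt_diagonal_shift) (auto intro!: theta1_pi_nz simp: algebra_simps)
  show "(case y of (\<alpha>, \<zeta>) \<Rightarrow> p_const q * theta1 (of_real pi * \<alpha>) qh * theta1 (of_real pi * (\<alpha> + \<zeta>)) qh / theta1 (of_real pi * \<zeta>) qh *
        (theta1' (of_real pi * \<alpha>) qh / theta1 (of_real pi * \<alpha>) qh - theta1' (of_real pi * (\<alpha> + \<zeta>)) qh / theta1 (of_real pi * (\<alpha> + \<zeta>)) qh)) = period_integral_theta y"
    if "y \<in> {(\<alpha>, \<zeta>). theta1 (of_real pi * \<alpha>) qh \<noteq> 0 \<and> theta1 (of_real pi * (\<alpha> + \<zeta>)) qh \<noteq> 0 \<and> theta1 (of_real pi * \<zeta>) qh \<noteq> 0}"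
       "y \<in> {x. \<bar>Im (snd x)\<bar> < per / 2}" for y
  proof -
    obtain a w where y: "y = (a, w)" by (cases y)
    have nz: "theta1_pi a \<noteq> 0" "theta1_pi (a + w) \<noteq> 0" "theta1_pi w \<noteq> 0" "\<bar>Im w\<bar> < per / 2" using that by (auto simp: y theta1_pi_def)
    have t: "theta1' (of_real pi * x) qh = theta1_pi' x / of_real pi" for x by (simp add: theta1_pi'_theta1')
    show ?thesis unfolding y period_integral_theta_residues[OF nz(4,3)] prod.case t theta1_pi_def[symmetric] p_const_theta1_pi'
      using nz theta1_pi'_0_nz by (simp add: field_simps)
  qed
qed

section \<open>Moments as period integrals\<close>

text \<open>The factor of \<open>P_exp\<close> besides the theta function.\<close>
definition P_gauss :: "complex \<Rightarrow> complex" where "P_gauss s = - L * of_real (C_q q) * E_q q (s * L)"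

lemma P_gauss_nz: "P_gauss s \<noteq> 0" using L_nz C_q_pos by (simp add: P_gauss_def E_q_def)

lemma P_exp_P_gauss: "P_exp s = P_gauss s * th (exp (s * L))" by (simp add: P_exp_eq P_gauss_def)

text \<open>The quadratic exponents differ by a constant, because the arguments on both sides have the same sum. This
  constant is the power of \<open>a z\<close> in the expansion.\<close>
lemma P_gauss_product: "P_gauss (s + \<alpha>) * P_gauss (s - \<zeta> - \<alpha>) = exp (L * (\<alpha> * (\<alpha> + \<zeta>))) * (P_gauss s * P_gauss (s - \<zeta>))"
proof -
  have "L * (s + \<alpha> - 1/2)\<^sup>2 / 2 + L * (s - \<zeta> - \<alpha> - 1/2)\<^sup>2 / 2 = L * (\<alpha> * (\<alpha> + \<zeta>)) + (L * (s - 1/2)\<^sup>2 / 2 + L * (s - \<zeta> - 1/2)\<^sup>2 / 2)"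
    by (simp add: field_simps power2_eq_square)
  then have "E_q q ((s + \<alpha>) * L) * E_q q ((s - \<zeta> - \<alpha>) * L) = exp (L * (\<alpha> * (\<alpha> + \<zeta>))) * (E_q q (s * L) * E_q q ((s - \<zeta>) * L))"
    unfolding E_q_exponent exp_add[symmetric] by (rule arg_cong)
  then show ?thesis unfolding P_gauss_def by (simp add: mult_ac)
qed

lemma P_exp_product:
  "P_exp (s + \<alpha>) * P_exp (s - \<zeta> - \<alpha>) = exp (L * (\<alpha> * (\<alpha> + \<zeta>))) * (P_gauss s * P_gauss (s - \<zeta>)) *
     (th (exp (\<alpha> * L) * exp (s * L)) * th (exp (s * L) / (exp (\<alpha> * L) * exp (\<zeta> * L))))"
proof -
  have "exp ((s + \<alpha>) * L) = exp (\<alpha> * L) * exp (s * L)" "exp ((s - \<zeta> - \<alpha>) * L) = exp (s * L) / (exp (\<alpha> * L) * exp (\<zeta> * L))"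
    unfolding exp_add[symmetric] exp_diff[symmetric] by (simp_all add: algebra_simps)
  then show ?thesis unfolding P_exp_P_gauss P_gauss_product[symmetric] by (simp add: mult_ac)
qed

interpretation pos: qmeasure q pos_line pos_measure by (rule qmeasure_pos)
interpretation gau: qkernel q pos_line pos_measure gauss_weight slit by (rule qkernel_gauss)
interpretation the: qkernel q pos_line pos_measure "\<lambda>z t. of_real (- 1 / ln q) / th (t / z)" slit by (rule qkernel_theta)

lemma qexp_exp: "qexp s = exp (of_real s * L)" unfolding qexp_def exp_of_real[symmetric] by simp

lemma Ln_slit_strip: "z \<in> slit \<Longrightarrow> \<bar>Im (Ln z / L)\<bar> < per / 2"
proof -
  assume z: "z \<in> slit"
  then have "\<bar>Im (Ln z)\<bar> < pi" by (auto simp: slit_def Arg_eq_Im_Ln)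
  then have "\<bar>Im (Ln z)\<bar> / \<bar>ln q\<bar> < pi / \<bar>ln q\<bar>" using ln_q by (intro divide_strict_right_mono) auto
  then show ?thesis using ln_q by (simp add: per_def Im_divide_of_real)
qed

lemma moment_gauss:
  assumes z: "z \<in> slit" and a: "a \<noteq> 0"
  shows "gau.moment a z = period_integral_E (Ln a / L, Ln z / L) * exp (- (Ln a / L) * (Ln a + Ln z))"
proof -
  define \<alpha> \<zeta> where "\<alpha> = Ln a / L" "\<zeta> = Ln z / L"
  have z0: "z \<noteq> 0" using z by (simp add: slit_def)
  have e: "exp (\<alpha> * L) = a" "exp (\<zeta> * L) = z" "\<alpha> * L = Ln a" "\<zeta> * L = Ln z" using L_nz a z0 by (simp_all add: \<alpha>_\<zeta>_def)
  have "gau.moment a z = of_real (- ln q) * integral {0..0+1} (\<lambda>s. th (a * qexp s) / th (qexp s) * gauss_weight z (qexp s) * th (qexp s / (a * z)))"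
    unfolding gau.moment_def by (rule pos_fold[OF pos.weight_theta[OF gau.weight_w[OF z] a]])
  also have "\<dots> = integral {0..1} (\<lambda>s. of_real (- ln q) * (th (a * qexp s) / th (qexp s) * gauss_weight z (qexp s) * th (qexp s / (a * z))))" by (simp only: integral_mult_right add_0)
  also have "\<dots> = integral {0..1} (\<lambda>s. exp (- (L * (\<alpha> * (\<alpha> + \<zeta>)))) * (P_exp (of_real s + \<alpha>) * P_exp (of_real s - \<zeta> - \<alpha>) / P_exp (of_real s)))"
  proof (rule arg_cong[where f="integral {0..1}"], rule ext)
    fix s
    have w: "gauss_weight z (qexp s) * of_real (- ln q) = P_gauss (of_real s - \<zeta>)"
    proof -
      have "Ln (qexp s) = of_real s * L" unfolding qexp_def by (simp add: Ln_of_real)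
      then show ?thesis by (simp add: gauss_weight_def P_gauss_def e left_diff_distrib)
    qed
    have x: "exp (- (L * (\<alpha> * (\<alpha> + \<zeta>)))) * exp (L * (\<alpha> * (\<alpha> + \<zeta>))) = 1" unfolding exp_add[symmetric] by simp
    have "exp (- (L * (\<alpha> * (\<alpha> + \<zeta>)))) * (P_exp (of_real s + \<alpha>) * P_exp (of_real s - \<zeta> - \<alpha>) / P_exp (of_real s)) =
      (exp (- (L * (\<alpha> * (\<alpha> + \<zeta>)))) * exp (L * (\<alpha> * (\<alpha> + \<zeta>)))) * (P_gauss (of_real s - \<zeta>) * th (a * qexp s) * th (qexp s / (a * z)) / th (qexp s))"
      unfolding P_exp_product P_exp_P_gauss[of "of_real s"] e(1,2) qexp_exp[symmetric] using P_gauss_nz[of "of_real s"] by (simp add: field_simps)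
    then show "of_real (- ln q) * (th (a * qexp s) / th (qexp s) * gauss_weight z (qexp s) * th (qexp s / (a * z))) =
      exp (- (L * (\<alpha> * (\<alpha> + \<zeta>)))) * (P_exp (of_real s + \<alpha>) * P_exp (of_real s - \<zeta> - \<alpha>) / P_exp (of_real s))"
      unfolding x w[symmetric] by simp
  qed
  also have "\<dots> = exp (- (L * (\<alpha> * (\<alpha> + \<zeta>)))) * period_integral_E (\<alpha>, \<zeta>)" by (simp only: period_integral_E_def prod.case integral_mult_right)
  also have "- (L * (\<alpha> * (\<alpha> + \<zeta>))) = - \<alpha> * (Ln a + Ln z)" unfolding e(3,4)[symmetric] by (simp add: algebra_simps)
  finally show ?thesis unfolding \<alpha>_\<zeta>_def by simp
qed

lemma moment_theta:
  assumes z: "z \<in> slit" and a: "a \<noteq> 0"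
  shows "the.moment a z = period_integral_theta (Ln a / L, Ln z / L) * exp (- (Ln a / L) * (Ln a + Ln z))"
proof -
  define \<alpha> \<zeta> where "\<alpha> = Ln a / L" "\<zeta> = Ln z / L"
  have z0: "z \<noteq> 0" using z by (simp add: slit_def)
  have e: "exp (\<alpha> * L) = a" "exp (\<zeta> * L) = z" "\<alpha> * L = Ln a" "\<zeta> * L = Ln z" using L_nz a z0 by (simp_all add: \<alpha>_\<zeta>_def)
  have "the.moment a z = of_real (- ln q) * integral {0..0+1} (\<lambda>s. th (a * qexp s) / th (qexp s) * (of_real (- 1 / ln q) / th (qexp s / z)) * th (qexp s / (a * z)))"
    unfolding the.moment_def by (rule pos_fold[OF pos.weight_theta[OF the.weight_w[OF z] a]])
  also have "\<dots> = integral {0..1} (\<lambda>s. of_real (- ln q) * (th (a * qexp s) / th (qexp s) * (of_real (- 1 / ln q) / th (qexp s / z)) * th (qexp s / (a * z))))" by (simp only: integral_mult_right add_0)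
  also have "\<dots> = integral {0..1} (\<lambda>s. exp (- (L * (\<alpha> * (\<alpha> + \<zeta>)))) * (P_exp (of_real s + \<alpha>) * P_exp (of_real s - \<zeta> - \<alpha>) / (P_exp (of_real s) * P_exp (of_real s - \<zeta>))))"
  proof (rule arg_cong[where f="integral {0..1}"], rule ext)
    fix s
    have x: "exp (- (L * (\<alpha> * (\<alpha> + \<zeta>)))) * exp (L * (\<alpha> * (\<alpha> + \<zeta>))) = 1" unfolding exp_add[symmetric] by simp
    have ed: "exp ((of_real s - \<zeta>) * L) = qexp s / z" unfolding left_diff_distrib exp_diff e(1,2) qexp_exp ..
    have "exp (- (L * (\<alpha> * (\<alpha> + \<zeta>)))) * (P_exp (of_real s + \<alpha>) * P_exp (of_real s - \<zeta> - \<alpha>) / (P_exp (of_real s) * P_exp (of_real s - \<zeta>))) =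
      (exp (- (L * (\<alpha> * (\<alpha> + \<zeta>)))) * exp (L * (\<alpha> * (\<alpha> + \<zeta>)))) * (th (a * qexp s) * th (qexp s / (a * z)) / (th (qexp s) * th (qexp s / z)))"
      unfolding P_exp_product P_exp_P_gauss[of "of_real s"] P_exp_P_gauss[of "of_real s - \<zeta>"] ed e(1,2) qexp_exp[symmetric]
      using P_gauss_nz[of "of_real s"] P_gauss_nz[of "of_real s - \<zeta>"] by (simp add: field_simps)
    then show "of_real (- ln q) * (th (a * qexp s) / th (qexp s) * (of_real (- 1 / ln q) / th (qexp s / z)) * th (qexp s / (a * z))) =
      exp (- (L * (\<alpha> * (\<alpha> + \<zeta>)))) * (P_exp (of_real s + \<alpha>) * P_exp (of_real s - \<zeta> - \<alpha>) / (P_exp (of_real s) * P_exp (of_real s - \<zeta>)))"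
      unfolding x using ln_q by simp
  qed
  also have "\<dots> = exp (- (L * (\<alpha> * (\<alpha> + \<zeta>)))) * period_integral_theta (\<alpha>, \<zeta>)" by (simp only: period_integral_theta_def prod.case integral_mult_right)
  also have "- (L * (\<alpha> * (\<alpha> + \<zeta>))) = - \<alpha> * (Ln a + Ln z)" unfolding e(3,4)[symmetric] by (simp add: algebra_simps)
  finally show ?thesis unfolding \<alpha>_\<zeta>_def by simp
qed

text \<open>The same rearrangement as for the integrals, at the single point \<open>s = ln l / ln q\<close>.\<close>
lemma P_q_quotient:
  assumes "a \<noteq> 0" "z \<noteq> 0" "l \<noteq> 0"
  shows "th (a * l) * th (l / (a * z)) / (th l * th (l / z)) =
    P_q q (Ln a + Ln l) * P_q q (Ln l - (Ln a + Ln z)) / (P_q q (Ln l) * P_q q (Ln l - Ln z)) * exp (- (Ln a / L) * (Ln a + Ln z))"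
proof -
  define \<alpha> \<zeta> s where "\<alpha> = Ln a / L" "\<zeta> = Ln z / L" "s = Ln l / L"
  have e: "exp (\<alpha> * L) = a" "exp (\<zeta> * L) = z" "exp (s * L) = l" "\<alpha> * L = Ln a" "\<zeta> * L = Ln z" "s * L = Ln l"
    using L_nz assms by (simp_all add: \<alpha>_\<zeta>_s_def)
  have P: "P_q q (Ln a + Ln l) = P_exp (s + \<alpha>)" "P_q q (Ln l - (Ln a + Ln z)) = P_exp (s - \<zeta> - \<alpha>)"
    "P_q q (Ln l) = P_exp s" "P_q q (Ln l - Ln z) = P_exp (s - \<zeta>)"
    unfolding P_q_P_exp \<alpha>_\<zeta>_s_def by (simp_all add: add_divide_distrib diff_divide_distrib add_ac diff_diff_eq)
  have x: "exp (- (L * (\<alpha> * (\<alpha> + \<zeta>)))) * exp (L * (\<alpha> * (\<alpha> + \<zeta>))) = 1" unfolding exp_add[symmetric] by simp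
  have ed: "exp ((s - \<zeta>) * L) = l / z" unfolding left_diff_distrib exp_diff e(1-3) ..
  have "P_exp (s + \<alpha>) * P_exp (s - \<zeta> - \<alpha>) / (P_exp s * P_exp (s - \<zeta>)) * exp (- (L * (\<alpha> * (\<alpha> + \<zeta>)))) =
      (exp (- (L * (\<alpha> * (\<alpha> + \<zeta>)))) * exp (L * (\<alpha> * (\<alpha> + \<zeta>)))) * (th (a * l) * th (l / (a * z)) / (th l * th (l / z)))"
    unfolding P_exp_product P_exp_P_gauss[of s] P_exp_P_gauss[of "s - \<zeta>"] ed e(1-3)
    using P_gauss_nz[of s] P_gauss_nz[of "s - \<zeta>"] by (simp add: field_simps)
  moreover have "- (L * (\<alpha> * (\<alpha> + \<zeta>))) = - (Ln a / L) * (Ln a + Ln z)"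
    unfolding e(4,5)[symmetric] using L_nz by (simp add: field_simps)
  ultimately show ?thesis unfolding P x by simp
qed

end

context qbase
begin

interpretation pos: qmeasure q pos_line pos_measure by (rule qmeasure_pos)
interpretation gau: qkernel q pos_line pos_measure gauss_weight slit by (rule qkernel_gauss)
interpretation the: qkernel q pos_line pos_measure "\<lambda>z t. of_real (- 1 / ln q) / th (t / z)" slit by (rule qkernel_theta)

section \<open>The expansion of the three transforms\<close>

lemma weight_transform_half_line:
  assumes ab: "generic a b" and w: "pos.weight z w"
  shows "(LINT t:{0<..}|lborel. phi21 q a b 0 (- of_real t) * w (of_real t) / of_real t) =
         (LINT t:pos_line|pos_measure. phi21 q a b 0 (- t) * w t)"
proof (rule half_line_integral)
  show "continuous_on pos_line (\<lambda>t. phi21 q a b 0 (- t) * w t)"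
    using w by (intro continuous_on_mult pos.phi21_continuous_on_X) (simp add: pos.weight_def)
  show "set_integrable pos_measure pos_line (\<lambda>t. phi21 q a b 0 (- t) * w t)"
    by (rule pos.phi21_weight_integrable[OF ab w])
qed

lemma U_E_transform:
  assumes ab: "generic a b" and z: "z \<in> slit"
  shows "U q Ker_E a b z = gau.transform a b z"
proof -
  have "U q Ker_E a b z = (LINT t:{0<..}|lborel. of_real (C_q q) * (phi21 q a b 0 (- of_real t) * E_q q (of_real (ln t) - Ln z) / of_real t))"
    by (simp only: U.simps set_integral_mult_right)
  also have "\<dots> = (LINT t:{0<..}|lborel. phi21 q a b 0 (- of_real t) * gauss_weight z (of_real t) / of_real t)"
    by (rule set_lebesgue_integral_cong) (auto simp: gauss_weight_def Ln_of_real)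
  also have "\<dots> = gau.transform a b z"
    unfolding gau.transform_def by (rule weight_transform_half_line[OF ab gau.weight_w[OF z]])
  finally show ?thesis .
qed

lemma U_theta_transform:
  assumes ab: "generic a b" and z: "z \<in> slit"
  shows "U q Ker_theta a b z = the.transform a b z"
proof -
  have "U q Ker_theta a b z = (LINT t:{0<..}|lborel. of_real (- 1 / ln q) * (phi21 q a b 0 (- of_real t) / th (of_real t / z) / of_real t))"
    by (simp only: U.simps set_integral_mult_right)
  also have "\<dots> = (LINT t:{0<..}|lborel. phi21 q a b 0 (- of_real t) * (of_real (- 1 / ln q) / th (of_real t / z)) / of_real t)"
    by (rule set_lebesgue_integral_cong) auto
  also have "\<dots> = the.transform a b z"
    unfolding the.transform_def by (rule weight_transform_half_line[OF ab the.weight_w[OF z]])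
  finally show ?thesis .
qed

lemma admissible_lambda:
  assumes "admissible q (Ker_lambda l) z"
  shows "l \<noteq> 0" "l \<noteq> - (Q powi n)" "z \<in> prog_domain l" "z \<noteq> 0"
  using assms by (auto simp: prog_domain_def)

text \<open>The expansion of \<open>transform_expansion\<close>, with the moment of each kernel written as \<open>p\<close> times the
  exponential.\<close>
lemma U_expansion:
  assumes ab: "generic a b" and z: "admissible q e z" and pole: "Q / (a * b * z) \<notin> phi21_poles q"
  shows "U q e a b z =
           p q e a z * exp (- (Ln a / L) * (Ln a + Ln z)) * (qp b / qp (b / a))
             * phi21 q a 0 (a * Q / b) (Q / (a * b * z))
         + p q e b z * exp (- (Ln b / L) * (Ln b + Ln z)) * (qp a / qp (a / b))
             * phi21 q b 0 (b * Q / a) (Q / (a * b * z))"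
proof -
  have nz: "a \<noteq> 0" "b \<noteq> 0" using ab by (auto simp: generic_def)
  show ?thesis
  proof (cases e)
    case Ker_E
    then have zs: "z \<in> slit" using z by (simp add: slit_def)
    have "p q e c z = period_integral_E (Ln c / L, Ln z / L)" for c by (simp add: Ker_E pE_exp_eq)
    then show ?thesis
      using gau.transform_expansion[OF zs ab pole] unfolding Ker_E U_E_transform[OF ab zs]
        moment_gauss[OF zs nz(1)] moment_gauss[OF zs nz(2)] by (simp add: mult_ac)
  next
    case Ker_theta
    then have zs: "z \<in> slit" using z by (simp add: slit_def)
    have "p q e c z = period_integral_theta (Ln c / L, Ln z / L)" for c
      by (simp add: Ker_theta ptheta_exp_eq[OF Ln_slit_strip[OF zs]])
    then show ?thesis
      using the.transform_expansion[OF zs ab pole] unfolding Ker_theta U_theta_transform[OF ab zs]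
        moment_theta[OF zs nz(1)] moment_theta[OF zs nz(2)] by (simp add: mult_ac)
  next
    case (Ker_lambda l)
    note adm = admissible_lambda[OF z[unfolded Ker_lambda]]
    interpret lam: qkernel q "progression l" "prog_measure l" "\<lambda>z t. 1 / th (t / z)" "prog_domain l"
      by (rule qkernel_progression[OF adm(1,2)])
    have m: "lam.moment c z = p q e c z * exp (- (Ln c / L) * (Ln c + Ln z))" if "c \<noteq> 0" for c
      unfolding prog_moment[OF adm(1,2) that adm(3)] P_q_quotient[OF that adm(4,1)] by (simp add: Ker_lambda)
    have "U q e a b z = lam.transform a b z"
      unfolding prog_transform[OF adm(1,2,3) ab] by (simp add: Ker_lambda)
    then show ?thesis
      using lam.transform_expansion[OF adm(3) ab pole] unfolding m[OF nz(1)] m[OF nz(2)] by (simp add: mult_ac)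
  qed
qed

lemma p_periodic:
  assumes c: "c \<noteq> 0" and w: "admissible q e w"
  shows "p q e (Q * c) w = p q e c w" "p q e c (Q * w) = p q e c w"
proof -
  have w0: "w \<noteq> 0" using w by (cases e) auto
  have Lc: "Ln (Q * c) / L = Ln c / L + 1" "Ln (Q * w) / L = Ln w / L + 1"
    using L_nz by (simp_all add: Ln_Q_times c w0 add_divide_distrib)
  have "p q e (Q * c) w = p q e c w \<and> p q e c (Q * w) = p q e c w"
  proof (cases e)
    case Ker_E
    show ?thesis unfolding Ker_E by (simp add: Lc pE_exp_eq period_integral_E_periodic)
  next
    case Ker_theta
    then have ws: "w \<in> slit" using w by (simp add: slit_def)
    have i: "\<bar>Im (Ln w / L)\<bar> < per / 2" "\<bar>Im (Ln w / L + 1)\<bar> < per / 2" using Ln_slit_strip[OF ws] by simp_all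
    show ?thesis unfolding Ker_theta p.simps Lc ptheta_exp_eq[OF i(1)] ptheta_exp_eq[OF i(2)] period_integral_theta_periodic by simp
  next
    case (Ker_lambda l)
    have P: "P_q q (L + s) = P_q q s" "P_q q (s - L) = P_q q s" for s
      unfolding P_q_P_exp using P_exp_1[of "s / L"] P_exp_minus_1[of "s / L"] L_nz
      by (simp_all add: add_divide_distrib diff_divide_distrib add.commute)
    have s: "P_q q (L + Ln c + Ln l) = P_q q (Ln c + Ln l)" 
      "P_q q (Ln l - (L + Ln c + Ln w)) = P_q q (Ln l - (Ln c + Ln w))"
      "P_q q (Ln l - (Ln c + (L + Ln w))) = P_q q (Ln l - (Ln c + Ln w))"
      "P_q q (Ln l - (L + Ln w)) = P_q q (Ln l - Ln w)"
      using P(1)[of "Ln c + Ln l"] P(2)[of "Ln l - (Ln c + Ln w)"] P(2)[of "Ln l - Ln w"]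
      by (simp_all add: algebra_simps)
    show ?thesis unfolding Ker_lambda p.simps Ln_Q_times[OF c] Ln_Q_times[OF w0] s by simp
  qed
  then show "p q e (Q * c) w = p q e c w" "p q e c (Q * w) = p q e c w" by auto
qed

end

theorem theorem6p1:
  fixes q :: real and e :: kernel and a b z :: complex
  assumes "0 < q" and "q < 1"
    and "a \<noteq> 0" and "b \<noteq> 0"
    and "\<forall>n::int. b / a \<noteq> of_real q powi n"
    and "admissible q e z"
    and "of_real q / (a * b * z) \<notin> phi21_poles q"
  shows "U q e a b z =
           p q e a z * exp (- (Ln a / of_real (ln q)) * (Ln a + Ln z))
             * (qpoch_inf q b / qpoch_inf q (b / a))
             * phi21 q a 0 (a * of_real q / b) (of_real q / (a * b * z))
         + p q e b z * exp (- (Ln b / of_real (ln q)) * (Ln b + Ln z))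
             * (qpoch_inf q a / qpoch_inf q (a / b))
             * phi21 q b 0 (b * of_real q / a) (of_real q / (a * b * z))
       \<and> (\<forall>c w. c \<noteq> 0 \<and> admissible q e w \<longrightarrow>
           p q e (of_real q * c) w = p q e c w \<and> p q e c (of_real q * w) = p q e c w)"
proof -
  interpret qbase q using assms(1,2) by unfold_locales
  have "generic a b" using assms(3-5) by (simp add: generic_def)
  from U_expansion[OF this assms(6,7)] p_periodic show ?thesis by blast
qed

end
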